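(* Let $L,T>0$. For every pair of measures $\bar\mu_\pm\in\mathcal M^+(Q_L)$ with $\bar\mu_+(Q_L)=\bar\mu_-(Q_L)$, the infimum $$\inf\{I(\mu):\ \mu\in\mathcal A^*_{L,T},\ \mu_{\pm T}=\bar\mu_\pm\}$$ is finite and attained.
   Context: Notation. $Q_L:=(-\frac L2,\frac L2)^2$, $Q_{L,T}:=Q_L\times(-T,T)$, $x=(x',x_3)$. Everything is $Q_L$-periodic in $x'$, i.e. $Q_L$ is identified with the torus $\mathbb R^2/L\mathbb Z^2$. $\mathcal M^+$ denotes finite positive Radon measures and $\mathcal M(\cdot;\mathbb R^2)$ finite vector-valued Radon measures. $\mathcal A_{L,T}$ is the set of pairs $\mu\in\mathcal M^+(Q_{L,T})$, $m\in\mathcal M(Q_{L,T};\mathbb R^2)$ with $m\ll\mu$, $\partial_3\mu+\mathrm{div}'m=0$ in $Q_{L,T}$ (distributionally, periodically in $x'$), and $\mu=\mu_{x_3}\otimes dx_3$ where for a.e. $x_3\in(-T,T)$, $\mu_{x_3}=\sum_i\varphi_i\delta_{X_i}$ (at most countable, $\varphi_i>0$, $X_i\in Q_L$). $\mathcal A^*_{L,T}:=\{\mu:\exists m,\ (\mu,m)\in\mathcal A_{L,T}\}$. With $K_*:=\frac{8\sqrt\pi}3$ and $\mu_{x_3}(x'):=\mu_{x_3}(\{x'\})$, $$I(\mu,m):=\frac{K_*}{L^2}\int_{-T}^T\sum_{x'\in Q_L}(\mu_{x_3}(x'))^{1/2}dx_3+\frac1{L^2}\int_{Q_{L,T}}\left|\frac{dm}{d\mu}\right|^2d\mu,\qquad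 I(\mu):=\min\{I(\mu,m):\ m\ll\mu,\ \partial_3\mu+\mathrm{div}'m=0\}.$$ When $I(\mu)<\infty$ the map $x_3\mapsto\mu_{x_3}$ has a weakly continuous representative on $[-T,T]$, which is always used; in particular the traces $\mu_{\pm T}$ are defined. *)

theory Defs
  imports "HOL-Analysis.Analysis"
begin

text \<open>The torus \<open>\<real>\<^sup>2 / L\<int>\<^sup>2\<close> is represented by its half-open fundamental domain. As a
  measurable space this domain carries exactly the Borel sets of the torus; the topology of the
  torus enters only through the periodicity of test functions.\<close>

definition torus :: "real \<Rightarrow> (real^2) set"
  where "torus L = {x. \<forall>i. - L / 2 \<le> x $ i \<and> x $ i < L / 2}"

definition cylinder :: "real \<Rightarrow> real \<Rightarrow> ((real^2) \<times> real) set"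
  where "cylinder L T = torus L \<times> {-T<..<T}"

text \<open>On these spaces every finite Borel measure is Radon.\<close>

definition finite_borel_measure :: "'a::topological_space set \<Rightarrow> 'a measure \<Rightarrow> bool"
  where "finite_borel_measure S \<mu> \<longleftrightarrow> finite_measure \<mu> \<and> sets \<mu> = sets (restrict_space borel S)"

text \<open>A vector measure is a countably additive set function; its values outside the
  \<open>\<sigma>\<close>-algebra are irrelevant. In finite dimensions finiteness of the total variation
  is automatic.\<close>

definition vector_measure :: "'a::topological_space set \<Rightarrow> ('a set \<Rightarrow> 'b::euclidean_space) \<Rightarrow> bool"
  where "vector_measure S m \<longleftrightarrow>
    (\<forall>A :: nat \<Rightarrow> 'a set. range A \<subseteq> sets (restrict_space borel S) \<longrightarrow> disjoint_family A \<longrightarrow>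
       (\<lambda>n. m (A n)) sums m (\<Union>n. A n))"

definition vector_abs_cont :: "('a set \<Rightarrow> 'b::euclidean_space) \<Rightarrow> 'a measure \<Rightarrow> bool"
  where "vector_abs_cont m \<mu> \<longleftrightarrow> (\<forall>A\<in>sets \<mu>. emeasure \<mu> A = 0 \<longrightarrow> m A = 0)"

text \<open>The Radon--Nikodym derivative \<open>dm/d\<mu>\<close>; it exists and is unique \<open>\<mu>\<close>-a.e. whenever
  \<open>m \<lless> \<mu>\<close> and \<open>\<mu>\<close> is finite.\<close>

definition vector_RN_deriv ::
    "'a measure \<Rightarrow> ('a set \<Rightarrow> 'b::euclidean_space) \<Rightarrow> 'a \<Rightarrow> 'b"
  where "vector_RN_deriv \<mu> m =
    (SOME v. integrable \<mu> v \<and> (\<forall>A\<in>sets \<mu>. m A = set_lebesgue_integral \<mu> A v))"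

primrec C_times :: "nat \<Rightarrow> ('a::euclidean_space \<Rightarrow> real) \<Rightarrow> bool"
  where
    "C_times 0 f \<longleftrightarrow> continuous_on UNIV f"
  | "C_times (Suc k) f \<longleftrightarrow> (\<forall>x. f differentiable (at x)) \<and>
       (\<forall>b\<in>Basis. C_times k (\<lambda>x. frechet_derivative f (at x) b))"

definition smooth :: "('a::euclidean_space \<Rightarrow> real) \<Rightarrow> bool"
  where "smooth f \<longleftrightarrow> (\<forall>k. C_times k f)"

definition periodic :: "real \<Rightarrow> (real^2 \<Rightarrow> 'b) \<Rightarrow> bool"
  where "periodic L f \<longleftrightarrow> (\<forall>x i. f (x + L *\<^sub>R axis i 1) = f x)"

text \<open>Smooth functions with compact support in (torus) \<open>\<times> (-T, T)\<close>.\<close>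

definition test_function :: "real \<Rightarrow> real \<Rightarrow> ((real^2) \<times> real \<Rightarrow> real) \<Rightarrow> bool"
  where "test_function L T \<psi> \<longleftrightarrow> smooth \<psi> \<and> (\<forall>t. periodic L (\<lambda>x. \<psi> (x, t))) \<and>
    (\<exists>s<T. \<forall>x t. s \<le> \<bar>t\<bar> \<longrightarrow> \<psi> (x, t) = 0)"

text \<open>The distributional equation \<open>\<partial>\<^sub>3 \<mu> + div' m = 0\<close> for \<open>m \<lless> \<mu>\<close>, where
  \<open>\<integral> \<nabla>'\<psi> \<sqdot> dm = \<integral> \<nabla>'\<psi> \<sqdot> (dm/d\<mu>) d\<mu>\<close>; the Frechet derivative in direction \<open>(v, 0)\<close>
  is \<open>\<nabla>'\<psi> \<sqdot> v\<close>.\<close>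

definition continuity_equation ::
    "real \<Rightarrow> real \<Rightarrow> ((real^2) \<times> real) measure \<Rightarrow> (((real^2) \<times> real) set \<Rightarrow> real^2) \<Rightarrow> bool"
  where "continuity_equation L T \<mu> m \<longleftrightarrow>
    (\<forall>\<psi>. test_function L T \<psi> \<longrightarrow>
       (\<integral>p. frechet_derivative \<psi> (at p) (0, 1) \<partial>\<mu>)
       + (\<integral>p. frechet_derivative \<psi> (at p) (vector_RN_deriv \<mu> m p, 0) \<partial>\<mu>) = 0)"

text \<open>\<open>\<mu> = \<kappa>\<^sub>t \<otimes> dt\<close>. The values \<open>\<kappa> t\<close> for \<open>t\<close> outside the open interval are unconstrained
  here.\<close>

definition disintegration ::
    "real \<Rightarrow> real \<Rightarrow> ((real^2) \<times> real) measure \<Rightarrow> (real \<Rightarrow> (real^2) measure) \<Rightarrow> bool"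
  where "disintegration L T \<mu> \<kappa> \<longleftrightarrow>
    (\<forall>t\<in>{-T<..<T}. finite_borel_measure (torus L) (\<kappa> t)) \<and>
    (\<forall>B\<in>sets (restrict_space borel (torus L)).
       (\<lambda>t. emeasure (\<kappa> t) B) \<in> borel_measurable (restrict_space borel {-T<..<T})) \<and>
    (\<forall>A\<in>sets \<mu>. emeasure \<mu> A =
       (\<integral>\<^sup>+t\<in>{-T<..<T}. emeasure (\<kappa> t) {x. (x, t) \<in> A} \<partial>lborel))"

definition weakly_continuous_rep ::
    "real \<Rightarrow> real \<Rightarrow> ((real^2) \<times> real) measure \<Rightarrow> (real \<Rightarrow> (real^2) measure) \<Rightarrow> bool"
  where "weakly_continuous_rep L T \<mu> \<kappa> \<longleftrightarrow>
    disintegration L T \<mu> \<kappa> \<and>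
    (\<forall>t\<in>{-T..T}. finite_borel_measure (torus L) (\<kappa> t)) \<and>
    (\<forall>f :: real^2 \<Rightarrow> real. continuous_on UNIV f \<longrightarrow> periodic L f \<longrightarrow>
       continuous_on {-T..T} (\<lambda>t. \<integral>x. f x \<partial>(\<kappa> t)))"

text \<open>The slices \<open>\<mu>\<^sub>t\<close>: the weakly continuous representative if there is one (it is unique on
  \<open>[-T, T]\<close>), otherwise some representative of the a.e. unique disintegration.\<close>

definition slice ::
    "real \<Rightarrow> real \<Rightarrow> ((real^2) \<times> real) measure \<Rightarrow> real \<Rightarrow> (real^2) measure"
  where "slice L T \<mu> = (SOME \<kappa>. disintegration L T \<mu> \<kappa> \<and>
    ((\<exists>\<kappa>'. weakly_continuous_rep L T \<mu> \<kappa>') \<longrightarrow> weakly_continuous_rep L T \<mu> \<kappa>))"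

definition has_traces ::
    "real \<Rightarrow> real \<Rightarrow> ((real^2) \<times> real) measure \<Rightarrow> (real^2) measure \<Rightarrow> (real^2) measure \<Rightarrow> bool"
  where "has_traces L T \<mu> \<nu>\<^sub>m \<nu>\<^sub>p \<longleftrightarrow>
    (\<exists>\<kappa>. weakly_continuous_rep L T \<mu> \<kappa>) \<and> slice L T \<mu> (-T) = \<nu>\<^sub>m \<and> slice L T \<mu> T = \<nu>\<^sub>p"

definition countable_dirac_sum :: "real \<Rightarrow> (real^2) measure \<Rightarrow> bool"
  where "countable_dirac_sum L \<nu> \<longleftrightarrow>
    (\<exists>X \<phi>. countable X \<and> X \<subseteq> torus L \<and> (\<forall>x\<in>X. (0::real) < \<phi> x) \<and>
       (\<forall>B\<in>sets \<nu>. emeasure \<nu> B = (\<integral>\<^sup>+x. ennreal (\<phi> x) * indicator B x \<partial>count_space X)))"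

definition admissible ::
    "real \<Rightarrow> real \<Rightarrow> (((real^2) \<times> real) measure \<times> (((real^2) \<times> real) set \<Rightarrow> real^2)) set"
  where "admissible L T = {(\<mu>, m).
    finite_borel_measure (cylinder L T) \<mu> \<and>
    vector_measure (cylinder L T) m \<and>
    vector_abs_cont m \<mu> \<and>
    continuity_equation L T \<mu> m \<and>
    (\<exists>\<kappa>. disintegration L T \<mu> \<kappa>) \<and>
    (AE t in lborel. t \<in> {-T<..<T} \<longrightarrow> countable_dirac_sum L (slice L T \<mu> t))}"

definition admissible_star :: "real \<Rightarrow> real \<Rightarrow> ((real^2) \<times> real) measure set"
  where "admissible_star L T = {\<mu>. \<exists>m. (\<mu>, m) \<in> admissible L T}"

definition K_star :: real
  where "K_star = 8 * sqrt pi / 3"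

definition energy ::
    "real \<Rightarrow> real \<Rightarrow> ((real^2) \<times> real) measure \<Rightarrow> (((real^2) \<times> real) set \<Rightarrow> real^2) \<Rightarrow> ennreal"
  where "energy L T \<mu> m =
    ennreal (K_star / L\<^sup>2) *
      (\<integral>\<^sup>+t\<in>{-T<..<T}.
         (\<integral>\<^sup>+x. ennreal (sqrt (measure (slice L T \<mu> t) {x})) \<partial>count_space (torus L)) \<partial>lborel)
    + ennreal (1 / L\<^sup>2) * (\<integral>\<^sup>+p. ennreal ((norm (vector_RN_deriv \<mu> m p))\<^sup>2) \<partial>\<mu>)"

text \<open>The minimum over \<open>m\<close>, written as an infimum.\<close>

definition min_energy :: "real \<Rightarrow> real \<Rightarrow> ((real^2) \<times> real) measure \<Rightarrow> ennreal"
  where "min_energy L T \<mu> =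
    (INF m\<in>{m. vector_measure (cylinder L T) m \<and> vector_abs_cont m \<mu> \<and>
               continuity_equation L T \<mu> m}. energy L T \<mu> m)"

definition competitors ::
    "real \<Rightarrow> real \<Rightarrow> (real^2) measure \<Rightarrow> (real^2) measure \<Rightarrow> ((real^2) \<times> real) measure set"
  where "competitors L T \<nu>\<^sub>m \<nu>\<^sub>p = {\<mu> \<in> admissible_star L T. has_traces L T \<mu> \<nu>\<^sub>m \<nu>\<^sub>p}"

end

theory Submission
  imports "HOL-Probability.Probability" "HOL-Library.Diagonal_Subsequence" "HOL-Real_Asymp.Real_Asymp" Defs
begin

text \<open>The proof is the direct method, on slices.

  Finiteness: couple the two traces by their normalised product. A pair \<open>(x, y)\<close> travels from \<open>x\<close>
  to the corner of the torus during \<open>t < 0\<close> and from there to \<open>y\<close> during \<open>t > 0\<close>, correcting one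
  dyadic digit of the coordinates at a time. Before the \<open>n\<close>-th time level there are at most \<open>4\<^sup>n\<close>
  different positions, so every slice is atomic, and geometrically decreasing time steps make both
  perimeter and kinetic energy finite.

  Attainment: the kinetic energy controls the modulus of continuity of \<open>t \<mapsto> \<integral> f d\<mu>\<^sub>t\<close> for smooth
  \<open>f\<close>, so a minimising sequence has a subsequence whose slices converge weakly for every \<open>t\<close>;
  this keeps the traces. Along it the fluxes converge after a compactification of the velocities.
  The sum of square roots of the atoms is weakly lower semicontinuous on atomic measures, being
  the supremum of the sums of \<open>sqrt (\<mu>\<^sub>t C)\<close> over the cells \<open>C\<close> of finer and finer partitions, and its
  finiteness in the limit forces atomicity; Fatou's lemma finishes the argument.\<close>

section \<open>Weak compactness through a space-filling curve\<close>

text \<open>Several obstacles shape the proof. The fundamental domain is half open, so weak limits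
  may charge faces that it lacks; topological arguments run on the image of the torus in
  four-dimensional Euclidean space, or on the closed square followed by \<open>wrap\<close>. The
  slices in the energy come from a choice operator; the proof carries representatives of its own and
  returns to \<open>slice\<close> through uniqueness of the weakly continuous one. Velocities do not
  converge along weak limits, and particles that share a position may differ in velocity. Both the
  competitor and the limit are therefore built from a measure \<gamma> of particles with positions
  \<pi> and velocities V: the flux is the image of V \<gamma>, its density is a conditional mean of
  V, and Jensen's inequality bounds its energy. As the minimum over fluxes is encoded as an infimum,
  the minimising sequence consists of pairs of measure and flux. Atomicity along that sequence is
  what makes the perimeter semicontinuous: diffuse measures have no atoms, yet may converge to a
  Dirac mass.\<close>

text \<open>Schoenberg's construction: \<open>tooth\<close> has period 2, vanishes on \<open>[0, 1/3]\<close> and equals 1 on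
  \<open>[2/3, 1]\<close>, so that \<open>tooth (3\<^sup>k t)\<close> reads off a ternary digit of a point \<open>t\<close> of the Cantor set.
  The curve and its Borel section reduce weak compactness in Euclidean space to Helly's theorem.\<close>

definition tooth :: "real \<Rightarrow> real"
  where "tooth t = max 0 (min 1 (1 / 2 - cos (pi * t)))"

lemma tooth_bounds: "0 \<le> tooth t" "tooth t \<le> 1"
  by (auto simp: tooth_def)

lemma continuous_tooth: "continuous_on S tooth"
  unfolding tooth_def by (intro continuous_intros)

text \<open>The even integer drops out of the cosine. What remains, \<open>r\<close> or
  \<open>2/3 + r\<close>, lies where \<open>1/2 - cos\<close> is at most 0 or at least 1, and the
  clipping makes the value exact.\<close>

lemma tooth_eq:
  fixes K a :: int
  assumes a: "a \<in> {0, 1}" and r: "0 \<le> r" "r \<le> 1 / 3"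
  shows "tooth (2 * of_int K + 2 * of_int a / 3 + r) = of_int a"
proof -
  have "cos (pi * (2 * of_int K + 2 * of_int a / 3 + r)) = cos (2 * pi * of_int K + pi * (2 * of_int a / 3 + r))"
    by (simp add: algebra_simps)
  also have "\<dots> = cos (pi * (2 * of_int a / 3 + r))"
    by (simp add: cos_add)
  finally have c: "cos (pi * (2 * of_int K + 2 * of_int a / 3 + r)) = cos (pi * (2 * of_int a / 3 + r))" .
  consider "a = 0" | "a = 1" using a by auto
  then show ?thesis
  proof cases
    case 1
    have "pi * r \<le> pi * (1 / 3)" using r by (intro mult_left_mono) auto
    then have "cos (pi / 3) \<le> cos (pi * r)"
      using r by (intro cos_monotone_0_pi_le) auto
    then show ?thesis using c 1 by (simp add: tooth_def cos_60)
  next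
    case 2
    have "pi * (2 / 3) \<le> pi * (2 / 3 + r)" "pi * (2 / 3 + r) \<le> pi * 1"
      using r by (intro mult_left_mono; simp)+
    then have "cos (pi * (2 / 3 + r)) \<le> cos (pi * (2 / 3))"
      by (intro cos_monotone_0_pi_le) auto
    also have "cos (pi * (2 / 3)) = - cos (pi / 3)"
      using cos_pi_minus[of "pi / 3"] by (simp add: field_simps)
    finally show ?thesis using c 2 by (simp add: tooth_def cos_60)
  qed
qed

text \<open>All ternary digits are 0 or 2, so multiplication by \<open>3 ^ n\<close> turns the
  earlier ones into an even integer \<open>2 * K\<close>. Digit \<open>n\<close> contributes
  \<open>2 * a n / 3\<close>, and the later digits add at most 1/3, which is the width of the flat
  pieces of \<open>tooth\<close>.\<close>

lemma tooth_ternary: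
  fixes a :: "nat \<Rightarrow> int"
  assumes a: "\<And>j. a j \<in> {0, 1}"
  shows "tooth (3 ^ n * (\<Sum>j. 2 * of_int (a j) / 3 ^ Suc j)) = of_int (a n)"
proof -
  let ?f = "\<lambda>j. 2 * real_of_int (a j) / 3 ^ Suc j"
  have a01: "0 \<le> real_of_int (a j)" "real_of_int (a j) \<le> 1" for j
    using a[of j] by auto
  have geo: "(\<lambda>j. (2 / 9) * (1 / 3) ^ j) sums ((2 / 9) * (1 / (1 - 1 / 3 :: real)))"
    by (intro sums_mult geometric_sums) auto
  have sm: "summable ?f"
  proof (rule summable_comparison_test')
    show "summable (\<lambda>j. (1 / 3 :: real) ^ j)" by (intro summable_geometric) auto
    show "norm (?f j) \<le> (1 / 3) ^ j" for j
      using a01[of j] by (simp add: power_divide field_simps)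
  qed
  define r where "r = 3 ^ n * (\<Sum>j. ?f (j + Suc n))"
  have r: "r = (\<Sum>j. 2 * real_of_int (a (j + Suc n)) / 9 / 3 ^ j)"
    unfolding r_def
    by (subst suminf_mult[symmetric], use sm summable_ignore_initial_segment in blast)
       (intro arg_cong[where f=suminf] ext, simp add: power_add field_simps)
  have sm': "summable (\<lambda>j. 2 * real_of_int (a (j + Suc n)) / 9 / 3 ^ j)"
    using summable_mult[OF summable_ignore_initial_segment[OF sm, of "Suc n"], of "3^n"]
    by (simp add: power_add field_simps)
  have r0: "0 \<le> r" unfolding r by (rule suminf_nonneg[OF sm']) (use a01 in auto)
  have "r \<le> (\<Sum>j. (2 / 9) * (1 / 3) ^ j)"
    unfolding r
  proof (rule suminf_le[OF _ sm' sums_summable[OF geo]])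
    show "2 * real_of_int (a (j + Suc n)) / 9 / 3 ^ j \<le> 2 / 9 * (1 / 3) ^ j" for j
      using a01[of "j + Suc n"] by (simp add: power_divide field_simps)
  qed
  also have "\<dots> = 1 / 3" using sums_unique[OF geo] by simp
  finally have r1: "r \<le> 1 / 3" .
  define K where "K = (\<Sum>j<n. a j * 3 ^ (n - Suc j))"
  have "3 ^ n * (\<Sum>j<n. ?f j) = (\<Sum>j<n. 2 * (of_int (a j) * 3 ^ (n - Suc j)))"
    unfolding sum_distrib_left
  proof (rule sum.cong[OF refl])
    fix j assume "j \<in> {..<n}"
    then have "(3::real) ^ n = 3 ^ (n - Suc j) * 3 ^ Suc j"
      by (subst power_add[symmetric]) auto
    then show "3 ^ n * ?f j = 2 * (of_int (a j) * 3 ^ (n - Suc j))" by simp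
  qed
  also have "\<dots> = 2 * of_int K" by (simp add: K_def sum_distrib_left)
  finally have K: "3 ^ n * (\<Sum>j<n. ?f j) = 2 * of_int K" .
  have "suminf ?f = (\<Sum>j. ?f (j + Suc n)) + (\<Sum>j<Suc n. ?f j)"
    by (rule suminf_split_initial_segment[OF sm])
  then have "3 ^ n * suminf ?f = r + (2 * of_int K + 3 ^ n * ?f n)"
    using K by (simp add: r_def algebra_simps del: power_Suc)
  then have "3 ^ n * suminf ?f = 2 * of_int K + 2 * of_int (a n) / 3 + r" by simp
  then show ?thesis using tooth_eq[OF a r0 r1] by metis
qed

definition bindigit :: "nat \<Rightarrow> real \<Rightarrow> int"
  where "bindigit k y = \<lfloor>2 ^ Suc k * y\<rfloor> mod 2"

lemma bindigit_01: "bindigit k y \<in> {0, 1}"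
  by (auto simp: bindigit_def)

lemma tendsto_dyadic_floor: "(\<lambda>n. of_int \<lfloor>2 ^ n * y\<rfloor> / 2 ^ n) \<longlonglongrightarrow> (y::real)"
proof (rule LIMSEQ_I)
  fix e :: real assume "e > 0"
  then obtain N where N: "(1 / 2) ^ N < e" using real_arch_pow_inv[of e "1/2"] by auto
  show "\<exists>N. \<forall>n\<ge>N. norm (of_int \<lfloor>2 ^ n * y\<rfloor> / 2 ^ n - y) < e"
  proof (intro exI[of _ N] allI impI)
    fix n assume "N \<le> n"
    then have "(1 / 2 :: real) ^ n \<le> (1 / 2) ^ N" by (intro power_decreasing) auto
    then have e: "(1 / 2 :: real) ^ n < e" using N by (rule le_less_trans)
    have "\<bar>of_int \<lfloor>2 ^ n * y\<rfloor> - 2 ^ n * y\<bar> \<le> 1" by linarith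
    then have "\<bar>of_int \<lfloor>2 ^ n * y\<rfloor> - 2 ^ n * y\<bar> / 2 ^ n \<le> 1 / 2 ^ n"
      by (intro divide_right_mono) auto
    also have "\<bar>of_int \<lfloor>2 ^ n * y\<rfloor> - 2 ^ n * y\<bar> / 2 ^ n = \<bar>(of_int \<lfloor>2 ^ n * y\<rfloor> - 2 ^ n * y) / 2 ^ n\<bar>"
      by simp
    also have "(of_int \<lfloor>2 ^ n * y\<rfloor> - 2 ^ n * y) / 2 ^ n = of_int \<lfloor>2 ^ n * y\<rfloor> / 2 ^ n - y"
      by (simp add: diff_divide_distrib)
    finally show "norm (of_int \<lfloor>2 ^ n * y\<rfloor> / 2 ^ n - y) < e" using e by (simp add: power_divide)
  qed
qed

text \<open>The partial sums telescope to the dyadic truncation of \<open>y\<close> from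
  below.\<close>

lemma bindigit_sums:
  assumes "0 \<le> y" "y < 1"
  shows "(\<lambda>k. of_int (bindigit k y) / 2 ^ Suc k) sums y"
proof -
  have "(\<Sum>k<n. of_int (bindigit k y) / 2 ^ Suc k) = of_int \<lfloor>2 ^ n * y\<rfloor> / (2 ^ n :: real)" for n
  proof (induction n)
    case 0
    then show ?case using assms by (simp add: floor_eq_iff)
  next
    case (Suc n)
    have "\<lfloor>2 ^ Suc n * y\<rfloor> div 2 = \<lfloor>2 ^ n * y\<rfloor>"
      using floor_divide_real_eq_div[of 2 "2 ^ Suc n * y"] by simp
    then have "\<lfloor>2 ^ Suc n * y\<rfloor> = 2 * \<lfloor>2 ^ n * y\<rfloor> + bindigit n y"
      unfolding bindigit_def by presburger
    then have "of_int \<lfloor>2 ^ Suc n * y\<rfloor> = 2 * real_of_int \<lfloor>2 ^ n * y\<rfloor> + of_int (bindigit n y)"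
      by simp
    then show ?case using Suc by (simp add: field_simps)
  qed
  then show ?thesis using tendsto_dyadic_floor[of y] by (simp add: sums_def)
qed

text \<open>The binary digits of the \<open>d\<close> coordinates are interleaved into one Cantor
  point \<open>h x\<close>, and \<open>g\<close> reads them back through \<open>tooth\<close>.
  Floors make \<open>h\<close> merely Borel; \<open>g\<close> is continuous on the whole line
  because \<open>tooth\<close> is.\<close>

lemma space_filling_unit_cube:
  "\<exists>(g :: real \<Rightarrow> 'a::euclidean_space) h. continuous_on UNIV g \<and> bounded (range g) \<and>
    h \<in> borel_measurable borel \<and> (\<forall>x. 0 \<le> h x \<and> h x \<le> 1) \<and>
    (\<forall>x. (\<forall>b\<in>Basis. 0 \<le> x \<bullet> b \<and> x \<bullet> b < 1) \<longrightarrow> g (h x) = x)"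
proof -
  define d where "d = DIM('a)"
  have d: "d > 0" by (simp add: d_def)
  have "\<exists>e :: nat \<Rightarrow> 'a. bij_betw e {0..<d} Basis"
    unfolding d_def by (rule ex_bij_betw_nat_finite[OF finite_Basis])
  then obtain e :: "nat \<Rightarrow> 'a" where e: "bij_betw e {0..<d} Basis" by blast
  \<comment> \<open>Coordinate \<open>i\<close> owns the digits number \<open>i\<close>,
    \<open>d + i\<close>, \<open>2 * d + i\<close>, and so on.\<close>
  define c where "c i t = (\<Sum>k. tooth (3 ^ (d * k + i) * t) / 2 ^ Suc k)" for i t
  have half: "(\<lambda>k. (1 / 2 :: real) ^ Suc k) sums 1" by (rule power_half_series)
  have bd: "norm (tooth (3 ^ (d * k + i) * t) / 2 ^ Suc k) \<le> (1 / 2) ^ Suc k" for i k t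
    using tooth_bounds[of "3 ^ (d * k + i) * t"] by (simp add: power_divide field_simps)
  have smc: "summable (\<lambda>k. tooth (3 ^ (d * k + i) * t) / 2 ^ Suc k)" for i t
    by (rule summable_comparison_test'[OF sums_summable[OF half]]) (rule bd)
  have c0: "0 \<le> c i t" for i t
    unfolding c_def by (intro suminf_nonneg smc) (simp add: tooth_bounds)
  have c1: "c i t \<le> 1" for i t
  proof -
    have "c i t \<le> (\<Sum>k. (1 / 2) ^ Suc k)"
      unfolding c_def
      by (intro suminf_le smc sums_summable[OF half]) (rule order_trans[OF abs_ge_self bd[unfolded real_norm_def]])
    then show ?thesis using sums_unique[OF half] by simp
  qed
  have cc: "continuous_on UNIV (c i)" for i
  proof -
    have "uniform_limit UNIV (\<lambda>n t. \<Sum>k<n. tooth (3 ^ (d * k + i) * t) / 2 ^ Suc k) (\<lambda>t. \<Sum>k. tooth (3 ^ (d * k + i) * t) / 2 ^ Suc k) sequentially"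
      by (rule Weierstrass_m_test[OF bd sums_summable[OF half]])
    then have "uniform_limit UNIV (\<lambda>n t. \<Sum>k<n. tooth (3 ^ (d * k + i) * t) / 2 ^ Suc k) (c i) sequentially"
      unfolding c_def .
    then show ?thesis
      by (rule uniform_limit_theorem[rotated])
         (auto intro!: always_eventually continuous_intros continuous_on_compose2[OF continuous_tooth[of UNIV]])
  qed
  define g where "g t = (\<Sum>i<d. c i t *\<^sub>R e i)" for t
  \<comment> \<open>Digit \<open>j\<close> belongs to coordinate \<open>j mod d\<close>, where it is
    binary digit number \<open>j div d\<close>; doubling it gives a ternary digit 0 or 2.\<close>
  define h where "h x = (\<Sum>j. 2 * real_of_int (bindigit (j div d) (x \<bullet> e (j mod d))) / 3 ^ Suc j)" for x
  have geo: "(\<lambda>j. (2 / 3) * (1 / 3) ^ j) sums ((2 / 3) * (1 / (1 - 1 / 3 :: real)))"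
    by (intro sums_mult geometric_sums) auto
  have b01: "0 \<le> real_of_int (bindigit k y)" "real_of_int (bindigit k y) \<le> 1" for k y
    using bindigit_01[of k y] by auto
  have hb: "norm (2 * real_of_int (bindigit (j div d) (x \<bullet> e (j mod d))) / 3 ^ Suc j) \<le> (2 / 3) * (1 / 3) ^ j" for j x
    using b01 by (simp add: power_divide field_simps)
  have smh: "summable (\<lambda>j. 2 * real_of_int (bindigit (j div d) (x \<bullet> e (j mod d))) / 3 ^ Suc j)" for x
    by (rule summable_comparison_test'[OF sums_summable[OF geo] hb])
  show ?thesis
  proof (intro exI[of _ g] exI[of _ h] conjI allI impI)
    show "continuous_on UNIV g"
      unfolding g_def by (intro continuous_intros cc)
    show "bounded (range g)"
    proof (rule boundedI)
      fix y assume "y \<in> range g"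
      then obtain t where t: "y = g t" by auto
      have "norm (g t) \<le> (\<Sum>i<d. norm (c i t *\<^sub>R e i))" unfolding g_def by (rule norm_sum)
      also have "\<dots> \<le> (\<Sum>i<d. norm (e i))"
        using c0 c1 by (intro sum_mono) (simp add: mult_left_le_one_le)
      finally show "norm y \<le> (\<Sum>i<d. norm (e i))" using t by simp
    qed
    show "h \<in> borel_measurable borel"
      unfolding h_def bindigit_def by measurable
    show "0 \<le> h x" for x
      unfolding h_def by (intro suminf_nonneg smh divide_nonneg_nonneg mult_nonneg_nonneg b01) auto
    show "h x \<le> 1" for x
    proof -
      have "2 * real_of_int (bindigit (j div d) (x \<bullet> e (j mod d))) / 3 ^ Suc j \<le> (2 / 3) * (1 / 3) ^ j" for j
        using hb[of j x] unfolding real_norm_def by linarith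
      then have "h x \<le> (\<Sum>j. (2 / 3) * (1 / 3) ^ j)"
        unfolding h_def by (intro suminf_le smh sums_summable[OF geo])
      then show ?thesis using sums_unique[OF geo] by simp
    qed
    fix x :: 'a assume x: "\<forall>b\<in>Basis. 0 \<le> x \<bullet> b \<and> x \<bullet> b < 1"
    have "c i (h x) = x \<bullet> e i" if i: "i < d" for i
    proof -
      have "tooth (3 ^ (d * k + i) * h x) = of_int (bindigit k (x \<bullet> e i))" for k
        unfolding h_def by (subst tooth_ternary) (use bindigit_01 i in \<open>auto simp: div_add1_eq\<close>)
      moreover have "e i \<in> Basis" using e i by (auto simp: bij_betw_def)
      ultimately show ?thesis
        unfolding c_def using bindigit_sums[of "x \<bullet> e i"] x by (simp add: sums_iff)
    qed
    then have "g (h x) = (\<Sum>i\<in>{0..<d}. (x \<bullet> e i) *\<^sub>R e i)"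
      unfolding g_def by (intro sum.cong) auto
    also have "\<dots> = (\<Sum>b\<in>Basis. (x \<bullet> b) *\<^sub>R b)" by (rule sum.reindex_bij_betw[OF e])
    finally show "g (h x) = x" by (simp add: euclidean_representation)
  qed
qed

lemma space_filling_ball:
  fixes R :: real assumes R: "R > 0"
  obtains g :: "real \<Rightarrow> 'a::euclidean_space" and h :: "'a \<Rightarrow> real"
  where "continuous_on UNIV g" "bounded (range g)" "h \<in> borel_measurable borel"
    "\<And>x. 0 \<le> h x" "\<And>x. h x \<le> 1" "\<And>x. norm x < R \<Longrightarrow> g (h x) = x"
proof -
  obtain g :: "real \<Rightarrow> 'a" and h where gh: "continuous_on UNIV g" "bounded (range g)"
    "h \<in> borel_measurable borel" "\<forall>x. 0 \<le> h x \<and> h x \<le> 1"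
    "\<forall>x. (\<forall>b\<in>Basis. 0 \<le> x \<bullet> b \<and> x \<bullet> b < 1) \<longrightarrow> g (h x) = x"
    using space_filling_unit_cube[where 'a='a] by blast
  define c :: 'a where "c = (1 / 2) *\<^sub>R One"
  show thesis
  proof (rule that[of "\<lambda>t. (2 * R) *\<^sub>R (g t - c)" "\<lambda>x. h ((1 / (2 * R)) *\<^sub>R x + c)"])
    show "continuous_on UNIV (\<lambda>t. (2 * R) *\<^sub>R (g t - c))" by (intro continuous_intros gh)
    have "bounded ((\<lambda>x. (2 * R) *\<^sub>R x) ` ((\<lambda>x. x - c) ` range g))"
      by (intro bounded_scaling bounded_translation_minus gh)
    then show "bounded (range (\<lambda>t. (2 * R) *\<^sub>R (g t - c)))" by (simp add: image_image)
    show "(\<lambda>x. h ((1 / (2 * R)) *\<^sub>R x + c)) \<in> borel_measurable borel"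
      by (intro measurable_compose[OF _ gh(3)]) measurable
    show "(2 * R) *\<^sub>R (g (h ((1 / (2 * R)) *\<^sub>R x + c)) - c) = x" if "norm x < R" for x
    proof -
      have "\<forall>b\<in>Basis. 0 \<le> ((1 / (2 * R)) *\<^sub>R x + c) \<bullet> b \<and> ((1 / (2 * R)) *\<^sub>R x + c) \<bullet> b < 1"
      proof
        fix b :: 'a assume b: "b \<in> Basis"
        have "\<bar>x \<bullet> b\<bar> < R" using Basis_le_norm[OF b, of x] that by simp
        then have "- 1 < (x \<bullet> b) / R" "(x \<bullet> b) / R < 1" using R by (simp_all add: field_simps abs_less_iff)
        then show "0 \<le> ((1 / (2 * R)) *\<^sub>R x + c) \<bullet> b \<and> ((1 / (2 * R)) *\<^sub>R x + c) \<bullet> b < 1"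
          using b by (simp add: c_def inner_add_left)
      qed
      then have "g (h ((1 / (2 * R)) *\<^sub>R x + c)) = (1 / (2 * R)) *\<^sub>R x + c" using gh(5) by blast
      then show ?thesis using R by simp
    qed
  qed (use gh in auto)
qed


text \<open>Normalised to probabilities and pushed to the unit interval by \<open>h\<close>, the
  measures are tight, so Helly's theorem applies on the line. As \<open>g\<close> inverts
  \<open>h\<close> on \<open>K\<close>, the integral of \<open>f\<close> is the mass times the
  integral of \<open>f\<close> composed with \<open>g\<close>, a bounded continuous function, and
  the limit is carried back by \<open>g\<close>.\<close>

theorem weakly_convergent_subsequence:
  fixes M :: "nat \<Rightarrow> 'a::euclidean_space measure"
  assumes sets: "\<And>n. sets (M n) = sets borel" and fin: "\<And>n. finite_measure (M n)"
    and supp: "\<And>n. AE x in M n. x \<in> K" and K: "compact K"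
    and mass: "\<And>n. measure (M n) UNIV \<le> C"
  shows "\<exists>r N. strict_mono (r :: nat \<Rightarrow> nat) \<and> sets N = sets borel \<and> finite_measure N \<and>
    (AE x in N. x \<in> K) \<and>
    (\<forall>f :: 'a \<Rightarrow> real. continuous_on UNIV f \<longrightarrow> (\<lambda>n. \<integral>x. f x \<partial>M (r n)) \<longlonglongrightarrow> (\<integral>x. f x \<partial>N))"
proof -
  note [measurable_cong] = sets
  have space: "space (M n) = UNIV" for n using sets_eq_imp_space_eq[OF sets] by simp
  obtain R where R: "R > 0" "K \<subseteq> ball 0 R"
    using compact_imp_bounded[OF K] bounded_subset_ballD[of K 0] by auto
  obtain g :: "real \<Rightarrow> 'a" and h where g: "continuous_on UNIV g" "bounded (range g)"
    and h[measurable]: "h \<in> borel_measurable borel" and h01: "\<And>x. 0 \<le> h x" "\<And>x. h x \<le> 1"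
    and gh: "\<And>x. norm x < R \<Longrightarrow> g (h x) = x"
    using space_filling_ball[OF R(1), where 'a='a] by blast
  have gm[measurable]: "g \<in> borel_measurable borel" by (rule borel_measurable_continuous_onI[OF g(1)])
  have ghK: "g (h x) = x" if "x \<in> K" for x using R gh that by auto
  define a where "a n = measure (M n) UNIV" for n
  have a0: "0 \<le> a n" for n by (simp add: a_def)
  have "bounded (range a)"
    using mass a0 by (intro boundedI[of _ C]) (auto simp: a_def)
  then obtain s A where s: "strict_mono s" "(a \<circ> s) \<longlonglongrightarrow> A"
    using bounded_imp_convergent_subsequence by blast
  have A0: "0 \<le> A" by (rule LIMSEQ_le_const[OF s(2)]) (auto simp: a0)
  \<comment> \<open>A zero measure cannot be normalised. Any probability may replace it, because the
    factor \<open>a n = 0\<close> is restored later.\<close>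
  define Q where "Q n = (if a n = 0 then return borel 0 else density (M n) (\<lambda>_. ennreal (1 / a n)))" for n
  have setsQ[measurable_cong]: "sets (Q n) = sets borel" for n by (simp add: Q_def sets)
  have Q: "prob_space (Q n)" for n
  proof (cases "a n = 0")
    case False
    interpret finite_measure "M n" by (rule fin)
    have "emeasure (Q n) (space (Q n)) = ennreal (1 / a n) * emeasure (M n) UNIV"
      using False space[of n] by (simp add: Q_def emeasure_density_const sets)
    also have "\<dots> = ennreal (1 / a n * a n)"
      using a0[of n] by (simp add: a_def emeasure_eq_measure flip: ennreal_mult)
    finally show ?thesis using False by (intro prob_spaceI) simp
  qed (simp add: Q_def prob_space_return)
  define P where "P n = distr (Q n) borel h" for n
  have P: "real_distribution (P n)" for n
    unfolding P_def by (rule prob_space.real_distribution_distr[OF Q]) measurable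
  have "tight P"
    unfolding tight_def
  proof (intro conjI allI impI P)
    fix \<epsilon> :: real assume "\<epsilon> > 0"
    \<comment> \<open>Tightness is phrased with half-open intervals and \<open>h\<close> may take
      the value 0, hence a left end point below 0.\<close>
    have "measure (P n) {-1<..1} = 1" for n
    proof -
      interpret Q: prob_space "Q n" by (rule Q)
      have "h x \<in> {-1<..1}" for x
        unfolding greaterThanAtMost_iff by (intro conjI less_le_trans[OF _ h01(1)] h01(2)) simp
      then have hU: "h -` {-1<..1} \<inter> space (Q n) = space (Q n)"
        by (intro Int_absorb1 subsetI vimageI2)
      have "measure (P n) {-1<..1} = measure (Q n) (h -` {-1<..1} \<inter> space (Q n))"
        unfolding P_def by (rule measure_distr) auto
      then show ?thesis unfolding hU by (simp add: Q.prob_space)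
    qed
    then show "\<exists>a b. a < b \<and> (\<forall>n. 1 - \<epsilon> < measure (P n) {a<..b})"
      using \<open>\<epsilon> > 0\<close> by (intro exI[of _ "-1"] exI[of _ 1]) auto
  qed
  then obtain r \<rho> where r: "strict_mono (r :: nat \<Rightarrow> nat)" and \<rho>: "real_distribution \<rho>"
    and conv: "weak_conv_m (P \<circ> s \<circ> r) \<rho>"
    using tight_imp_convergent_subsubsequence[OF _ s(1)] by blast
  interpret \<rho>: real_distribution \<rho> by fact
  define N where "N = density (distr \<rho> borel g) (\<lambda>_. ennreal A)"
  have setsN[measurable_cong]: "sets N = sets borel" by (simp add: N_def)
  have spaceN: "space N = UNIV" using sets_eq_imp_space_eq[OF setsN] by simp
  have finN: "finite_measure N"
  proof (rule finite_measureI)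
    interpret D: prob_space "distr \<rho> borel g" by (rule \<rho>.prob_space_distr) simp
    show "emeasure N (space N) \<noteq> \<infinity>"
      unfolding spaceN unfolding N_def by (subst emeasure_density_const) (auto simp: ennreal_mult_eq_top_iff)
  qed
  \<comment> \<open>The function \<open>f\<close> is continuous but possibly unbounded. Only its
    values on the bounded curve enter, and there compactness bounds it.\<close>
  have bdd: "\<exists>B. \<forall>x. \<bar>f (g x)\<bar> \<le> B" if f: "continuous_on UNIV f" for f :: "'a \<Rightarrow> real"
  proof -
    have "compact (closure (range g))" using g(2) by (simp add: compact_closure)
    then have cp: "compact (f ` closure (range g))"
      by (rule compact_continuous_image[OF continuous_on_subset[OF f subset_UNIV]])
    obtain B where "\<forall>y\<in>f ` closure (range g). norm y \<le> B"
      using compact_imp_bounded[OF cp] unfolding bounded_iff by blast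
    then have B: "\<bar>f y\<bar> \<le> B" if "y \<in> closure (range g)" for y using that by simp
    have "g x \<in> closure (range g)" for x using closure_subset[of "range g"] by (rule subsetD) simp
    then show ?thesis by (intro exI[of _ B] allI B)
  qed
  have intN: "(\<integral>x. f x \<partial>N) = A * (\<integral>y. f (g y) \<partial>\<rho>)" and integrN: "integrable N f"
    if f: "continuous_on UNIV f" for f :: "'a \<Rightarrow> real"
  proof -
    have [measurable]: "f \<in> borel_measurable borel" by (rule borel_measurable_continuous_onI[OF f])
    show "(\<integral>x. f x \<partial>N) = A * (\<integral>y. f (g y) \<partial>\<rho>)"
      unfolding N_def using A0 by (subst integral_density) (auto simp: integral_distr)
    obtain B where B: "\<forall>x. \<bar>f (g x)\<bar> \<le> B" using bdd[OF f] by blast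
    have "integrable \<rho> (\<lambda>y. f (g y))"
      using B by (intro \<rho>.integrable_const_bound[of _ B]) auto
    then show "integrable N f"
      unfolding N_def using A0 by (subst integrable_density) (auto simp: integrable_distr_eq)
  qed
  have main: "(\<lambda>n. \<integral>x. f x \<partial>M ((s \<circ> r) n)) \<longlonglongrightarrow> (\<integral>x. f x \<partial>N)"
    if f: "continuous_on UNIV f" for f :: "'a \<Rightarrow> real"
  proof -
    have [measurable]: "f \<in> borel_measurable borel" by (rule borel_measurable_continuous_onI[OF f])
    have *: "(\<integral>x. f x \<partial>M n) = a n * (\<integral>y. f (g y) \<partial>P n)" for n
    proof (cases "a n = 0")
      case True
      interpret finite_measure "M n" by (rule fin)
      have "emeasure (M n) (space (M n)) = 0" using True space by (simp add: a_def emeasure_eq_measure)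
      then have "AE x in M n. f x = 0" by (intro AE_I[of _ _ "space (M n)"]) auto
      then have "(\<integral>x. f x \<partial>M n) = (\<integral>x. 0 \<partial>M n)" by (intro integral_cong_AE) auto
      then show ?thesis using True by simp
    next
      case False
      have "(\<integral>y. f (g y) \<partial>P n) = (\<integral>x. f (g (h x)) \<partial>Q n)"
        unfolding P_def by (subst integral_distr) auto
      also have "\<dots> = (1 / a n) * (\<integral>x. f (g (h x)) \<partial>M n)"
        using False a0[of n] unfolding Q_def by (simp add: integral_density)
      also have "(\<integral>x. f (g (h x)) \<partial>M n) = (\<integral>x. f x \<partial>M n)"
        by (rule integral_cong_AE) (use supp[of n] ghK in \<open>auto elim!: eventually_mono\<close>)
      finally show ?thesis using False by simp
    qed
    obtain B where B: "\<forall>x. \<bar>f (g x)\<bar> \<le> B" using bdd[OF f] by blast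
    have "(\<lambda>n. \<integral>y. f (g y) \<partial>((P \<circ> s \<circ> r) n)) \<longlonglongrightarrow> (\<integral>y. f (g y) \<partial>\<rho>)"
    proof (rule weak_conv_imp_integral_bdd_continuous_conv[OF _ \<rho> conv])
      show "real_distribution ((P \<circ> s \<circ> r) n)" for n using P by simp
      show "isCont (\<lambda>y. f (g y)) x" for x
        using continuous_on_compose2[OF f g(1)] by (simp add: continuous_on_eq_continuous_at)
      show "norm (f (g x)) \<le> B" for x using B by simp
    qed
    moreover have "(\<lambda>n. a (s (r n))) \<longlonglongrightarrow> A"
      using LIMSEQ_subseq_LIMSEQ[OF s(2) r] by (simp add: o_def)
    ultimately have "(\<lambda>n. a (s (r n)) * (\<integral>y. f (g y) \<partial>P (s (r n)))) \<longlonglongrightarrow> A * (\<integral>y. f (g y) \<partial>\<rho>)"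
      by (intro tendsto_mult) (simp_all add: o_def)
    then show ?thesis using intN[OF f] by (simp add: *)
  qed
  have suppN: "AE x in N. x \<in> K"
  proof -
    \<comment> \<open>The distance to \<open>K\<close> integrates to 0 along the sequence, hence
      also in the limit. As \<open>infdist\<close> to the empty set is 0 by convention, that case
      takes the constant 1.\<close>
    define f where "f x = (if K = {} then 1 else infdist x K)" for x
    have f: "continuous_on UNIV f" unfolding f_def by (cases "K = {}") (auto intro!: continuous_intros)
    have [measurable]: "f \<in> borel_measurable borel" by (rule borel_measurable_continuous_onI[OF f])
    have f0: "f x = 0 \<longleftrightarrow> x \<in> K" for x
      using in_closed_iff_infdist_zero[OF compact_imp_closed[OF K]] by (auto simp: f_def)
    have fn: "0 \<le> f x" for x by (simp add: f_def infdist_nonneg)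
    have M0: "(\<integral>x. f x \<partial>M n) = (\<integral>x. 0 \<partial>M n)" for n
      by (rule integral_cong_AE) (use supp[of n] f0 in \<open>auto elim!: eventually_mono\<close>)
    then have "(\<integral>x. f x \<partial>N) = 0" using main[OF f] by (simp add: M0 LIMSEQ_const_iff)
    then have "AE x in N. f x = 0"
      using integral_nonneg_eq_0_iff_AE[OF integrN[OF f] AE_I2[OF fn]] by simp
    then show ?thesis by (simp add: f0)
  qed
  show ?thesis
    using strict_mono_o[OF s(1) r] setsN finN suppN main by (intro exI[of _ "s \<circ> r"] exI[of _ N]) auto
qed

section \<open>Vector measures with square-integrable densities\<close>

definition signed_measure_on :: "'a set set \<Rightarrow> ('a set \<Rightarrow> real) \<Rightarrow> bool"
  where "signed_measure_on \<M> m \<longleftrightarrow> (\<forall>A :: nat \<Rightarrow> 'a set. range A \<subseteq> \<M> \<longrightarrow> disjoint_family A \<longrightarrow>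
    (\<lambda>n. m (A n)) sums m (\<Union>n. A n))"

context sigma_algebra
begin

lemma signed_measure_empty:
  assumes "signed_measure_on M m" shows "m {} = 0"
proof -
  have "(\<lambda>n::nat. m {}) sums m (\<Union>n::nat. {})"
    using assms[unfolded signed_measure_on_def, rule_format, of "\<lambda>_. {}"] by (auto simp: disjoint_family_on_def)
  then have "(\<lambda>n::nat. m {}) \<longlonglongrightarrow> 0" by (intro summable_LIMSEQ_zero sums_summable)
  then show ?thesis by (simp add: tendsto_const_iff)
qed

lemma signed_measure_Un:
  assumes m: "signed_measure_on M m" and A: "A \<in> M" "B \<in> M" "A \<inter> B = {}"
  shows "m (A \<union> B) = m A + m B"
proof -
  have "(\<lambda>n. m (binaryset A B n)) sums m (\<Union>n. binaryset A B n)"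
  proof (rule m[unfolded signed_measure_on_def, rule_format])
    show "range (binaryset A B) \<subseteq> M" using A by (auto simp: range_binaryset_eq)
    show "disjoint_family (binaryset A B)"
      using A by (auto simp: disjoint_family_on_def binaryset_def)
  qed
  then have "(\<lambda>n. m (binaryset A B n)) sums m (A \<union> B)" by (simp add: UN_binaryset_eq)
  moreover have "(\<lambda>n. m (binaryset A B n)) sums (m A + m B)"
    using binaryset_sums[where f=m, OF signed_measure_empty[OF m]] by blast
  ultimately show ?thesis by (rule sums_unique2)
qed

lemma signed_measure_Diff:
  assumes m: "signed_measure_on M m" and A: "A \<in> M" "B \<in> M" "B \<subseteq> A"
  shows "m (A - B) = m A - m B"
proof -
  have "m ((A - B) \<union> B) = m (A - B) + m B"
    using A by (intro signed_measure_Un[OF m]) auto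
  moreover have "(A - B) \<union> B = A" using A by auto
  ultimately show ?thesis by simp
qed

text \<open>If \<open>m\<close> is unbounded on \<open>A\<close>, choose \<open>B\<close> inside
  \<open>A\<close> with \<open>m B\<close> above \<open>1 + \<bar>m A\<bar>\<close>. Both
  \<open>B\<close> and \<open>A - B\<close> then have value larger than 1 in modulus, and
  \<open>m\<close> is unbounded on one of them; keep that one and discard the other. The discarded
  sets are disjoint, and their values do not tend to 0, against countable additivity.\<close>

lemma signed_measure_bounded_above:
  assumes m: "signed_measure_on M m" and \<Omega>: "A0 \<in> M"
  shows "\<exists>C. \<forall>B\<in>M. B \<subseteq> A0 \<longrightarrow> m B \<le> C"
proof (rule ccontr)
  define unb where "unb A \<longleftrightarrow> A \<in> M \<and> (\<forall>C. \<exists>B\<in>M. B \<subseteq> A \<and> C < m B)" for A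
  assume "\<not> ?thesis"
  then have unb0: "unb A0" using \<Omega> unfolding unb_def by (meson not_le)
  have step: "\<exists>A'. unb A' \<and> A' \<subseteq> A \<and> 1 < \<bar>m (A - A')\<bar>" if A: "unb A" for A
  proof -
    obtain B where B: "B \<in> M" "B \<subseteq> A" "1 + \<bar>m A\<bar> < m B" using A unfolding unb_def by blast
    have AM: "A \<in> M" using A by (simp add: unb_def)
    have d: "m (A - B) = m A - m B" by (rule signed_measure_Diff[OF m AM B(1,2)])
    show ?thesis
    proof (cases "unb B")
      case True
      then show ?thesis using B d by (intro exI[of _ B]) auto
    next
      case False
      then obtain C where C: "\<And>D. D \<in> M \<Longrightarrow> D \<subseteq> B \<Longrightarrow> m D \<le> C"
        using B unfolding unb_def by (meson not_le)
      have "unb (A - B)"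
        unfolding unb_def
      proof (intro conjI allI)
        show "A - B \<in> M" using AM B by auto
        fix C'
        obtain D where D: "D \<in> M" "D \<subseteq> A" "C + C' < m D" using A unfolding unb_def by blast
        have "m D = m (D \<inter> B) + m (D - B)"
          using signed_measure_Un[OF m, of "D \<inter> B" "D - B"] D B by (auto simp: Int_Diff_Un Int_Diff_disjoint)
        moreover have "m (D \<inter> B) \<le> C" using C D B by auto
        ultimately have "C' < m (D - B)" using D by linarith
        then show "\<exists>B'\<in>M. B' \<subseteq> A - B \<and> C' < m B'" using D B by (intro bexI[of _ "D - B"]) auto
      qed
      moreover have "A - (A - B) = B" using B by auto
      ultimately show ?thesis using B by (intro exI[of _ "A - B"]) auto
    qed
  qed
  then obtain f where f: "\<And>A. unb A \<Longrightarrow> unb (f A) \<and> f A \<subseteq> A \<and> 1 < \<bar>m (A - f A)\<bar>" by metis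
  define D where "D n = (f ^^ n) A0" for n
  have D: "unb (D n)" for n by (induction n) (auto simp: D_def unb0 f)
  have DS: "D (Suc n) = f (D n)" for n by (simp add: D_def)
  have dec: "decseq D" by (rule decseq_SucI) (use D f DS in auto)
  define E where "E n = D n - D (Suc n)" for n
  have E: "1 < \<bar>m (E n)\<bar>" for n using D f DS by (simp add: E_def)
  have "disjoint_family E"
    unfolding disjoint_family_on_def
  proof (intro ballI impI)
    fix i j :: nat assume "i \<noteq> j"
    then consider "Suc i \<le> j" | "Suc j \<le> i" by linarith
    then show "E i \<inter> E j = {}"
    proof cases
      case 1
      then have "D j \<subseteq> D (Suc i)" using dec by (auto simp: decseq_def)
      then show ?thesis by (auto simp: E_def)
    next
      case 2
      then have "D i \<subseteq> D (Suc j)" using dec by (auto simp: decseq_def)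
      then show ?thesis by (auto simp: E_def)
    qed
  qed
  moreover have "range E \<subseteq> M" using D by (auto simp: E_def unb_def)
  ultimately have "(\<lambda>n. m (E n)) \<longlonglongrightarrow> 0"
    using m unfolding signed_measure_on_def by (meson summable_LIMSEQ_zero sums_summable)
  then have "eventually (\<lambda>n. \<bar>m (E n)\<bar> < 1) sequentially"
    using order_tendstoD(2)[OF tendsto_rabs_zero] by (metis zero_less_one)
  then obtain n where "\<bar>m (E n)\<bar> < 1" by (auto simp: eventually_sequentially)
  then show False using E[of n] by simp
qed

text \<open>The positive part \<open>p\<close> is the upper variation, the supremum of
  \<open>m\<close> over measurable subsets, and \<open>q = p - m\<close>. The last conjunct serves
  absolute continuity: if \<open>m\<close> vanishes on all subsets of a set, so do both
  parts.\<close>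

lemma signed_measure_Jordan:
  assumes m: "signed_measure_on M m" and \<Omega>: "\<Omega> \<in> M" and sub: "\<And>A. A \<in> M \<Longrightarrow> A \<subseteq> \<Omega>"
  shows "\<exists>p q. (\<forall>A\<in>M. m A = p A - q A \<and> 0 \<le> p A \<and> 0 \<le> q A) \<and>
    signed_measure_on M p \<and> signed_measure_on M q \<and>
    (\<forall>A\<in>M. (\<forall>B\<in>M. B \<subseteq> A \<longrightarrow> m B = 0) \<longrightarrow> p A = 0 \<and> q A = 0)"
proof -
  obtain C where C: "\<And>B. B \<in> M \<Longrightarrow> m B \<le> C"
    using signed_measure_bounded_above[OF m \<Omega>] sub by metis
  define p where "p A = (SUP B\<in>{B\<in>M. B \<subseteq> A}. m B)" for A
  have ne: "{B\<in>M. B \<subseteq> A} \<noteq> {}" for A by auto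
  have bdd: "bdd_above (m ` {B\<in>M. B \<subseteq> A})" for A using C by (intro bdd_aboveI[of _ C]) auto
  have up: "m B \<le> p A" if "B \<in> M" "B \<subseteq> A" for A B
    unfolding p_def by (rule cSUP_upper[OF _ bdd]) (use that in auto)
  have least: "p A \<le> c" if "\<And>B. B \<in> M \<Longrightarrow> B \<subseteq> A \<Longrightarrow> m B \<le> c" for A c
    unfolding p_def by (rule cSUP_least[OF ne]) (use that in auto)
  have p0: "0 \<le> p A" for A using up[of "{}" A] signed_measure_empty[OF m] by simp
  have pge: "m A \<le> p A" if "A \<in> M" for A using up that by auto
  have psig: "signed_measure_on M p"
    unfolding signed_measure_on_def
  proof (intro allI impI)
    fix A :: "nat \<Rightarrow> 'a set" assume A: "range A \<subseteq> M" "disjoint_family A"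
    have AM: "A n \<in> M" for n using A by auto
    have fin: "(\<Sum>i<n. p (A i)) \<le> p (\<Union>n. A n)" for n
    proof (rule field_le_epsilon)
      fix e :: real assume e: "e > 0"
      have "\<exists>B. B \<in> M \<and> B \<subseteq> A i \<and> p (A i) - e / real (Suc n) < m B" for i
      proof (rule ccontr)
        assume *: "\<not> (\<exists>B. B \<in> M \<and> B \<subseteq> A i \<and> p (A i) - e / real (Suc n) < m B)"
        have "p (A i) \<le> p (A i) - e / real (Suc n)"
        proof (rule least)
          fix B assume "B \<in> M" "B \<subseteq> A i"
          then show "m B \<le> p (A i) - e / real (Suc n)" using * not_less by blast
        qed
        moreover have "0 < e / real (Suc n)" using e by simp
        ultimately show False by linarith
      qed
      then have "\<exists>B. \<forall>i. B i \<in> M \<and> B i \<subseteq> A i \<and> p (A i) - e / real (Suc n) < m (B i)"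
        by (intro choice allI)
      then obtain B where B: "\<And>i. B i \<in> M" "\<And>i. B i \<subseteq> A i" "\<And>i. p (A i) - e / real (Suc n) < m (B i)" by blast
      have "m (\<Union>i<k. B i) = (\<Sum>i<k. m (B i))" for k
      proof (induction k)
        case (Suc k)
        have "(\<Union>i<k. B i) \<inter> B k = {}"
        proof -
          have "A i \<inter> A k = {}" if "i < k" for i using A(2) that by (auto simp: disjoint_family_on_def)
          then have "B i \<inter> B k = {}" if "i < k" for i using B(2)[of i] B(2)[of k] that by blast
          then show ?thesis by auto
        qed
        then have "m ((\<Union>i<k. B i) \<union> B k) = m (\<Union>i<k. B i) + m (B k)"
          using B(1) by (intro signed_measure_Un[OF m]) auto
        then show ?case using Suc by (simp add: lessThan_Suc Un_commute)
      qed (simp add: signed_measure_empty[OF m])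
      moreover have "m (\<Union>i<n. B i) \<le> p (\<Union>n. A n)" 
      proof (rule up)
        show "(\<Union>i<n. B i) \<in> M" using B(1) by auto
        show "(\<Union>i<n. B i) \<subseteq> (\<Union>n. A n)" using B(2) by (intro UN_mono) auto
      qed
      ultimately have s: "(\<Sum>i<n. m (B i)) \<le> p (\<Union>n. A n)" by simp
      have "(\<Sum>i<n. p (A i)) \<le> (\<Sum>i<n. m (B i) + e / real (Suc n))"
        using B(3) by (intro sum_mono) (simp add: less_imp_le algebra_simps)
      also have "\<dots> = (\<Sum>i<n. m (B i)) + real n * (e / real (Suc n))" by (simp add: sum.distrib)
      also have "real n * (e / real (Suc n)) \<le> e" using e by (simp add: field_simps)
      finally show "(\<Sum>i<n. p (A i)) \<le> p (\<Union>n. A n) + e" using s by linarith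
    qed
    have sm: "summable (\<lambda>i. p (A i))"
    proof (rule bounded_imp_summable[of _ "p (\<Union>n. A n)"])
      show "(\<Sum>i\<le>n. p (A i)) \<le> p (\<Union>n. A n)" for n
        using fin[of "Suc n"] by (simp only: lessThan_Suc_atMost)
    qed (rule p0)
    have "p (\<Union>n. A n) \<le> (\<Sum>i. p (A i))"
    proof (rule least)
      fix B assume B: "B \<in> M" "B \<subseteq> (\<Union>n. A n)"
      have "(\<lambda>n. m (A n \<inter> B)) sums m (\<Union>n. A n \<inter> B)"
      proof (rule m[unfolded signed_measure_on_def, rule_format])
        show "range (\<lambda>n. A n \<inter> B) \<subseteq> M" using AM B(1) by auto
        show "disjoint_family (\<lambda>n. A n \<inter> B)"
          using A(2) unfolding disjoint_family_on_def by blast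
      qed
      moreover have "(\<Union>n. A n \<inter> B) = B" using B by auto
      ultimately have s: "(\<lambda>n. m (A n \<inter> B)) sums m B" by simp
      then have "m B = (\<Sum>n. m (A n \<inter> B))" by (simp add: sums_iff)
      also have "\<dots> \<le> (\<Sum>i. p (A i))"
        by (rule suminf_le[OF _ sums_summable[OF s] sm], rule up) (use AM B(1) in auto)
      finally show "m B \<le> (\<Sum>i. p (A i))" .
    qed
    moreover have "(\<Sum>i. p (A i)) \<le> p (\<Union>n. A n)" by (rule suminf_le_const[OF sm fin])
    ultimately show "(\<lambda>n. p (A n)) sums p (\<Union>n. A n)" using sm by (simp add: sums_iff)
  qed
  have qsig: "signed_measure_on M (\<lambda>A. p A - m A)"
    unfolding signed_measure_on_def
  proof (intro allI impI)
    fix A :: "nat \<Rightarrow> 'a set" assume "range A \<subseteq> M" "disjoint_family A"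
    then show "(\<lambda>n. p (A n) - m (A n)) sums (p (\<Union>n. A n) - m (\<Union>n. A n))"
      using psig m unfolding signed_measure_on_def by (intro sums_diff) blast+
  qed
  have "p A = 0 \<and> p A - m A = 0" if "A \<in> M" "\<forall>B\<in>M. B \<subseteq> A \<longrightarrow> m B = 0" for A
  proof -
    have "p A \<le> 0" by (rule least) (simp add: that)
    then show ?thesis using p0[of A] that by simp
  qed
  then show ?thesis
    using p0 pge psig qsig by (intro exI[of _ p] exI[of _ "\<lambda>A. p A - m A"]) simp
qed

end

section \<open>Radon-Nikodym densities of signed and vector measures\<close>

lemma (in finite_measure) nonneg_signed_Radon_Nikodym:
  assumes m: "signed_measure_on (sets M) p" and nn: "\<And>A. A \<in> sets M \<Longrightarrow> 0 \<le> p A"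
    and ac: "\<And>A. A \<in> null_sets M \<Longrightarrow> p A = 0"
  obtains f :: "'a \<Rightarrow> real" where "integrable M f" "\<And>A. A \<in> sets M \<Longrightarrow> p A = (\<integral>x. indicator A x * f x \<partial>M)"
proof -
  define N where "N = measure_of (space M) (sets M) (\<lambda>A. ennreal (p A))"
  have setsN: "sets N = sets M" by (simp add: N_def sets.sigma_sets_eq sets.space_closed)
  have emN: "emeasure N A = ennreal (p A)" if A: "A \<in> sets M" for A
  proof (rule emeasure_measure_of[OF N_def])
    show "sets M \<subseteq> Pow (space M)" by (rule sets.space_closed)
    show "A \<in> sets N" using A setsN by simp
    show "positive (sets N) (\<lambda>A. ennreal (p A))"
      using sets.signed_measure_empty[OF m] by (simp add: positive_def)
    show "countably_additive (sets N) (\<lambda>A. ennreal (p A))"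
      unfolding countably_additive_def setsN
    proof (intro allI impI)
      fix A :: "nat \<Rightarrow> 'a set" assume A: "range A \<subseteq> sets M" "disjoint_family A"
      have s: "(\<lambda>n. p (A n)) sums p (\<Union>n. A n)" using m A by (auto simp: signed_measure_on_def)
      have "\<And>n. 0 \<le> p (A n)" using nn A by auto
      then show "(\<Sum>i. ennreal (p (A i))) = ennreal (p (\<Union>i. A i))"
        using s by (subst suminf_ennreal2) (auto simp: sums_iff)
    qed
  qed
  have finN: "finite_measure N"
    by (rule finite_measureI) (simp add: sets_eq_imp_space_eq[OF setsN] emN)
  have "absolutely_continuous M N"
    unfolding absolutely_continuous_def
  proof
    fix A assume "A \<in> null_sets M"
    then show "A \<in> null_sets N" using ac emN by (auto simp: null_sets_def setsN)
  qed
  then obtain F where F: "F \<in> borel_measurable M" "density M F = N"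
    using Radon_Nikodym_finite_measure[OF finN setsN] by blast
  have "(\<integral>\<^sup>+x. F x \<partial>M) = emeasure N (space M)"
    using F by (subst F(2)[symmetric], subst emeasure_density) (auto intro!: nn_integral_cong)
  also have "\<dots> < \<infinity>" by (simp add: emN)
  finally have Fi: "(\<integral>\<^sup>+x. F x \<partial>M) \<noteq> \<infinity>" by simp
  then have "AE x in M. F x \<noteq> \<infinity>" by (intro nn_integral_PInf_AE F)
  then have Fe: "AE x in M. F x = ennreal (enn2real (F x))"
    by eventually_elim (simp add: top.not_eq_extremum)
  show thesis
  proof (rule that[of "\<lambda>x. enn2real (F x)"])
    have "(\<integral>\<^sup>+x. ennreal (enn2real (F x)) \<partial>M) = (\<integral>\<^sup>+x. F x \<partial>M)"
      by (rule nn_integral_cong_AE) (use Fe in \<open>auto elim!: eventually_mono\<close>)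
    then show i: "integrable M (\<lambda>x. enn2real (F x))"
      using F(1) Fi by (intro integrableI_nonneg) (auto simp: top.not_eq_extremum)
    fix A assume A: "A \<in> sets M"
    have "ennreal (p A) = (\<integral>\<^sup>+x. F x * indicator A x \<partial>M)"
      using A F by (subst emN[symmetric], simp, subst F(2)[symmetric], subst emeasure_density) auto
    also have "\<dots> = (\<integral>\<^sup>+x. ennreal (indicator A x * enn2real (F x)) \<partial>M)"
      by (rule nn_integral_cong_AE) (use Fe in \<open>auto elim!: eventually_mono simp: indicator_def\<close>)
    also have "\<dots> = ennreal (\<integral>x. indicator A x * enn2real (F x) \<partial>M)"
      using integrable_real_mult_indicator[OF A i]
      by (intro nn_integral_eq_integral) (auto simp: mult.commute)
    finally show "p A = (\<integral>x. indicator A x * enn2real (F x) \<partial>M)"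
      using nn[OF A] by (subst (asm) ennreal_inj) (auto intro!: integral_nonneg_AE)
  qed
qed

text \<open>Measurable subsets of a null set are null, so \<open>m\<close> vanishes on all of them
  and both Jordan parts are absolutely continuous.\<close>

lemma (in finite_measure) signed_Radon_Nikodym:
  assumes m: "signed_measure_on (sets M) m" and ac: "\<And>A. A \<in> null_sets M \<Longrightarrow> m A = 0"
  obtains f :: "'a \<Rightarrow> real" where "integrable M f" "\<And>A. A \<in> sets M \<Longrightarrow> m A = (\<integral>x. indicator A x * f x \<partial>M)"
proof -
  obtain p q where pq: "\<forall>A\<in>sets M. m A = p A - q A \<and> 0 \<le> p A \<and> 0 \<le> q A"
    and sig: "signed_measure_on (sets M) p" "signed_measure_on (sets M) q"
    and null: "\<forall>A\<in>sets M. (\<forall>B\<in>sets M. B \<subseteq> A \<longrightarrow> m B = 0) \<longrightarrow> p A = 0 \<and> q A = 0"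
    using sets.signed_measure_Jordan[OF m sets.top sets.sets_into_space] by blast
  have n: "p A = 0 \<and> q A = 0" if A: "A \<in> null_sets M" for A
  proof -
    have "m B = 0" if "B \<in> sets M" "B \<subseteq> A" for B
      using that A by (intro ac null_sets_subset[OF A]) auto
    then show ?thesis using null A by auto
  qed
  obtain f where f: "integrable M f" "\<And>A. A \<in> sets M \<Longrightarrow> p A = (\<integral>x. indicator A x * f x \<partial>M)"
    using nonneg_signed_Radon_Nikodym[OF sig(1)] pq n by blast
  obtain g where g: "integrable M g" "\<And>A. A \<in> sets M \<Longrightarrow> q A = (\<integral>x. indicator A x * g x \<partial>M)"
    using nonneg_signed_Radon_Nikodym[OF sig(2)] pq n by blast
  show thesis
  proof (rule that[of "\<lambda>x. f x - g x"])
    fix A assume A: "A \<in> sets M"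
    have "(\<integral>x. indicator A x * (f x - g x) \<partial>M) = (\<integral>x. indicator A x * f x - indicator A x * g x \<partial>M)"
      by (simp add: right_diff_distrib)
    also have "\<dots> = p A - q A"
      using f(2)[OF A] g(2)[OF A] integrable_real_mult_indicator[OF A f(1)] integrable_real_mult_indicator[OF A g(1)]
      by (subst Bochner_Integration.integral_diff) (simp_all add: mult.commute)
    finally show "m A = (\<integral>x. indicator A x * (f x - g x) \<partial>M)" using pq A by simp
  qed (use f g in auto)
qed

text \<open>Densities of the coordinates are assembled to one vector density. Its existence is what
  makes the choice in \<open>vector_RN_deriv\<close> meaningful; from here on only these two
  properties of the chosen density are used.\<close>

lemma vector_RN_deriv:
  fixes m :: "'a::topological_space set \<Rightarrow> 'b::euclidean_space"
  assumes \<mu>: "finite_borel_measure S \<mu>" and m: "vector_measure S m" and ac: "vector_abs_cont m \<mu>"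
  shows "integrable \<mu> (vector_RN_deriv \<mu> m)"
    and "A \<in> sets \<mu> \<Longrightarrow> m A = (\<integral>x. indicator A x *\<^sub>R vector_RN_deriv \<mu> m x \<partial>\<mu>)"
proof -
  interpret finite_measure \<mu> using \<mu> by (simp add: finite_borel_measure_def)
  have sets: "sets \<mu> = sets (restrict_space borel S)" using \<mu> by (simp add: finite_borel_measure_def)
  have "\<forall>b. \<exists>f :: 'a \<Rightarrow> real. integrable \<mu> f \<and> (\<forall>A\<in>sets \<mu>. m A \<bullet> b = (\<integral>x. indicator A x * f x \<partial>\<mu>))"
  proof
    fix b
    have sg: "signed_measure_on (sets \<mu>) (\<lambda>A. m A \<bullet> b)"
      unfolding signed_measure_on_def
    proof (intro allI impI)
      fix A :: "nat \<Rightarrow> 'a set" assume "range A \<subseteq> sets \<mu>" "disjoint_family A"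
      then have "(\<lambda>n. m (A n)) sums m (\<Union>n. A n)"
        using m unfolding vector_measure_def sets by blast
      then show "(\<lambda>n. m (A n) \<bullet> b) sums (m (\<Union>n. A n) \<bullet> b)"
        by (rule bounded_linear.sums[OF bounded_linear_inner_left])
    qed
    have nl: "m A \<bullet> b = 0" if "A \<in> null_sets \<mu>" for A
      using ac that by (auto simp: vector_abs_cont_def null_sets_def)
    obtain f where f: "integrable \<mu> f" "\<And>A. A \<in> sets \<mu> \<Longrightarrow> m A \<bullet> b = (\<integral>x. indicator A x * f x \<partial>\<mu>)"
      using signed_Radon_Nikodym[OF sg nl] by blast
    show "\<exists>f :: 'a \<Rightarrow> real. integrable \<mu> f \<and> (\<forall>A\<in>sets \<mu>. m A \<bullet> b = (\<integral>x. indicator A x * f x \<partial>\<mu>))"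
      using f by (intro exI[of _ f]) simp
  qed
  from choice[OF this] obtain f :: "'b \<Rightarrow> 'a \<Rightarrow> real" where f: "\<And>b. integrable \<mu> (f b)"
    "\<And>b A. A \<in> sets \<mu> \<Longrightarrow> m A \<bullet> b = (\<integral>x. indicator A x * f b x \<partial>\<mu>)" by blast
  define v where "v x = (\<Sum>b\<in>Basis. f b x *\<^sub>R b)" for x
  have v: "integrable \<mu> v" unfolding v_def using f(1) by auto
  have "m A = set_lebesgue_integral \<mu> A v" if A: "A \<in> sets \<mu>" for A
  proof (rule euclidean_eqI)
    fix b :: 'b assume b: "b \<in> Basis"
    have iv: "integrable \<mu> (\<lambda>x. indicator A x *\<^sub>R v x)" using A v by (rule integrable_mult_indicator)
    have "set_lebesgue_integral \<mu> A v \<bullet> b = (\<integral>x. (indicator A x *\<^sub>R v x) \<bullet> b \<partial>\<mu>)"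
      unfolding set_lebesgue_integral_def by (rule integral_inner_left[symmetric]) (rule iv)
    also have "\<dots> = (\<integral>x. indicator A x * f b x \<partial>\<mu>)"
      using b by (simp add: v_def inner_sum_left inner_Basis if_distrib sum.delta cong: if_cong)
    finally show "m A \<bullet> b = set_lebesgue_integral \<mu> A v \<bullet> b" using f(2)[OF A] by simp
  qed
  with v have "\<exists>v. integrable \<mu> v \<and> (\<forall>A\<in>sets \<mu>. m A = set_lebesgue_integral \<mu> A v)" by blast
  then have *: "integrable \<mu> (vector_RN_deriv \<mu> m) \<and> (\<forall>A\<in>sets \<mu>. m A = set_lebesgue_integral \<mu> A (vector_RN_deriv \<mu> m))"
    unfolding vector_RN_deriv_def by (rule someI_ex)
  then show "integrable \<mu> (vector_RN_deriv \<mu> m)" by blast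
  show "m A = (\<integral>x. indicator A x *\<^sub>R vector_RN_deriv \<mu> m x \<partial>\<mu>)" if "A \<in> sets \<mu>"
    using * that by (auto simp: set_lebesgue_integral_def)
qed


section \<open>Projecting a measure that carries square-integrable velocities\<close>

lemma integrable_square_imp_integrable:
  fixes V :: "'w \<Rightarrow> 'b::euclidean_space"
  assumes "finite_measure \<gamma>" and [measurable]: "V \<in> borel_measurable \<gamma>"
    and L2: "(\<integral>\<^sup>+\<omega>. ennreal ((norm (V \<omega>))\<^sup>2) \<partial>\<gamma>) < \<infinity>"
  shows "integrable \<gamma> (\<lambda>\<omega>. (norm (V \<omega>))\<^sup>2)" "integrable \<gamma> V"
proof -
  interpret finite_measure \<gamma> by fact
  show i: "integrable \<gamma> (\<lambda>\<omega>. (norm (V \<omega>))\<^sup>2)"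
    using L2 by (intro integrableI_nonneg) auto
  have b: "a \<le> 1 + a\<^sup>2" for a :: real
    using zero_le_power2[of "a - 1 / 2"] by (simp add: power2_eq_square algebra_simps)
  show "integrable \<gamma> V"
    by (rule Bochner_Integration.integrable_bound[of _ "\<lambda>\<omega>. 1 + (norm (V \<omega>))\<^sup>2"])
       (use i b in \<open>auto intro!: AE_I2\<close>)
qed

context
  fixes \<gamma> :: "'w measure" and \<pi> :: "'w \<Rightarrow> 'a::topological_space" and V :: "'w \<Rightarrow> 'b::euclidean_space"
    and S :: "'a set"
  assumes fin: "finite_measure \<gamma>" and \<pi>[measurable]: "\<pi> \<in> measurable \<gamma> (restrict_space borel S)"
    and V[measurable]: "V \<in> borel_measurable \<gamma>"
    and L2: "(\<integral>\<^sup>+\<omega>. ennreal ((norm (V \<omega>))\<^sup>2) \<partial>\<gamma>) < \<infinity>"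
begin

definition bary_measure :: "'a measure"
  where "bary_measure = distr \<gamma> (restrict_space borel S) \<pi>"

text \<open>The image of the vector measure \<open>V \<gamma>\<close> under \<open>\<pi>\<close>.
  Its density with respect to \<open>bary_measure\<close> is the conditional expectation of
  \<open>V\<close> given \<open>\<pi>\<close>: particles at the same place are replaced by one with
  their mean velocity.\<close>

definition bary_flux :: "'a set \<Rightarrow> 'b"
  where "bary_flux A = (\<integral>\<omega>. indicator A (\<pi> \<omega>) *\<^sub>R V \<omega> \<partial>\<gamma>)"

lemma sets_bary_measure[measurable_cong]: "sets bary_measure = sets (restrict_space borel S)"
  by (simp add: bary_measure_def)

lemma finite_borel_bary_measure: "finite_borel_measure S bary_measure"
proof -
  interpret finite_measure \<gamma> by (rule fin)
  show ?thesis
    unfolding finite_borel_measure_def bary_measure_def by (auto intro!: finite_measure_distr)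
qed

lemma integrable_bary_indicator:
  assumes "A \<in> sets (restrict_space borel S)"
  shows "integrable \<gamma> (\<lambda>\<omega>. indicator A (\<pi> \<omega>) *\<^sub>R V \<omega>)"
proof (rule Bochner_Integration.integrable_bound[OF integrable_square_imp_integrable(2)[OF fin V L2]])
  note [measurable] = assms
  show "(\<lambda>\<omega>. indicator A (\<pi> \<omega>) *\<^sub>R V \<omega>) \<in> borel_measurable \<gamma>" by measurable
qed (auto simp: indicator_def)

lemma vector_measure_bary_flux: "vector_measure S bary_flux"
  unfolding vector_measure_def
proof (intro allI impI)
  fix A :: "nat \<Rightarrow> 'a set" assume A: "range A \<subseteq> sets (restrict_space borel S)" and dis: "disjoint_family A"
  have [measurable]: "A n \<in> sets (restrict_space borel S)" for n using A by auto
  have isum: "(\<lambda>i. indicator (A i) x :: real) sums indicator (\<Union>i. A i) x" for x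
    by (rule indicator_sums) (use dis in \<open>auto simp: disjoint_family_on_def\<close>)
  have le1: "\<bar>\<Sum>i<n. indicator (A i) x :: real\<bar> \<le> 1" for n x
  proof -
    have "(\<Sum>i<n. indicator (A i) x :: real) \<le> (\<Sum>i. indicator (A i) x)"
      by (rule sum_le_suminf) (use isum[of x] in \<open>auto simp: sums_iff\<close>)
    also have "\<dots> \<le> 1" using isum[of x] by (simp add: sums_iff indicator_def)
    finally show ?thesis by (simp add: sum_nonneg)
  qed
  have "(\<lambda>n. \<integral>\<omega>. (\<Sum>i<n. indicator (A i) (\<pi> \<omega>)) *\<^sub>R V \<omega> \<partial>\<gamma>) \<longlonglongrightarrow> (\<integral>\<omega>. indicator (\<Union>i. A i) (\<pi> \<omega>) *\<^sub>R V \<omega> \<partial>\<gamma>)"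
  proof (rule integral_dominated_convergence[where w="\<lambda>\<omega>. norm (V \<omega>)"])
    show "integrable \<gamma> (\<lambda>\<omega>. norm (V \<omega>))" using integrable_square_imp_integrable(2)[OF fin V L2] by simp
    show "AE \<omega> in \<gamma>. (\<lambda>n. (\<Sum>i<n. indicator (A i) (\<pi> \<omega>)) *\<^sub>R V \<omega>) \<longlonglongrightarrow> indicator (\<Union>i. A i) (\<pi> \<omega>) *\<^sub>R V \<omega>"
      by (intro AE_I2 tendsto_scaleR tendsto_const) (rule isum[unfolded sums_def])
    show "AE \<omega> in \<gamma>. norm ((\<Sum>i<n. indicator (A i) (\<pi> \<omega>)) *\<^sub>R V \<omega>) \<le> norm (V \<omega>)" for n
      by (intro AE_I2) (simp add: mult_left_le_one_le le1)
    show "(\<lambda>\<omega>. indicator (\<Union>i. A i) (\<pi> \<omega>) *\<^sub>R V \<omega>) \<in> borel_measurable \<gamma>"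
      using integrable_bary_indicator[of "\<Union>i. A i"] by auto
    have [measurable]: "(\<lambda>\<omega>. indicator (A i) (\<pi> \<omega>) :: real) \<in> borel_measurable \<gamma>" for i
      by (rule measurable_compose[OF \<pi>]) measurable
    note V[measurable]
    show "(\<lambda>\<omega>. (\<Sum>i<n. indicator (A i) (\<pi> \<omega>)) *\<^sub>R V \<omega>) \<in> borel_measurable \<gamma>" for n
      by measurable
  qed
  moreover have "(\<integral>\<omega>. (\<Sum>i<n. indicator (A i) (\<pi> \<omega>)) *\<^sub>R V \<omega> \<partial>\<gamma>) = (\<Sum>i<n. bary_flux (A i))" for n
    unfolding bary_flux_def scaleR_sum_left
    by (rule Bochner_Integration.integral_sum) (auto intro!: integrable_bary_indicator)
  ultimately show "(\<lambda>n. bary_flux (A n)) sums bary_flux (\<Union>n. A n)"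
    by (simp add: sums_def bary_flux_def)
qed

lemma vector_abs_cont_bary_flux: "vector_abs_cont bary_flux bary_measure"
  unfolding vector_abs_cont_def
proof (intro ballI impI)
  fix A assume A: "A \<in> sets bary_measure" "emeasure bary_measure A = 0"
  then have [measurable]: "A \<in> sets (restrict_space borel S)" by (simp add: sets_bary_measure)
  have "emeasure \<gamma> (\<pi> -` A \<inter> space \<gamma>) = 0"
    using A(2) by (simp add: bary_measure_def emeasure_distr)
  then have "AE \<omega> in \<gamma>. \<pi> \<omega> \<notin> A"
    by (intro AE_I[of _ _ "\<pi> -` A \<inter> space \<gamma>"]) (auto intro: measurable_sets[OF \<pi>])
  then have "AE \<omega> in \<gamma>. indicator A (\<pi> \<omega>) *\<^sub>R V \<omega> = 0" by (auto elim!: eventually_mono)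
  then show "bary_flux A = 0" unfolding bary_flux_def by (rule integral_eq_zero_AE)
qed

abbreviation (input) "bary_density \<equiv> vector_RN_deriv bary_measure bary_flux"

lemma integrable_bary_density: "integrable bary_measure bary_density"
  by (rule vector_RN_deriv(1)[OF finite_borel_bary_measure vector_measure_bary_flux vector_abs_cont_bary_flux])

text \<open>For indicators both sides are the flux of the set; the identity spreads by linearity and
  dominated convergence, with a multiple of the density and of \<open>V\<close> as
  majorants.\<close>

lemma bary_density_test_nonneg:
  fixes \<phi> :: "'a \<Rightarrow> real"
  assumes \<phi>: "\<phi> \<in> borel_measurable bary_measure" "\<And>p. 0 \<le> \<phi> p" and C: "\<And>p. \<phi> p \<le> C"
  shows "(\<integral>p. \<phi> p *\<^sub>R bary_density p \<partial>bary_measure) = (\<integral>\<omega>. \<phi> (\<pi> \<omega>) *\<^sub>R V \<omega> \<partial>\<gamma>)"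
proof -
  let ?w = bary_density and ?\<mu> = bary_measure
  have [measurable]: "?w \<in> borel_measurable ?\<mu>" using integrable_bary_density by auto
  have iV: "integrable \<gamma> V" by (rule integrable_square_imp_integrable(2)[OF fin V L2])
  have sp: "\<pi> \<omega> \<in> space ?\<mu>" if "\<omega> \<in> space \<gamma>" for \<omega>
    using measurable_space[OF \<pi> that] by (simp add: bary_measure_def)
  have meas: "(\<lambda>\<omega>. u (\<pi> \<omega>)) \<in> borel_measurable \<gamma>" if u: "u \<in> borel_measurable ?\<mu>" for u :: "'a \<Rightarrow> real"
    using u by (intro measurable_compose[OF \<pi>]) (simp add: measurable_cong_sets[OF sets_bary_measure])
  have int1: "integrable ?\<mu> (\<lambda>p. u p *\<^sub>R ?w p)"
    if u: "u \<in> borel_measurable ?\<mu>" "\<And>p. 0 \<le> u p" "\<forall>p\<in>space ?\<mu>. u p \<le> D" for u :: "'a \<Rightarrow> real" and D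
  proof (rule Bochner_Integration.integrable_bound[of _ "\<lambda>p. D *\<^sub>R ?w p"])
    show "integrable ?\<mu> (\<lambda>p. D *\<^sub>R ?w p)" using integrable_bary_density by simp
    show "(\<lambda>p. u p *\<^sub>R ?w p) \<in> borel_measurable ?\<mu>" using u(1) by measurable
    show "AE p in ?\<mu>. norm (u p *\<^sub>R ?w p) \<le> norm (D *\<^sub>R ?w p)"
      using u(2,3) by (intro AE_I2) (force intro!: mult_right_mono intro: order_trans)
  qed
  have int2: "integrable \<gamma> (\<lambda>\<omega>. u (\<pi> \<omega>) *\<^sub>R V \<omega>)"
    if u: "u \<in> borel_measurable ?\<mu>" "\<And>p. 0 \<le> u p" "\<forall>p\<in>space ?\<mu>. u p \<le> D" for u :: "'a \<Rightarrow> real" and D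
  proof (rule Bochner_Integration.integrable_bound[of _ "\<lambda>p. D *\<^sub>R V p"])
    show "integrable \<gamma> (\<lambda>p. D *\<^sub>R V p)" using iV by simp
    show "(\<lambda>p. u (\<pi> p) *\<^sub>R V p) \<in> borel_measurable \<gamma>" using meas[OF u(1)] by measurable
    show "AE \<omega> in \<gamma>. norm (u (\<pi> \<omega>) *\<^sub>R V \<omega>) \<le> norm (D *\<^sub>R V \<omega>)"
      using u(2,3) sp by (intro AE_I2) (force intro!: mult_right_mono intro: order_trans)
  qed
  \<comment> \<open>The bound is quantified inside the induction because it changes on the way:
    \<open>u\<close> inherits \<open>D / c\<close> from \<open>c * u\<close>, and summands and
    approximants inherit \<open>D\<close> from the whole.\<close>
  have "\<forall>D. (\<forall>p\<in>space ?\<mu>. \<phi> p \<le> D) \<longrightarrow>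
      (\<integral>p. \<phi> p *\<^sub>R ?w p \<partial>?\<mu>) = (\<integral>\<omega>. \<phi> (\<pi> \<omega>) *\<^sub>R V \<omega> \<partial>\<gamma>)"
    using \<phi>
  proof (induction rule: borel_measurable_induct_real)
    case (set A)
    then show ?case
      using vector_RN_deriv(2)[OF finite_borel_bary_measure vector_measure_bary_flux vector_abs_cont_bary_flux set]
      by (simp add: bary_flux_def[of A])
  next
    case (mult u c)
    show ?case
    proof (cases "c = 0")
      case False
      then have "c > 0" using mult by simp
      then have "u p \<le> D / c" if "c * u p \<le> D" for p D using that by (simp add: field_simps)
      then have "(\<forall>p\<in>space ?\<mu>. c * u p \<le> D) \<Longrightarrow> \<forall>p\<in>space ?\<mu>. u p \<le> D / c" for D by blast
      then show ?thesis using mult(4)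
        by (intro allI impI) (simp flip: scaleR_scaleR, blast)
    qed simp
  next
    case (add u v)
    show ?case
    proof (intro allI impI)
      fix D assume D: "\<forall>p\<in>space ?\<mu>. v p + u p \<le> D"
      have D1: "u p \<le> D" "v p \<le> D" if "p \<in> space ?\<mu>" for p
        using bspec[OF D that] add.hyps(2)[of p] add.hyps(4)[of p] by linarith+
      then have D': "\<forall>p\<in>space ?\<mu>. u p \<le> D" "\<forall>p\<in>space ?\<mu>. v p \<le> D" by blast+
      show "(\<integral>p. (v p + u p) *\<^sub>R ?w p \<partial>?\<mu>) = (\<integral>\<omega>. (v (\<pi> \<omega>) + u (\<pi> \<omega>)) *\<^sub>R V \<omega> \<partial>\<gamma>)"
        unfolding scaleR_add_left
        using add.IH(1)[rule_format, OF D'(1)[rule_format]] add.IH(2)[rule_format, OF D'(2)[rule_format]]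
          int1[OF add.hyps(1,2) D'(1)] int1[OF add.hyps(3,4) D'(2)] int2[OF add.hyps(1,2) D'(1)] int2[OF add.hyps(3,4) D'(2)]
        by simp
    qed
  next
    case (seq U)
    show ?case
    proof (intro allI impI)
      fix D assume D: "\<forall>p\<in>space ?\<mu>. \<phi> p \<le> D"
      have Ule: "U i p \<le> \<phi> p" if "p \<in> space ?\<mu>" for i p
        by (rule incseq_le[OF _ seq.hyps(4)[OF that]]) (use seq.hyps(3) in \<open>auto simp: incseq_def le_fun_def\<close>)
      then have UD: "\<forall>p\<in>space ?\<mu>. U i p \<le> D" for i using D order_trans by blast
      have um: "\<phi> \<in> borel_measurable ?\<mu>"
        by (rule borel_measurable_LIMSEQ_real[OF seq.hyps(4) seq.hyps(1)])
      have "(\<lambda>i. \<integral>p. U i p *\<^sub>R ?w p \<partial>?\<mu>) \<longlonglongrightarrow> (\<integral>p. \<phi> p *\<^sub>R ?w p \<partial>?\<mu>)"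
      proof (rule integral_dominated_convergence[where w="\<lambda>p. norm (D *\<^sub>R ?w p)"])
        show "(\<lambda>p. \<phi> p *\<^sub>R ?w p) \<in> borel_measurable ?\<mu>" using um by measurable
        show "(\<lambda>p. U i p *\<^sub>R ?w p) \<in> borel_measurable ?\<mu>" for i using seq.hyps(1)[of i] by measurable
        show "integrable ?\<mu> (\<lambda>p. norm (D *\<^sub>R ?w p))" using integrable_bary_density by simp
        show "AE p in ?\<mu>. (\<lambda>i. U i p *\<^sub>R ?w p) \<longlonglongrightarrow> \<phi> p *\<^sub>R ?w p"
          using seq.hyps(4) by (intro AE_I2 tendsto_scaleR tendsto_const)
        show "AE p in ?\<mu>. norm (U i p *\<^sub>R ?w p) \<le> norm (D *\<^sub>R ?w p)" for i
          using seq.hyps(2)[of i] UD[of i] by (intro AE_I2) (force intro!: mult_right_mono intro: order_trans)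
      qed
      moreover have "(\<lambda>i. \<integral>\<omega>. U i (\<pi> \<omega>) *\<^sub>R V \<omega> \<partial>\<gamma>) \<longlonglongrightarrow> (\<integral>\<omega>. \<phi> (\<pi> \<omega>) *\<^sub>R V \<omega> \<partial>\<gamma>)"
      proof (rule integral_dominated_convergence[where w="\<lambda>p. norm (D *\<^sub>R V p)"])
        show "(\<lambda>p. \<phi> (\<pi> p) *\<^sub>R V p) \<in> borel_measurable \<gamma>" using meas[OF um] by measurable
        show "(\<lambda>p. U i (\<pi> p) *\<^sub>R V p) \<in> borel_measurable \<gamma>" for i using meas[OF seq.hyps(1)[of i]] by measurable
        show "integrable \<gamma> (\<lambda>p. norm (D *\<^sub>R V p))" using iV by simp
        show "AE p in \<gamma>. (\<lambda>i. U i (\<pi> p) *\<^sub>R V p) \<longlonglongrightarrow> \<phi> (\<pi> p) *\<^sub>R V p"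
          using seq.hyps(4) sp by (intro AE_I2 tendsto_scaleR tendsto_const) auto
        show "AE p in \<gamma>. norm (U i (\<pi> p) *\<^sub>R V p) \<le> norm (D *\<^sub>R V p)" for i
          using seq.hyps(2)[of i] UD[of i] sp by (intro AE_I2) (force intro!: mult_right_mono intro: order_trans)
      qed
      moreover have "(\<integral>p. U i p *\<^sub>R ?w p \<partial>?\<mu>) = (\<integral>\<omega>. U i (\<pi> \<omega>) *\<^sub>R V \<omega> \<partial>\<gamma>)" for i
        using seq.IH[of i] UD[of i] by blast
      ultimately show "(\<integral>p. \<phi> p *\<^sub>R ?w p \<partial>?\<mu>) = (\<integral>\<omega>. \<phi> (\<pi> \<omega>) *\<^sub>R V \<omega> \<partial>\<gamma>)"
        using LIMSEQ_unique by simp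
    qed
  qed
  then show ?thesis using C by blast
qed


lemma bary_density_test_real:
  fixes \<phi> :: "'a \<Rightarrow> real"
  assumes \<phi>: "\<phi> \<in> borel_measurable bary_measure" and C: "\<And>p. \<bar>\<phi> p\<bar> \<le> C"
  shows "(\<integral>p. \<phi> p *\<^sub>R bary_density p \<partial>bary_measure) = (\<integral>\<omega>. \<phi> (\<pi> \<omega>) *\<^sub>R V \<omega> \<partial>\<gamma>)"
proof -
  let ?w = bary_density and ?\<mu> = bary_measure
  have [measurable]: "?w \<in> borel_measurable ?\<mu>" using integrable_bary_density by auto
  note [measurable] = \<phi>
  have iV: "integrable \<gamma> V" by (rule integrable_square_imp_integrable(2)[OF fin V L2])
  have C0: "0 \<le> C" using C[of undefined] by linarith
  have [measurable]: "(\<lambda>\<omega>. \<phi> (\<pi> \<omega>)) \<in> borel_measurable \<gamma>"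
    using \<phi> by (intro measurable_compose[OF \<pi>]) (simp add: measurable_cong_sets[OF sets_bary_measure])
  have i1: "integrable ?\<mu> (\<lambda>p. \<phi> p *\<^sub>R ?w p)"
  proof (rule Bochner_Integration.integrable_bound[of _ "\<lambda>p. C *\<^sub>R ?w p"])
    show "AE p in ?\<mu>. norm (\<phi> p *\<^sub>R ?w p) \<le> norm (C *\<^sub>R ?w p)"
      using C C0 by (intro AE_I2) (simp add: mult_right_mono)
  qed (use integrable_bary_density in auto)
  have i2: "integrable \<gamma> (\<lambda>p. \<phi> (\<pi> p) *\<^sub>R V p)"
  proof (rule Bochner_Integration.integrable_bound[of _ "\<lambda>p. C *\<^sub>R V p"])
    show "AE p in \<gamma>. norm (\<phi> (\<pi> p) *\<^sub>R V p) \<le> norm (C *\<^sub>R V p)"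
      using C C0 by (intro AE_I2) (simp add: mult_right_mono)
  qed (use iV in auto)
  \<comment> \<open>Adding the constant \<open>C\<close> reduces signed test functions to
    nonnegative ones.\<close>
  have "(\<integral>p. (\<phi> p + C) *\<^sub>R ?w p \<partial>?\<mu>) = (\<integral>\<omega>. (\<phi> (\<pi> \<omega>) + C) *\<^sub>R V \<omega> \<partial>\<gamma>)"
  proof (rule bary_density_test_nonneg)
    show "0 \<le> \<phi> p + C" "\<phi> p + C \<le> 2 * C" for p using C[of p] by linarith+
  qed measurable
  moreover have "(\<integral>p. C *\<^sub>R ?w p \<partial>?\<mu>) = (\<integral>\<omega>. C *\<^sub>R V \<omega> \<partial>\<gamma>)"
    by (rule bary_density_test_nonneg[of "\<lambda>_. C", OF _ C0 order_refl]) simp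
  ultimately show ?thesis
    unfolding scaleR_add_left using i1 i2 iV integrable_bary_density by auto
qed

text \<open>Each coordinate of \<open>G\<close> is a bounded real test function; the inner product
  is recovered by summing over the basis.\<close>

lemma bary_density_test:
  fixes G :: "'a \<Rightarrow> 'b"
  assumes G: "G \<in> borel_measurable bary_measure" and C: "\<And>p. norm (G p) \<le> C"
  shows "(\<integral>p. G p \<bullet> bary_density p \<partial>bary_measure) = (\<integral>\<omega>. G (\<pi> \<omega>) \<bullet> V \<omega> \<partial>\<gamma>)"
    "integrable bary_measure (\<lambda>p. G p \<bullet> bary_density p)" "integrable \<gamma> (\<lambda>\<omega>. G (\<pi> \<omega>) \<bullet> V \<omega>)"
proof -
  let ?w = bary_density and ?\<mu> = bary_measure
  have [measurable]: "?w \<in> borel_measurable ?\<mu>" using integrable_bary_density by auto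
  note [measurable] = G
  have C0: "0 \<le> C" using norm_ge_zero C by (rule order_trans)
  have iV: "integrable \<gamma> V" by (rule integrable_square_imp_integrable(2)[OF fin V L2])
  have [measurable]: "(\<lambda>\<omega>. G (\<pi> \<omega>)) \<in> borel_measurable \<gamma>"
    using G by (intro measurable_compose[OF \<pi>]) (simp add: measurable_cong_sets[OF sets_bary_measure])
  have bd: "\<bar>G p \<bullet> y\<bar> \<le> C * norm y" for p y
    using Cauchy_Schwarz_ineq2[of "G p" y] mult_right_mono[OF C[of p], of "norm y"] by simp
  have Cb: "\<bar>G p \<bullet> b\<bar> \<le> C" if "b \<in> Basis" for p b
    using bd[of p b] that by simp
  show "integrable ?\<mu> (\<lambda>p. G p \<bullet> ?w p)"
  proof (rule Bochner_Integration.integrable_bound[of _ "\<lambda>p. C *\<^sub>R ?w p"])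
    show "AE p in ?\<mu>. norm (G p \<bullet> ?w p) \<le> norm (C *\<^sub>R ?w p)"
      using bd C0 by (intro AE_I2) simp
  qed (use integrable_bary_density in auto)
  show "integrable \<gamma> (\<lambda>p. G (\<pi> p) \<bullet> V p)"
  proof (rule Bochner_Integration.integrable_bound[of _ "\<lambda>p. C *\<^sub>R V p"])
    show "AE p in \<gamma>. norm (G (\<pi> p) \<bullet> V p) \<le> norm (C *\<^sub>R V p)"
      using bd C0 by (intro AE_I2) simp
  qed (use iV in auto)
  have i1: "integrable ?\<mu> (\<lambda>p. (G p \<bullet> b) *\<^sub>R ?w p)" if "b \<in> Basis" for b
  proof (rule Bochner_Integration.integrable_bound[of _ "\<lambda>p. C *\<^sub>R ?w p"])
    show "AE p in ?\<mu>. norm ((G p \<bullet> b) *\<^sub>R ?w p) \<le> norm (C *\<^sub>R ?w p)"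
      using Cb[OF that] C0 by (intro AE_I2) (simp add: mult_right_mono)
  qed (use integrable_bary_density in auto)
  have i2: "integrable \<gamma> (\<lambda>p. (G (\<pi> p) \<bullet> b) *\<^sub>R V p)" if "b \<in> Basis" for b
  proof (rule Bochner_Integration.integrable_bound[of _ "\<lambda>p. C *\<^sub>R V p"])
    show "AE p in \<gamma>. norm ((G (\<pi> p) \<bullet> b) *\<^sub>R V p) \<le> norm (C *\<^sub>R V p)"
      using Cb[OF that] C0 by (intro AE_I2) (simp add: mult_right_mono)
  qed (use iV in auto)
  have dec: "x \<bullet> y = (\<Sum>b\<in>Basis. ((x \<bullet> b) *\<^sub>R y) \<bullet> b)" for x y :: 'b
    by (simp add: euclidean_inner[of x y])
  have "(\<integral>p. G p \<bullet> ?w p \<partial>?\<mu>) = (\<Sum>b\<in>Basis. (\<integral>p. ((G p \<bullet> b) *\<^sub>R ?w p) \<bullet> b \<partial>?\<mu>))"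
    by (subst dec, rule Bochner_Integration.integral_sum) (intro integrable_inner_left i1)
  also have "\<dots> = (\<Sum>b\<in>Basis. (\<integral>p. ((G (\<pi> p) \<bullet> b) *\<^sub>R V p) \<bullet> b \<partial>\<gamma>))"
  proof (rule sum.cong[OF refl])
    fix b :: 'b assume b: "b \<in> Basis"
    have "(\<integral>p. (G p \<bullet> b) *\<^sub>R ?w p \<partial>?\<mu>) = (\<integral>p. (G (\<pi> p) \<bullet> b) *\<^sub>R V p \<partial>\<gamma>)"
      by (rule bary_density_test_real[OF _ Cb[OF b]]) measurable
    then show "(\<integral>p. ((G p \<bullet> b) *\<^sub>R ?w p) \<bullet> b \<partial>?\<mu>) = (\<integral>p. ((G (\<pi> p) \<bullet> b) *\<^sub>R V p) \<bullet> b \<partial>\<gamma>)"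
      using integral_inner_left[of b ?\<mu>, OF i1[OF b]] integral_inner_left[of b \<gamma>, OF i2[OF b]] by simp
  qed
  also have "\<dots> = (\<integral>\<omega>. G (\<pi> \<omega>) \<bullet> V \<omega> \<partial>\<gamma>)"
    by (subst dec[of "G (\<pi> _)"], rule Bochner_Integration.integral_sum[symmetric]) (intro integrable_inner_left i2)
  finally show "(\<integral>p. G p \<bullet> ?w p \<partial>?\<mu>) = (\<integral>\<omega>. G (\<pi> \<omega>) \<bullet> V \<omega> \<partial>\<gamma>)" .
qed

text \<open>Jensen's inequality by duality: for truncations \<open>\<phi>\<close> of the density,
  \<open>\<integral> \<bar>\<phi>\<bar>\<^sup>2 = \<integral> 2 \<phi> \<sqdot> V - \<bar>\<phi>\<bar>\<^sup>2 \<le> \<integral> \<bar>V\<bar>\<^sup>2\<close>.\<close>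

lemma nn_integral_bary_density_le:
  "(\<integral>\<^sup>+p. ennreal ((norm (bary_density p))\<^sup>2) \<partial>bary_measure) \<le> (\<integral>\<^sup>+\<omega>. ennreal ((norm (V \<omega>))\<^sup>2) \<partial>\<gamma>)"
proof -
  let ?w = bary_density and ?\<mu> = bary_measure
  interpret \<mu>: finite_measure ?\<mu> using finite_borel_bary_measure by (simp add: finite_borel_measure_def)
  interpret \<gamma>: finite_measure \<gamma> by (rule fin)
  have wm[measurable]: "?w \<in> borel_measurable ?\<mu>" using integrable_bary_density by auto
  have iV2: "integrable \<gamma> (\<lambda>\<omega>. (norm (V \<omega>))\<^sup>2)" by (rule integrable_square_imp_integrable(1)[OF fin V L2])
  define \<phi> where "\<phi> R p = (if norm (?w p) \<le> real R then ?w p else 0)" for R p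
  have [measurable]: "\<phi> R \<in> borel_measurable ?\<mu>" for R unfolding \<phi>_def by measurable
  have \<phi>R: "norm (\<phi> R p) \<le> real R" for R p by (simp add: \<phi>_def)
  have [measurable]: "(\<lambda>\<omega>. \<phi> R (\<pi> \<omega>)) \<in> borel_measurable \<gamma>" for R
    by (intro measurable_compose[OF \<pi>]) (simp add: measurable_cong_sets[OF sets_bary_measure, symmetric])
  have main: "(\<integral>\<^sup>+p. ennreal ((norm (\<phi> R p))\<^sup>2) \<partial>?\<mu>) \<le> (\<integral>\<^sup>+\<omega>. ennreal ((norm (V \<omega>))\<^sup>2) \<partial>\<gamma>)" for R
  proof -
    have b2: "(norm (\<phi> R p))\<^sup>2 \<le> (real R)\<^sup>2" for p by (intro power_mono \<phi>R) simp
    have i1: "integrable ?\<mu> (\<lambda>p. (norm (\<phi> R p))\<^sup>2)"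
      by (rule \<mu>.integrable_const_bound[of _ "(real R)\<^sup>2"]) (use b2 in auto)
    have i2: "integrable \<gamma> (\<lambda>\<omega>. (norm (\<phi> R (\<pi> \<omega>)))\<^sup>2)"
      by (rule \<gamma>.integrable_const_bound[of _ "(real R)\<^sup>2"]) (use b2 in auto)
    have "(\<integral>p. (norm (\<phi> R p))\<^sup>2 \<partial>?\<mu>) = (\<integral>p. \<phi> R p \<bullet> ?w p \<partial>?\<mu>)"
      by (rule Bochner_Integration.integral_cong) (auto simp: \<phi>_def power2_norm_eq_inner)
    also have "\<dots> = (\<integral>\<omega>. \<phi> R (\<pi> \<omega>) \<bullet> V \<omega> \<partial>\<gamma>)"
      by (rule bary_density_test(1)[OF _ \<phi>R]) measurable
    finally have e1: "(\<integral>p. (norm (\<phi> R p))\<^sup>2 \<partial>?\<mu>) = (\<integral>\<omega>. \<phi> R (\<pi> \<omega>) \<bullet> V \<omega> \<partial>\<gamma>)" .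
    have e2: "(\<integral>p. (norm (\<phi> R p))\<^sup>2 \<partial>?\<mu>) = (\<integral>\<omega>. (norm (\<phi> R (\<pi> \<omega>)))\<^sup>2 \<partial>\<gamma>)"
    proof -
      have "(\<lambda>p. (norm (\<phi> R p))\<^sup>2) \<in> borel_measurable (restrict_space borel S)"
        by (simp add: measurable_cong_sets[OF sets_bary_measure, symmetric])
      then show ?thesis by (subst bary_measure_def, subst integral_distr) auto
    qed
    have i3: "integrable \<gamma> (\<lambda>\<omega>. \<phi> R (\<pi> \<omega>) \<bullet> V \<omega>)"
      by (rule bary_density_test(3)[OF _ \<phi>R]) measurable
    have "(\<integral>p. (norm (\<phi> R p))\<^sup>2 \<partial>?\<mu>) = (\<integral>\<omega>. 2 * (\<phi> R (\<pi> \<omega>) \<bullet> V \<omega>) - (norm (\<phi> R (\<pi> \<omega>)))\<^sup>2 \<partial>\<gamma>)"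
      using i2 i3 e1 e2 by simp
    also have "\<dots> \<le> (\<integral>\<omega>. (norm (V \<omega>))\<^sup>2 \<partial>\<gamma>)"
    proof (rule integral_mono[OF _ iV2])
      show "integrable \<gamma> (\<lambda>\<omega>. 2 * (\<phi> R (\<pi> \<omega>) \<bullet> V \<omega>) - (norm (\<phi> R (\<pi> \<omega>)))\<^sup>2)" using i2 i3 by simp
      fix \<omega>
      have "0 \<le> (V \<omega> - \<phi> R (\<pi> \<omega>)) \<bullet> (V \<omega> - \<phi> R (\<pi> \<omega>))" by simp
      then show "2 * (\<phi> R (\<pi> \<omega>) \<bullet> V \<omega>) - (norm (\<phi> R (\<pi> \<omega>)))\<^sup>2 \<le> (norm (V \<omega>))\<^sup>2"
        by (simp add: power2_norm_eq_inner inner_diff_left inner_diff_right inner_commute)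
    qed
    finally show ?thesis
      using i1 iV2 by (simp add: nn_integral_eq_integral)
  qed
  have "(\<integral>\<^sup>+p. ennreal ((norm (?w p))\<^sup>2) \<partial>?\<mu>) = (\<integral>\<^sup>+p. (SUP R. ennreal ((norm (\<phi> R p))\<^sup>2)) \<partial>?\<mu>)"
  proof (rule nn_integral_cong)
    fix p
    obtain R :: nat where R: "norm (?w p) \<le> real R" using real_arch_simple by blast
    show "ennreal ((norm (?w p))\<^sup>2) = (SUP R. ennreal ((norm (\<phi> R p))\<^sup>2))"
    proof (rule antisym)
      show "ennreal ((norm (?w p))\<^sup>2) \<le> (SUP R. ennreal ((norm (\<phi> R p))\<^sup>2))"
        by (rule SUP_upper2[of R]) (use R in \<open>auto simp: \<phi>_def\<close>)
      show "(SUP R. ennreal ((norm (\<phi> R p))\<^sup>2)) \<le> ennreal ((norm (?w p))\<^sup>2)"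
        by (rule SUP_least) (auto simp: \<phi>_def)
    qed
  qed
  also have "\<dots> = (SUP R. \<integral>\<^sup>+p. ennreal ((norm (\<phi> R p))\<^sup>2) \<partial>?\<mu>)"
  proof (rule nn_integral_monotone_convergence_SUP)
    show "incseq (\<lambda>R p. ennreal ((norm (\<phi> R p))\<^sup>2))"
      by (rule incseq_SucI) (auto simp: \<phi>_def le_fun_def)
  qed measurable
  also have "\<dots> \<le> (\<integral>\<^sup>+\<omega>. ennreal ((norm (V \<omega>))\<^sup>2) \<partial>\<gamma>)" by (rule SUP_least) (rule main)
  finally show ?thesis .
qed

end

section \<open>Measures on the torus\<close>

lemma closed_indicator_limit:
  fixes C :: "'b::metric_space set"
  assumes C: "closed C"
  shows "\<exists>f :: nat \<Rightarrow> 'b \<Rightarrow> real. (\<forall>n. continuous_on UNIV (f n)) \<and> (\<forall>n x. 0 \<le> f n x \<and> f n x \<le> 1) \<and>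
    (\<forall>x. (\<lambda>n. f n x) \<longlonglongrightarrow> indicator C x)"
proof (cases "C = {}")
  case True
  then show ?thesis by (intro exI[of _ "\<lambda>n x. 0"]) simp
next
  case False
  define f where "f n x = max 0 (1 - real n * infdist x C)" for n x
  have fc: "continuous_on UNIV (f n)" for n unfolding f_def by (intro continuous_intros)
  have f01: "0 \<le> f n x \<and> f n x \<le> 1" for n x by (auto simp: f_def infdist_nonneg)
  have lim: "(\<lambda>n. f n x) \<longlonglongrightarrow> indicator C x" for x
  proof (cases "x \<in> C")
    case True
    then have "f n x = 1" for n by (simp add: f_def)
    then show ?thesis using True by simp
  next
    case x: False
    then have "infdist x C > 0"
      using in_closed_iff_infdist_zero[OF C False, of x] infdist_nonneg[of x C] by simp
    then obtain m :: nat where m: "1 < real m * infdist x C" using reals_Archimedean3 by blast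
    have "f n x = 0" if "m \<le> n" for n
    proof -
      have "real m * infdist x C \<le> real n * infdist x C"
        using that by (intro mult_right_mono infdist_nonneg) simp
      then show ?thesis using m by (simp add: f_def)
    qed
    then have "eventually (\<lambda>n. f n x = 0) sequentially" unfolding eventually_sequentially by blast
    then show ?thesis using x by (simp add: tendsto_eventually)
  qed
  show ?thesis using fc f01 lim by (intro exI[of _ f]) simp
qed

lemma measure_eqI_bounded_continuous:
  fixes M N :: "'b::metric_space measure"
  assumes M: "finite_measure M" "sets M = sets borel" and N: "finite_measure N" "sets N = sets borel"
    and eq: "\<And>f :: 'b \<Rightarrow> real. continuous_on UNIV f \<Longrightarrow> bounded (range f) \<Longrightarrow> (\<integral>x. f x \<partial>M) = (\<integral>x. f x \<partial>N)"
  shows "M = N"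
proof -
  interpret M: finite_measure M by fact
  interpret N: finite_measure N by fact
  have cl: "measure M C = measure N C" if C: "closed C" for C
  proof -
    obtain f :: "nat \<Rightarrow> 'b \<Rightarrow> real" where f: "(\<forall>n. continuous_on UNIV (f n)) \<and> (\<forall>n x. 0 \<le> f n x \<and> f n x \<le> 1) \<and>
      (\<forall>x. (\<lambda>n. f n x) \<longlonglongrightarrow> indicator C x)"
      using closed_indicator_limit[OF C] by (rule exE)
    have fc: "continuous_on UNIV (f n)" and f01: "0 \<le> f n x" "f n x \<le> 1" and lim: "(\<lambda>n. f n x) \<longlonglongrightarrow> indicator C x" for n x
      using f by simp_all
    have fb: "bounded (range (f n))" for n
      by (rule boundedI[of _ 1]) (use f01 in auto)
    have fm: "f n \<in> borel_measurable borel" for n by (rule borel_measurable_continuous_onI[OF fc])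
    have *: "(\<lambda>n. \<integral>x. f n x \<partial>K) \<longlonglongrightarrow> measure K C" if K: "finite_measure K" "sets K = sets borel" for K
    proof -
      interpret K: finite_measure K by fact
      have "(\<lambda>n. \<integral>x. f n x \<partial>K) \<longlonglongrightarrow> (\<integral>x. indicator C x \<partial>K)"
        by (rule integral_dominated_convergence[where w="\<lambda>_. 1"])
           (use fm lim f01 C in \<open>auto simp: K(2) cong: measurable_cong_sets\<close>)
      then show ?thesis using C K by simp
    qed
    show ?thesis
      using LIMSEQ_unique[OF *[OF M] *[OF N, folded eq[OF fc fb]]] .
  qed
  show ?thesis
  proof (rule measure_eqI_generator_eq[where E="Collect closed" and \<Omega>=UNIV and A="\<lambda>_. UNIV"])
    show "Int_stable (Collect closed)" by (auto simp: Int_stable_def)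
    show "emeasure M C = emeasure N C" if "C \<in> Collect closed" for C
      using cl[of C] that by (simp add: M.emeasure_eq_measure N.emeasure_eq_measure)
    have "sets (borel :: 'b measure) = sigma_sets UNIV (Collect closed)"
      by (subst borel_eq_closed) simp
    then show "sets M = sigma_sets UNIV (Collect closed)" "sets N = sigma_sets UNIV (Collect closed)"
      using M N by simp_all
  qed auto
qed

lemma measure_eqI_embedding:
  fixes e :: "'a::topological_space \<Rightarrow> 'b::metric_space"
  assumes M: "finite_measure M" "sets M = sets (restrict_space borel S)"
    and N: "finite_measure N" "sets N = sets (restrict_space borel S)"
    and S: "S \<in> sets borel" and e: "continuous_on UNIV e" and r: "r \<in> measurable borel borel"
    and inv: "\<And>x. x \<in> S \<Longrightarrow> r (e x) = x"
    and eq: "\<And>f :: 'b \<Rightarrow> real. continuous_on UNIV f \<Longrightarrow> bounded (range f) \<Longrightarrow> (\<integral>x. f (e x) \<partial>M) = (\<integral>x. f (e x) \<partial>N)"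
  shows "M = N"
proof -
  have em: "e \<in> measurable K borel" if "sets K = sets (restrict_space borel S)" for K
    using measurable_restrict_space1[OF borel_measurable_continuous_onI[OF e]] measurable_cong_sets[OF that refl] by blast
  have spS: "space K = S" if "sets K = sets (restrict_space borel S)" for K
    using sets_eq_imp_space_eq[OF that] by (simp add: space_restrict_space)
  have D: "distr M borel e = distr N borel e"
  proof (rule measure_eqI_bounded_continuous)
    show "finite_measure (distr M borel e)" by (rule finite_measure.finite_measure_distr[OF M(1) em[OF M(2)]])
    show "finite_measure (distr N borel e)" by (rule finite_measure.finite_measure_distr[OF N(1) em[OF N(2)]])
    fix f :: "'b \<Rightarrow> real" assume f: "continuous_on UNIV f" "bounded (range f)"
    have fm: "f \<in> borel_measurable borel" by (rule borel_measurable_continuous_onI[OF f(1)])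
    show "(\<integral>x. f x \<partial>distr M borel e) = (\<integral>x. f x \<partial>distr N borel e)"
      using eq[OF f] by (simp add: integral_distr[OF em[OF M(2)] fm] integral_distr[OF em[OF N(2)] fm])
  qed simp_all
  show ?thesis
  proof (rule measure_eqI)
    show "sets M = sets N" using M N by simp
    fix A assume "A \<in> sets M"
    then have A: "A \<subseteq> S" "A \<in> sets borel" using M(2) S by (auto simp: sets_restrict_space_iff)
    have *: "emeasure K A = emeasure (distr K borel e) (r -` A)" if K: "sets K = sets (restrict_space borel S)" for K
    proof -
      have rA: "r -` A \<in> sets borel" using measurable_sets[OF r A(2)] by simp
      have "e -` (r -` A) \<inter> space K = A"
        using A(1) inv by (auto simp: spS[OF K])
      then show ?thesis by (simp add: emeasure_distr[OF em[OF K] rA])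
    qed
    show "emeasure M A = emeasure N A" using *[OF M(2)] *[OF N(2)] D by simp
  qed
qed

section \<open>The torus in Euclidean space and periodic functions\<close>

lemma borel_measurable_vec_nth': "(\<lambda>x::real^'n. x $ i) \<in> borel_measurable borel"
  by (intro borel_measurable_continuous_onI linear_continuous_on bounded_linear_vec_nth)

lemmas borel_measurable_vec_nth_compose[measurable (raw)] = measurable_compose[OF _ borel_measurable_vec_nth']

lemma borel_measurable_vec_lambda[measurable (raw)]:
  fixes f :: "'a \<Rightarrow> 'n::finite \<Rightarrow> real"
  assumes "\<And>i. (\<lambda>x. f x i) \<in> borel_measurable M"
  shows "(\<lambda>x. \<chi> i. f x i) \<in> borel_measurable M"
proof (rule borel_measurable_euclidean_space[THEN iffD2], rule ballI)
  fix b :: "real^'n" assume "b \<in> Basis"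
  from axis_inverse[OF this] obtain i where b: "b = axis i 1" by (rule exE)
  have "(\<lambda>x. (\<chi> i. f x i) \<bullet> b) = (\<lambda>x. f x i)" unfolding b by (simp add: inner_axis)
  then show "(\<lambda>x. (\<chi> i. f x i) \<bullet> b) \<in> borel_measurable M" by (simp only: assms)
qed

text \<open>The flat (Clifford) torus: each coordinate is mapped to a point of the unit circle, all
  cosines in the first component and all sines in the second.\<close>

definition torus_emb :: "real \<Rightarrow> real^2 \<Rightarrow> (real^2) \<times> (real^2)"
  where "torus_emb L x = ((\<chi> i. cos (2 * pi * (x $ i / L))), (\<chi> i. sin (2 * pi * (x $ i / L))))"

text \<open>The half-angle formula: the tangent of half the angle is sine over one plus cosine. The
  denominator vanishes only for the angle that belongs to the included face
  \<open>- L / 2\<close>.\<close>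

definition torus_inv :: "real \<Rightarrow> (real^2) \<times> (real^2) \<Rightarrow> real^2"
  where "torus_inv L z = (\<chi> i. if fst z $ i = - 1 then - L / 2
    else L / pi * arctan (snd z $ i / (fst z $ i + 1)))"

text \<open>The representative in the fundamental domain; the shift by 1/2 places the jump of the
  floor at the seam.\<close>

definition wrap :: "real \<Rightarrow> real^2 \<Rightarrow> real^2"
  where "wrap L x = (\<chi> i. x $ i - L * of_int \<lfloor>x $ i / L + 1 / 2\<rfloor>)"

lemma continuous_torus_emb: "continuous_on S (torus_emb L)"
  unfolding torus_emb_def divide_inverse by (intro continuous_intros)

lemma torus_inv_measurable: "torus_inv L \<in> measurable borel borel"
  unfolding torus_inv_def borel_prod[symmetric] by measurable

lemma wrap_in_torus: "L > 0 \<Longrightarrow> wrap L x \<in> torus L"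
proof -
  assume L: "L > 0"
  have "- L / 2 \<le> wrap L x $ i \<and> wrap L x $ i < L / 2" for i
  proof -
    have "of_int \<lfloor>x $ i / L + 1 / 2\<rfloor> \<le> x $ i / L + 1 / 2" "x $ i / L + 1 / 2 < of_int \<lfloor>x $ i / L + 1 / 2\<rfloor> + 1"
      by linarith+
    then have "L * of_int \<lfloor>x $ i / L + 1 / 2\<rfloor> \<le> L * (x $ i / L + 1 / 2)"
      "L * (x $ i / L + 1 / 2) < L * (of_int \<lfloor>x $ i / L + 1 / 2\<rfloor> + 1)"
      using L by (auto intro: mult_left_mono mult_strict_left_mono)
    then show ?thesis using L by (simp add: wrap_def algebra_simps)
  qed
  then show ?thesis by (simp add: torus_def)
qed

lemma torus_emb_wrap: "L > 0 \<Longrightarrow> torus_emb L (wrap L x) = torus_emb L x"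
proof -
  assume L: "L > 0"
  have "2 * pi * (wrap L x $ i / L) = 2 * pi * (x $ i / L) - (2 * pi) * of_int \<lfloor>x $ i / L + 1 / 2\<rfloor>" for i
    using L by (simp add: wrap_def field_simps)
  then show ?thesis
    by (simp add: torus_emb_def vec_eq_iff cos_diff sin_diff)
qed

lemma torus_inv_emb_torus:
  assumes L: "L > 0" and x: "x \<in> torus L"
  shows "torus_inv L (torus_emb L x) = x"
proof -
  have "torus_inv L (torus_emb L x) $ i = x $ i" for i
  proof -
    define \<theta> where "\<theta> = pi * (x $ i / L)"
    have "- L / 2 \<le> x $ i" "x $ i < L / 2" using x by (simp_all add: torus_def)
    then have "- (1 / 2) \<le> x $ i / L" "x $ i / L < 1 / 2" using L by (simp_all add: field_simps)
    then have "pi * (- (1 / 2)) \<le> \<theta>" "\<theta> < pi * (1 / 2)"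
      unfolding \<theta>_def by (intro mult_left_mono mult_strict_left_mono; simp)+
    then have \<theta>: "- (pi / 2) \<le> \<theta>" "\<theta> < pi / 2" by simp_all
    have xi: "x $ i = L / pi * \<theta>" using L by (simp add: \<theta>_def)
    have c: "fst (torus_emb L x) $ i = cos (2 * \<theta>)" "snd (torus_emb L x) $ i = sin (2 * \<theta>)"
      by (simp_all add: torus_emb_def \<theta>_def mult.assoc)
    show ?thesis
    proof (cases "\<theta> = - (pi / 2)")
      case True
      then show ?thesis using c xi L by (simp add: torus_inv_def)
    next
      case False
      then have t: "- (pi / 2) < \<theta>" using \<theta> by simp
      have "cos \<theta> > 0" using t \<theta> by (intro cos_gt_zero_pi) auto
      then have "cos (2 * \<theta>) \<noteq> - 1" using cos_double_cos[of \<theta>] by simp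
      then show ?thesis
        using c xi arctan_tan[OF t \<theta>(2)] by (simp add: torus_inv_def tan_half[symmetric])
    qed
  qed
  then show ?thesis by (simp add: vec_eq_iff)
qed

lemma torus_inv_emb: "L > 0 \<Longrightarrow> torus_inv L (torus_emb L x) = wrap L x"
  using torus_inv_emb_torus[OF _ wrap_in_torus] by (simp add: torus_emb_wrap)

lemma measurable_wrap_borel: "wrap L \<in> measurable borel borel"
  unfolding wrap_def by measurable

lemma torus_borel: "torus L \<in> sets borel"
proof -
  have "torus L = (\<Inter>i. {x. - L / 2 \<le> x $ i} \<inter> {x. x $ i < L / 2})" by (auto simp: torus_def)
  also have "\<dots> \<in> sets borel" by measurable
  finally show ?thesis .
qed

lemma measurable_wrap: "L > 0 \<Longrightarrow> wrap L \<in> measurable borel (restrict_space borel (torus L))"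
  by (rule measurable_restrict_space2) (auto simp: wrap_in_torus measurable_wrap_borel)

lemma periodic_shift:
  assumes "periodic L f"
  shows "f (x + (L * of_int k) *\<^sub>R axis i 1) = f x"
proof -
  have s: "f (x + (L * real n) *\<^sub>R axis i 1) = f x" for n x
  proof (induction n)
    case (Suc n)
    have "x + (L * real (Suc n)) *\<^sub>R axis i 1 = (x + (L * real n) *\<^sub>R axis i 1) + L *\<^sub>R axis i 1"
      by (simp add: algebra_simps)
    then show ?case using Suc assms unfolding periodic_def by metis
  qed simp
  show ?thesis
  proof (cases "0 \<le> k")
    case True
    then show ?thesis using s[of x "nat k"] by simp
  next
    case False
    then show ?thesis using s[of "x + (L * of_int k) *\<^sub>R axis i 1" "nat (- k)"] by simp
  qed
qed

lemma periodic_wrap: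
  assumes f: "periodic L f" shows "f (wrap L x) = f x"
proof -
  define k where "k i = - \<lfloor>x $ i / L + 1 / 2\<rfloor>" for i :: 2
  have "wrap L x = (x + (L * of_int (k 1)) *\<^sub>R axis 1 1) + (L * of_int (k 2)) *\<^sub>R axis 2 1"
    by (simp add: vec_eq_iff forall_2 wrap_def k_def axis_def)
  then show ?thesis by (simp add: periodic_shift[OF f])
qed

lemma torus_subset_cbox: "torus L \<subseteq> cbox (\<chi> i. - L / 2) (\<chi> i. L / 2)"
  by (auto simp: torus_def mem_box_cart less_imp_le)

lemma periodic_bounded:
  assumes L: "L > 0" and f: "continuous_on UNIV f" "periodic L (f :: real^2 \<Rightarrow> real)"
  obtains C where "\<And>x. \<bar>f x\<bar> \<le> C"
proof -
  have cp: "compact (f ` cbox (\<chi> i. - L / 2) (\<chi> i. L / 2))"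
    by (rule compact_continuous_image[OF continuous_on_subset[OF f(1) subset_UNIV] compact_cbox])
  obtain C where C: "\<forall>y\<in>f ` cbox (\<chi> i. - L / 2) (\<chi> i. L / 2). norm y \<le> C"
    using compact_imp_bounded[OF cp] unfolding bounded_iff by blast
  have "\<bar>f x\<bar> \<le> C" for x
  proof -
    have "wrap L x \<in> cbox (\<chi> i. - L / 2) (\<chi> i. L / 2)" by (rule subsetD[OF torus_subset_cbox wrap_in_torus[OF L]])
    then have "norm (f (wrap L x)) \<le> C" using C by blast
    then show ?thesis by (simp add: periodic_wrap[OF f(2)])
  qed
  then show thesis by (rule that)
qed

lemma periodic_torus_emb: "L > 0 \<Longrightarrow> periodic L (\<lambda>x. g (torus_emb L x))"
proof -
  assume L: "L > 0"
  have "torus_emb L (x + L *\<^sub>R axis i 1) = torus_emb L x" for x i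
  proof -
    have "2 * pi * ((x + L *\<^sub>R axis i 1) $ j / L) = 2 * pi * (x $ j / L) + (if j = i then 2 * pi else 0)" for j
      using L by (simp add: axis_def field_simps)
    then show ?thesis by (simp add: torus_emb_def vec_eq_iff del: vector_add_component)
  qed
  then show ?thesis by (simp add: periodic_def)
qed

text \<open>Stone-Weierstrass on the compact image of the closed square. Polynomials in the cosines
  and sines are trigonometric polynomials, so the approximants are smooth and periodic.\<close>

lemma periodic_approx:
  assumes L: "L > 0" and f: "continuous_on UNIV f" "periodic L (f :: real^2 \<Rightarrow> real)" and e: "e > 0"
  obtains g where "real_polynomial_function g" "\<And>x. \<bar>f x - g (torus_emb L x)\<bar> < e"
proof -
  let ?Q = "cbox (\<chi> i. - L / 2) (\<chi> i. L / 2) :: (real^2) set"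
  define S where "S = torus_emb L ` ?Q"
  have S: "compact S" unfolding S_def by (intro compact_continuous_image continuous_torus_emb compact_cbox)
  have Fe: "f (torus_inv L (torus_emb L x)) = f x" for x
    by (simp add: torus_inv_emb[OF L] periodic_wrap[OF f(2)])
  \<comment> \<open>The map \<open>torus_inv\<close> jumps at the seam, but \<open>f\<close> does
    not notice: the preimage of a closed set is the \<open>torus_emb\<close> image of a compact part
    of the square, hence closed.\<close>
  have "continuous_on S (\<lambda>z. f (torus_inv L z))"
    unfolding continuous_on_closed_vimage[OF compact_imp_closed[OF S]]
  proof (intro allI impI)
    fix B :: "real set" assume B: "closed B"
    have "compact (f -` B \<inter> ?Q)"
      by (rule closed_Int_compact[OF closed_vimage[OF B f(1)] compact_cbox])
    then have "closed (torus_emb L ` (f -` B \<inter> ?Q))"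
      by (intro compact_imp_closed compact_continuous_image continuous_torus_emb)
    also have "torus_emb L ` (f -` B \<inter> ?Q) = (\<lambda>z. f (torus_inv L z)) -` B \<inter> S"
      by (auto simp: S_def Fe)
    finally show "closed ((\<lambda>z. f (torus_inv L z)) -` B \<inter> S)" .
  qed
  then obtain g where g: "real_polynomial_function g" "\<And>z. z \<in> S \<Longrightarrow> \<bar>f (torus_inv L z) - g z\<bar> < e"
    using Stone_Weierstrass_real_polynomial_function[OF S _ e] by blast
  have "\<bar>f x - g (torus_emb L x)\<bar> < e" for x
  proof -
    have "wrap L x \<in> ?Q" by (rule subsetD[OF torus_subset_cbox wrap_in_torus[OF L]])
    then have "torus_emb L (wrap L x) \<in> S" unfolding S_def by (rule imageI)
    then have "torus_emb L x \<in> S" by (simp only: torus_emb_wrap[OF L])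
    from g(2)[OF this] show ?thesis by (simp add: Fe)
  qed
  then show thesis using that[OF g(1)] by blast
qed

lemma torus_measure_eqI:
  assumes L: "L > 0" and M: "finite_borel_measure (torus L) M" and N: "finite_borel_measure (torus L) N"
    and eq: "\<And>f :: real^2 \<Rightarrow> real. continuous_on UNIV f \<Longrightarrow> periodic L f \<Longrightarrow> (\<integral>x. f x \<partial>M) = (\<integral>x. f x \<partial>N)"
  shows "M = N"
proof (rule measure_eqI_embedding[where e="torus_emb L" and r="torus_inv L" and S="torus L"])
  fix f :: "(real^2) \<times> (real^2) \<Rightarrow> real" assume f: "continuous_on UNIV f" "bounded (range f)"
  show "(\<integral>x. f (torus_emb L x) \<partial>M) = (\<integral>x. f (torus_emb L x) \<partial>N)"
    by (rule eq[OF continuous_on_compose2[OF f(1) continuous_torus_emb] periodic_torus_emb[OF L]]) simp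
qed (use M N L in \<open>auto simp: finite_borel_measure_def torus_borel continuous_torus_emb torus_inv_measurable torus_inv_emb_torus\<close>)

text \<open>Same embedding, with time as an untouched extra coordinate. It will identify the
  projection of a limit measure in position and velocity.\<close>

lemma torus_prod_measure_eqI:
  fixes M N :: "((real^2) \<times> real) measure"
  assumes L: "L > 0" and M: "finite_measure M" "sets M = sets (restrict_space borel (torus L \<times> UNIV))"
    and N: "finite_measure N" "sets N = sets (restrict_space borel (torus L \<times> UNIV))"
    and eq: "\<And>f :: (real^2) \<times> real \<Rightarrow> real. continuous_on UNIV f \<Longrightarrow> (\<And>t. periodic L (\<lambda>x. f (x, t))) \<Longrightarrow>
      bounded (range f) \<Longrightarrow> (\<integral>x. f x \<partial>M) = (\<integral>x. f x \<partial>N)"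
  shows "M = N"
proof (rule measure_eqI_embedding[where e="\<lambda>p. (torus_emb L (fst p), snd p)" and r="\<lambda>z. (torus_inv L (fst z), snd z)" and S="torus L \<times> UNIV"])
  show ec: "continuous_on UNIV (\<lambda>p :: (real^2) \<times> real. (torus_emb L (fst p), snd p))"
    by (intro continuous_intros continuous_on_compose2[OF continuous_torus_emb[of UNIV]]) auto
  show "torus L \<times> (UNIV :: real set) \<in> sets borel"
    unfolding borel_prod[symmetric] using torus_borel by (intro pair_measureI) auto
  show "(\<lambda>z. (torus_inv L (fst z), snd z)) \<in> measurable borel (borel :: ((real^2) \<times> real) measure)"
    unfolding borel_prod[symmetric]
    by (intro measurable_Pair measurable_compose[OF measurable_fst torus_inv_measurable[unfolded borel_prod[symmetric]]] measurable_snd)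
  fix f :: "((real^2) \<times> (real^2)) \<times> real \<Rightarrow> real" assume f: "continuous_on UNIV f" "bounded (range f)"
  show "(\<integral>x. f (torus_emb L (fst x), snd x) \<partial>M) = (\<integral>x. f (torus_emb L (fst x), snd x) \<partial>N)"
  proof (rule eq)
    show "continuous_on UNIV (\<lambda>x. f (torus_emb L (fst x), snd x))"
      by (rule continuous_on_compose2[OF f(1) ec]) simp
    show "periodic L (\<lambda>x. f (torus_emb L (fst (x, t)), snd (x, t)))" for t
      using periodic_torus_emb[OF L, of "\<lambda>z. f (z, t)"] by simp
    show "bounded (range (\<lambda>x. f (torus_emb L (fst x), snd x)))"
      by (rule bounded_subset[OF f(2)]) auto
  qed
qed (use M N L in \<open>auto simp: torus_inv_emb_torus\<close>)

section \<open>Smooth functions: calculus, trigonometric polynomials, cut-offs\<close>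

lemma C_times_SucI:
  assumes "\<And>x. (f has_derivative f' x) (at x)" and "\<And>b. b \<in> Basis \<Longrightarrow> C_times k (\<lambda>x. f' x b)"
  shows "C_times (Suc k) f"
proof -
  have "frechet_derivative f (at x) = f' x" for x using frechet_derivative_at[OF assms(1)] by simp
  then show ?thesis using assms by (auto simp: differentiable_def)
qed

lemma C_times_SucD:
  assumes "C_times (Suc k) f"
  shows "(f has_derivative frechet_derivative f (at x)) (at x)"
    and "b \<in> Basis \<Longrightarrow> C_times k (\<lambda>x. frechet_derivative f (at x) b)"
  using assms by (auto simp: frechet_derivative_works)

lemma C_times_Suc_imp: "C_times (Suc k) f \<Longrightarrow> C_times k f"
proof (induction k arbitrary: f)
  case 0
  then show ?case
    by (auto intro!: continuous_at_imp_continuous_on differentiable_imp_continuous_within)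
next
  case (Suc k)
  show ?case
  proof (rule C_times_SucI)
    show "(f has_derivative frechet_derivative f (at x)) (at x)" for x by (rule C_times_SucD[OF Suc.prems])
    show "C_times k (\<lambda>x. frechet_derivative f (at x) b)" if "b \<in> Basis" for b
      by (rule Suc.IH[OF C_times_SucD(2)[OF Suc.prems that]])
  qed
qed

lemma C_times_const: "C_times k (\<lambda>x. c)"
proof (induction k arbitrary: c)
  case (Suc k)
  show ?case
    by (rule C_times_SucI[where f'="\<lambda>_ _. 0"]) (auto intro: derivative_eq_intros Suc)
qed simp

lemma C_times_add: "C_times k f \<Longrightarrow> C_times k g \<Longrightarrow> C_times k (\<lambda>x. f x + g x)"
proof (induction k arbitrary: f g)
  case (Suc k)
  show ?case
  proof (rule C_times_SucI)
    show "((\<lambda>x. f x + g x) has_derivative (\<lambda>b. frechet_derivative f (at x) b + frechet_derivative g (at x) b)) (at x)" for x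
      by (intro has_derivative_add C_times_SucD(1)[OF Suc.prems(1)] C_times_SucD(1)[OF Suc.prems(2)])
    show "C_times k (\<lambda>x. frechet_derivative f (at x) b + frechet_derivative g (at x) b)" if "b \<in> Basis" for b
      by (intro Suc.IH C_times_SucD(2)[OF Suc.prems(1) that] C_times_SucD(2)[OF Suc.prems(2) that])
  qed
qed (auto intro: continuous_intros)

lemma C_times_mult: "C_times k f \<Longrightarrow> C_times k g \<Longrightarrow> C_times k (\<lambda>x. f x * g x)"
proof (induction k arbitrary: f g)
  case (Suc k)
  show ?case
  proof (rule C_times_SucI)
    show "((\<lambda>x. f x * g x) has_derivative (\<lambda>b. f x * frechet_derivative g (at x) b + frechet_derivative f (at x) b * g x)) (at x)" for x
      by (intro has_derivative_mult C_times_SucD(1)[OF Suc.prems(1)] C_times_SucD(1)[OF Suc.prems(2)])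
    show "C_times k (\<lambda>x. f x * frechet_derivative g (at x) b + frechet_derivative f (at x) b * g x)" if "b \<in> Basis" for b
      by (intro C_times_add Suc.IH C_times_SucD(2)[OF Suc.prems(1) that] C_times_SucD(2)[OF Suc.prems(2) that]
          C_times_Suc_imp[OF Suc.prems(1)] C_times_Suc_imp[OF Suc.prems(2)])
  qed
qed (auto intro: continuous_intros)

lemma C_times_sum: "(\<And>i. i \<in> I \<Longrightarrow> C_times k (f i)) \<Longrightarrow> C_times k (\<lambda>x. \<Sum>i\<in>I. f i x)"
  by (induction I rule: infinite_finite_induct) (auto intro: C_times_const C_times_add)

text \<open>Chain rule. The derivative of \<open>f\<close> in direction \<open>l b\<close> is
  expanded in the basis, because the induction hypothesis speaks only of partial derivatives along
  basis vectors.\<close>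

lemma C_times_affine:
  fixes l :: "'b::euclidean_space \<Rightarrow> 'a::euclidean_space"
  assumes l: "bounded_linear l"
  shows "C_times k f \<Longrightarrow> C_times k (\<lambda>p. f (c + l p))"
proof (induction k arbitrary: f)
  case 0
  then have "continuous_on UNIV f" by simp
  then have "continuous_on UNIV (\<lambda>p. f (c + l p))"
    by (rule continuous_on_compose2) (auto intro!: continuous_intros linear_continuous_on[OF l])
  then show ?case by simp
next
  case (Suc k)
  show ?case
  proof (rule C_times_SucI)
    fix x
    have "((\<lambda>p. c + l p) has_derivative l) (at x)"
      using bounded_linear_imp_has_derivative[OF l] by (auto intro!: derivative_eq_intros)
    then show "((\<lambda>p. f (c + l p)) has_derivative (\<lambda>b. frechet_derivative f (at (c + l x)) (l b))) (at x)"
      by (rule has_derivative_compose) (rule C_times_SucD(1)[OF Suc.prems])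
  next
    fix b :: 'b
    have "frechet_derivative f (at y) (l b) = (\<Sum>b'\<in>Basis. (l b \<bullet> b') * frechet_derivative f (at y) b')" for y
    proof -
      have lin: "linear (frechet_derivative f (at y))"
        using C_times_SucD(1)[OF Suc.prems] by (rule has_derivative_linear)
      have "frechet_derivative f (at y) (l b) = frechet_derivative f (at y) (\<Sum>b'\<in>Basis. (l b \<bullet> b') *\<^sub>R b')"
        by (simp add: euclidean_representation)
      then show ?thesis by (simp add: linear_sum[OF lin] linear_scale[OF lin])
    qed
    then show "C_times k (\<lambda>x. frechet_derivative f (at (c + l x)) (l b))"
      by (simp only:) (intro C_times_sum C_times_mult C_times_const Suc.IH C_times_SucD(2)[OF Suc.prems])
  qed
qed

lemma C_times_real_SucI:
  fixes f :: "real \<Rightarrow> real"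
  assumes "\<And>x. (f has_real_derivative f' x) (at x)" "C_times k f'"
  shows "C_times (Suc k) f"
proof (rule C_times_SucI)
  show "(f has_derivative (\<lambda>h. f' x * h)) (at x)" for x using assms(1) by (simp add: has_field_derivative_def)
  show "C_times k (\<lambda>x. f' x * b)" if "b \<in> Basis" for b using that assms(2) by simp
qed

lemma C_times_trig: "C_times k (\<lambda>x::real. a * cos x + b * sin x)"
proof (induction k arbitrary: a b)
  case 0
  then show ?case by (auto intro!: continuous_intros)
next
  case (Suc k)
  show ?case
    by (rule C_times_real_SucI[OF _ Suc[of b "- a"]]) (auto intro!: derivative_eq_intros)
qed

lemma C_times_torus_emb: "C_times k (\<lambda>x. torus_emb L x \<bullet> b)"
proof -
  have bl: "bounded_linear (\<lambda>x::real^2. 2 * pi / L * (x $ i))" for i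
    by (intro bounded_linear_mult_right[THEN bounded_linear_compose] bounded_linear_vec_nth)
  have "torus_emb L x \<bullet> b = (\<Sum>i\<in>UNIV. fst b $ i * cos (0 + 2 * pi / L * (x $ i)) + snd b $ i * sin (0 + 2 * pi / L * (x $ i)))" for x
    by (cases b) (simp add: torus_emb_def inner_vec_def sum.distrib mult.commute)
  then show ?thesis
    by (simp only:) (intro C_times_sum C_times_affine[OF bl, of k "\<lambda>y. _ * cos y + _ * sin y" 0] C_times_trig)
qed

text \<open>With \<open>periodic_approx\<close> this makes smooth periodic functions uniformly dense
  among the continuous periodic ones.\<close>

lemma smooth_trig_poly:
  "real_polynomial_function g \<Longrightarrow> C_times k (\<lambda>x. g (torus_emb L x))"
proof (induction g rule: real_polynomial_function.induct)
  case (linear f)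
  have "f (torus_emb L x) = (\<Sum>b\<in>Basis. f b * (torus_emb L x \<bullet> b))" for x
  proof -
    have lin: "linear f" using linear by (rule bounded_linear.linear)
    have "f (torus_emb L x) = f (\<Sum>b\<in>Basis. (torus_emb L x \<bullet> b) *\<^sub>R b)"
      by (simp only: euclidean_representation)
    then show ?thesis by (simp add: linear_sum[OF lin] linear_scale[OF lin] mult.commute)
  qed
  then show ?case by (simp only:) (intro C_times_sum C_times_mult C_times_const C_times_torus_emb)
qed (auto intro: C_times_const C_times_add C_times_mult)

text \<open>The classical flat function \<open>exp (- 1 / t)\<close>, divided by powers of
  \<open>t\<close> so that the family is closed under differentiation up to linear
  combinations.\<close>

definition exp_inv :: "nat \<Rightarrow> real \<Rightarrow> real"
  where "exp_inv n t = (if t > 0 then exp (- 1 / t) / t ^ n else 0)"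

lemma exp_inv_nonneg: "0 \<le> exp_inv n t" by (simp add: exp_inv_def)

text \<open>A single term of the exponential series, number \<open>n + 1\<close> at
  \<open>1 / t\<close>, already beats the power of \<open>t\<close>. The estimate gives the limit at
  0.\<close>

lemma exp_inv_le: "\<bar>exp_inv n t\<bar> \<le> fact (Suc n) * \<bar>t\<bar>"
proof (cases "t > 0")
  case True
  have "(1 / t) ^ Suc n / fact (Suc n) \<le> exp (1 / t)"
  proof -
    have s: "(\<lambda>k. (1 / t) ^ k /\<^sub>R fact k) sums exp (1 / t)" by (rule exp_converges)
    have "sum (\<lambda>k. (1 / t) ^ k /\<^sub>R fact k) {Suc n} \<le> (\<Sum>k. (1 / t) ^ k /\<^sub>R fact k)"
      by (rule sum_le_suminf[OF sums_summable[OF s]]) (use True in auto)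
    then show ?thesis using s by (simp add: sums_iff divide_inverse mult.commute del: power_Suc fact_Suc)
  qed
  then have "exp (- (1 / t)) * ((1 / t) ^ Suc n / fact (Suc n)) \<le> exp (- (1 / t)) * exp (1 / t)"
    by (intro mult_left_mono) auto
  also have "\<dots> = 1" by (simp add: exp_minus_inverse mult.commute)
  finally have le: "exp (- (1 / t)) * ((1 / t) ^ Suc n / fact (Suc n)) \<le> 1" .
  have F: "(0::real) < fact (Suc n)" by (rule fact_gt_zero)
  from le have "exp (- 1 / t) / t ^ n \<le> fact (Suc n) * t"
    using True F by (simp add: field_simps del: fact_Suc)
  then show ?thesis using True by (simp add: exp_inv_def)
next
  case False
  then have "exp_inv n t = 0" by (simp add: exp_inv_def)
  then show ?thesis by (simp only: abs_zero) (intro mult_nonneg_nonneg fact_ge_zero abs_ge_zero)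
qed

lemma exp_inv_deriv: "(exp_inv n has_real_derivative exp_inv (n + 2) t - real n * exp_inv (n + 1) t) (at t)"
proof -
  consider "t > 0" | "t < 0" | "t = 0" by linarith
  then show ?thesis
  proof cases
    case 1
    have d: "((\<lambda>t. exp (- 1 / t) / t ^ n) has_real_derivative exp_inv (n + 2) t - real n * exp_inv (n + 1) t) (at t)"
      using 1
      apply (cases n)
       apply (auto intro!: derivative_eq_intros simp: exp_inv_def field_simps power2_eq_square)
      subgoal for m by (cases m) auto
      done
    show ?thesis
      by (rule has_field_derivative_transform_within_open[OF d, of "{0<..}"]) (use 1 in \<open>auto simp: exp_inv_def\<close>)
  next
    case 2
    have d: "((\<lambda>t. 0) has_real_derivative exp_inv (n + 2) t - real n * exp_inv (n + 1) t) (at t)"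
      using 2 by (simp add: exp_inv_def)
    show ?thesis
      by (rule has_field_derivative_transform_within_open[OF d, of "{..<0}"]) (use 2 in \<open>auto simp: exp_inv_def\<close>)
  next
    case 3
    \<comment> \<open>Away from 0, \<open>exp_inv (Suc n) h\<close> is exactly the difference
      quotient of \<open>exp_inv n\<close> at 0.\<close>
    have "((\<lambda>h. exp_inv (Suc n) h) \<longlongrightarrow> 0) (at 0)"
    proof (rule Lim_null_comparison)
      show "eventually (\<lambda>h. norm (exp_inv (Suc n) h) \<le> fact (Suc (Suc n)) * \<bar>h\<bar>) (at 0)"
        using exp_inv_le[of "Suc n"] by (simp del: fact_Suc)
      show "((\<lambda>h. fact (Suc (Suc n)) * \<bar>h\<bar>) \<longlongrightarrow> (0::real)) (at 0)"
        by (rule tendsto_eq_intros | simp)+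
    qed
    then have "((\<lambda>h. (exp_inv n (0 + h) - exp_inv n 0) / h) \<longlongrightarrow> 0) (at 0)"
      by (rule Lim_transform_eventually) (auto simp: exp_inv_def)
    then show ?thesis using 3 by (simp add: DERIV_def exp_inv_def)
  qed
qed

lemma C_times_exp_inv: "C_times k (exp_inv n)"
proof (induction k arbitrary: n)
  case 0
  have "continuous_on UNIV (exp_inv n)"
    using DERIV_isCont[OF exp_inv_deriv] by (auto intro: continuous_at_imp_continuous_on)
  then show ?case by simp
next
  case (Suc k)
  have "C_times k (\<lambda>t. exp_inv (n + 2) t + (- real n) * exp_inv (n + 1) t)"
    by (intro C_times_add C_times_mult C_times_const Suc)
  then show ?case by (intro C_times_real_SucI[OF exp_inv_deriv]) simp
qed

text \<open>The product of two flat functions, one vanishing left of 0 and one right of 1, is a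
  bump; its primitive, normalised by the total integral \<open>Z\<close>, is the step.\<close>

lemma smooth_step:
  obtains B b :: "real \<Rightarrow> real" where "\<And>k. C_times k B" "\<And>y. (B has_real_derivative b y) (at y)"
    "\<And>y. 0 \<le> b y" "\<And>y. y \<le> 0 \<Longrightarrow> B y = 0" "\<And>y. 1 \<le> y \<Longrightarrow> B y = 1" "continuous_on UNIV b"
    "\<And>y. y \<le> 0 \<or> 1 \<le> y \<Longrightarrow> b y = 0"
proof -
  define c where "c t = exp_inv 0 t * exp_inv 0 (1 + - t)" for t
  have cC: "C_times k c" for k
    unfolding c_def by (intro C_times_mult C_times_exp_inv C_times_affine[where l="\<lambda>t. - t"] bounded_linear_minus bounded_linear_ident)
  have cc: "continuous_on S c" for S using cC[of 0] by (auto intro: continuous_on_subset)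
  have c0: "0 \<le> c t" for t by (simp add: c_def exp_inv_nonneg)
  have cz: "c t = 0" if "t \<le> 0 \<or> 1 \<le> t" for t using that by (auto simp: c_def exp_inv_def)
  \<comment> \<open>The lower limit -1 rather than 0 makes 0 an interior point, so the fundamental
    theorem gives the two-sided derivative there.\<close>
  define A where "A y = integral {-1..y} c" for y
  have A0: "A y = 0" if "y \<le> 0" for y
  proof -
    have "A y = integral {-1..y} (\<lambda>_. 0)"
      unfolding A_def by (rule Henstock_Kurzweil_Integration.integral_cong) (use that cz in auto)
    then show ?thesis by simp
  qed
  have dA: "(A has_real_derivative c y) (at y)" for y
  proof (cases "y < 0")
    case True
    have d: "((\<lambda>y. 0) has_real_derivative c y) (at y)" using True cz by simp
    show ?thesis
      by (rule has_field_derivative_transform_within_open[OF d, of "{..<0}"]) (use True A0 in auto)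
  next
    case False
    have "(A has_real_derivative c y) (at y within {-1..y + 1})"
      unfolding A_def by (rule integral_has_real_derivative) (use False cc in auto)
    then show ?thesis using at_within_interior[of y "{-1..y + 1}"] False by simp
  qed
  define Z where "Z = A 1"
  have A1: "A y = Z" if "1 \<le> y" for y
  proof -
    have "integral {-1..1} c + integral {1..y} c = integral {-1..y} c"
      by (rule Henstock_Kurzweil_Integration.integral_combine) (use that cc in \<open>auto intro: integrable_continuous_real\<close>)
    moreover have "integral {1..y} c = integral {1..y} (\<lambda>_. 0)"
      by (rule Henstock_Kurzweil_Integration.integral_cong) (use cz in auto)
    ultimately show ?thesis by (simp add: A_def Z_def)
  qed
  have Z: "Z > 0"
  proof -
    have mono: "A x \<le> A y" if "x \<le> y" for x y
      using that by (rule DERIV_nonneg_imp_nondecreasing) (use dA c0 in auto)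
    \<comment> \<open>If \<open>Z\<close> were 0, the monotone primitive would be constant on the
      unit interval and the bump would vanish at 1/2.\<close>
    have "Z \<noteq> 0"
    proof
      assume "Z = 0"
      then have "A y = 0" if "0 < y" "y < 1" for y
        using mono[of 0 y] mono[of y 1] that A0[of 0] by (simp add: Z_def)
      then have "((\<lambda>y. 0) has_real_derivative c (1/2)) (at (1/2))"
        by (intro has_field_derivative_transform_within_open[OF dA, of "{0<..<1}"]) auto
      then have "c (1/2) = 0" using DERIV_unique[OF _ DERIV_const] by blast
      then show False by (simp add: c_def exp_inv_def)
    qed
    then show ?thesis using mono[of 0 1] A0[of 0] by (simp add: Z_def)
  qed
  show thesis
  proof (rule that[of "\<lambda>y. (1 / Z) * A y" "\<lambda>y. (1 / Z) * c y"])
    show d: "((\<lambda>y. (1 / Z) * A y) has_real_derivative (1 / Z) * c y) (at y)" for y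
      by (rule DERIV_cmult[OF dA])
    show "C_times k (\<lambda>y. (1 / Z) * A y)" for k
      by (rule C_times_Suc_imp, rule C_times_real_SucI[OF d]) (intro C_times_mult C_times_const cC)
    show "continuous_on UNIV (\<lambda>y. (1 / Z) * c y)" by (intro continuous_intros cc)
  qed (use c0 A0 A1 Z cz in auto)
qed

section \<open>Slices and disintegration\<close>

lemma sets_torus: "A \<in> sets (restrict_space borel (torus L)) \<longleftrightarrow> A \<subseteq> torus L \<and> A \<in> sets borel"
  using torus_borel by (simp add: sets_restrict_space_iff)

lemma cylinder_borel: "cylinder L T \<in> sets borel"
  unfolding cylinder_def borel_prod[symmetric] using torus_borel by (intro pair_measureI) auto

lemma sets_cylinder: "A \<in> sets (restrict_space borel (cylinder L T)) \<longleftrightarrow> A \<subseteq> cylinder L T \<and> A \<in> sets borel"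
  using cylinder_borel by (simp add: sets_restrict_space_iff)

lemma space_torus_measure: "finite_borel_measure (torus L) \<nu> \<Longrightarrow> space \<nu> = torus L"
  using sets_eq_imp_space_eq[of \<nu> "restrict_space borel (torus L)"]
  by (simp add: finite_borel_measure_def space_restrict_space)

lemma space_cylinder_measure: "finite_borel_measure (cylinder L T) \<mu> \<Longrightarrow> space \<mu> = cylinder L T"
  using sets_eq_imp_space_eq[of \<mu> "restrict_space borel (cylinder L T)"]
  by (simp add: finite_borel_measure_def space_restrict_space)

lemma borel_measurable_torus_measure:
  assumes "finite_borel_measure (torus L) \<nu>" "f \<in> measurable borel N"
  shows "f \<in> measurable \<nu> N"
proof -
  have "sets \<nu> = sets (restrict_space borel (torus L))" using assms by (simp add: finite_borel_measure_def)
  from measurable_cong_sets[OF this refl] measurable_restrict_space1[OF assms(2)] show ?thesis by blast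
qed

lemma borel_measurable_cylinder_measure:
  assumes "finite_borel_measure (cylinder L T) \<mu>" "f \<in> measurable borel N"
  shows "f \<in> measurable \<mu> N"
proof -
  have "sets \<mu> = sets (restrict_space borel (cylinder L T))" using assms by (simp add: finite_borel_measure_def)
  from measurable_cong_sets[OF this refl] measurable_restrict_space1[OF assms(2)] show ?thesis by blast
qed

lemma measurable_section: "f \<in> measurable (borel :: ('a::second_countable_topology \<times> 'b::second_countable_topology) measure) N \<Longrightarrow> (\<lambda>x. f (x, t)) \<in> measurable borel N"
proof (rule measurable_compose[where N=borel and f="\<lambda>x. (x, t)"])
  show "(\<lambda>x. (x, t)) \<in> measurable (borel :: 'a measure) (borel :: ('a \<times> 'b) measure)"
    by (intro borel_measurable_continuous_onI continuous_intros)
qed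

text \<open>The clauses of \<open>disintegration\<close> that do not mention the measure, so that
  slices can be handled before the measure on the cylinder exists.\<close>

definition kernel :: "real \<Rightarrow> real \<Rightarrow> (real \<Rightarrow> (real^2) measure) \<Rightarrow> bool"
  where "kernel L T \<kappa> \<longleftrightarrow>
    (\<forall>t\<in>{-T<..<T}. finite_borel_measure (torus L) (\<kappa> t)) \<and>
    (\<forall>B\<in>sets (restrict_space borel (torus L)).
       (\<lambda>t. emeasure (\<kappa> t) B) \<in> borel_measurable (restrict_space borel {-T<..<T}))"

lemma disintegration_kernel: "disintegration L T \<mu> \<kappa> \<Longrightarrow> kernel L T \<kappa>"
  by (simp add: disintegration_def kernel_def)

context
  fixes L T :: real and \<kappa> :: "real \<Rightarrow> (real^2) measure"
  assumes \<kappa>: "kernel L T \<kappa>"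
begin

lemma kernel_finite: "t \<in> {-T<..<T} \<Longrightarrow> finite_borel_measure (torus L) (\<kappa> t)"
  using \<kappa> by (simp add: kernel_def)

lemma kernel_section:
  assumes A: "A \<in> sets (borel :: ((real^2) \<times> real) measure)"
  shows "{x \<in> torus L. (x, t) \<in> A} \<in> sets (restrict_space borel (torus L))"
proof -
  have "(\<lambda>x. (x, t)) -` A \<inter> space borel \<in> sets (borel :: (real^2) measure)"
  proof (rule measurable_sets[OF _ A])
    show "(\<lambda>x. (x, t)) \<in> measurable (borel :: (real^2) measure) (borel :: ((real^2) \<times> real) measure)"
      using measurable_section[OF measurable_ident] by (simp add: id_def)
  qed
  then have "torus L \<inter> (\<lambda>x. (x, t)) -` A \<in> sets borel" using torus_borel by auto
  moreover have "torus L \<inter> (\<lambda>x. (x, t)) -` A = {x \<in> torus L. (x, t) \<in> A}" by auto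
  ultimately show ?thesis by (simp add: sets_torus)
qed

text \<open>Induction over the generator of rectangles: for \<open>a \<times> b\<close> the section
  has the measure of \<open>a\<close> inside the torus times the indicator of \<open>b\<close>.
  Complements can be subtracted because every slice is finite.\<close>

lemma kernel_section_measurable:
  assumes A: "A \<in> sets (borel :: ((real^2) \<times> real) measure)"
  shows "(\<lambda>t. emeasure (\<kappa> t) {x \<in> torus L. (x, t) \<in> A}) \<in> borel_measurable (restrict_space borel {-T<..<T})"
proof -
  let ?R = "restrict_space borel {-T<..<T}"
  have sp: "space ?R = {-T<..<T}" by (simp add: space_restrict_space)
  have sec: "{x \<in> torus L. (x, t) \<in> A} \<in> sets (\<kappa> t)" if "t \<in> {-T<..<T}" "A \<in> sets borel" for A t
    using kernel_section[OF that(2)] kernel_finite[OF that(1)] by (simp add: finite_borel_measure_def)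
  let ?G = "{a \<times> b | a b. a \<in> sets (borel :: (real^2) measure) \<and> b \<in> sets (borel :: real measure)}"
  have S: "sets (borel :: ((real^2) \<times> real) measure) = sigma_sets UNIV ?G"
    unfolding borel_prod[symmetric] sets_pair_measure by simp
  have A': "A \<in> sigma_sets UNIV ?G" using A S by simp
  have GP: "?G \<subseteq> Pow UNIV" by simp
  have stab: "Int_stable ?G" using Int_stable_pair_measure_generator[of borel borel] by simp
  show ?thesis
    using stab GP A'
  proof (induction rule: sigma_sets_induct_disjoint)
    case (basic A)
    then obtain a b where ab: "A = a \<times> b" "a \<in> sets borel" "b \<in> sets borel" by auto
    have "a \<inter> torus L \<in> sets (restrict_space borel (torus L))" using ab torus_borel by (auto simp: sets_torus)
    then have m: "(\<lambda>t. emeasure (\<kappa> t) (a \<inter> torus L)) \<in> borel_measurable ?R" using \<kappa> by (simp add: kernel_def)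
    have i: "(indicator b :: real \<Rightarrow> ennreal) \<in> borel_measurable ?R"
      using ab by (intro measurable_restrict_space1) simp
    have "(\<lambda>t. emeasure (\<kappa> t) (a \<inter> torus L) * indicator b t) \<in> borel_measurable ?R"
      using m i by measurable
    moreover have "emeasure (\<kappa> t) {x \<in> torus L. (x, t) \<in> A} = emeasure (\<kappa> t) (a \<inter> torus L) * indicator b t" for t
    proof (cases "t \<in> b")
      case True
      then have "{x \<in> torus L. (x, t) \<in> A} = a \<inter> torus L" using ab by auto
      then show ?thesis using True by simp
    next
      case False
      then have e: "{x \<in> torus L. (x, t) \<in> A} = {}" using ab by auto
      show ?thesis unfolding e using False by simp
    qed
    ultimately show ?case by simp
  next
    case empty
    then show ?case by simp
  next
    case (compl A)
    have AB: "A \<in> sets borel" using compl.hyps S by simp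
    have "(\<lambda>t. emeasure (\<kappa> t) (torus L) - emeasure (\<kappa> t) {x \<in> torus L. (x, t) \<in> A}) \<in> borel_measurable ?R"
    proof -
      have "(\<lambda>t. emeasure (\<kappa> t) (torus L)) \<in> borel_measurable ?R"
        using \<kappa> torus_borel by (auto simp: kernel_def sets_torus)
      then show ?thesis using compl.IH by measurable
    qed
    then show ?case
    proof (rule measurable_cong[THEN iffD1, rotated])
      fix t assume "t \<in> space ?R"
      then have t: "t \<in> {-T<..<T}" by (simp add: sp)
      interpret finite_measure "\<kappa> t" using kernel_finite[OF t] by (simp add: finite_borel_measure_def)
      have "torus L \<in> sets (\<kappa> t)"
        using kernel_finite[OF t] torus_borel by (simp add: finite_borel_measure_def sets_torus)
      then have "emeasure (\<kappa> t) (torus L - {x \<in> torus L. (x, t) \<in> A}) = emeasure (\<kappa> t) (torus L) - emeasure (\<kappa> t) {x \<in> torus L. (x, t) \<in> A}"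
        using sec[OF t AB] by (intro emeasure_Diff) (auto simp: emeasure_eq_measure)
      moreover have "torus L - {x \<in> torus L. (x, t) \<in> A} = {x \<in> torus L. (x, t) \<in> UNIV - A}" by auto
      ultimately show "emeasure (\<kappa> t) (torus L) - emeasure (\<kappa> t) {x \<in> torus L. (x, t) \<in> A} = emeasure (\<kappa> t) {x \<in> torus L. (x, t) \<in> UNIV - A}"
        by simp
    qed
  next
    case (union A)
    have AB: "A i \<in> sets borel" for i using union.hyps(2) S by auto
    have "(\<lambda>t. \<Sum>i. emeasure (\<kappa> t) {x \<in> torus L. (x, t) \<in> A i}) \<in> borel_measurable ?R"
      using union.IH by measurable
    then show ?case
    proof (rule measurable_cong[THEN iffD1, rotated])
      fix t assume "t \<in> space ?R"
      then have t: "t \<in> {-T<..<T}" by (simp add: sp)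
      have "(\<Sum>i. emeasure (\<kappa> t) {x \<in> torus L. (x, t) \<in> A i}) = emeasure (\<kappa> t) (\<Union>i. {x \<in> torus L. (x, t) \<in> A i})"
      proof (rule suminf_emeasure)
        show "range (\<lambda>i. {x \<in> torus L. (x, t) \<in> A i}) \<subseteq> sets (\<kappa> t)" using sec[OF t AB] by (rule image_subsetI)
        show "disjoint_family (\<lambda>i. {x \<in> torus L. (x, t) \<in> A i})"
          using union.hyps(1) unfolding disjoint_family_on_def by blast
      qed
      also have "(\<Union>i. {x \<in> torus L. (x, t) \<in> A i}) = {x \<in> torus L. (x, t) \<in> (\<Union>i. A i)}" by auto
      finally show "(\<Sum>i. emeasure (\<kappa> t) {x \<in> torus L. (x, t) \<in> A i}) = emeasure (\<kappa> t) {x \<in> torus L. (x, t) \<in> (\<Union>i. A i)}" .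
    qed
  qed
qed

lemma kernel_nn_integral_measurable:
  fixes f :: "(real^2) \<times> real \<Rightarrow> ennreal"
  assumes f: "f \<in> borel_measurable borel"
  shows "(\<lambda>t. \<integral>\<^sup>+x. f (x, t) \<partial>\<kappa> t) \<in> borel_measurable (restrict_space borel {-T<..<T})"
proof -
  let ?R = "restrict_space borel {-T<..<T}"
  have sp: "space ?R = {-T<..<T}" by (simp add: space_restrict_space)
  have fk: "(\<lambda>x. f (x, t)) \<in> borel_measurable (\<kappa> t)"
    if "t \<in> {-T<..<T}" "f \<in> borel_measurable borel" for t and f :: "(real^2) \<times> real \<Rightarrow> ennreal"
    by (rule borel_measurable_torus_measure[OF kernel_finite[OF that(1)] measurable_section[OF that(2)]])
  show ?thesis
    using f
  proof (induction rule: borel_measurable_induct)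
    case (cong f g)
    then have "f = g" by auto
    then show ?case using cong by simp
  next
    case (set A)
    show ?case
    proof (rule measurable_cong[THEN iffD1, OF _ kernel_section_measurable[OF set]])
      fix t assume "t \<in> space ?R"
      then have t: "t \<in> {-T<..<T}" by (simp add: sp)
      have "{x \<in> torus L. (x, t) \<in> A} \<in> sets (\<kappa> t)"
        using kernel_section[OF set] kernel_finite[OF t] by (simp add: finite_borel_measure_def)
      then have "emeasure (\<kappa> t) {x \<in> torus L. (x, t) \<in> A} = (\<integral>\<^sup>+x. indicator {x \<in> torus L. (x, t) \<in> A} x \<partial>\<kappa> t)"
        by simp
      also have "\<dots> = (\<integral>\<^sup>+x. indicator A (x, t) \<partial>\<kappa> t)"
        by (rule nn_integral_cong) (simp add: indicator_def space_torus_measure[OF kernel_finite[OF t]])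
      finally show "emeasure (\<kappa> t) {x \<in> torus L. (x, t) \<in> A} = (\<integral>\<^sup>+x. indicator A (x, t) \<partial>\<kappa> t)" .
    qed
  next
    case (mult u c)
    have "(\<lambda>t. c * (\<integral>\<^sup>+x. u (x, t) \<partial>\<kappa> t)) \<in> borel_measurable ?R" using mult.IH by measurable
    then show ?case
      by (rule measurable_cong[THEN iffD1, rotated]) (simp add: nn_integral_cmult[OF fk] mult.hyps sp)
  next
    case (add u v)
    have "(\<lambda>t. (\<integral>\<^sup>+x. v (x, t) \<partial>\<kappa> t) + (\<integral>\<^sup>+x. u (x, t) \<partial>\<kappa> t)) \<in> borel_measurable ?R" using add.IH by measurable
    then show ?case
      by (rule measurable_cong[THEN iffD1, rotated]) (simp add: nn_integral_add[OF fk fk] add.hyps sp)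
  next
    case (seq U)
    have "(\<lambda>t. SUP i. (\<integral>\<^sup>+x. U i (x, t) \<partial>\<kappa> t)) \<in> borel_measurable ?R"
      using seq.IH by (intro borel_measurable_SUP) auto
    then show ?case
    proof (rule measurable_cong[THEN iffD1, rotated])
      fix t assume "t \<in> space ?R"
      then have t: "t \<in> {-T<..<T}" by (simp add: sp)
      have "incseq (\<lambda>i x. U i (x, t))" using seq.hyps(3) by (auto simp: incseq_def le_fun_def)
      then show "(SUP i. (\<integral>\<^sup>+x. U i (x, t) \<partial>\<kappa> t)) = (\<integral>\<^sup>+x. (SUP i. U i) (x, t) \<partial>\<kappa> t)"
        unfolding SUP_apply by (intro nn_integral_monotone_convergence_SUP[symmetric] fk[OF t] seq.hyps(1))
    qed
  qed
qed

lemma kernel_nn_integral_measurable_lborel: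
  fixes f :: "(real^2) \<times> real \<Rightarrow> ennreal"
  assumes f: "f \<in> borel_measurable borel"
  shows "(\<lambda>t. (\<integral>\<^sup>+x. f (x, t) \<partial>\<kappa> t) * indicator {-T<..<T} t) \<in> borel_measurable lborel"
  using kernel_nn_integral_measurable[OF f] by (simp add: borel_measurable_restrict_space_iff_ennreal)

lemma kernel_indicator:
  assumes A: "A \<in> sets borel" "A \<subseteq> cylinder L T" and t: "t \<in> {-T<..<T}"
  shows "(\<integral>\<^sup>+x. indicator A (x, t) \<partial>\<kappa> t) = emeasure (\<kappa> t) {x. (x, t) \<in> A}"
proof -
  have e: "{x. (x, t) \<in> A} = {x \<in> torus L. (x, t) \<in> A}" using A(2) by (auto simp: cylinder_def)
  have "{x. (x, t) \<in> A} \<in> sets (\<kappa> t)"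
    using kernel_section[OF A(1), of t] kernel_finite[OF t] by (simp add: finite_borel_measure_def e)
  then have "emeasure (\<kappa> t) {x. (x, t) \<in> A} = (\<integral>\<^sup>+x. indicator {x. (x, t) \<in> A} x \<partial>\<kappa> t)" by simp
  then show ?thesis by (simp add: indicator_def)
qed

text \<open>The slices are integrated over time. Countable additivity is monotone convergence,
  applied in each slice and then in time; the uniform bound \<open>C\<close> on the masses makes the
  result finite.\<close>

lemma kernel_measure_exists:
  assumes C: "C < \<infinity>" "\<And>t. t \<in> {-T<..<T} \<Longrightarrow> emeasure (\<kappa> t) (torus L) \<le> C"
  obtains \<mu> where "finite_borel_measure (cylinder L T) \<mu>" "disintegration L T \<mu> \<kappa>"
proof -
  let ?S = "restrict_space borel (cylinder L T)"
  define E where "E A = (\<integral>\<^sup>+t. (\<integral>\<^sup>+x. indicator A (x, t) \<partial>\<kappa> t) * indicator {-T<..<T} t \<partial>lborel)" for A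
  define \<mu> where "\<mu> = measure_of (space ?S) (sets ?S) E"
  have s\<mu>: "sets \<mu> = sets ?S" by (simp add: \<mu>_def sets.sigma_sets_eq sets.space_closed)
  have im: "(indicator A :: _ \<Rightarrow> ennreal) \<in> borel_measurable borel" if "A \<in> sets ?S" for A
    using that by (auto simp: sets_cylinder)
  have em: "emeasure \<mu> A = E A" if A: "A \<in> sets ?S" for A
  proof (rule emeasure_measure_of[OF \<mu>_def])
    show "sets ?S \<subseteq> Pow (space ?S)" by (rule sets.space_closed)
    show "A \<in> sets \<mu>" using A s\<mu> by simp
    show "positive (sets \<mu>) E" by (simp add: positive_def E_def)
    show "countably_additive (sets \<mu>) E"
      unfolding countably_additive_def s\<mu>
    proof (intro allI impI)
      fix A :: "nat \<Rightarrow> ((real^2) \<times> real) set" assume A: "range A \<subseteq> sets ?S" "disjoint_family A"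
      have AS: "A i \<in> sets ?S" for i using A by auto
      have "(\<Sum>i. E (A i)) = (\<integral>\<^sup>+t. (\<Sum>i. (\<integral>\<^sup>+x. indicator (A i) (x, t) \<partial>\<kappa> t) * indicator {-T<..<T} t) \<partial>lborel)"
        unfolding E_def by (rule nn_integral_suminf[symmetric]) (rule kernel_nn_integral_measurable_lborel[OF im[OF AS]])
      also have "\<dots> = E (\<Union>i. A i)"
        unfolding E_def
      proof (rule nn_integral_cong)
        fix t
        show "(\<Sum>i. (\<integral>\<^sup>+x. indicator (A i) (x, t) \<partial>\<kappa> t) * indicator {-T<..<T} t) = (\<integral>\<^sup>+x. indicator (\<Union>i. A i) (x, t) \<partial>\<kappa> t) * indicator {-T<..<T} t"
        proof (cases "t \<in> {-T<..<T}")
          case True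
          have "(\<Sum>i. (\<integral>\<^sup>+x. indicator (A i) (x, t) \<partial>\<kappa> t)) = (\<integral>\<^sup>+x. (\<Sum>i. indicator (A i) (x, t)) \<partial>\<kappa> t)"
            by (rule nn_integral_suminf[symmetric])
               (rule borel_measurable_torus_measure[OF kernel_finite[OF True] measurable_section[OF im[OF AS]]])
          then show ?thesis using True by (simp add: suminf_indicator[OF A(2)])
        qed simp
      qed
      finally show "(\<Sum>i. E (A i)) = E (\<Union>i. A i)" .
    qed
  qed
  have fin: "finite_measure \<mu>"
  proof (rule finite_measureI)
    have "emeasure \<mu> (space \<mu>) = E (cylinder L T)"
      using em[of "cylinder L T"] sets_eq_imp_space_eq[OF s\<mu>] cylinder_borel by (simp add: sets_cylinder space_restrict_space)
    also have "\<dots> \<le> (\<integral>\<^sup>+t. C * indicator {-T<..<T} t \<partial>lborel)"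
      unfolding E_def
    proof (rule nn_integral_mono)
      fix t
      show "(\<integral>\<^sup>+x. indicator (cylinder L T) (x, t) \<partial>\<kappa> t) * indicator {-T<..<T} t \<le> C * indicator {-T<..<T} t"
      proof (cases "t \<in> {-T<..<T}")
        case True
        have "{x. (x, t) \<in> cylinder L T} = torus L" using True by (auto simp: cylinder_def)
        then show ?thesis using C(2)[OF True] True kernel_indicator[OF cylinder_borel order_refl True] by simp
      qed simp
    qed
    also have "\<dots> = C * emeasure lborel {-T<..<T}" by (simp add: nn_integral_cmult_indicator)
    also have "\<dots> < \<infinity>"
    proof -
      have "emeasure lborel {-T<..<T} < \<infinity>"
        by (rule emeasure_bounded_finite, rule bounded_subset[OF bounded_closed_interval[of "-T" T]]) auto
      then show ?thesis using C(1) by (simp add: ennreal_mult_less_top)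
    qed
    finally show "emeasure \<mu> (space \<mu>) \<noteq> \<infinity>" by simp
  qed
  show thesis
  proof (rule that)
    show "finite_borel_measure (cylinder L T) \<mu>" using fin s\<mu> by (simp add: finite_borel_measure_def)
    have "emeasure \<mu> A = (\<integral>\<^sup>+t\<in>{-T<..<T}. emeasure (\<kappa> t) {x. (x, t) \<in> A} \<partial>lborel)" if A: "A \<in> sets \<mu>" for A
    proof -
      have A': "A \<in> sets borel" "A \<subseteq> cylinder L T" using A s\<mu> by (auto simp: sets_cylinder)
      have "emeasure \<mu> A = E A" using em A s\<mu> by simp
      also have "\<dots> = (\<integral>\<^sup>+t\<in>{-T<..<T}. emeasure (\<kappa> t) {x. (x, t) \<in> A} \<partial>lborel)"
        unfolding E_def
      proof (rule nn_integral_cong)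
        fix t
        show "(\<integral>\<^sup>+x. indicator A (x, t) \<partial>\<kappa> t) * indicator {-T<..<T} t = emeasure (\<kappa> t) {x. (x, t) \<in> A} * indicator {-T<..<T} t"
          by (cases "t \<in> {-T<..<T}") (simp_all add: kernel_indicator[OF A'])
      qed
      finally show ?thesis .
    qed
    then show "disintegration L T \<mu> \<kappa>" using \<kappa> by (simp add: disintegration_def kernel_def)
  qed
qed

end

section \<open>Integration against a disintegrated measure\<close>

context
  fixes L T :: real and \<kappa> :: "real \<Rightarrow> (real^2) measure" and \<mu> :: "((real^2) \<times> real) measure"
  assumes \<mu>: "finite_borel_measure (cylinder L T) \<mu>" and dis: "disintegration L T \<mu> \<kappa>"
begin

lemma disintegration_nn_integral:
  fixes f :: "(real^2) \<times> real \<Rightarrow> ennreal"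
  assumes f: "f \<in> borel_measurable borel"
  shows "(\<integral>\<^sup>+p. f p \<partial>\<mu>) = (\<integral>\<^sup>+t. (\<integral>\<^sup>+x. f (x, t) \<partial>\<kappa> t) * indicator {-T<..<T} t \<partial>lborel)"
proof -
  note ker = disintegration_kernel[OF dis]
  have fk: "(\<lambda>x. f (x, t)) \<in> borel_measurable (\<kappa> t)"
    if "t \<in> {-T<..<T}" "f \<in> borel_measurable borel" for t and f :: "(real^2) \<times> real \<Rightarrow> ennreal"
    by (rule borel_measurable_torus_measure[OF kernel_finite[OF ker that(1)] measurable_section[OF that(2)]])
  have fl: "(\<lambda>t. (\<integral>\<^sup>+x. f (x, t) \<partial>\<kappa> t) * indicator {-T<..<T} t) \<in> borel_measurable lborel"
    if "f \<in> borel_measurable borel" for f :: "(real^2) \<times> real \<Rightarrow> ennreal"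
    by (rule kernel_nn_integral_measurable_lborel[OF ker that])
  note fm = borel_measurable_cylinder_measure[OF \<mu>]
  show ?thesis
    using f
  proof (induction rule: borel_measurable_induct)
    case (cong f g)
    then have "f = g" by auto
    then show ?case using cong by simp
  next
    case (set A)
    let ?A = "A \<inter> cylinder L T"
    have A: "?A \<in> sets \<mu>" using \<mu> set cylinder_borel by (auto simp: finite_borel_measure_def sets_cylinder)
    have A': "?A \<in> sets borel" "?A \<subseteq> cylinder L T" using set cylinder_borel by auto
    have "(\<integral>\<^sup>+p. indicator A p \<partial>\<mu>) = (\<integral>\<^sup>+p. indicator ?A p \<partial>\<mu>)"
      by (rule nn_integral_cong) (simp add: indicator_def space_cylinder_measure[OF \<mu>])
    also have "\<dots> = (\<integral>\<^sup>+t\<in>{-T<..<T}. emeasure (\<kappa> t) {x. (x, t) \<in> ?A} \<partial>lborel)"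
      using A dis by (simp add: disintegration_def)
    also have "\<dots> = (\<integral>\<^sup>+t. (\<integral>\<^sup>+x. indicator A (x, t) \<partial>\<kappa> t) * indicator {-T<..<T} t \<partial>lborel)"
    proof (rule nn_integral_cong)
      fix t
      show "emeasure (\<kappa> t) {x. (x, t) \<in> ?A} * indicator {-T<..<T} t = (\<integral>\<^sup>+x. indicator A (x, t) \<partial>\<kappa> t) * indicator {-T<..<T} t"
      proof (cases "t \<in> {-T<..<T}")
        case True
        have "(\<integral>\<^sup>+x. indicator A (x, t) \<partial>\<kappa> t) = (\<integral>\<^sup>+x. indicator ?A (x, t) \<partial>\<kappa> t)"
          by (rule nn_integral_cong) (use True in \<open>simp add: indicator_def cylinder_def space_torus_measure[OF kernel_finite[OF ker True]]\<close>)
        then show ?thesis by (simp add: kernel_indicator[OF ker A' True])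
      qed simp
    qed
    finally show ?case .
  next
    case (mult u c)
    have "(\<integral>\<^sup>+p. c * u p \<partial>\<mu>) = c * (\<integral>\<^sup>+p. u p \<partial>\<mu>)" by (rule nn_integral_cmult[OF fm[OF mult.hyps(2)]])
    also have "\<dots> = (\<integral>\<^sup>+t. c * ((\<integral>\<^sup>+x. u (x, t) \<partial>\<kappa> t) * indicator {-T<..<T} t) \<partial>lborel)"
      unfolding mult.IH by (rule nn_integral_cmult[symmetric, OF fl[OF mult.hyps(2)]])
    also have "\<dots> = (\<integral>\<^sup>+t. (\<integral>\<^sup>+x. c * u (x, t) \<partial>\<kappa> t) * indicator {-T<..<T} t \<partial>lborel)"
      by (rule nn_integral_cong) (simp add: indicator_def nn_integral_cmult[OF fk] mult.hyps)
    finally show ?case .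
  next
    case (add u v)
    have "(\<integral>\<^sup>+p. v p + u p \<partial>\<mu>) = (\<integral>\<^sup>+p. v p \<partial>\<mu>) + (\<integral>\<^sup>+p. u p \<partial>\<mu>)"
      by (rule nn_integral_add[OF fm[OF add.hyps(3)] fm[OF add.hyps(1)]])
    also have "\<dots> = (\<integral>\<^sup>+t. (\<integral>\<^sup>+x. v (x, t) \<partial>\<kappa> t) * indicator {-T<..<T} t + (\<integral>\<^sup>+x. u (x, t) \<partial>\<kappa> t) * indicator {-T<..<T} t \<partial>lborel)"
      unfolding add.IH by (rule nn_integral_add[symmetric, OF fl[OF add.hyps(3)] fl[OF add.hyps(1)]])
    also have "\<dots> = (\<integral>\<^sup>+t. (\<integral>\<^sup>+x. v (x, t) + u (x, t) \<partial>\<kappa> t) * indicator {-T<..<T} t \<partial>lborel)"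
      by (rule nn_integral_cong) (simp add: indicator_def nn_integral_add[OF fk fk] add.hyps)
    finally show ?case .
  next
    case (seq U)
    have "(\<integral>\<^sup>+p. (SUP i. U i) p \<partial>\<mu>) = (SUP i. \<integral>\<^sup>+p. U i p \<partial>\<mu>)"
      unfolding SUP_apply by (rule nn_integral_monotone_convergence_SUP[OF seq.hyps(3) fm[OF seq.hyps(1)]])
    also have "\<dots> = (\<integral>\<^sup>+t. (SUP i. (\<integral>\<^sup>+x. U i (x, t) \<partial>\<kappa> t) * indicator {-T<..<T} t) \<partial>lborel)"
      unfolding seq.IH
    proof (rule nn_integral_monotone_convergence_SUP[symmetric, OF _ fl[OF seq.hyps(1)]])
      show "incseq (\<lambda>i t. (\<integral>\<^sup>+x. U i (x, t) \<partial>\<kappa> t) * indicator {-T<..<T} t)"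
        using seq.hyps(3) by (intro incseq_SucI le_funI mult_right_mono nn_integral_mono) (auto simp: incseq_Suc_iff le_fun_def)
    qed
    also have "\<dots> = (\<integral>\<^sup>+t. (\<integral>\<^sup>+x. (SUP i. U i) (x, t) \<partial>\<kappa> t) * indicator {-T<..<T} t \<partial>lborel)"
    proof (rule nn_integral_cong)
      fix t
      show "(SUP i. (\<integral>\<^sup>+x. U i (x, t) \<partial>\<kappa> t) * indicator {-T<..<T} t) = (\<integral>\<^sup>+x. (SUP i. U i) (x, t) \<partial>\<kappa> t) * indicator {-T<..<T} t"
      proof (cases "t \<in> {-T<..<T}")
        case True
        have "incseq (\<lambda>i x. U i (x, t))" using seq.hyps(3) by (auto simp: incseq_def le_fun_def)
        then have "(\<integral>\<^sup>+x. (SUP i. U i) (x, t) \<partial>\<kappa> t) = (SUP i. (\<integral>\<^sup>+x. U i (x, t) \<partial>\<kappa> t))"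
          unfolding SUP_apply by (intro nn_integral_monotone_convergence_SUP fk[OF True] seq.hyps(1))
        then show ?thesis using True by simp
      qed simp
    qed
    finally show ?case .
  qed
qed

lemma disintegration_integral_nonneg:
  fixes f :: "(real^2) \<times> real \<Rightarrow> real"
  assumes f: "f \<in> borel_measurable borel" and f0: "\<And>p. 0 \<le> f p" and fC: "\<And>p. f p \<le> C"
  shows "set_integrable lborel {-T<..<T} (\<lambda>t. \<integral>x. f (x, t) \<partial>\<kappa> t)"
    and "(\<integral>p. f p \<partial>\<mu>) = (LINT t:{-T<..<T}|lborel. (\<integral>x. f (x, t) \<partial>\<kappa> t))"
proof -
  note ker = disintegration_kernel[OF dis]
  interpret \<mu>: finite_measure \<mu> using \<mu> by (simp add: finite_borel_measure_def)
  have fe: "(\<lambda>p. ennreal (f p)) \<in> borel_measurable borel" using f by measurable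
  have F: "ennreal (\<integral>x. f (x, t) \<partial>\<kappa> t) = (\<integral>\<^sup>+x. ennreal (f (x, t)) \<partial>\<kappa> t)" if t: "t \<in> {-T<..<T}" for t
  proof -
    interpret finite_measure "\<kappa> t" using kernel_finite[OF ker t] by (simp add: finite_borel_measure_def)
    have "integrable (\<kappa> t) (\<lambda>x. f (x, t))"
      by (rule integrable_const_bound[of _ C])
         (use f0 fC in \<open>auto intro!: borel_measurable_torus_measure[OF kernel_finite[OF ker t] measurable_section[OF f]]\<close>)
    then show ?thesis using f0 by (simp add: nn_integral_eq_integral)
  qed
  have F': "ennreal (indicator {-T<..<T} t *\<^sub>R (\<integral>x. f (x, t) \<partial>\<kappa> t)) = (\<integral>\<^sup>+x. ennreal (f (x, t)) \<partial>\<kappa> t) * indicator {-T<..<T} t" for t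
    by (cases "t \<in> {-T<..<T}") (simp_all add: F)
  have F0: "0 \<le> indicator {-T<..<T} t *\<^sub>R (\<integral>x. f (x, t) \<partial>\<kappa> t)" for t
    using f0 by (simp add: integral_nonneg_AE)
  \<comment> \<open>Measurability in time is known for extended nonnegative integrals only; it is
    transferred through \<open>enn2real\<close>.\<close>
  have m: "(\<lambda>t. indicator {-T<..<T} t *\<^sub>R (\<integral>x. f (x, t) \<partial>\<kappa> t)) \<in> borel_measurable lborel"
  proof -
    have "(\<lambda>t. enn2real (ennreal (indicator {-T<..<T} t *\<^sub>R (\<integral>x. f (x, t) \<partial>\<kappa> t)))) \<in> borel_measurable lborel"
      unfolding F' by (intro measurable_compose[OF kernel_nn_integral_measurable_lborel[OF ker fe]] borel_measurable_enn2real) auto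
    then show ?thesis using F0 by simp
  qed
  have fi: "integrable \<mu> f"
    by (rule \<mu>.integrable_const_bound[of _ C]) (use f0 fC in \<open>auto intro!: borel_measurable_cylinder_measure[OF \<mu> f]\<close>)
  have "(\<integral>\<^sup>+t. ennreal (indicator {-T<..<T} t *\<^sub>R (\<integral>x. f (x, t) \<partial>\<kappa> t)) \<partial>lborel) = (\<integral>\<^sup>+p. ennreal (f p) \<partial>\<mu>)"
    unfolding F' disintegration_nn_integral[OF fe] ..
  also have "\<dots> = ennreal (\<integral>p. f p \<partial>\<mu>)" using fi f0 by (simp add: nn_integral_eq_integral)
  finally have e: "(\<integral>\<^sup>+t. ennreal (indicator {-T<..<T} t *\<^sub>R (\<integral>x. f (x, t) \<partial>\<kappa> t)) \<partial>lborel) = ennreal (\<integral>p. f p \<partial>\<mu>)" .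
  have i: "integrable lborel (\<lambda>t. indicator {-T<..<T} t *\<^sub>R (\<integral>x. f (x, t) \<partial>\<kappa> t))"
    by (rule integrableI_nonneg[OF m]) (use e F0 in auto)
  then show "set_integrable lborel {-T<..<T} (\<lambda>t. \<integral>x. f (x, t) \<partial>\<kappa> t)" by (simp add: set_integrable_def)
  have "ennreal (\<integral>t. indicator {-T<..<T} t *\<^sub>R (\<integral>x. f (x, t) \<partial>\<kappa> t) \<partial>lborel) = ennreal (\<integral>p. f p \<partial>\<mu>)"
    using e nn_integral_eq_integral[OF i] F0 by simp
  then show "(\<integral>p. f p \<partial>\<mu>) = (LINT t:{-T<..<T}|lborel. (\<integral>x. f (x, t) \<partial>\<kappa> t))"
    unfolding set_lebesgue_integral_def using F0 f0
    by (subst (asm) ennreal_inj) (auto intro!: integral_nonneg_AE)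
qed

lemma disintegration_integral:
  fixes f :: "(real^2) \<times> real \<Rightarrow> real"
  assumes f: "f \<in> borel_measurable borel" and fC: "\<And>p. \<bar>f p\<bar> \<le> C"
  shows "set_integrable lborel {-T<..<T} (\<lambda>t. \<integral>x. f (x, t) \<partial>\<kappa> t)"
    and "(\<integral>p. f p \<partial>\<mu>) = (LINT t:{-T<..<T}|lborel. (\<integral>x. f (x, t) \<partial>\<kappa> t))"
proof -
  note ker = disintegration_kernel[OF dis]
  interpret \<mu>: finite_measure \<mu> using \<mu> by (simp add: finite_borel_measure_def)
  have C0: "0 \<le> C" using fC[of undefined] by linarith
  have b: "0 \<le> f p + C" "f p + C \<le> 2 * C" for p using fC[of p] by linarith+
  have fm: "(\<lambda>p. f p + C) \<in> borel_measurable borel" using f by measurable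
  note 1 = disintegration_integral_nonneg[OF fm b]
  note 2 = disintegration_integral_nonneg[of "\<lambda>_. C", OF borel_measurable_const C0 order_refl]
  have s: "(\<integral>x. f (x, t) \<partial>\<kappa> t) = (\<integral>x. f (x, t) + C \<partial>\<kappa> t) - (\<integral>x. C \<partial>\<kappa> t)" if t: "t \<in> {-T<..<T}" for t
  proof -
    interpret finite_measure "\<kappa> t" using kernel_finite[OF ker t] by (simp add: finite_borel_measure_def)
    have "integrable (\<kappa> t) (\<lambda>x. f (x, t))"
      by (rule integrable_const_bound[of _ C])
         (use fC in \<open>auto intro!: borel_measurable_torus_measure[OF kernel_finite[OF ker t] measurable_section[OF f]]\<close>)
    then show ?thesis by simp
  qed
  have d: "set_integrable lborel {-T<..<T} (\<lambda>t. (\<integral>x. f (x, t) + C \<partial>\<kappa> t) - (\<integral>x. C \<partial>\<kappa> t))"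
    by (rule set_integral_diff(1)[OF 1(1) 2(1)])
  then show "set_integrable lborel {-T<..<T} (\<lambda>t. \<integral>x. f (x, t) \<partial>\<kappa> t)"
    by (rule set_integrable_cong[THEN iffD1, rotated -1]) (simp_all add: s)
  have fi: "integrable \<mu> f"
    by (rule \<mu>.integrable_const_bound[of _ C]) (use fC in \<open>auto intro!: borel_measurable_cylinder_measure[OF \<mu> f]\<close>)
  have "(\<integral>p. f p \<partial>\<mu>) = (\<integral>p. f p + C \<partial>\<mu>) - (\<integral>p. C \<partial>\<mu>)" using fi by simp
  also have "\<dots> = (LINT t:{-T<..<T}|lborel. (\<integral>x. f (x, t) + C \<partial>\<kappa> t) - (\<integral>x. C \<partial>\<kappa> t))"
    unfolding 1(2) 2(2) by (rule set_integral_diff(2)[OF 1(1) 2(1), symmetric])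
  also have "\<dots> = (LINT t:{-T<..<T}|lborel. (\<integral>x. f (x, t) \<partial>\<kappa> t))"
    by (rule set_lebesgue_integral_cong) (auto simp: s)
  finally show "(\<integral>p. f p \<partial>\<mu>) = (LINT t:{-T<..<T}|lborel. (\<integral>x. f (x, t) \<partial>\<kappa> t))" .
qed

end


section \<open>Uniqueness of the weakly continuous representative\<close>

lemma weakly_continuous_repD:
  fixes f :: "real^2 \<Rightarrow> real"
  assumes "weakly_continuous_rep L T \<mu> \<kappa>"
  shows "disintegration L T \<mu> \<kappa>" "t \<in> {-T..T} \<Longrightarrow> finite_borel_measure (torus L) (\<kappa> t)"
    "continuous_on UNIV f \<Longrightarrow> periodic L f \<Longrightarrow> continuous_on {-T..T} (\<lambda>t. \<integral>x. f x \<partial>(\<kappa> t))"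
  using assms by (auto simp: weakly_continuous_rep_def)

text \<open>Both disintegrations give the same integral to \<open>f x * k t\<close>, where
  \<open>k\<close> is the difference of the two slice integrals of \<open>f\<close>. Hence the
  square of \<open>k\<close> integrates to 0, so \<open>k\<close> vanishes almost everywhere, by
  continuity on the open interval, and by closure at its end points.\<close>

lemma weakly_continuous_rep_unique:
  assumes L: "L > 0" and T: "T > 0" and \<mu>: "finite_borel_measure (cylinder L T) \<mu>"
    and \<kappa>: "weakly_continuous_rep L T \<mu> \<kappa>" and \<kappa>': "weakly_continuous_rep L T \<mu> \<kappa>'"
    and t: "t \<in> {-T..T}"
  shows "\<kappa> t = \<kappa>' t"
proof (rule torus_measure_eqI[OF L weakly_continuous_repD(2)[OF \<kappa> t] weakly_continuous_repD(2)[OF \<kappa>' t]])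
  fix f :: "real^2 \<Rightarrow> real" assume f: "continuous_on UNIV f" "periodic L f"
  define h where "h s = (\<integral>x. f x \<partial>\<kappa> s) - (\<integral>x. f x \<partial>\<kappa>' s)" for s
  \<comment> \<open>Clamping the time turns the difference into a continuous function on the whole
    line, as a test function requires.\<close>
  define k where "k s = h (max (-T) (min T s))" for s
  have hc: "continuous_on {-T..T} h"
    unfolding h_def by (intro continuous_intros weakly_continuous_repD(3)[OF \<kappa> f] weakly_continuous_repD(3)[OF \<kappa>' f])
  have kc: "continuous_on UNIV k"
    unfolding k_def by (rule continuous_on_compose2[OF hc]) (use T in \<open>auto intro!: continuous_intros\<close>)
  have kh: "k s = h s" if "s \<in> {-T..T}" for s using that by (simp add: k_def)
  obtain C where C: "\<And>x. \<bar>f x\<bar> \<le> C" using periodic_bounded[OF L f] by blast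
  have cp: "compact (h ` {-T..T})" by (rule compact_continuous_image[OF hc]) simp
  obtain D where D: "\<forall>y\<in>h ` {-T..T}. norm y \<le> D"
    using compact_imp_bounded[OF cp] unfolding bounded_iff by blast
  have kD: "\<bar>k s\<bar> \<le> D" for s
  proof -
    have "max (-T) (min T s) \<in> {-T..T}" using T by auto
    then show ?thesis using D unfolding k_def by (metis imageI real_norm_def)
  qed
  have fm: "(\<lambda>p :: (real^2) \<times> real. f (fst p) * k (snd p)) \<in> borel_measurable borel"
    by (intro borel_measurable_continuous_onI continuous_intros continuous_on_compose2[OF f(1)] continuous_on_compose2[OF kc]) auto
  have fb: "\<bar>f (fst p) * k (snd p)\<bar> \<le> C * D" for p :: "(real^2) \<times> real"
    unfolding abs_mult by (rule mult_mono'[OF C kD abs_ge_zero abs_ge_zero])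
  note d1 = disintegration_integral[OF \<mu> weakly_continuous_repD(1)[OF \<kappa>] fm fb]
  note d2 = disintegration_integral[OF \<mu> weakly_continuous_repD(1)[OF \<kappa>'] fm fb]
  have "(LINT t:{-T<..<T}|lborel. (\<integral>x. f (fst (x, t)) * k (snd (x, t)) \<partial>\<kappa> t) - (\<integral>x. f (fst (x, t)) * k (snd (x, t)) \<partial>\<kappa>' t)) = 0"
    using d1(2) d2(2) by (subst set_integral_diff(2)[OF d1(1) d2(1)]) simp
  moreover have sq: "(\<integral>x. f (fst (x, t)) * k (snd (x, t)) \<partial>\<kappa> t) - (\<integral>x. f (fst (x, t)) * k (snd (x, t)) \<partial>\<kappa>' t) = (k t)\<^sup>2"
    if "t \<in> {-T<..<T}" for t
  proof -
    have "(\<integral>x. f (fst (x, t)) * k (snd (x, t)) \<partial>\<kappa> t) - (\<integral>x. f (fst (x, t)) * k (snd (x, t)) \<partial>\<kappa>' t) = h t * k t"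
      by (simp add: h_def left_diff_distrib)
    then show ?thesis using that kh[of t] by (simp add: power2_eq_square)
  qed
  ultimately have z: "(LINT t:{-T<..<T}|lborel. (k t)\<^sup>2) = 0"
    by (subst (asm) set_lebesgue_integral_cong[where g="\<lambda>t. (k t)\<^sup>2"]) auto
  have "set_integrable lborel {-T<..<T} (\<lambda>t. (\<integral>x. f (fst (x, t)) * k (snd (x, t)) \<partial>\<kappa> t) - (\<integral>x. f (fst (x, t)) * k (snd (x, t)) \<partial>\<kappa>' t))"
    by (rule set_integral_diff(1)[OF d1(1) d2(1)])
  then have i: "set_integrable lborel {-T<..<T} (\<lambda>t. (k t)\<^sup>2)"
    by (rule set_integrable_cong[THEN iffD1, rotated -1]) (use sq in simp_all)
  have "AE s in lborel. indicator {-T<..<T} s *\<^sub>R (k s)\<^sup>2 = 0"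
    using integral_nonneg_eq_0_iff_AE[OF i[unfolded set_integrable_def]] z
    by (simp add: set_lebesgue_integral_def)
  then have ae: "AE s in lborel. s \<in> {-T<..<T} \<longrightarrow> k s = 0" by (auto elim!: eventually_mono)
  have z0: "k s = 0" if s: "s \<in> {-T<..<T}" for s
  proof (rule ccontr)
    assume ks: "k s \<noteq> 0"
    have "open ({-T<..<T} \<inter> k -` (- {0}))"
      by (intro open_Int open_vimage kc) auto
    then obtain e where e: "e > 0" "ball s e \<subseteq> {-T<..<T} \<inter> k -` (- {0})"
      using s ks openE[of _ s] by (metis ComplI IntI singletonD vimageI2)
    obtain N where N: "{x \<in> space lborel. \<not> (x \<in> {-T<..<T} \<longrightarrow> k x = 0)} \<subseteq> N" "emeasure lborel N = 0" "N \<in> sets lborel"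
      using ae by (rule AE_E)
    have "{s - e<..<s + e} \<subseteq> N"
    proof
      fix y assume "y \<in> {s - e<..<s + e}"
      then have "y \<in> ball s e" by (simp add: dist_real_def abs_less_iff)
      then have "y \<in> {-T<..<T} \<inter> k -` (- {0})" by (rule subsetD[OF e(2)])
      then show "y \<in> N" by (intro subsetD[OF N(1)]) simp
    qed
    then have "emeasure lborel {s - e<..<s + e} \<le> emeasure lborel N" by (rule emeasure_mono[OF _ N(3)])
    then show False using N(2) e(1) by simp
  qed
  have "k t = 0"
  proof (rule continuous_constant_on_closure[of "{-T<..<T}" k 0])
    show "continuous_on (closure {-T<..<T}) k" by (rule continuous_on_subset[OF kc subset_UNIV])
    show "t \<in> closure {-T<..<T}" using t T by simp
  qed (rule z0)
  then show "(\<integral>x. f x \<partial>\<kappa> t) = (\<integral>x. f x \<partial>\<kappa>' t)" using kh[OF t] by (simp add: h_def)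
qed

lemma weakly_continuous_rep_slice:
  assumes "weakly_continuous_rep L T \<mu> \<kappa>"
  shows "weakly_continuous_rep L T \<mu> (slice L T \<mu>)"
proof -
  have "\<exists>\<kappa>. disintegration L T \<mu> \<kappa> \<and> ((\<exists>\<kappa>'. weakly_continuous_rep L T \<mu> \<kappa>') \<longrightarrow> weakly_continuous_rep L T \<mu> \<kappa>)"
    using assms weakly_continuous_repD(1)[OF assms] by blast
  then have "disintegration L T \<mu> (slice L T \<mu>) \<and> ((\<exists>\<kappa>'. weakly_continuous_rep L T \<mu> \<kappa>') \<longrightarrow> weakly_continuous_rep L T \<mu> (slice L T \<mu>))"
    unfolding slice_def by (rule someI_ex)
  then show ?thesis using assms by blast
qed

text \<open>This removes the choice in \<open>slice\<close>: any weakly continuous representative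
  that the proof constructs is the one in the energy and in the traces.\<close>

lemma slice_eq:
  assumes "L > 0" "T > 0" "finite_borel_measure (cylinder L T) \<mu>" "weakly_continuous_rep L T \<mu> \<kappa>" "t \<in> {-T..T}"
  shows "slice L T \<mu> t = \<kappa> t"
  by (rule weakly_continuous_rep_unique[OF assms(1-3) weakly_continuous_rep_slice[OF assms(4)] assms(4,5)])

section \<open>Equicontinuity of slices\<close>

text \<open>The rescaled derivative of the step is a probability density on an interval of length
  \<delta>, so its average of \<open>F\<close> stays within the oscillation \<epsilon> of
  \<open>F\<close> there.\<close>

lemma bump_average:
  fixes F :: "real \<Rightarrow> real"
  assumes dB: "\<And>y. (B has_real_derivative b y) (at y)" and b0: "\<And>y. 0 \<le> b y"
    and B01: "B 0 = 0" "B 1 = 1" and bc: "continuous_on UNIV b" and \<delta>: "\<delta> > 0"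
    and F: "continuous_on {a..a + \<delta>} F" and \<epsilon>: "\<And>\<tau>. \<tau> \<in> {a..a + \<delta>} \<Longrightarrow> \<bar>F \<tau> - F a\<bar> \<le> \<epsilon>"
  shows "\<bar>(LINT \<tau>:{a..a + \<delta>}|lborel. F \<tau> * (b ((\<tau> - a) / \<delta>) / \<delta>)) - F a\<bar> \<le> \<epsilon>"
proof -
  define \<beta> where "\<beta> \<tau> = b ((\<tau> - a) / \<delta>) / \<delta>" for \<tau>
  have \<beta>c: "continuous_on S \<beta>" for S
    unfolding \<beta>_def using \<delta> by (intro continuous_intros continuous_on_compose2[OF bc]) auto
  have \<beta>0: "0 \<le> \<beta> \<tau>" for \<tau> using b0 \<delta> by (simp add: \<beta>_def)
  have d: "((\<lambda>\<tau>. B ((\<tau> - a) / \<delta>)) has_real_derivative \<beta> \<tau>) (at \<tau>)" for \<tau>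
  proof -
    have "((\<lambda>\<tau>. B ((\<tau> - a) / \<delta>)) has_real_derivative b ((\<tau> - a) / \<delta>) * (1 / \<delta>)) (at \<tau>)"
      by (rule DERIV_chain2[OF dB]) (use \<delta> in \<open>auto intro!: derivative_eq_intros\<close>)
    then show ?thesis by (simp add: \<beta>_def)
  qed
  have "(LINT \<tau>:{a..a + \<delta>}|lborel. \<beta> \<tau>) = B ((a + \<delta> - a) / \<delta>) - B ((a - a) / \<delta>)"
    unfolding set_lebesgue_integral_def
    by (rule integral_FTC_atLeastAtMost)
       (use \<delta> d \<beta>c in \<open>auto simp flip: has_real_derivative_iff_has_vector_derivative intro: DERIV_subset\<close>)
  then have int1: "(LINT \<tau>:{a..a + \<delta>}|lborel. \<beta> \<tau>) = 1" using \<delta> B01 by simp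
  have i\<beta>: "set_integrable lborel {a..a + \<delta>} (\<lambda>\<tau>. c * \<beta> \<tau>)" for c
    by (rule borel_integrable_atLeastAtMost') (intro continuous_intros \<beta>c)
  have iF: "set_integrable lborel {a..a + \<delta>} (\<lambda>\<tau>. F \<tau> * \<beta> \<tau>)"
    by (rule borel_integrable_atLeastAtMost') (intro continuous_intros \<beta>c F)
  have c1: "(LINT \<tau>:{a..a + \<delta>}|lborel. c * \<beta> \<tau>) = c" for c by (simp add: int1)
  have "(LINT \<tau>:{a..a + \<delta>}|lborel. F \<tau> * \<beta> \<tau>) \<le> (LINT \<tau>:{a..a + \<delta>}|lborel. (F a + \<epsilon>) * \<beta> \<tau>)"
  proof (rule set_integral_mono[OF iF i\<beta>])
    fix \<tau> assume "\<tau> \<in> {a..a + \<delta>}"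
    then have "F \<tau> \<le> F a + \<epsilon>" using \<epsilon>[of \<tau>] by linarith
    then show "F \<tau> * \<beta> \<tau> \<le> (F a + \<epsilon>) * \<beta> \<tau>" by (rule mult_right_mono[OF _ \<beta>0])
  qed
  moreover have "(LINT \<tau>:{a..a + \<delta>}|lborel. (F a - \<epsilon>) * \<beta> \<tau>) \<le> (LINT \<tau>:{a..a + \<delta>}|lborel. F \<tau> * \<beta> \<tau>)"
  proof (rule set_integral_mono[OF i\<beta> iF])
    fix \<tau> assume "\<tau> \<in> {a..a + \<delta>}"
    then have "F a - \<epsilon> \<le> F \<tau>" using \<epsilon>[of \<tau>] by linarith
    then show "(F a - \<epsilon>) * \<beta> \<tau> \<le> F \<tau> * \<beta> \<tau>" by (rule mult_right_mono[OF _ \<beta>0])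
  qed
  ultimately have "\<bar>(LINT \<tau>:{a..a + \<delta>}|lborel. F \<tau> * \<beta> \<tau>) - F a\<bar> \<le> \<epsilon>"
    unfolding c1 by linarith
  then show ?thesis unfolding \<beta>_def .
qed

text \<open>Young's inequality with a free parameter. Applied to the length of the velocity, it
  splits the flux into \<open>l\<close> times energy plus mass over \<open>l\<close>.\<close>

lemma am_gm_scaled: "l > 0 \<Longrightarrow> n \<le> l * n\<^sup>2 + 1 / l" for n l :: real
proof -
  assume l: "l > 0"
  have "0 \<le> (2 * l * n - 1)\<^sup>2" by simp
  then have "4 * l * n \<le> 4 * l\<^sup>2 * n\<^sup>2 + 1" by (simp add: power2_eq_square algebra_simps)
  then have "l * n \<le> l * (l * n\<^sup>2 + 1 / l)" using l by (simp add: power2_eq_square algebra_simps)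
  then show ?thesis using l by simp
qed

context
  fixes L T :: real and \<mu> :: "((real^2) \<times> real) measure" and \<kappa> :: "real \<Rightarrow> (real^2) measure"
    and m :: "((real^2) \<times> real) set \<Rightarrow> real^2" and B0 :: real
  assumes L: "L > 0" and T: "T > 0" and \<mu>: "finite_borel_measure (cylinder L T) \<mu>"
    and \<kappa>: "weakly_continuous_rep L T \<mu> \<kappa>"
    and m: "vector_measure (cylinder L T) m" "vector_abs_cont m \<mu>" "continuity_equation L T \<mu> m"
    and B0: "0 \<le> B0" "(\<integral>\<^sup>+p. ennreal ((norm (vector_RN_deriv \<mu> m p))\<^sup>2) \<partial>\<mu>) \<le> ennreal B0"
begin

text \<open>The continuity equation is tested with \<open>f x * \<eta> \<tau>\<close>, where \<eta>
  switches on after time \<open>s\<close> and off after time \<open>t\<close>. The time derivative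
  produces averages of \<open>F\<close> near \<open>s\<close> and \<open>t\<close>; the gradient
  term is at most \<open>C\<close> times the integral of the speed over the slab, which Young's
  inequality splits.\<close>

lemma slice_increment:
  fixes f :: "real^2 \<Rightarrow> real"
  defines "F \<equiv> \<lambda>t. \<integral>x. f x \<partial>\<kappa> t"
  assumes f: "\<And>k. C_times k f" "periodic L f" and C: "0 \<le> C" "\<And>x w. \<bar>frechet_derivative f (at x) w\<bar> \<le> C * norm w"
    and st: "- T < s" "s \<le> t" "t + \<delta> < T" and \<delta>: "\<delta> > 0" and l: "l > 0"
    and \<epsilon>: "\<And>\<tau>. \<tau> \<in> {s..s + \<delta>} \<Longrightarrow> \<bar>F \<tau> - F s\<bar> \<le> \<epsilon>" "\<And>\<tau>. \<tau> \<in> {t..t + \<delta>} \<Longrightarrow> \<bar>F \<tau> - F t\<bar> \<le> \<epsilon>"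
  shows "\<bar>F t - F s\<bar> \<le> 2 * \<epsilon> + C * (l * B0 + measure \<mu> {p \<in> cylinder L T. snd p \<in> {s..t + \<delta>}} / l)"
proof -
  interpret \<mu>: finite_measure \<mu> using \<mu> by (simp add: finite_borel_measure_def)
  define v where "v = vector_RN_deriv \<mu> m"
  have v: "integrable \<mu> v" unfolding v_def by (rule vector_RN_deriv(1)[OF \<mu> m(1,2)])
  have v2: "integrable \<mu> (\<lambda>p. (norm (v p))\<^sup>2)"
    by (rule integrable_square_imp_integrable(1)[OF \<mu>.finite_measure_axioms])
       (use v B0 in \<open>auto simp: v_def intro: le_less_trans\<close>)
  have "ennreal (\<integral>p. (norm (v p))\<^sup>2 \<partial>\<mu>) \<le> ennreal B0"
    using B0(2) nn_integral_eq_integral[OF v2] by (simp add: v_def)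
  then have vB: "(\<integral>p. (norm (v p))\<^sup>2 \<partial>\<mu>) \<le> B0" using B0(1) by simp
  obtain B b :: "real \<Rightarrow> real" where B: "\<And>k. C_times k B" and dB: "\<And>y. (B has_real_derivative b y) (at y)"
    and b0: "\<And>y. 0 \<le> b y" and Bz: "\<And>y. y \<le> 0 \<Longrightarrow> B y = 0" and B1: "\<And>y. 1 \<le> y \<Longrightarrow> B y = 1"
    and bc: "continuous_on UNIV b" and bz: "\<And>y. y \<le> 0 \<or> 1 \<le> y \<Longrightarrow> b y = 0"
    using smooth_step by blast
  have Bmono: "B x \<le> B y" if "x \<le> y" for x y
    using that by (rule DERIV_nonneg_imp_nondecreasing) (use dB b0 in blast)
  have Bge: "0 \<le> B y" for y using Bmono[of "min y 0" y] Bz[of "min y 0"] by simp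
  have Ble: "B y \<le> 1" for y using Bmono[of y "max y 1"] B1[of "max y 1"] by simp
  \<comment> \<open>Difference of two steps: it lives on \<open>{s..t + \<delta>}\<close>, compactly
    inside the open interval, and its derivative consists of one positive and one negative
    bump.\<close>
  define \<eta> where "\<eta> \<tau> = B ((\<tau> - s) / \<delta>) - B ((\<tau> - t) / \<delta>)" for \<tau>
  define \<eta>' where "\<eta>' \<tau> = b ((\<tau> - s) / \<delta>) / \<delta> - b ((\<tau> - t) / \<delta>) / \<delta>" for \<tau>
  have d\<eta>: "(\<eta> has_real_derivative \<eta>' \<tau>) (at \<tau>)" for \<tau>
  proof -
    have "((\<lambda>\<tau>. B ((\<tau> - a) / \<delta>)) has_real_derivative b ((\<tau> - a) / \<delta>) * (1 / \<delta>)) (at \<tau>)" for a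
      by (rule DERIV_chain2[OF dB]) (use \<delta> in \<open>auto intro!: derivative_eq_intros\<close>)
    from DERIV_diff[OF this[of s] this[of t]] show ?thesis by (simp add: \<eta>_def[abs_def] \<eta>'_def)
  qed
  have \<eta>1: "\<bar>\<eta> \<tau>\<bar> \<le> 1" for \<tau>
    using Bge[of "(\<tau> - s) / \<delta>"] Ble[of "(\<tau> - s) / \<delta>"] Bge[of "(\<tau> - t) / \<delta>"] Ble[of "(\<tau> - t) / \<delta>"]
    unfolding \<eta>_def by linarith
  have \<eta>z1: "\<eta> \<tau> = 0" if "\<tau> \<le> s" for \<tau>
  proof -
    have "(\<tau> - s) / \<delta> \<le> 0" "(\<tau> - t) / \<delta> \<le> 0" using that st \<delta> by (simp_all add: divide_le_0_iff)
    then show ?thesis by (simp add: \<eta>_def Bz)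
  qed
  have \<eta>z2: "\<eta> \<tau> = 0" if "t + \<delta> \<le> \<tau>" for \<tau>
  proof -
    have "1 \<le> (\<tau> - s) / \<delta>" "1 \<le> (\<tau> - t) / \<delta>" using that st \<delta> by (simp_all add: field_simps)
    then show ?thesis by (simp add: \<eta>_def B1)
  qed
  define \<psi> where "\<psi> p = f (fst p) * \<eta> (snd p)" for p :: "(real^2) \<times> real"
  have C\<eta>: "C_times k \<eta>" for k
  proof -
    have "\<eta> = (\<lambda>\<tau>. B (- s / \<delta> + \<tau> / \<delta>) + (- 1) * B (- t / \<delta> + \<tau> / \<delta>))"
      by (rule ext) (simp add: \<eta>_def diff_divide_distrib add.commute)
    moreover have "bounded_linear (\<lambda>\<tau>. \<tau> / \<delta>)" by (rule bounded_linear_divide)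
    ultimately show ?thesis
      by (simp only:) (intro C_times_add C_times_mult C_times_const C_times_affine B)
  qed
  have "test_function L T \<psi>"
    unfolding test_function_def
  proof (intro conjI allI)
    have "C_times k (\<lambda>p :: (real^2) \<times> real. f (0 + fst p) * \<eta> (0 + snd p))" for k
      by (intro C_times_mult C_times_affine f C\<eta> bounded_linear_fst bounded_linear_snd)
    then show "smooth \<psi>" by (simp add: smooth_def \<psi>_def[abs_def])
    show "periodic L (\<lambda>x. \<psi> (x, \<tau>))" for \<tau> using f(2) by (simp add: periodic_def \<psi>_def)
    show "\<exists>s0<T. \<forall>x \<tau>. s0 \<le> \<bar>\<tau>\<bar> \<longrightarrow> \<psi> (x, \<tau>) = 0"
    proof (intro exI[of _ "max \<bar>s\<bar> \<bar>t + \<delta>\<bar>"] conjI allI impI)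
      show "max \<bar>s\<bar> \<bar>t + \<delta>\<bar> < T" using st \<delta> by auto
      fix x \<tau> assume "max \<bar>s\<bar> \<bar>t + \<delta>\<bar> \<le> \<bar>\<tau>\<bar>"
      then have "\<tau> \<le> s \<or> t + \<delta> \<le> \<tau>" by linarith
      then show "\<psi> (x, \<tau>) = 0" using \<eta>z1 \<eta>z2 by (auto simp: \<psi>_def)
    qed
  qed
  then have ce: "(\<integral>p. frechet_derivative \<psi> (at p) (0, 1) \<partial>\<mu>) + (\<integral>p. frechet_derivative \<psi> (at p) (v p, 0) \<partial>\<mu>) = 0"
    using m(3) by (simp add: continuity_equation_def v_def)
  have fd: "(f has_derivative frechet_derivative f (at x)) (at x)" for x by (rule C_times_SucD(1)[OF f(1)[of "Suc 0"]])
  have "(\<psi> has_derivative (\<lambda>h. f (fst p) * (\<eta>' (snd p) * snd h) + frechet_derivative f (at (fst p)) (fst h) * \<eta> (snd p))) (at p)" for p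
  proof -
    have 1: "((\<lambda>p :: (real^2) \<times> real. f (fst p)) has_derivative (\<lambda>h. frechet_derivative f (at (fst p)) (fst h))) (at p)"
      by (rule has_derivative_compose[OF bounded_linear_imp_has_derivative[OF bounded_linear_fst] fd])
    have 2: "((\<lambda>p :: (real^2) \<times> real. \<eta> (snd p)) has_derivative (\<lambda>h. \<eta>' (snd p) * snd h)) (at p)"
      by (rule has_derivative_compose[OF bounded_linear_imp_has_derivative[OF bounded_linear_snd]])
         (use d\<eta> in \<open>simp add: has_field_derivative_def\<close>)
    show ?thesis unfolding \<psi>_def[abs_def] by (rule has_derivative_mult[OF 1 2])
  qed
  then have fr: "frechet_derivative \<psi> (at p) = (\<lambda>h. f (fst p) * (\<eta>' (snd p) * snd h) + frechet_derivative f (at (fst p)) (fst h) * \<eta> (snd p))" for p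
    by (rule frechet_derivative_at[symmetric])
  have lin: "linear (frechet_derivative f (at x))" for x using fd by (rule has_derivative_linear)
  have ce': "(\<integral>p. f (fst p) * \<eta>' (snd p) \<partial>\<mu>) + (\<integral>p. frechet_derivative f (at (fst p)) (v p) * \<eta> (snd p) \<partial>\<mu>) = 0"
    using ce by (simp add: fr linear_0[OF lin])
  let ?S = "{p \<in> cylinder L T. snd p \<in> {s..t + \<delta>}}"
  have S: "?S \<in> sets \<mu>"
  proof -
    have "?S = cylinder L T \<inter> (UNIV \<times> {s..t + \<delta>})" by auto
    moreover have "(UNIV :: (real^2) set) \<times> {s..t + \<delta>} \<in> sets borel"
      unfolding borel_prod[symmetric] by (intro pair_measureI) auto
    ultimately show ?thesis using \<mu> cylinder_borel by (simp add: finite_borel_measure_def sets_cylinder)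
  qed
  have second: "\<bar>\<integral>p. frechet_derivative f (at (fst p)) (v p) * \<eta> (snd p) \<partial>\<mu>\<bar> \<le> C * (l * B0 + measure \<mu> ?S / l)"
  proof -
    let ?g = "\<lambda>p. C * (l * (norm (v p))\<^sup>2 + indicator ?S p / l)"
    have iS: "integrable \<mu> (indicator ?S :: _ \<Rightarrow> real)"
      by (rule integrable_real_indicator[OF S]) (simp add: \<mu>.emeasure_eq_measure)
    have ig: "integrable \<mu> ?g"
      by (intro integrable_mult_right Bochner_Integration.integrable_add integrable_divide v2 iS)
    have g0: "0 \<le> ?g p" for p using C l by simp
    have le: "\<bar>frechet_derivative f (at (fst p)) (v p) * \<eta> (snd p)\<bar> \<le> ?g p" if "p \<in> space \<mu>" for p
    proof (cases "snd p \<in> {s..t + \<delta>}")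
      case True
      then have p: "indicator ?S p = (1::real)" using that by (simp add: space_cylinder_measure[OF \<mu>])
      have "\<bar>frechet_derivative f (at (fst p)) (v p) * \<eta> (snd p)\<bar> \<le> (C * norm (v p)) * 1"
        unfolding abs_mult by (rule mult_mono'[OF C(2) \<eta>1 abs_ge_zero abs_ge_zero])
      also have "\<dots> \<le> C * (l * (norm (v p))\<^sup>2 + 1 / l)"
        using am_gm_scaled[OF l, of "norm (v p)"] C(1) by (simp add: mult_left_mono)
      finally show ?thesis using p by simp
    next
      case False
      then have "\<eta> (snd p) = 0" using \<eta>z1 \<eta>z2 by auto
      then show ?thesis using g0[of p] by simp
    qed
    have "\<bar>\<integral>p. frechet_derivative f (at (fst p)) (v p) * \<eta> (snd p) \<partial>\<mu>\<bar> \<le> (\<integral>p. ?g p \<partial>\<mu>)"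
    \<comment> \<open>A non-integrable function has integral 0 by convention, so the bound also
      holds in that case.\<close>
    proof (cases "integrable \<mu> (\<lambda>p. frechet_derivative f (at (fst p)) (v p) * \<eta> (snd p))")
      case True
      have "norm (\<integral>p. frechet_derivative f (at (fst p)) (v p) * \<eta> (snd p) \<partial>\<mu>) \<le> (\<integral>p. norm (frechet_derivative f (at (fst p)) (v p) * \<eta> (snd p)) \<partial>\<mu>)"
        by (rule integral_norm_bound)
      also have "\<dots> \<le> (\<integral>p. ?g p \<partial>\<mu>)"
        by (rule integral_mono[OF integrable_norm[OF True] ig]) (use le in simp)
      finally show ?thesis by simp
    next
      case False
      moreover have "0 \<le> (\<integral>p. ?g p \<partial>\<mu>)" by (rule Bochner_Integration.integral_nonneg[OF g0])
      ultimately show ?thesis by (simp only: not_integrable_integral_eq[OF False] abs_zero)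
    qed
    also have "(\<integral>p. ?g p \<partial>\<mu>) = C * (l * (\<integral>p. (norm (v p))\<^sup>2 \<partial>\<mu>) + measure \<mu> ?S / l)"
      using v2 iS S by simp
    also have "\<dots> \<le> C * (l * B0 + measure \<mu> ?S / l)"
      using vB C(1) l by (intro mult_left_mono add_right_mono) auto
    finally show ?thesis .
  qed
  have fc: "continuous_on UNIV f" using f(1)[of 0] by simp
  obtain D where D: "\<And>x. \<bar>f x\<bar> \<le> D" using periodic_bounded[OF L fc f(2)] by blast
  have bsc: "continuous_on S (\<lambda>\<tau>. b ((\<tau> - a) / \<delta>) / \<delta>)" for S a
    using \<delta> by (intro continuous_intros continuous_on_compose2[OF bc]) auto
  have \<eta>'c: "continuous_on S \<eta>'" for S
    unfolding \<eta>'_def by (intro continuous_intros bsc)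
  have \<eta>'z: "b ((\<tau> - a) / \<delta>) / \<delta> = 0" if "\<tau> \<notin> {a..a + \<delta>}" for \<tau> a
  proof -
    have "(\<tau> - a) / \<delta> \<le> 0 \<or> 1 \<le> (\<tau> - a) / \<delta>"
      using that \<delta> by (auto simp: divide_le_0_iff field_simps)
    then show ?thesis using bz by simp
  qed
  have cp: "compact (\<eta>' ` {-T..T})" by (rule compact_continuous_image[OF \<eta>'c]) simp
  obtain H where H: "\<forall>y\<in>\<eta>' ` {-T..T}. norm y \<le> H"
    using compact_imp_bounded[OF cp] unfolding bounded_iff by blast
  have "0 \<in> {-T..T}" using T by simp
  then have H0: "0 \<le> H" using H norm_ge_zero order_trans by (meson imageI)
  have \<eta>'b: "\<bar>\<eta>' \<tau>\<bar> \<le> H" for \<tau>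
  proof (cases "\<tau> \<in> {-T..T}")
    case False
    then have "\<tau> \<notin> {s..s + \<delta>}" "\<tau> \<notin> {t..t + \<delta>}" using st \<delta> by auto
    then show ?thesis using H0 by (simp add: \<eta>'_def \<eta>'z)
  qed (use H in simp)
  have Fc: "continuous_on {-T..T} F"
    unfolding F_def by (rule weakly_continuous_repD(3)[OF \<kappa> fc f(2)])
  have fm: "(\<lambda>p :: (real^2) \<times> real. f (fst p) * \<eta>' (snd p)) \<in> borel_measurable borel"
    by (intro borel_measurable_continuous_onI continuous_intros continuous_on_compose2[OF fc] continuous_on_compose2[OF \<eta>'c[of UNIV]]) auto
  have fb: "\<bar>f (fst p) * \<eta>' (snd p)\<bar> \<le> D * H" for p :: "(real^2) \<times> real"
    unfolding abs_mult by (rule mult_mono'[OF D \<eta>'b abs_ge_zero abs_ge_zero])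
  have "(\<integral>p. f (fst p) * \<eta>' (snd p) \<partial>\<mu>) = (LINT \<tau>:{-T<..<T}|lborel. F \<tau> * \<eta>' \<tau>)"
    using disintegration_integral(2)[OF \<mu> weakly_continuous_repD(1)[OF \<kappa>] fm fb] by (simp add: F_def)
  also have "\<dots> = (LINT \<tau>:{s..s + \<delta>}|lborel. F \<tau> * (b ((\<tau> - s) / \<delta>) / \<delta>)) - (LINT \<tau>:{t..t + \<delta>}|lborel. F \<tau> * (b ((\<tau> - t) / \<delta>) / \<delta>))"
  proof -
    have i: "set_integrable lborel {a..a + \<delta>} (\<lambda>\<tau>. F \<tau> * (b ((\<tau> - a) / \<delta>) / \<delta>))" if "- T < a" "a + \<delta> < T" for a
      by (rule borel_integrable_atLeastAtMost', intro continuous_intros bsc, rule continuous_on_subset[OF Fc])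
         (use that in auto)
    have "indicator {-T<..<T} \<tau> *\<^sub>R (F \<tau> * \<eta>' \<tau>) = indicator {s..s + \<delta>} \<tau> *\<^sub>R (F \<tau> * (b ((\<tau> - s) / \<delta>) / \<delta>)) - indicator {t..t + \<delta>} \<tau> *\<^sub>R (F \<tau> * (b ((\<tau> - t) / \<delta>) / \<delta>))" for \<tau>
    proof (cases "\<tau> \<in> {-T<..<T}")
      case True
      then show ?thesis using \<eta>'z[of \<tau> s] \<eta>'z[of \<tau> t]
        unfolding \<eta>'_def right_diff_distrib
        by (cases "\<tau> \<in> {s..s + \<delta>}"; cases "\<tau> \<in> {t..t + \<delta>}") (simp_all only: indicator_simps if_True if_False not_False_eq_True simp_thms scaleR_one scaleR_zero_left mult_zero_right diff_0_right diff_0 minus_zero diff_self)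
    next
      case False
      then have "\<tau> \<notin> {s..s + \<delta>}" "\<tau> \<notin> {t..t + \<delta>}" using st \<delta> by auto
      then show ?thesis using False by simp
    qed
    then show ?thesis
      using i[of s] i[of t] st \<delta> unfolding set_lebesgue_integral_def set_integrable_def by simp
  qed
  finally have first: "(\<integral>p. f (fst p) * \<eta>' (snd p) \<partial>\<mu>) = (LINT \<tau>:{s..s + \<delta>}|lborel. F \<tau> * (b ((\<tau> - s) / \<delta>) / \<delta>)) - (LINT \<tau>:{t..t + \<delta>}|lborel. F \<tau> * (b ((\<tau> - t) / \<delta>) / \<delta>))" .
  have as: "\<bar>(LINT \<tau>:{s..s + \<delta>}|lborel. F \<tau> * (b ((\<tau> - s) / \<delta>) / \<delta>)) - F s\<bar> \<le> \<epsilon>"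
    by (rule bump_average[OF dB b0 _ _ bc \<delta> continuous_on_subset[OF Fc] \<epsilon>(1)]) (use Bz B1 st \<delta> in auto)
  have at: "\<bar>(LINT \<tau>:{t..t + \<delta>}|lborel. F \<tau> * (b ((\<tau> - t) / \<delta>) / \<delta>)) - F t\<bar> \<le> \<epsilon>"
    by (rule bump_average[OF dB b0 _ _ bc \<delta> continuous_on_subset[OF Fc] \<epsilon>(2)]) (use Bz B1 st \<delta> in auto)
  show ?thesis using as at second first ce' by linarith
qed

text \<open>By continuity of \<open>F\<close> the oscillation \<epsilon> can be made small by a
  shorter ramp, while the slab keeps its original length \<delta>; monotonicity of the measure
  absorbs the difference.\<close>

lemma slice_increment_limit:
  fixes f :: "real^2 \<Rightarrow> real"
  defines "F \<equiv> \<lambda>t. \<integral>x. f x \<partial>\<kappa> t"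
  assumes f: "\<And>k. C_times k f" "periodic L f" and C: "0 \<le> C" "\<And>x w. \<bar>frechet_derivative f (at x) w\<bar> \<le> C * norm w"
    and st: "- T < s" "s \<le> t" "t + \<delta> < T" and \<delta>: "\<delta> > 0" and l: "l > 0"
  shows "\<bar>F t - F s\<bar> \<le> C * (l * B0 + measure \<mu> {p \<in> cylinder L T. snd p \<in> {s..t + \<delta>}} / l)"
proof (rule field_le_epsilon)
  fix e :: real assume e: "e > 0"
  interpret \<mu>: finite_measure \<mu> using \<mu> by (simp add: finite_borel_measure_def)
  have fc: "continuous_on UNIV f" using f(1)[of 0] by simp
  have Fc: "continuous_on {-T..T} F"
    unfolding F_def by (rule weakly_continuous_repD(3)[OF \<kappa> fc f(2)])
  have ex: "\<exists>d>0. \<forall>\<tau>\<in>{-T..T}. dist \<tau> a < d \<longrightarrow> dist (F \<tau>) (F a) < e / 2" if "a \<in> {-T..T}" for a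
    using Fc that e unfolding continuous_on_iff by (meson half_gt_zero)
  obtain d1 where d1: "d1 > 0" "\<And>\<tau>. \<tau> \<in> {-T..T} \<Longrightarrow> dist \<tau> s < d1 \<Longrightarrow> dist (F \<tau>) (F s) < e / 2"
    using ex[of s] st \<delta> by auto
  obtain d2 where d2: "d2 > 0" "\<And>\<tau>. \<tau> \<in> {-T..T} \<Longrightarrow> dist \<tau> t < d2 \<Longrightarrow> dist (F \<tau>) (F t) < e / 2"
    using ex[of t] st \<delta> by auto
  define d where "d = min \<delta> (min (d1 / 2) (d2 / 2))"
  have d: "d > 0" "d \<le> \<delta>" "d < d1" "d < d2" using \<delta> d1(1) d2(1) by (auto simp: d_def)
  have "\<bar>F t - F s\<bar> \<le> 2 * (e / 2) + C * (l * B0 + measure \<mu> {p \<in> cylinder L T. snd p \<in> {s..t + d}} / l)"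
    unfolding F_def
  proof (rule slice_increment[OF f C st(1,2) _ d(1) l])
    show "t + d < T" using st d by simp
    show "\<bar>(\<integral>x. f x \<partial>\<kappa> \<tau>) - (\<integral>x. f x \<partial>\<kappa> s)\<bar> \<le> e / 2" if "\<tau> \<in> {s..s + d}" for \<tau>
      using d1(2)[of \<tau>] that st d by (simp add: dist_real_def F_def)
    show "\<bar>(\<integral>x. f x \<partial>\<kappa> \<tau>) - (\<integral>x. f x \<partial>\<kappa> t)\<bar> \<le> e / 2" if "\<tau> \<in> {t..t + d}" for \<tau>
      using d2(2)[of \<tau>] that st d by (simp add: dist_real_def F_def)
  qed
  also have "\<dots> \<le> 2 * (e / 2) + C * (l * B0 + measure \<mu> {p \<in> cylinder L T. snd p \<in> {s..t + \<delta>}} / l)"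
  proof -
    have "{p \<in> cylinder L T. snd p \<in> {s..t + \<delta>}} = cylinder L T \<inter> (UNIV \<times> {s..t + \<delta>})" by auto
    moreover have "(UNIV :: (real^2) set) \<times> {s..t + \<delta>} \<in> sets borel"
      unfolding borel_prod[symmetric] by (intro pair_measureI) auto
    ultimately have "{p \<in> cylinder L T. snd p \<in> {s..t + \<delta>}} \<in> sets \<mu>"
      using \<mu> cylinder_borel by (simp add: finite_borel_measure_def sets_cylinder)
    then have "measure \<mu> {p \<in> cylinder L T. snd p \<in> {s..t + d}} \<le> measure \<mu> {p \<in> cylinder L T. snd p \<in> {s..t + \<delta>}}"
      by (rule \<mu>.finite_measure_mono[rotated]) (use d in auto)
    then show ?thesis using C(1) l by (intro add_left_mono mult_left_mono divide_right_mono) auto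
  qed
  finally show "\<bar>F t - F s\<bar> \<le> C * (l * B0 + measure \<mu> {p \<in> cylinder L T. snd p \<in> {s..t + \<delta>}} / l) + e" by simp
qed

text \<open>The constant test function has gradient 0, so the increment bound holds with
  \<open>C = 0\<close>. The end points follow by continuity of the slices.\<close>

lemma mass_const:
  assumes t: "t \<in> {-T..T}"
  shows "measure (\<kappa> t) (torus L) = measure (\<kappa> (-T)) (torus L)"
proof -
  define F :: "real \<Rightarrow> real" where "F t = (\<integral>x. 1 \<partial>\<kappa> t)" for t
  have Fm: "F t = measure (\<kappa> t) (torus L)" if "t \<in> {-T..T}" for t
    using space_torus_measure[OF weakly_continuous_repD(2)[OF \<kappa> that]] by (simp add: F_def)
  have per: "periodic L (\<lambda>_ :: real^2. 1 :: real)" by (simp add: periodic_def)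
  have Fc: "continuous_on {-T..T} F"
    unfolding F_def by (rule weakly_continuous_repD(3)[OF \<kappa> _ per]) simp
  have eq: "F t = F s" if st: "- T < s" "s \<le> t" "t < T" for s t
  proof -
    have fr: "frechet_derivative (\<lambda>_ :: real^2. 1 :: real) (at x) = (\<lambda>_. 0)" for x
      by (rule frechet_derivative_at[symmetric]) simp
    have "\<bar>F t - F s\<bar> \<le> 0 * (1 * B0 + measure \<mu> {p \<in> cylinder L T. snd p \<in> {s..t + (T - t) / 2}} / 1)"
      unfolding F_def
      by (rule slice_increment_limit[OF C_times_const per]) (use st in \<open>auto simp: fr field_simps\<close>)
    then show ?thesis by simp
  qed
  have c: "F t = F 0" if "t \<in> {-T<..<T}" for t
    using eq[of 0 t] eq[of t 0] that T by (cases "0 \<le> t") auto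
  have cl: "closure {-T<..<T} = {-T..T}" using T by simp
  have "F t = F 0" if "t \<in> {-T..T}" for t
    by (rule continuous_constant_on_closure[of "{-T<..<T}" F "F 0", unfolded cl, OF Fc c that])
  from this[OF t] this[of "-T"] have "F t = F (-T)" using T by simp
  then show ?thesis using Fm[OF t] Fm[of "-T"] T by simp
qed

lemma time_slab_measure:
  assumes ab: "- T < a" "a \<le> b" "b < T"
  shows "measure \<mu> {p \<in> cylinder L T. snd p \<in> {a..b}} = measure (\<kappa> (-T)) (torus L) * (b - a)"
proof -
  define M where "M = measure (\<kappa> (-T)) (torus L)"
  have im: "(\<lambda>p :: (real^2) \<times> real. indicator {a..b} (snd p) :: real) \<in> borel_measurable borel"
    unfolding borel_prod[symmetric] by measurable
  have "measure \<mu> {p \<in> cylinder L T. snd p \<in> {a..b}} = (\<integral>p. indicator {p \<in> cylinder L T. snd p \<in> {a..b}} p \<partial>\<mu>)"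
  proof -
    have "{p \<in> cylinder L T. snd p \<in> {a..b}} = cylinder L T \<inter> (UNIV \<times> {a..b})" by auto
    moreover have "(UNIV :: (real^2) set) \<times> {a..b} \<in> sets borel"
      unfolding borel_prod[symmetric] by (intro pair_measureI) auto
    ultimately have "{p \<in> cylinder L T. snd p \<in> {a..b}} \<in> sets \<mu>"
      using \<mu> cylinder_borel by (simp add: finite_borel_measure_def sets_cylinder)
    then show ?thesis by simp
  qed
  also have "\<dots> = (\<integral>p. indicator {a..b} (snd p) \<partial>\<mu>)"
    by (rule Bochner_Integration.integral_cong) (auto simp: space_cylinder_measure[OF \<mu>] indicator_def)
  also have "\<dots> = (LINT t:{-T<..<T}|lborel. (\<integral>x. indicator {a..b} t \<partial>\<kappa> t))"
    using disintegration_integral(2)[OF \<mu> weakly_continuous_repD(1)[OF \<kappa>] im, of 1] by (simp add: indicator_def)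
  also have "\<dots> = (LINT t:{a..b}|lborel. M)"
    unfolding set_lebesgue_integral_def
  proof (rule Bochner_Integration.integral_cong[OF refl])
    fix t
    have "measure (\<kappa> t) (space (\<kappa> t)) = M" if "t \<in> {a..b}"
      using that ab mass_const[of t] space_torus_measure[OF weakly_continuous_repD(2)[OF \<kappa>, of t]] by (simp add: M_def)
    then show "indicator {-T<..<T} t *\<^sub>R (\<integral>x. indicator {a..b} t \<partial>\<kappa> t) = indicator {a..b} t *\<^sub>R M"
      using ab by (cases "t \<in> {a..b}") auto
  qed
  also have "\<dots> = M * (b - a)" using ab by (simp add: set_lebesgue_integral_def)
  finally show ?thesis by (simp add: M_def)
qed

text \<open>The slab has mass \<open>M * (t + \<delta> - s)\<close>, and \<delta> tends to 0. The
  bound depends on the transport only through its mass and its energy bound, which makes it uniform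
  along a minimising sequence; \<open>l\<close> is still free to be chosen.\<close>

lemma slice_equicontinuous:
  fixes f :: "real^2 \<Rightarrow> real"
  assumes f: "\<And>k. C_times k f" "periodic L f" and C: "0 \<le> C" "\<And>x w. \<bar>frechet_derivative f (at x) w\<bar> \<le> C * norm w"
    and st: "- T \<le> s" "s \<le> t" "t \<le> T" and l: "l > 0"
  shows "\<bar>(\<integral>x. f x \<partial>\<kappa> t) - (\<integral>x. f x \<partial>\<kappa> s)\<bar> \<le> C * (l * B0 + measure (\<kappa> (-T)) (torus L) * (t - s) / l)"
proof -
  define F where "F t = (\<integral>x. f x \<partial>\<kappa> t)" for t
  define M where "M = measure (\<kappa> (-T)) (torus L)"
  have fc: "continuous_on UNIV f" using f(1)[of 0] by simp
  have Fc: "continuous_on {-T..T} F"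
    unfolding F_def by (rule weakly_continuous_repD(3)[OF \<kappa> fc f(2)])
  have int: "\<bar>F t - F s\<bar> \<le> C * (l * B0 + M * (t - s) / l)" if st: "- T < s" "s \<le> t" "t < T" for s t
  proof -
    have "((\<lambda>\<delta>. C * (l * B0 + M * (t + \<delta> - s) / l)) \<longlongrightarrow> C * (l * B0 + M * (t + 0 - s) / l)) (at_right 0)"
      by (intro tendsto_intros) (use l in auto)
    moreover have "eventually (\<lambda>\<delta>. \<bar>F t - F s\<bar> \<le> C * (l * B0 + M * (t + \<delta> - s) / l)) (at_right 0)"
    proof -
      have "\<bar>F t - F s\<bar> \<le> C * (l * B0 + M * (t + \<delta> - s) / l)" if "0 < \<delta>" "\<delta> < T - t" for \<delta>
      proof -
        have "measure \<mu> {p \<in> cylinder L T. snd p \<in> {s..t + \<delta>}} = M * (t + \<delta> - s)"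
          unfolding M_def by (rule time_slab_measure) (use st that in auto)
        then show ?thesis
          using slice_increment_limit[OF f C st(1,2) _ that(1) l] that by (simp add: F_def)
      qed
      then show ?thesis
        using st by (intro eventually_at_rightI[of 0 "T - t"]) auto
    qed
    ultimately have "\<bar>F t - F s\<bar> \<le> C * (l * B0 + M * (t + 0 - s) / l)"
      by (rule tendsto_lowerbound) simp
    then show ?thesis by simp
  qed
  \<comment> \<open>Contracting all times by factors below 1 moves them into the open interval,
    where test functions reach them; continuity recovers the end points.\<close>
  define r where "r n = 1 - 1 / (real n + 2)" for n
  have r: "0 < r n" "r n < 1" for n by (simp_all add: r_def)
  have rl: "r \<longlonglongrightarrow> 1"
    unfolding r_def by real_asymp
  have rT: "r n * a \<in> {-T..T}" "- T < r n * a" "r n * a < T" if "a \<in> {-T..T}" for n a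
  proof -
    have "\<bar>r n * a\<bar> \<le> r n * T" using r[of n] that by (simp add: abs_mult abs_le_iff mult_left_mono)
    also have "r n * T < T" using r[of n] T by simp
    finally show "r n * a \<in> {-T..T}" "- T < r n * a" "r n * a < T" by (simp_all add: abs_less_iff)
  qed
  have Fl: "(\<lambda>n. F (r n * a)) \<longlonglongrightarrow> F a" if a: "a \<in> {-T..T}" for a
  proof -
    have "(\<lambda>n. r n * a) \<longlonglongrightarrow> 1 * a" by (intro tendsto_intros rl)
    then show ?thesis
      using continuous_on_tendsto_compose[OF Fc, of "\<lambda>n. r n * a" a sequentially] rT(1)[OF a] a by simp
  qed
  have M0: "0 \<le> M" by (simp add: M_def)
  have "\<bar>F t - F s\<bar> \<le> C * (l * B0 + M * (t - s) / l)"
  proof (rule tendsto_upperbound)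
    show "(\<lambda>n. \<bar>F (r n * t) - F (r n * s)\<bar>) \<longlonglongrightarrow> \<bar>F t - F s\<bar>"
      by (intro tendsto_intros Fl) (use st in auto)
    have "\<bar>F (r n * t) - F (r n * s)\<bar> \<le> C * (l * B0 + M * (t - s) / l)" for n
    proof -
      have "\<bar>F (r n * t) - F (r n * s)\<bar> \<le> C * (l * B0 + M * (r n * t - r n * s) / l)"
        by (rule int) (use rT[of s n] rT[of t n] st r[of n] in \<open>auto intro: mult_left_mono\<close>)
      also have "\<dots> \<le> C * (l * B0 + M * (t - s) / l)"
      proof -
        have "r n * (t - s) \<le> 1 * (t - s)" using r[of n] st by (intro mult_right_mono) auto
        then have "r n * t - r n * s \<le> t - s" by (simp add: right_diff_distrib)
        then show ?thesis
          using C(1) M0 l by (intro mult_left_mono add_left_mono divide_right_mono) auto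
      qed
      finally show ?thesis .
    qed
    then show "eventually (\<lambda>n. \<bar>F (r n * t) - F (r n * s)\<bar> \<le> C * (l * B0 + M * (t - s) / l)) sequentially" by simp
  qed simp
  then show ?thesis by (simp add: F_def M_def)
qed

end

section \<open>Compactness of slices\<close>

lemma torus_integrable:
  fixes f :: "real^2 \<Rightarrow> real"
  assumes L: "L > 0" and \<nu>: "finite_borel_measure (torus L) \<nu>" and f: "continuous_on UNIV f" "periodic L f"
  shows "integrable \<nu> f"
proof -
  interpret finite_measure \<nu> using \<nu> by (simp add: finite_borel_measure_def)
  obtain C where C: "\<And>x. \<bar>f x\<bar> \<le> C" using periodic_bounded[OF L f] by blast
  show ?thesis
    by (rule integrable_const_bound[of _ C])
       (use C in \<open>auto intro!: borel_measurable_torus_measure[OF \<nu> borel_measurable_continuous_onI[OF f(1)]]\<close>)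
qed

lemma torus_integral_diff_le:
  fixes f g :: "real^2 \<Rightarrow> real"
  assumes L: "L > 0" and \<nu>: "finite_borel_measure (torus L) \<nu>"
    and f: "continuous_on UNIV f" "periodic L f" and g: "continuous_on UNIV g" "periodic L g"
    and e: "\<And>x. \<bar>f x - g x\<bar> \<le> e"
  shows "\<bar>(\<integral>x. f x \<partial>\<nu>) - (\<integral>x. g x \<partial>\<nu>)\<bar> \<le> e * measure \<nu> (torus L)"
proof -
  interpret finite_measure \<nu> using \<nu> by (simp add: finite_borel_measure_def)
  note i = torus_integrable[OF L \<nu> f] torus_integrable[OF L \<nu> g]
  have d: "integrable \<nu> (\<lambda>x. f x - g x)" using i by simp
  have "(\<integral>x. f x \<partial>\<nu>) - (\<integral>x. g x \<partial>\<nu>) = (\<integral>x. f x - g x \<partial>\<nu>)" using i by simp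
  also have "\<bar>\<dots>\<bar> \<le> (\<integral>x. \<bar>f x - g x\<bar> \<partial>\<nu>)" by (rule integral_abs_bound)
  also have "\<dots> \<le> (\<integral>x. e \<partial>\<nu>)"
    by (rule integral_mono[OF integrable_abs[OF d]]) (use e in simp_all)
  also have "\<dots> = e * measure \<nu> (torus L)" by (simp add: space_torus_measure[OF \<nu>])
  finally show ?thesis .
qed

lemma finite_borel_measure_distr:
  assumes "finite_measure M" "g \<in> measurable M (restrict_space borel S)"
  shows "finite_borel_measure S (distr M (restrict_space borel S) g)"
  using finite_measure.finite_measure_distr[OF assms] by (simp add: finite_borel_measure_def)

text \<open>On the closed square weak compactness is available. The limit may charge the faces that
  the domain lacks; \<open>wrap\<close> moves this mass to the opposite faces, which periodic
  functions do not see.\<close>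

lemma torus_weakly_convergent_subsequence:
  assumes L: "L > 0" and \<nu>: "\<And>n. finite_borel_measure (torus L) (\<nu> n)"
    and mass: "\<And>n. measure (\<nu> n) (torus L) \<le> C"
  shows "\<exists>r N. strict_mono (r :: nat \<Rightarrow> nat) \<and> finite_borel_measure (torus L) N \<and>
    (\<forall>f :: real^2 \<Rightarrow> real. continuous_on UNIV f \<longrightarrow> periodic L f \<longrightarrow> (\<lambda>n. \<integral>x. f x \<partial>\<nu> (r n)) \<longlonglongrightarrow> (\<integral>x. f x \<partial>N))"
proof -
  let ?Q = "cbox (\<chi> i. - L / 2) (\<chi> i. L / 2) :: (real^2) set"
  define M where "M n = distr (\<nu> n) borel (\<lambda>x. x)" for n
  have id: "(\<lambda>x. x) \<in> measurable (\<nu> n) borel" for n by (rule borel_measurable_torus_measure[OF \<nu>]) simp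
  have fin: "finite_measure (\<nu> n)" for n using \<nu> by (simp add: finite_borel_measure_def)
  have "\<exists>r N. strict_mono (r :: nat \<Rightarrow> nat) \<and> sets N = sets borel \<and> finite_measure N \<and>
    (AE x in N. x \<in> ?Q) \<and>
    (\<forall>f :: real^2 \<Rightarrow> real. continuous_on UNIV f \<longrightarrow> (\<lambda>n. \<integral>x. f x \<partial>M (r n)) \<longlonglongrightarrow> (\<integral>x. f x \<partial>N))"
  proof (rule weakly_convergent_subsequence)
    show "sets (M n) = sets borel" for n by (simp add: M_def)
    show "finite_measure (M n)" for n unfolding M_def by (rule finite_measure.finite_measure_distr[OF fin id])
    show "AE x in M n. x \<in> ?Q" for n
      unfolding M_def
    proof (subst AE_distr_iff[OF id])
      show "AE x in \<nu> n. x \<in> ?Q"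
        by (rule AE_I2) (simp only: space_torus_measure[OF \<nu>] subsetD[OF torus_subset_cbox])
    qed simp
    show "compact ?Q" by (rule compact_cbox)
    show "measure (M n) UNIV \<le> C" for n
      unfolding M_def using mass[of n] by (subst measure_distr[OF id]) (simp_all add: space_torus_measure[OF \<nu>])
  qed
  then obtain r N where r: "strict_mono (r :: nat \<Rightarrow> nat)" and N: "sets N = sets borel" "finite_measure N"
    and conv: "\<And>f :: real^2 \<Rightarrow> real. continuous_on UNIV f \<Longrightarrow> (\<lambda>n. \<integral>x. f x \<partial>M (r n)) \<longlonglongrightarrow> (\<integral>x. f x \<partial>N)"
    by blast
  have wm: "wrap L \<in> measurable N (restrict_space borel (torus L))"
    using measurable_wrap[OF L] measurable_cong_sets[OF N(1) refl] by blast
  show ?thesis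
  proof (intro exI[of _ r] exI[of _ "distr N (restrict_space borel (torus L)) (wrap L)"] conjI allI impI r)
    show "finite_borel_measure (torus L) (distr N (restrict_space borel (torus L)) (wrap L))"
      by (rule finite_borel_measure_distr[OF N(2) wm])
    fix f :: "real^2 \<Rightarrow> real" assume f: "continuous_on UNIV f" "periodic L f"
    have fm: "f \<in> borel_measurable borel" by (rule borel_measurable_continuous_onI[OF f(1)])
    have "(\<integral>x. f x \<partial>M n) = (\<integral>x. f x \<partial>\<nu> n)" for n
      unfolding M_def by (rule integral_distr[OF id fm])
    moreover have "(\<integral>x. f x \<partial>distr N (restrict_space borel (torus L)) (wrap L)) = (\<integral>x. f x \<partial>N)"
      using integral_distr[OF wm measurable_restrict_space1[OF fm]] by (simp add: periodic_wrap[OF f(2)])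
    ultimately show "(\<lambda>n. \<integral>x. f x \<partial>\<nu> (r n)) \<longlonglongrightarrow> (\<integral>x. f x \<partial>distr N (restrict_space borel (torus L)) (wrap L))"
      using conv[OF f(1)] by simp
  qed
qed

text \<open>A diagonal sequence converges at countably many dense times. Equicontinuity extends this
  to all times for smooth \<open>f\<close>, and uniform density of smooth functions to all
  continuous periodic \<open>f\<close>. The same two estimates survive in the limit and give its
  continuity in time.\<close>

lemma slices_convergent_subsequence:
  fixes \<kappa> :: "nat \<Rightarrow> real \<Rightarrow> (real^2) measure"
  assumes L: "L > 0" and T: "T > 0"
    and fin: "\<And>n t. t \<in> {-T..T} \<Longrightarrow> finite_borel_measure (torus L) (\<kappa> n t)"
    and mass: "\<And>n t. t \<in> {-T..T} \<Longrightarrow> measure (\<kappa> n t) (torus L) = M"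
    and equi: "\<And>f e. (\<And>k. C_times k f) \<Longrightarrow> periodic L f \<Longrightarrow> e > 0 \<Longrightarrow>
      \<exists>d>0. \<forall>n. \<forall>s\<in>{-T..T}. \<forall>t\<in>{-T..T}. \<bar>t - s\<bar> < d \<longrightarrow> \<bar>(\<integral>x. f x \<partial>\<kappa> n t) - (\<integral>x. f x \<partial>\<kappa> n s)\<bar> \<le> e"
  shows "\<exists>r \<kappa>'. strict_mono (r :: nat \<Rightarrow> nat) \<and> (\<forall>t\<in>{-T..T}. finite_borel_measure (torus L) (\<kappa>' t)) \<and>
    (\<forall>f :: real^2 \<Rightarrow> real. continuous_on UNIV f \<longrightarrow> periodic L f \<longrightarrow>
      continuous_on {-T..T} (\<lambda>t. \<integral>x. f x \<partial>\<kappa>' t) \<and>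
      (\<forall>t\<in>{-T..T}. (\<lambda>n. \<integral>x. f x \<partial>\<kappa> (r n) t) \<longlonglongrightarrow> (\<integral>x. f x \<partial>\<kappa>' t)))"
proof -
  define adm where "adm f \<longleftrightarrow> continuous_on UNIV f \<and> periodic L f" for f :: "real^2 \<Rightarrow> real"
  \<comment> \<open>An enumeration of the rationals clamped to the time interval: a countable dense
    set of times that never leaves it.\<close>
  define q where "q n = max (-T) (min T (real_of_rat (from_nat_into UNIV n)))" for n
  have q: "q n \<in> {-T..T}" for n using T by (simp add: q_def)
  have qdense: "\<exists>n. \<bar>q n - t\<bar> < d" if "t \<in> {-T..T}" "d > 0" for t d
  proof -
    have "t - d < t + d" using that by simp
    from of_rat_dense[OF this] obtain x where x: "t - d < of_rat x" "of_rat x < t + d" by blast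
    obtain n where n: "from_nat_into UNIV n = x" using from_nat_into_surj[of UNIV x] by auto
    have "\<bar>q n - t\<bar> \<le> \<bar>of_rat x - t\<bar>" unfolding q_def n using that by auto
    then show ?thesis using x by (intro exI[of _ n]) linarith
  qed
  define P where "P k s \<longleftrightarrow> (\<forall>f. adm f \<longrightarrow> convergent (\<lambda>i. \<integral>x. f x \<partial>\<kappa> (s i) (q k)))" for k and s :: "nat \<Rightarrow> nat"
  interpret subseqs P
  proof
    fix n and s :: "nat \<Rightarrow> nat" assume "strict_mono s"
    obtain r N where r: "strict_mono (r :: nat \<Rightarrow> nat)"
      and c: "\<forall>f :: real^2 \<Rightarrow> real. continuous_on UNIV f \<longrightarrow> periodic L f \<longrightarrow> (\<lambda>i. \<integral>x. f x \<partial>\<kappa> (s (r i)) (q n)) \<longlonglongrightarrow> (\<integral>x. f x \<partial>N)"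
      using torus_weakly_convergent_subsequence[OF L, of "\<lambda>i. \<kappa> (s i) (q n)" M] fin[OF q] mass[OF q] by auto
    then have "P n (s \<circ> r)" unfolding P_def adm_def convergent_def o_def by blast
    then show "\<exists>r'. strict_mono r' \<and> P n (s \<circ> r')" using r by blast
  qed
  define r where "r = diagseq"
  have r: "strict_mono r" unfolding r_def by (rule subseq_diagseq)
  have Pr: "convergent (\<lambda>i. \<integral>x. f x \<partial>\<kappa> (r i) (q k))" if f: "adm f" for f k
  proof -
    have "P k (diagseq \<circ> (+) (Suc k))"
    proof (rule diagseq_holds)
      fix r s n assume "strict_mono (r :: nat \<Rightarrow> nat)" "P n s"
      then show "P n (s \<circ> r)"
        unfolding P_def
        using convergent_subseq_convergent[of "\<lambda>i. \<integral>x. _ x \<partial>\<kappa> (s i) (q n)" r] by (auto simp: o_def)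
    qed
    then have "convergent (\<lambda>i. \<integral>x. f x \<partial>\<kappa> (r (i + Suc k)) (q k))"
      using f by (simp add: P_def o_def r_def add.commute)
    then show ?thesis
      using convergent_ignore_initial_segment[of "\<lambda>i. \<integral>x. f x \<partial>\<kappa> (r i) (q k)" "Suc k"] by simp
  qed
  have smooth_conv: "convergent (\<lambda>i. \<integral>x. f x \<partial>\<kappa> (r i) t)"
    if f: "\<And>k. C_times k f" "periodic L f" and t: "t \<in> {-T..T}" for f t
  proof (rule Cauchy_convergent, rule CauchyI)
    fix e :: real assume e: "e > 0"
    have "adm f" using f(1)[of 0] f(2) by (simp add: adm_def)
    obtain d where d: "d > 0" "\<And>n s t. s \<in> {-T..T} \<Longrightarrow> t \<in> {-T..T} \<Longrightarrow> \<bar>t - s\<bar> < d \<Longrightarrow> \<bar>(\<integral>x. f x \<partial>\<kappa> n t) - (\<integral>x. f x \<partial>\<kappa> n s)\<bar> \<le> e / 4"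
      using equi[OF f, of "e / 4"] e by auto
    obtain k where k: "\<bar>q k - t\<bar> < d" using qdense[OF t d(1)] by blast
    have "Cauchy (\<lambda>i. \<integral>x. f x \<partial>\<kappa> (r i) (q k))" using Pr[OF \<open>adm f\<close>] by (rule convergent_Cauchy)
    then obtain N where N: "\<And>m n. m \<ge> N \<Longrightarrow> n \<ge> N \<Longrightarrow> \<bar>(\<integral>x. f x \<partial>\<kappa> (r m) (q k)) - (\<integral>x. f x \<partial>\<kappa> (r n) (q k))\<bar> < e / 4"
      using CauchyD[of _ "e / 4"] e by (metis divide_pos_pos real_norm_def zero_less_numeral)
    show "\<exists>N. \<forall>m\<ge>N. \<forall>n\<ge>N. norm ((\<integral>x. f x \<partial>\<kappa> (r m) t) - (\<integral>x. f x \<partial>\<kappa> (r n) t)) < e"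
    proof (intro exI[of _ N] allI impI)
      fix m n assume "m \<ge> N" "n \<ge> N"
      then show "norm ((\<integral>x. f x \<partial>\<kappa> (r m) t) - (\<integral>x. f x \<partial>\<kappa> (r n) t)) < e"
        using N[of m n] d(2)[OF t q k, of "r m"] d(2)[OF t q k, of "r n"] unfolding real_norm_def by linarith
    qed
  qed
  have M0: "0 \<le> M" using mass[of 0 0] T measure_nonneg[of "\<kappa> 0 0" "torus L"] by simp
  \<comment> \<open>One smooth function serves all measures of mass \<open>M\<close> at once, hence
    all slices. Dividing by \<open>M + 1\<close> covers \<open>M = 0\<close>.\<close>
  have approx: "\<exists>g. (\<forall>k. C_times k g) \<and> periodic L g \<and> (\<forall>\<nu>. finite_borel_measure (torus L) \<nu> \<longrightarrow> measure \<nu> (torus L) = M \<longrightarrow>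
      \<bar>(\<integral>x. f x \<partial>\<nu>) - (\<integral>x. g x \<partial>\<nu>)\<bar> \<le> e)" if f: "adm f" and e: "e > 0" for f e
  proof -
    have e': "e / (M + 1) > 0" using e M0 by simp
    obtain p where p: "real_polynomial_function p" "\<And>x. \<bar>f x - p (torus_emb L x)\<bar> < e / (M + 1)"
      using periodic_approx[OF L _ _ e', of f] f unfolding adm_def by blast
    have pc: "C_times k (\<lambda>x. p (torus_emb L x))" for k by (rule smooth_trig_poly[OF p(1)])
    have pp: "periodic L (\<lambda>x. p (torus_emb L x))" by (rule periodic_torus_emb[OF L])
    show ?thesis
    proof (intro exI[of _ "\<lambda>x. p (torus_emb L x)"] conjI allI impI pc pp)
      fix \<nu> assume \<nu>: "finite_borel_measure (torus L) \<nu>" "measure \<nu> (torus L) = M"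
      have "\<bar>(\<integral>x. f x \<partial>\<nu>) - (\<integral>x. p (torus_emb L x) \<partial>\<nu>)\<bar> \<le> e / (M + 1) * measure \<nu> (torus L)"
        using f pc[of 0] by (intro torus_integral_diff_le[OF L \<nu>(1) _ _ _ pp less_imp_le[OF p(2)]]) (auto simp: adm_def)
      also have "\<dots> \<le> e" using e M0 \<nu>(2) by (simp add: field_simps)
      finally show "\<bar>(\<integral>x. f x \<partial>\<nu>) - (\<integral>x. p (torus_emb L x) \<partial>\<nu>)\<bar> \<le> e" .
    qed
  qed
  have conv: "convergent (\<lambda>i. \<integral>x. f x \<partial>\<kappa> (r i) t)" if f: "adm f" and t: "t \<in> {-T..T}" for f t
  proof (rule Cauchy_convergent, rule CauchyI)
    fix e :: real assume e: "e > 0"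
    obtain g where g: "\<And>k. C_times k g" "periodic L g"
      and gf: "\<And>\<nu>. finite_borel_measure (torus L) \<nu> \<Longrightarrow> measure \<nu> (torus L) = M \<Longrightarrow> \<bar>(\<integral>x. f x \<partial>\<nu>) - (\<integral>x. g x \<partial>\<nu>)\<bar> \<le> e / 4"
      using approx[OF f, of "e / 4"] e by auto
    have "Cauchy (\<lambda>i. \<integral>x. g x \<partial>\<kappa> (r i) t)" using smooth_conv[OF g t] by (rule convergent_Cauchy)
    then obtain N where N: "\<And>m n. m \<ge> N \<Longrightarrow> n \<ge> N \<Longrightarrow> \<bar>(\<integral>x. g x \<partial>\<kappa> (r m) t) - (\<integral>x. g x \<partial>\<kappa> (r n) t)\<bar> < e / 4"
      using CauchyD[of _ "e / 4"] e by (metis divide_pos_pos real_norm_def zero_less_numeral)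
    show "\<exists>N. \<forall>m\<ge>N. \<forall>n\<ge>N. norm ((\<integral>x. f x \<partial>\<kappa> (r m) t) - (\<integral>x. f x \<partial>\<kappa> (r n) t)) < e"
    proof (intro exI[of _ N] allI impI)
      fix m n assume "m \<ge> N" "n \<ge> N"
      then show "norm ((\<integral>x. f x \<partial>\<kappa> (r m) t) - (\<integral>x. f x \<partial>\<kappa> (r n) t)) < e"
        using N[of m n] gf[OF fin[OF t] mass[OF t], of "r m"] gf[OF fin[OF t] mass[OF t], of "r n"]
        unfolding real_norm_def by linarith
    qed
  qed
  \<comment> \<open>Compactness at the single time \<open>t\<close> yields a limit measure along a
    further subsequence; since the integrals already converge, that measure is their limit along the
    whole sequence.\<close>
  have "\<forall>t\<in>{-T..T}. \<exists>N. finite_borel_measure (torus L) N \<and> (\<forall>f. adm f \<longrightarrow> (\<lambda>n. \<integral>x. f x \<partial>\<kappa> (r n) t) \<longlonglongrightarrow> (\<integral>x. f x \<partial>N))"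
  proof
    fix t assume t: "t \<in> {-T..T}"
    obtain r' N where r': "strict_mono (r' :: nat \<Rightarrow> nat)" and N: "finite_borel_measure (torus L) N"
      and c: "\<forall>f :: real^2 \<Rightarrow> real. continuous_on UNIV f \<longrightarrow> periodic L f \<longrightarrow> (\<lambda>i. \<integral>x. f x \<partial>\<kappa> (r (r' i)) t) \<longlonglongrightarrow> (\<integral>x. f x \<partial>N)"
      using torus_weakly_convergent_subsequence[OF L, of "\<lambda>i. \<kappa> (r i) t" M] fin[OF t] mass[OF t] by auto
    have "(\<lambda>n. \<integral>x. f x \<partial>\<kappa> (r n) t) \<longlonglongrightarrow> (\<integral>x. f x \<partial>N)" if f: "adm f" for f
    proof -
      obtain l where l: "(\<lambda>n. \<integral>x. f x \<partial>\<kappa> (r n) t) \<longlonglongrightarrow> l" using conv[OF f t] by (auto simp: convergent_def)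
      have "(\<lambda>i. \<integral>x. f x \<partial>\<kappa> (r (r' i)) t) \<longlonglongrightarrow> l" using LIMSEQ_subseq_LIMSEQ[OF l r'] by (simp add: o_def)
      moreover have "(\<lambda>i. \<integral>x. f x \<partial>\<kappa> (r (r' i)) t) \<longlonglongrightarrow> (\<integral>x. f x \<partial>N)" using c f by (simp add: adm_def)
      ultimately have "l = (\<integral>x. f x \<partial>N)" by (rule LIMSEQ_unique)
      then show ?thesis using l by simp
    qed
    then show "\<exists>N. finite_borel_measure (torus L) N \<and> (\<forall>f. adm f \<longrightarrow> (\<lambda>n. \<integral>x. f x \<partial>\<kappa> (r n) t) \<longlonglongrightarrow> (\<integral>x. f x \<partial>N))"
      using N by blast
  qed
  from bchoice[OF this] obtain \<kappa>' where \<kappa>': "\<And>t. t \<in> {-T..T} \<Longrightarrow> finite_borel_measure (torus L) (\<kappa>' t)"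
    and lim: "\<And>t f. t \<in> {-T..T} \<Longrightarrow> adm f \<Longrightarrow> (\<lambda>n. \<integral>x. f x \<partial>\<kappa> (r n) t) \<longlonglongrightarrow> (\<integral>x. f x \<partial>\<kappa>' t)"
    by blast
  have cont: "continuous_on {-T..T} (\<lambda>t. \<integral>x. f x \<partial>\<kappa>' t)" if f: "adm f" for f
    unfolding continuous_on_iff
  proof (intro ballI allI impI)
    fix s e :: real assume s: "s \<in> {-T..T}" and e: "e > 0"
    obtain g where g: "\<And>k. C_times k g" "periodic L g"
      and gf: "\<And>\<nu>. finite_borel_measure (torus L) \<nu> \<Longrightarrow> measure \<nu> (torus L) = M \<Longrightarrow> \<bar>(\<integral>x. f x \<partial>\<nu>) - (\<integral>x. g x \<partial>\<nu>)\<bar> \<le> e / 4"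
      using approx[OF f, of "e / 4"] e by auto
    obtain d where d: "d > 0" "\<And>n s t. s \<in> {-T..T} \<Longrightarrow> t \<in> {-T..T} \<Longrightarrow> \<bar>t - s\<bar> < d \<Longrightarrow> \<bar>(\<integral>x. g x \<partial>\<kappa> n t) - (\<integral>x. g x \<partial>\<kappa> n s)\<bar> \<le> e / 4"
      using equi[OF g, of "e / 4"] e by auto
    show "\<exists>d>0. \<forall>t\<in>{-T..T}. dist t s < d \<longrightarrow> dist (\<integral>x. f x \<partial>\<kappa>' t) (\<integral>x. f x \<partial>\<kappa>' s) < e"
    proof (intro exI[of _ d] conjI ballI impI d(1))
      fix t assume t: "t \<in> {-T..T}" "dist t s < d"
      have "\<bar>(\<integral>x. f x \<partial>\<kappa>' t) - (\<integral>x. f x \<partial>\<kappa>' s)\<bar> \<le> e * 3 / 4"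
      proof (rule LIMSEQ_le_const2)
        show "(\<lambda>n. \<bar>(\<integral>x. f x \<partial>\<kappa> (r n) t) - (\<integral>x. f x \<partial>\<kappa> (r n) s)\<bar>) \<longlonglongrightarrow> \<bar>(\<integral>x. f x \<partial>\<kappa>' t) - (\<integral>x. f x \<partial>\<kappa>' s)\<bar>"
          by (intro tendsto_intros lim f t s)
        have "\<bar>(\<integral>x. f x \<partial>\<kappa> (r n) t) - (\<integral>x. f x \<partial>\<kappa> (r n) s)\<bar> \<le> e * 3 / 4" for n
          using gf[OF fin[OF t(1)] mass[OF t(1)], of "r n"] gf[OF fin[OF s] mass[OF s], of "r n"] d(2)[OF s t(1), of "r n"] t(2)
          unfolding dist_real_def by linarith
        then show "\<exists>N. \<forall>n\<ge>N. \<bar>(\<integral>x. f x \<partial>\<kappa> (r n) t) - (\<integral>x. f x \<partial>\<kappa> (r n) s)\<bar> \<le> e * 3 / 4" by blast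
      qed
      then show "dist (\<integral>x. f x \<partial>\<kappa>' t) (\<integral>x. f x \<partial>\<kappa>' s) < e" using e by (simp add: dist_real_def)
    qed
  qed
  show ?thesis
    using r \<kappa>' cont lim by (intro exI[of _ r] exI[of _ \<kappa>']) (simp add: adm_def)
qed

section \<open>Lower semicontinuity of the sum over atoms\<close>

definition atom_sum :: "real \<Rightarrow> (real^2) measure \<Rightarrow> ennreal"
  where "atom_sum L \<nu> = (\<integral>\<^sup>+x. ennreal (sqrt (measure \<nu> {x})) \<partial>count_space (torus L))"

lemma singleton_torus: "x \<in> torus L \<Longrightarrow> {x} \<in> sets (restrict_space borel (torus L))"
  by (simp add: sets_torus)

lemma countable_dirac_sum_nn_integral:
  assumes \<nu>: "finite_borel_measure (torus L) \<nu>" and X: "countable X" "X \<subseteq> torus L"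
    and em: "\<And>B. B \<in> sets \<nu> \<Longrightarrow> emeasure \<nu> B = (\<integral>\<^sup>+x. ennreal (\<phi> x) * indicator B x \<partial>count_space X)"
    and g: "g \<in> borel_measurable \<nu>"
  shows "(\<integral>\<^sup>+x. g x \<partial>\<nu>) = (\<integral>\<^sup>+x. ennreal (\<phi> x) * g x \<partial>count_space X)"
proof -
  let ?D = "density (count_space X) (\<lambda>x. ennreal (\<phi> x))"
  have sp: "space \<nu> = torus L" by (rule space_torus_measure[OF \<nu>])
  have idm: "(\<lambda>x. x) \<in> measurable ?D \<nu>" using X sp by (simp add: measurable_def) auto
  have "\<nu> = distr ?D \<nu> (\<lambda>x. x)"
  proof (rule measure_eqI)
    fix B assume B: "B \<in> sets \<nu>"
    have "emeasure (distr ?D \<nu> (\<lambda>x. x)) B = emeasure ?D (B \<inter> X)"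
      by (subst emeasure_distr[OF idm B]) (simp add: vimage_def)
    also have "\<dots> = (\<integral>\<^sup>+x. ennreal (\<phi> x) * indicator (B \<inter> X) x \<partial>count_space X)"
      by (rule emeasure_density) auto
    also have "\<dots> = (\<integral>\<^sup>+x. ennreal (\<phi> x) * indicator B x \<partial>count_space X)"
      by (rule nn_integral_cong) (simp add: indicator_def)
    finally show "emeasure \<nu> B = emeasure (distr ?D \<nu> (\<lambda>x. x)) B" using em[OF B] by simp
  qed simp
  then have "(\<integral>\<^sup>+x. g x \<partial>\<nu>) = (\<integral>\<^sup>+x. g x \<partial>distr ?D \<nu> (\<lambda>x. x))" by simp
  also have "\<dots> = (\<integral>\<^sup>+x. g x \<partial>?D)" by (rule nn_integral_distr[OF idm]) (simp add: g)
  also have "\<dots> = (\<integral>\<^sup>+x. ennreal (\<phi> x) * g x \<partial>count_space X)"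
    by (rule nn_integral_density) auto
  finally show ?thesis .
qed

lemma sum_sqrt_disjoint_le_one:
  fixes f :: "'i \<Rightarrow> real"
  assumes I: "finite I" and f: "\<And>i. i \<in> I \<Longrightarrow> 0 \<le> f i \<and> f i \<le> 1"
    and dis: "\<And>i j. i \<in> I \<Longrightarrow> j \<in> I \<Longrightarrow> i \<noteq> j \<Longrightarrow> f i * f j = 0"
  shows "(\<Sum>i\<in>I. sqrt (f i)) \<le> 1"
proof (cases "\<exists>i\<in>I. f i \<noteq> 0")
  case True
  then obtain i where i: "i \<in> I" "f i \<noteq> 0" by blast
  then have "(\<Sum>j\<in>I. sqrt (f j)) = (\<Sum>j\<in>I. if j = i then sqrt (f i) else 0)"
    using dis[OF _ i(1)] by (intro sum.cong) auto
  also have "\<dots> = sqrt (f i)" using I i by simp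
  finally show ?thesis using f[OF i(1)] by simp
qed simp

text \<open>The square root is subadditive over the atoms. After exchanging the two sums, at each
  atom at most one of the functions is nonzero, so their roots add up to at most 1.\<close>

lemma disjoint_functions_le_atom_sum:
  fixes f :: "'i \<Rightarrow> real^2 \<Rightarrow> real"
  assumes \<nu>: "finite_borel_measure (torus L) \<nu>" and at: "countable_dirac_sum L \<nu>"
    and I: "finite I" and fm: "\<And>i. i \<in> I \<Longrightarrow> f i \<in> borel_measurable \<nu>"
    and f: "\<And>i x. i \<in> I \<Longrightarrow> 0 \<le> f i x \<and> f i x \<le> 1"
    and dis: "\<And>i j x. i \<in> I \<Longrightarrow> j \<in> I \<Longrightarrow> i \<noteq> j \<Longrightarrow> f i x * f j x = 0"
  shows "(\<Sum>i\<in>I. ennreal (sqrt (\<integral>x. f i x \<partial>\<nu>))) \<le> atom_sum L \<nu>"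
proof -
  interpret finite_measure \<nu> using \<nu> by (simp add: finite_borel_measure_def)
  obtain X \<phi> where X: "countable X" "X \<subseteq> torus L" and \<phi>: "\<And>x. x \<in> X \<Longrightarrow> 0 < \<phi> x"
    and em: "\<And>B. B \<in> sets \<nu> \<Longrightarrow> emeasure \<nu> B = (\<integral>\<^sup>+x. ennreal (\<phi> x) * indicator B x \<partial>count_space X)"
    using at unfolding countable_dirac_sum_def by blast
  have m\<phi>: "measure \<nu> {x} = \<phi> x" if x: "x \<in> X" for x
  proof -
    have s: "{x} \<in> sets \<nu>" using singleton_torus[of x L] X(2) x \<nu> by (auto simp: finite_borel_measure_def)
    have "emeasure \<nu> {x} = (\<integral>\<^sup>+y. ennreal (\<phi> x) * indicator {x} y \<partial>count_space X)"
      unfolding em[OF s] by (rule nn_integral_cong) (simp add: indicator_def)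
    also have "\<dots> = ennreal (\<phi> x)" using x by (subst nn_integral_cmult_indicator) auto
    finally show ?thesis using \<phi>[OF x] by (simp add: measure_def)
  qed
  have one: "ennreal (sqrt (\<integral>x. f i x \<partial>\<nu>)) \<le> (\<integral>\<^sup>+x. ennreal (sqrt (\<phi> x) * sqrt (f i x)) \<partial>count_space X)" if i: "i \<in> I" for i
  proof -
    define A where "A = (\<integral>x. f i x \<partial>\<nu>)"
    have fi: "integrable \<nu> (f i)"
      by (rule integrable_const_bound[of _ 1]) (use f[OF i] fm[OF i] in auto)
    have A0: "0 \<le> A" unfolding A_def using f[OF i] by (intro Bochner_Integration.integral_nonneg) auto
    have fe: "(\<lambda>x. ennreal (f i x)) \<in> borel_measurable \<nu>" using fm[OF i] by measurable
    have eA: "ennreal A = (\<integral>\<^sup>+x. ennreal (\<phi> x) * ennreal (f i x) \<partial>count_space X)"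
      using nn_integral_eq_integral[OF fi] f[OF i] countable_dirac_sum_nn_integral[OF \<nu> X em fe] by (simp add: A_def)
    show ?thesis
    proof (cases "A = 0")
      case True
      then show ?thesis by (simp add: A_def)
    next
      case False
      then have A: "A > 0" using A0 by simp
      \<comment> \<open>Each term is at most the total \<open>A\<close>, so one of its two root
        factors may be replaced by the root of \<open>A\<close>. Summing and cancelling that root
        gives subadditivity for countably many atoms.\<close>
      have le: "ennreal (\<phi> x) * ennreal (f i x) \<le> ennreal (sqrt A) * ennreal (sqrt (\<phi> x) * sqrt (f i x))" if x: "x \<in> X" for x
      proof -
        have nn: "0 \<le> \<phi> x * f i x" using \<phi>[OF x] f[OF i, of x] by simp
        have "ennreal (\<phi> x * f i x) \<le> ennreal A"
        proof -
          have "ennreal (\<phi> x * f i x) = (\<integral>\<^sup>+y. ennreal (\<phi> x) * ennreal (f i x) * indicator {x} y \<partial>count_space X)"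
            using x \<phi>[OF x] f[OF i, of x] by (subst nn_integral_cmult_indicator) (auto simp: ennreal_mult)
          also have "\<dots> \<le> (\<integral>\<^sup>+y. ennreal (\<phi> y) * ennreal (f i y) \<partial>count_space X)"
            by (rule nn_integral_mono) (simp add: indicator_def)
          finally show ?thesis by (simp add: eA)
        qed
        then have "\<phi> x * f i x \<le> A" using A0 by simp
        then have "sqrt (\<phi> x * f i x) * sqrt (\<phi> x * f i x) \<le> sqrt A * sqrt (\<phi> x * f i x)"
          using nn by (intro mult_right_mono) auto
        moreover have "sqrt (\<phi> x * f i x) * sqrt (\<phi> x * f i x) = \<phi> x * f i x" using nn by simp
        ultimately have "\<phi> x * f i x \<le> sqrt A * sqrt (\<phi> x * f i x)" by simp
        then have "\<phi> x * f i x \<le> sqrt A * (sqrt (\<phi> x) * sqrt (f i x))"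
          by (simp only: real_sqrt_mult)
        then have "ennreal (\<phi> x * f i x) \<le> ennreal (sqrt A * (sqrt (\<phi> x) * sqrt (f i x)))" by (rule ennreal_leI)
        then show ?thesis using \<phi>[OF x] f[OF i, of x] A0 by (simp add: ennreal_mult)
      qed
      have "ennreal (sqrt A) * ennreal (sqrt A) = ennreal A" using A0 by (simp flip: ennreal_mult)
      also have "\<dots> \<le> (\<integral>\<^sup>+x. ennreal (sqrt A) * ennreal (sqrt (\<phi> x) * sqrt (f i x)) \<partial>count_space X)"
        unfolding eA by (rule nn_integral_mono) (simp add: le)
      also have "\<dots> = ennreal (sqrt A) * (\<integral>\<^sup>+x. ennreal (sqrt (\<phi> x) * sqrt (f i x)) \<partial>count_space X)"
        by (rule nn_integral_cmult) simp
      finally have "ennreal (sqrt A) * ennreal (sqrt A) \<le> ennreal (sqrt A) * (\<integral>\<^sup>+x. ennreal (sqrt (\<phi> x) * sqrt (f i x)) \<partial>count_space X)" .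
      moreover have "ennreal (sqrt A) \<noteq> 0" "ennreal (sqrt A) \<noteq> \<top>" using A by auto
      ultimately show ?thesis unfolding A_def[symmetric] by (simp add: ennreal_mult_le_mult_iff)
    qed
  qed
  have "(\<Sum>i\<in>I. ennreal (sqrt (\<integral>x. f i x \<partial>\<nu>))) \<le> (\<Sum>i\<in>I. \<integral>\<^sup>+x. ennreal (sqrt (\<phi> x) * sqrt (f i x)) \<partial>count_space X)"
    by (rule sum_mono) (rule one)
  also have "\<dots> = (\<integral>\<^sup>+x. (\<Sum>i\<in>I. ennreal (sqrt (\<phi> x) * sqrt (f i x))) \<partial>count_space X)"
    by (rule nn_integral_sum[symmetric]) simp
  also have "\<dots> \<le> (\<integral>\<^sup>+x. ennreal (sqrt (measure \<nu> {x})) \<partial>count_space X)"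
  proof (rule nn_integral_mono)
    fix x assume "x \<in> space (count_space X)"
    then have x: "x \<in> X" by simp
    have "(\<Sum>i\<in>I. ennreal (sqrt (\<phi> x) * sqrt (f i x))) = ennreal (\<Sum>i\<in>I. sqrt (\<phi> x) * sqrt (f i x))"
      using \<phi>[OF x] f by (intro sum_ennreal) (simp add: less_imp_le)
    also have "(\<Sum>i\<in>I. sqrt (\<phi> x) * sqrt (f i x)) = sqrt (\<phi> x) * (\<Sum>i\<in>I. sqrt (f i x))"
      by (simp add: sum_distrib_left)
    also have "\<dots> \<le> sqrt (\<phi> x) * 1"
      by (rule mult_left_mono[OF sum_sqrt_disjoint_le_one[OF I f dis]]) (use \<phi>[OF x] in auto)
    finally show "(\<Sum>i\<in>I. ennreal (sqrt (\<phi> x) * sqrt (f i x))) \<le> ennreal (sqrt (measure \<nu> {x}))"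
      by (simp add: m\<phi>[OF x] ennreal_leI)
  qed
  also have "\<dots> = (\<integral>\<^sup>+x. ennreal (sqrt (measure \<nu> {x})) * indicator X x \<partial>count_space (torus L))"
    using X(2) by (simp add: nn_integral_count_space_indicator[of X] nn_integral_count_space_indicator[of "torus L"])
       (rule nn_integral_cong, auto simp: indicator_def)
  also have "\<dots> \<le> atom_sum L \<nu>"
    unfolding atom_sum_def by (rule nn_integral_mono) (simp add: indicator_def)
  finally show ?thesis .
qed

text \<open>With \<open>d\<close> a positive lower bound for all pairwise distances, each bump
  decays to 0 within distance \<open>d / 2\<close>; two of them cannot be positive at the same
  point.\<close>

lemma disjoint_compacts_bumps:
  fixes K :: "'i \<Rightarrow> 'a::heine_borel set"
  assumes I: "finite I" and K: "\<And>i. i \<in> I \<Longrightarrow> compact (K i)"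
    and dis: "\<And>i j. i \<in> I \<Longrightarrow> j \<in> I \<Longrightarrow> i \<noteq> j \<Longrightarrow> K i \<inter> K j = {}"
  shows "\<exists>f :: 'i \<Rightarrow> 'a \<Rightarrow> real. (\<forall>i. continuous_on UNIV (f i)) \<and> (\<forall>i x. 0 \<le> f i x \<and> f i x \<le> 1) \<and>
    (\<forall>i. \<forall>x\<in>K i. f i x = 1) \<and> (\<forall>i\<in>I. \<forall>j\<in>I. i \<noteq> j \<longrightarrow> (\<forall>x. f i x * f j x = 0))"
proof -
  have "\<exists>d>0. \<forall>x\<in>K i. \<forall>y\<in>K j. d \<le> dist x y" if "i \<in> I" "j \<in> I" "i \<noteq> j" for i j
    by (rule separate_compact_closed[OF K[OF that(1)] compact_imp_closed[OF K[OF that(2)]] dis[OF that]])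
  then have "\<forall>p\<in>{p \<in> I \<times> I. fst p \<noteq> snd p}. \<exists>d>0. \<forall>x\<in>K (fst p). \<forall>y\<in>K (snd p). d \<le> dist x y" by auto
  from bchoice[OF this] obtain D where D': "\<forall>p\<in>{p \<in> I \<times> I. fst p \<noteq> snd p}. 0 < D p \<and> (\<forall>x\<in>K (fst p). \<forall>y\<in>K (snd p). D p \<le> dist x y)"
    by blast
  have D: "0 < D (i, j) \<and> (\<forall>x\<in>K i. \<forall>y\<in>K j. D (i, j) \<le> dist x y)" if "i \<in> I" "j \<in> I" "i \<noteq> j" for i j
    using bspec[OF D', of "(i, j)"] that by simp
  define d where "d = Min (insert 1 (D ` {p \<in> I \<times> I. fst p \<noteq> snd p}))"
  have fin: "finite (insert 1 (D ` {p \<in> I \<times> I. fst p \<noteq> snd p}))" using I by simp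
  have d0: "d > 0" unfolding d_def using D' by (subst Min_gr_iff[OF fin]) auto
  have dle: "d \<le> D (i, j)" if "i \<in> I" "j \<in> I" "i \<noteq> j" for i j
    unfolding d_def using that by (intro Min_le[OF fin]) auto
  define f where "f i x = (if K i = {} then 0 else max 0 (1 - 2 * infdist x (K i) / d))" for i x
  show ?thesis
  proof (intro exI[of _ f] conjI allI ballI impI)
    show "continuous_on UNIV (f i)" for i
      unfolding f_def using d0 by (cases "K i = {}") (auto intro!: continuous_intros)
    show "0 \<le> f i x" "f i x \<le> 1" for i x
      using d0 infdist_nonneg[of x "K i"] by (simp_all add: f_def)
    show "f i x = 1" if "x \<in> K i" for i x using that by (auto simp: f_def)
    fix i j x assume ij: "i \<in> I" "j \<in> I" "i \<noteq> j"
    show "f i x * f j x = 0"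
    proof (rule ccontr)
      assume "f i x * f j x \<noteq> 0"
      then have nz: "f i x \<noteq> 0" "f j x \<noteq> 0" by auto
      have close: "\<exists>y\<in>K k. dist x y < d / 2" if "f k x \<noteq> 0" for k
      proof -
        have ne: "K k \<noteq> {}" and "0 < 1 - 2 * infdist x (K k) / d" using that by (auto simp: f_def split: if_splits)
        then have "infdist x (K k) < d / 2" using d0 by (simp add: field_simps)
        moreover have "d / 2 \<le> infdist x (K k)" if "\<not> ?thesis"
          unfolding infdist_notempty[OF ne] by (rule cINF_greatest[OF ne]) (use that in force)
        ultimately show ?thesis by linarith
      qed
      obtain y z where "y \<in> K i" "dist x y < d / 2" "z \<in> K j" "dist x z < d / 2" using close[OF nz(1)] close[OF nz(2)] by blast
      moreover then have "d \<le> dist y z" using D[OF ij] dle[OF ij] by force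
      ultimately show False using dist_triangle3[of y z x] by simp
    qed
  qed
qed

context
  fixes L :: real and \<nu> :: "nat \<Rightarrow> (real^2) measure" and N :: "(real^2) measure"
  assumes L: "L > 0" and \<nu>: "\<And>n. finite_borel_measure (torus L) (\<nu> n)" and at: "\<And>n. countable_dirac_sum L (\<nu> n)"
    and N: "finite_borel_measure (torus L) N"
    and conv: "\<And>f :: real^2 \<Rightarrow> real. continuous_on UNIV f \<Longrightarrow> periodic L f \<Longrightarrow> (\<lambda>n. \<integral>x. f x \<partial>\<nu> n) \<longlonglongrightarrow> (\<integral>x. f x \<partial>N)"
begin

text \<open>Inner regularity replaces the sets by disjoint compact sets in the embedded torus, and
  disjoint bumps on these are continuous test functions. For each atomic measure of the sequence the
  bumps are bounded by the atom sum, and their integrals converge.\<close>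

lemma disjoint_sets_le_liminf:
  fixes B :: "'i \<Rightarrow> (real^2) set"
  assumes I: "finite I" and B: "\<And>i. i \<in> I \<Longrightarrow> B i \<in> sets N"
    and dis: "\<And>i j. i \<in> I \<Longrightarrow> j \<in> I \<Longrightarrow> i \<noteq> j \<Longrightarrow> B i \<inter> B j = {}"
  shows "(\<Sum>i\<in>I. ennreal (sqrt (measure N (B i)))) \<le> liminf (\<lambda>n. atom_sum L (\<nu> n))"
proof -
  interpret N: finite_measure N using N by (simp add: finite_borel_measure_def)
  let ?e = "torus_emb L" and ?r = "torus_inv L"
  have em: "?e \<in> measurable N borel"
    by (rule borel_measurable_torus_measure[OF N borel_measurable_continuous_onI[OF continuous_torus_emb]])
  define M where "M = distr N borel ?e"
  interpret M: finite_measure M unfolding M_def by (rule N.finite_measure_distr[OF em])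
  have sM: "sets M = sets borel" by (simp add: M_def)
  have rB: "?r -` B i \<in> sets borel" if "i \<in> I" for i
  proof -
    have "B i \<in> sets borel" using B[OF that] N by (simp add: finite_borel_measure_def sets_torus)
    then show ?thesis using measurable_sets[OF torus_inv_measurable] by simp
  qed
  have MB: "measure M (?r -` B i) = measure N (B i)" if i: "i \<in> I" for i
  proof -
    have sub: "B i \<subseteq> torus L" using B[OF i] N by (simp add: finite_borel_measure_def sets_torus)
    have "x \<in> ?e -` (?r -` B i) \<inter> space N \<longleftrightarrow> x \<in> B i" for x
    proof (cases "x \<in> torus L")
      case True
      then show ?thesis by (simp add: torus_inv_emb_torus[OF L True] space_torus_measure[OF N])
    next
      case False
      then show ?thesis using sub by (auto simp: space_torus_measure[OF N])
    qed
    then have "?e -` (?r -` B i) \<inter> space N = B i" by blast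
    then show ?thesis unfolding M_def by (simp add: measure_distr[OF em rB[OF i]])
  qed
  \<comment> \<open>Regularity is applied to the image measure on Euclidean space; compactness there
    respects the gluing of opposite faces.\<close>
  have approx: "\<exists>K. compact K \<and> K \<subseteq> ?r -` B i \<and> measure N (B i) - e < measure M K" if i: "i \<in> I" and e: "e > 0" for i e
  proof (rule ccontr)
    assume no: "\<not> ?thesis"
    have "emeasure M (?r -` B i) = (SUP K\<in>{K. K \<subseteq> ?r -` B i \<and> compact K}. emeasure M K)"
      by (rule inner_regular[OF sM _ rB[OF i]]) simp
    also have "\<dots> \<le> ennreal (measure N (B i) - e)"
    proof (rule SUP_least)
      fix K assume "K \<in> {K. K \<subseteq> ?r -` B i \<and> compact K}"
      then have "measure M K \<le> measure N (B i) - e" using no by auto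
      then show "emeasure M K \<le> ennreal (measure N (B i) - e)" by (simp add: M.emeasure_eq_measure ennreal_leI)
    qed
    finally have le: "ennreal (measure N (B i)) \<le> ennreal (measure N (B i) - e)"
      by (simp add: M.emeasure_eq_measure MB[OF i])
    show False
    proof (cases "measure N (B i) - e \<ge> 0")
      case True
      then show ?thesis using le e by simp
    next
      case False
      then have "ennreal (measure N (B i) - e) = 0" by (simp add: ennreal_neg)
      then have z: "measure N (B i) = 0" using le by simp
      have "measure M {} \<le> measure N (B i) - e" using no by fastforce
      then show ?thesis using z e no[unfolded not_ex, rule_format, of "{}"] by simp
    qed
  qed
  define \<epsilon> where "\<epsilon> j = 1 / real (Suc j)" for j
  have \<epsilon>: "\<epsilon> j > 0" for j by (simp add: \<epsilon>_def)
  have "\<forall>j. \<forall>i\<in>I. \<exists>K. compact K \<and> K \<subseteq> ?r -` B i \<and> measure N (B i) - \<epsilon> j < measure M K"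
    by (intro allI ballI approx \<epsilon>)
  then have "\<forall>j. \<exists>K. \<forall>i\<in>I. compact (K i) \<and> K i \<subseteq> ?r -` B i \<and> measure N (B i) - \<epsilon> j < measure M (K i)"
    by (intro allI bchoice) simp
  from choice[OF this] obtain K where K: "\<And>j i. i \<in> I \<Longrightarrow> compact (K j i)" "\<And>j i. i \<in> I \<Longrightarrow> K j i \<subseteq> ?r -` B i"
    "\<And>j i. i \<in> I \<Longrightarrow> measure N (B i) - \<epsilon> j < measure M (K j i)" by blast
  have Klim: "(\<lambda>j. measure M (K j i)) \<longlonglongrightarrow> measure N (B i)" if i: "i \<in> I" for i
  proof (rule real_tendsto_sandwich)
    show "(\<lambda>j. measure N (B i) - \<epsilon> j) \<longlonglongrightarrow> measure N (B i)"
      unfolding \<epsilon>_def using LIMSEQ_inverse_real_of_nat tendsto_diff[OF tendsto_const, of _ 0 sequentially "measure N (B i)"]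
      by (simp add: inverse_eq_divide)
    show "(\<lambda>j. measure N (B i)) \<longlonglongrightarrow> measure N (B i)" by simp
    show "eventually (\<lambda>j. measure N (B i) - \<epsilon> j \<le> measure M (K j i)) sequentially"
      using K(3)[OF i] by (intro always_eventually allI less_imp_le)
    have "measure M (K j i) \<le> measure N (B i)" for j
      using M.finite_measure_mono[OF K(2)[OF i]] rB[OF i] by (simp add: sM MB[OF i])
    then show "eventually (\<lambda>j. measure M (K j i) \<le> measure N (B i)) sequentially" by simp
  qed
  have main: "(\<Sum>i\<in>I. ennreal (sqrt (measure M (K j i)))) \<le> liminf (\<lambda>n. atom_sum L (\<nu> n))" for j
  proof -
    have disK: "K j i \<inter> K j i' = {}" if "i \<in> I" "i' \<in> I" "i \<noteq> i'" for i i'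
      using K(2)[OF that(1), of j] K(2)[OF that(2), of j] dis[OF that] by blast
    obtain f :: "'i \<Rightarrow> (real^2) \<times> (real^2) \<Rightarrow> real" where f': "(\<forall>i. continuous_on UNIV (f i)) \<and> (\<forall>i x. 0 \<le> f i x \<and> f i x \<le> 1) \<and>
      (\<forall>i. \<forall>x\<in>K j i. f i x = 1) \<and> (\<forall>i\<in>I. \<forall>i'\<in>I. i \<noteq> i' \<longrightarrow> (\<forall>x. f i x * f i' x = 0))"
      using disjoint_compacts_bumps[where K="K j", OF I K(1) disK] by (rule exE)
    note f'2 = conjunct2[OF f'] and f'3 = conjunct2[OF conjunct2[OF f']]
    have f: "continuous_on UNIV (f i)" for i by (rule spec[OF conjunct1[OF f']])
    have f01: "0 \<le> f i x \<and> f i x \<le> 1" for i x by (rule spec[OF spec[OF conjunct1[OF f'2]]])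
    have f1: "f i x = 1" if "x \<in> K j i" for i x by (rule bspec[OF spec[OF conjunct1[OF f'3]] that])
    have fd: "f i x * f i' x = 0" if "i \<in> I" "i' \<in> I" "i \<noteq> i'" for i i' x
      by (rule spec[OF mp[OF bspec[OF bspec[OF conjunct2[OF f'3] that(1)] that(2)] that(3)]])
    have fc: "continuous_on UNIV (\<lambda>x. f i (?e x))" for i
      by (rule continuous_on_compose2[OF f continuous_torus_emb]) simp
    have fp: "periodic L (\<lambda>x. f i (?e x))" for i by (rule periodic_torus_emb[OF L])
    have le: "(\<Sum>i\<in>I. ennreal (sqrt (\<integral>x. f i (?e x) \<partial>\<nu> n))) \<le> atom_sum L (\<nu> n)" for n
    proof (rule disjoint_functions_le_atom_sum[OF \<nu> at I])
      show "(\<lambda>x. f i (?e x)) \<in> borel_measurable (\<nu> n)" for i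
        by (rule borel_measurable_torus_measure[OF \<nu> borel_measurable_continuous_onI[OF fc]])
    qed (rule f01, rule fd)
    have KM: "measure M (K j i) \<le> (\<integral>x. f i (?e x) \<partial>N)" if i: "i \<in> I" for i
    proof -
      have Ks: "K j i \<in> sets M" using compact_imp_closed[OF K(1)[OF i]] by (simp add: sM)
      have fb: "f i \<in> borel_measurable borel" by (rule borel_measurable_continuous_onI[OF f])
      have "measure M (K j i) = (\<integral>z. indicator (K j i) z \<partial>M)" using Ks by simp
      also have "\<dots> \<le> (\<integral>z. f i z \<partial>M)"
      proof (rule integral_mono)
        show "integrable M (indicator (K j i) :: _ \<Rightarrow> real)"
          by (rule integrable_real_indicator[OF Ks]) (simp add: M.emeasure_eq_measure)
        show "integrable M (f i)"
          by (rule M.integrable_const_bound[of _ 1]) (use f01[of i] fb in \<open>auto simp: measurable_cong_sets[OF sM refl]\<close>)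
        show "indicator (K j i) z \<le> f i z" for z using f01[of i z] f1[of z i] by (auto simp: indicator_def)
      qed
      also have "\<dots> = (\<integral>x. f i (?e x) \<partial>N)" unfolding M_def by (rule integral_distr[OF em fb])
      finally show ?thesis .
    qed
    have "(\<lambda>n. \<Sum>i\<in>I. ennreal (sqrt (\<integral>x. f i (?e x) \<partial>\<nu> n))) \<longlonglongrightarrow> (\<Sum>i\<in>I. ennreal (sqrt (\<integral>x. f i (?e x) \<partial>N)))"
      by (intro tendsto_sum tendsto_ennrealI tendsto_real_sqrt conv fc fp)
    then have "(\<Sum>i\<in>I. ennreal (sqrt (\<integral>x. f i (?e x) \<partial>N))) = liminf (\<lambda>n. \<Sum>i\<in>I. ennreal (sqrt (\<integral>x. f i (?e x) \<partial>\<nu> n)))"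
      by (intro lim_imp_Liminf[symmetric]) auto
    also have "\<dots> \<le> liminf (\<lambda>n. atom_sum L (\<nu> n))" by (intro Liminf_mono always_eventually allI le)
    finally have "(\<Sum>i\<in>I. ennreal (sqrt (\<integral>x. f i (?e x) \<partial>N))) \<le> liminf (\<lambda>n. atom_sum L (\<nu> n))" .
    moreover have "(\<Sum>i\<in>I. ennreal (sqrt (measure M (K j i)))) \<le> (\<Sum>i\<in>I. ennreal (sqrt (\<integral>x. f i (?e x) \<partial>N)))"
      by (intro sum_mono ennreal_leI real_sqrt_le_mono KM)
    ultimately show ?thesis by (rule order_trans[rotated])
  qed
  have "(\<lambda>j. \<Sum>i\<in>I. ennreal (sqrt (measure M (K j i)))) \<longlonglongrightarrow> (\<Sum>i\<in>I. ennreal (sqrt (measure N (B i))))"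
    by (intro tendsto_sum tendsto_ennrealI tendsto_real_sqrt Klim)
  then show ?thesis by (rule LIMSEQ_le_const2) (use main in blast)
qed

end

section \<open>Dyadic cells as a measurable substitute for atoms\<close>

definition cell :: "real \<Rightarrow> nat \<Rightarrow> real^2 \<Rightarrow> int \<times> int"
  where "cell L k x = (\<lfloor>2 ^ k * (x $ 1 / L)\<rfloor>, \<lfloor>2 ^ k * (x $ 2 / L)\<rfloor>)"

lemma floor_double_div: "\<lfloor>2 ^ Suc k * (y::real)\<rfloor> div 2 = \<lfloor>2 ^ k * y\<rfloor>"
  using floor_divide_real_eq_div[of 2 "2 ^ Suc k * y"] by simp

lemma cell_refine: "cell L (Suc k) x = cell L (Suc k) y \<Longrightarrow> cell L k x = cell L k y"
  unfolding cell_def prod.inject floor_double_div[of k, symmetric] by simp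

lemma finite_cells: "L > 0 \<Longrightarrow> finite (cell L k ` torus L)"
proof -
  assume L: "L > 0"
  have "cell L k ` torus L \<subseteq> {- (2 ^ k)..2 ^ k} \<times> {- (2 ^ k)..2 ^ k}"
  proof
    fix c assume "c \<in> cell L k ` torus L"
    then obtain x where x: "x \<in> torus L" "c = cell L k x" by auto
    have "\<lfloor>2 ^ k * (x $ i / L)\<rfloor> \<in> {- (2 ^ k)..2 ^ k}" for i
    proof -
      have "- L / 2 \<le> x $ i" "x $ i < L / 2" using x(1) by (simp_all add: torus_def)
      then have "- 1 \<le> x $ i / L" "x $ i / L \<le> 1" using L by (simp_all add: field_simps)
      then have "2 ^ k * (- 1) \<le> 2 ^ k * (x $ i / L)" "2 ^ k * (x $ i / L) \<le> 2 ^ k * 1"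
        by (intro mult_left_mono; simp)+
      then have "of_int (- (2 ^ k)) \<le> 2 ^ k * (x $ i / L)" "2 ^ k * (x $ i / L) < of_int (2 ^ k) + 1" by simp_all
      then show ?thesis by (simp add: le_floor_iff floor_le_iff)
    qed
    then show "c \<in> {- (2 ^ k)..2 ^ k} \<times> {- (2 ^ k)..2 ^ k}" using x by (simp add: cell_def)
  qed
  then show ?thesis by (rule finite_subset) simp
qed

lemma cell_separates:
  assumes L: "L > 0" and xy: "x \<noteq> y"
  shows "eventually (\<lambda>k. cell L k x \<noteq> cell L k y) sequentially"
proof -
  obtain i where i: "x $ i \<noteq> y $ i" using xy by (auto simp: vec_eq_iff)
  define d where "d = \<bar>x $ i / L - y $ i / L\<bar>"
  have d: "d > 0" using i L by (simp add: d_def)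
  obtain k0 where k0: "(1 / 2) ^ k0 < d" using real_arch_pow_inv[OF d, of "1/2"] by auto
  have "cell L k x \<noteq> cell L k y" if k: "k \<ge> k0" for k
  proof
    assume "cell L k x = cell L k y"
    then have eq: "\<lfloor>2 ^ k * (x $ i / L)\<rfloor> = \<lfloor>2 ^ k * (y $ i / L)\<rfloor>"
      using exhaust_2[of i] by (auto simp: cell_def)
    have "\<bar>2 ^ k * (x $ i / L) - 2 ^ k * (y $ i / L)\<bar> < 1" using eq by linarith
    also have "2 ^ k * (x $ i / L) - 2 ^ k * (y $ i / L) = 2 ^ k * (x $ i / L - y $ i / L)" by (simp add: right_diff_distrib)
    finally have "2 ^ k * d < 1" by (simp add: d_def abs_mult)
    moreover have "(1 / 2 :: real) ^ k \<le> (1 / 2) ^ k0" using k by (intro power_decreasing) auto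
    then have "(1 / 2) ^ k < d" using k0 by (rule le_less_trans)
    then have "1 < 2 ^ k * d" by (simp add: power_divide field_simps)
    ultimately show False by simp
  qed
  then show ?thesis unfolding eventually_sequentially by blast
qed

lemma cell_measurable: "{x \<in> torus L. cell L k x = c} \<in> sets (restrict_space borel (torus L))"
proof -
  have "{x \<in> torus L. cell L k x = c} = torus L \<inter> ({x. \<lfloor>2 ^ k * (x $ 1 / L)\<rfloor> = fst c} \<inter> {x. \<lfloor>2 ^ k * (x $ 2 / L)\<rfloor> = snd c})"
    by (auto simp: cell_def)
  moreover have "{x. \<lfloor>2 ^ k * (x $ i / L)\<rfloor> = a} \<in> sets (borel :: (real^2) measure)" for i and a :: int
  proof -
    have "{x \<in> space borel. \<lfloor>2 ^ k * (x $ i / L)\<rfloor> = a} \<in> sets (borel :: (real^2) measure)" by measurable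
    then show ?thesis by simp
  qed
  ultimately show ?thesis using torus_borel by (auto simp: sets_torus)
qed

text \<open>A finite sum over fixed Borel sets, hence measurable in time along a kernel. It stands
  in for the uncountable sum over points in \<open>atom_sum\<close>.\<close>

definition cell_sum :: "real \<Rightarrow> nat \<Rightarrow> (real^2) measure \<Rightarrow> ennreal"
  where "cell_sum L k \<nu> = (\<Sum>c\<in>cell L k ` torus L. ennreal (sqrt (measure \<nu> {x \<in> torus L. cell L k x = c})))"

lemma countable_atoms:
  assumes \<nu>: "finite_borel_measure (torus L) \<nu>"
  shows "countable {x. measure \<nu> {x} \<noteq> 0}" "{x. measure \<nu> {x} \<noteq> 0} \<subseteq> torus L"
proof -
  interpret finite_measure \<nu> using \<nu> by (simp add: finite_borel_measure_def)
  show "countable {x. measure \<nu> {x} \<noteq> 0}" by (rule countable_support)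
  show "{x. measure \<nu> {x} \<noteq> 0} \<subseteq> torus L"
  proof
    fix x assume "x \<in> {x. measure \<nu> {x} \<noteq> 0}"
    then have "{x} \<in> sets \<nu>" by (metis mem_Collect_eq measure_notin_sets)
    then show "x \<in> torus L" using \<nu> by (simp add: finite_borel_measure_def sets_torus)
  qed
qed

text \<open>A finite measure has countably many atoms; exhausting them by finite sets and monotone
  convergence bounds the whole sum.\<close>

lemma atom_sum_le:
  assumes \<nu>: "finite_borel_measure (torus L) \<nu>"
    and fin: "\<And>F. finite F \<Longrightarrow> F \<subseteq> torus L \<Longrightarrow> (\<Sum>x\<in>F. ennreal (sqrt (measure \<nu> {x}))) \<le> C"
  shows "atom_sum L \<nu> \<le> C"
proof -
  let ?A = "{x. measure \<nu> {x} \<noteq> 0}" and ?g = "\<lambda>x. ennreal (sqrt (measure \<nu> {x}))"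
  note A = countable_atoms[OF \<nu>]
  define F where "F n = {x \<in> ?A. to_nat_on ?A x < n}" for n
  have inj: "inj_on (to_nat_on ?A) ?A" by (rule inj_on_to_nat_on[OF A(1)])
  have Ff: "finite (F n)" for n
  proof (rule finite_imageD)
    show "finite (to_nat_on ?A ` F n)" by (rule finite_subset[of _ "{..<n}"]) (auto simp: F_def)
    show "inj_on (to_nat_on ?A) (F n)" by (rule inj_on_subset[OF inj]) (auto simp: F_def)
  qed
  have FA: "F n \<subseteq> torus L" for n using A(2) by (auto simp: F_def)
  have "atom_sum L \<nu> = (\<integral>\<^sup>+x. (SUP n. ?g x * indicator (F n) x) \<partial>count_space (torus L))"
    unfolding atom_sum_def
  proof (rule nn_integral_cong)
    fix x
    show "?g x = (SUP n. ?g x * indicator (F n) x)"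
    proof (cases "x \<in> ?A")
      case True
      show ?thesis
      proof (rule antisym)
        show "?g x \<le> (SUP n. ?g x * indicator (F n) x)"
          by (rule SUP_upper2[of "Suc (to_nat_on ?A x)"]) (use True in \<open>auto simp: F_def\<close>)
        show "(SUP n. ?g x * indicator (F n) x) \<le> ?g x" by (rule SUP_least) (simp add: indicator_def)
      qed
    qed simp
  qed
  also have "\<dots> = (SUP n. \<integral>\<^sup>+x. ?g x * indicator (F n) x \<partial>count_space (torus L))"
  proof (rule nn_integral_monotone_convergence_SUP)
    show "incseq (\<lambda>n x. ?g x * indicator (F n) x)"
      by (rule incseq_SucI) (auto simp: le_fun_def F_def indicator_def)
  qed simp
  also have "\<dots> \<le> C"
  proof (rule SUP_least)
    fix n
    have "(\<integral>\<^sup>+x. ?g x * indicator (F n) x \<partial>count_space (torus L)) = (\<Sum>x\<in>F n. ?g x * indicator (F n) x)"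
      by (rule nn_integral_count_space'[OF Ff]) (use FA in \<open>auto simp: indicator_def\<close>)
    also have "\<dots> = (\<Sum>x\<in>F n. ?g x)" by (rule sum.cong) auto
    also have "\<dots> \<le> C" by (rule fin[OF Ff FA])
    finally show "(\<integral>\<^sup>+x. ?g x * indicator (F n) x \<partial>count_space (torus L)) \<le> C" .
  qed
  finally show ?thesis .
qed

text \<open>Finitely many atoms lie in different cells once the cells are fine enough. Conversely
  the indicators of the cells are disjoint functions, to which atomicity applies; for a nonzero
  diffuse measure the atom sum is 0 and the cell sums are not.\<close>

lemma atom_sum_eq_SUP_cell_sum:
  assumes L: "L > 0" and \<nu>: "finite_borel_measure (torus L) \<nu>" and at: "countable_dirac_sum L \<nu>"
  shows "atom_sum L \<nu> = (SUP k. cell_sum L k \<nu>)"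
proof (rule antisym)
  interpret finite_measure \<nu> using \<nu> by (simp add: finite_borel_measure_def)
  have cm: "{x \<in> torus L. cell L k x = c} \<in> sets \<nu>" for k c
    using cell_measurable \<nu> by (simp add: finite_borel_measure_def)
  show "atom_sum L \<nu> \<le> (SUP k. cell_sum L k \<nu>)"
  proof (rule atom_sum_le[OF \<nu>])
    fix F assume F: "finite F" "F \<subseteq> torus L"
    have "eventually (\<lambda>k. \<forall>p\<in>{p \<in> F \<times> F. fst p \<noteq> snd p}. cell L k (fst p) \<noteq> cell L k (snd p)) sequentially"
      by (intro eventually_ball_finite ballI cell_separates[OF L]) (use F in auto)
    then obtain k where k: "\<forall>p\<in>{p \<in> F \<times> F. fst p \<noteq> snd p}. cell L k (fst p) \<noteq> cell L k (snd p)"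
      by (auto simp: eventually_sequentially)
    then have inj: "inj_on (cell L k) F" by (auto simp: inj_on_def)
    have "(\<Sum>x\<in>F. ennreal (sqrt (measure \<nu> {x}))) \<le> (\<Sum>x\<in>F. ennreal (sqrt (measure \<nu> {y \<in> torus L. cell L k y = cell L k x})))"
      using F(2) by (intro sum_mono ennreal_leI real_sqrt_le_mono finite_measure_mono cm) auto
    also have "\<dots> = (\<Sum>c\<in>cell L k ` F. ennreal (sqrt (measure \<nu> {y \<in> torus L. cell L k y = c})))"
      by (subst sum.reindex[OF inj]) simp
    also have "\<dots> \<le> cell_sum L k \<nu>"
      unfolding cell_sum_def using F(2) by (intro sum_mono2 finite_cells[OF L]) auto
    also have "\<dots> \<le> (SUP k. cell_sum L k \<nu>)" by (rule SUP_upper) simp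
    finally show "(\<Sum>x\<in>F. ennreal (sqrt (measure \<nu> {x}))) \<le> (SUP k. cell_sum L k \<nu>)" .
  qed
  show "(SUP k. cell_sum L k \<nu>) \<le> atom_sum L \<nu>"
  proof (rule SUP_least)
    fix k
    let ?f = "\<lambda>c. indicator {x \<in> torus L. cell L k x = c} :: _ \<Rightarrow> real"
    have "(\<Sum>c\<in>cell L k ` torus L. ennreal (sqrt (\<integral>x. ?f c x \<partial>\<nu>))) \<le> atom_sum L \<nu>"
      by (rule disjoint_functions_le_atom_sum[OF \<nu> at finite_cells[OF L] borel_measurable_indicator[OF cm]])
         (auto simp: indicator_def)
    then show "cell_sum L k \<nu> \<le> atom_sum L \<nu>" using cm by (simp add: cell_sum_def)
  qed
qed

text \<open>The set of atoms is cut down to the points of \<open>F\<close> with positive mass, since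
  the weights in \<open>countable_dirac_sum\<close> must be strictly positive.\<close>

lemma countable_dirac_sumI:
  assumes \<nu>: "finite_borel_measure (torus L) \<nu>" and F: "countable F" "F \<subseteq> torus L" and null: "emeasure \<nu> (torus L - F) = 0"
  shows "countable_dirac_sum L \<nu>"
  unfolding countable_dirac_sum_def
proof (intro exI[of _ "{x \<in> F. measure \<nu> {x} \<noteq> 0}"] exI[of _ "\<lambda>x. measure \<nu> {x}"] conjI ballI)
  interpret finite_measure \<nu> using \<nu> by (simp add: finite_borel_measure_def)
  let ?X = "{x \<in> F. measure \<nu> {x} \<noteq> 0}"
  have sing: "{x} \<in> sets \<nu>" if "x \<in> torus L" for x using singleton_torus[OF that] \<nu> by (simp add: finite_borel_measure_def)
  show "countable ?X" by (rule countable_subset[OF _ F(1)]) auto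
  show "?X \<subseteq> torus L" using F by auto
  show "0 < measure \<nu> {x}" if "x \<in> ?X" for x using that measure_nonneg[of \<nu> "{x}"] by (simp add: less_le)
  fix B assume B: "B \<in> sets \<nu>"
  have Fs: "F \<in> sets \<nu>"
  proof -
    have "F \<in> sets borel" using F(1) by (rule sets.countable[rotated]) simp
    then show ?thesis using F(2) \<nu> by (simp add: finite_borel_measure_def sets_torus)
  qed
  have BT: "B \<subseteq> torus L" using sets.sets_into_space[OF B] by (simp add: space_torus_measure[OF \<nu>])
  have tL: "torus L \<in> sets \<nu>" using \<nu> torus_borel by (simp add: finite_borel_measure_def sets_torus)
  have "emeasure \<nu> B = emeasure \<nu> (B \<inter> F) + emeasure \<nu> (B - F)"
    using B Fs by (subst plus_emeasure) (auto simp: Int_Diff_Un)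
  also have "emeasure \<nu> (B - F) = 0"
    using emeasure_mono[of "B - F" "torus L - F" \<nu>] null BT tL Fs by auto
  also have "emeasure \<nu> (B \<inter> F) = (\<integral>\<^sup>+x. emeasure \<nu> {x} \<partial>count_space (B \<inter> F))"
    by (rule emeasure_countable_singleton) (use F BT sing in \<open>auto intro: countable_subset\<close>)
  also have "\<dots> = (\<integral>\<^sup>+x. ennreal (measure \<nu> {x}) * indicator B x \<partial>count_space ?X)"
  proof -
    have e: "(\<integral>\<^sup>+x. g x \<partial>count_space Y) = (\<integral>\<^sup>+x. g x * indicator Y x \<partial>count_space UNIV)" for g and Y :: "(real^2) set"
      by (rule nn_integral_count_space_indicator) (simp add: NO_MATCH_def)
    show ?thesis
      unfolding e[where Y="B \<inter> F"] e[where Y="?X"]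
      by (rule nn_integral_cong) (auto simp: indicator_def emeasure_eq_measure)
  qed
  finally show "emeasure \<nu> B = (\<integral>\<^sup>+x. ennreal (measure \<nu> {x}) * indicator B x \<partial>count_space ?X)" by simp
qed

section \<open>Weak limits of atomic measures\<close>

context
  fixes L :: real and \<nu> :: "nat \<Rightarrow> (real^2) measure" and N :: "(real^2) measure"
  assumes L: "L > 0" and \<nu>: "\<And>n. finite_borel_measure (torus L) (\<nu> n)" and at: "\<And>n. countable_dirac_sum L (\<nu> n)"
    and N: "finite_borel_measure (torus L) N"
    and conv: "\<And>f :: real^2 \<Rightarrow> real. continuous_on UNIV f \<Longrightarrow> periodic L f \<Longrightarrow> (\<lambda>n. \<integral>x. f x \<partial>\<nu> n) \<longlonglongrightarrow> (\<integral>x. f x \<partial>N)"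
begin

lemma atom_sum_lower_semicontinuous: "atom_sum L N \<le> liminf (\<lambda>n. atom_sum L (\<nu> n))"
proof (rule atom_sum_le[OF N])
  fix F assume F: "finite F" "F \<subseteq> torus L"
  show "(\<Sum>x\<in>F. ennreal (sqrt (measure N {x}))) \<le> liminf (\<lambda>n. atom_sum L (\<nu> n))"
  proof (rule disjoint_sets_le_liminf[OF L \<nu> at N conv F(1)])
    show "{x} \<in> sets N" if "x \<in> F" for x
      using singleton_torus[of x L] that F(2) N by (auto simp: finite_borel_measure_def)
  qed auto
qed

text \<open>The sums of square roots over dyadic cells are bounded by \<open>l\<close> at every
  level. Cells of mass at most \<epsilon> therefore have total mass at most
  \<open>l * sqrt \<epsilon>\<close>, and every point without mass eventually lies in such a cell.
  Letting \<epsilon> tend to 0, the set of such points has measure 0.\<close>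

lemma limit_atomic:
  assumes fin: "liminf (\<lambda>n. atom_sum L (\<nu> n)) < \<infinity>"
  shows "countable_dirac_sum L N"
proof -
  interpret finite_measure N using N by (simp add: finite_borel_measure_def)
  let ?Q = "\<lambda>k c. {x \<in> torus L. cell L k x = c}"
  let ?I = "\<lambda>k. cell L k ` torus L"
  obtain l where l: "liminf (\<lambda>n. atom_sum L (\<nu> n)) = ennreal l" "0 \<le> l"
    using fin by (cases "liminf (\<lambda>n. atom_sum L (\<nu> n))") auto
  have Qm: "?Q k c \<in> sets N" for k c using cell_measurable N by (simp add: finite_borel_measure_def)
  have Qsub: "?Q (Suc k) (cell L (Suc k) x) \<subseteq> ?Q k (cell L k x)" for k x using cell_refine by blast
  have sum_le: "(\<Sum>c\<in>?I k. sqrt (measure N (?Q k c))) \<le> l" for k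
  proof -
    have "(\<Sum>c\<in>?I k. ennreal (sqrt (measure N (?Q k c)))) \<le> liminf (\<lambda>n. atom_sum L (\<nu> n))"
    proof (rule disjoint_sets_le_liminf[OF L \<nu> at N conv finite_cells[OF L] Qm])
      show "?Q k c \<inter> ?Q k c' = {}" if "c \<noteq> c'" for c c' using that by blast
    qed
    then show ?thesis using l by (simp add: sum_ennreal)
  qed
  let ?A = "{x. measure N {x} \<noteq> 0}"
  note A = countable_atoms[OF N]
  define D where "D = torus L - ?A"
  have As: "?A \<in> sets N"
  proof -
    have "?A \<in> sets borel" using A(1) by (rule sets.countable[rotated]) simp
    then show ?thesis using A(2) N by (simp add: finite_borel_measure_def sets_torus)
  qed
  have Ds: "D \<in> sets N"
    unfolding D_def using As N torus_borel by (intro sets.Diff) (simp_all add: finite_borel_measure_def sets_torus)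
  have bound: "measure N D \<le> l * sqrt \<epsilon>" if \<epsilon>: "\<epsilon> > 0" for \<epsilon>
  proof -
    let ?J = "\<lambda>k. {c \<in> ?I k. measure N (?Q k c) \<le> \<epsilon>}"
    \<comment> \<open>The points of \<open>D\<close> whose cell of level \<open>k\<close> is already
      light. The sets grow with \<open>k\<close>, and they exhaust \<open>D\<close> because the
      cells around a point shrink to that point.\<close>
    define E where "E k = (\<Union>c\<in>?J k. ?Q k c) \<inter> D" for k
    have Jf: "finite (?J k)" for k using finite_cells[OF L] by simp
    have Es: "E k \<in> sets N" for k
      unfolding E_def by (intro sets.Int sets.finite_UN Jf Qm Ds)
    have EQ: "x \<in> E k \<longleftrightarrow> x \<in> D \<and> measure N (?Q k (cell L k x)) \<le> \<epsilon>" for x k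
      by (auto simp: E_def D_def)
    have inc: "incseq E"
    proof (rule incseq_SucI, rule subsetI)
      fix k x assume x: "x \<in> E k"
      have "measure N (?Q (Suc k) (cell L (Suc k) x)) \<le> measure N (?Q k (cell L k x))"
        by (rule finite_measure_mono[OF Qsub Qm])
      then show "x \<in> E (Suc k)" using x by (simp add: EQ)
    qed
    have UE: "(\<Union>k. E k) = D"
    proof (intro equalityI subsetI)
      fix x assume x: "x \<in> D"
      have "(\<lambda>k. measure N (?Q k (cell L k x))) \<longlonglongrightarrow> measure N (\<Inter>k. ?Q k (cell L k x))"
        by (rule finite_Lim_measure_decseq[OF image_subsetI[OF Qm] decseq_SucI[where X="\<lambda>k. ?Q k (cell L k x)", OF Qsub]])
      moreover have "(\<Inter>k. ?Q k (cell L k x)) = {x}"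
      proof (intro equalityI subsetI)
        fix y assume y: "y \<in> (\<Inter>k. ?Q k (cell L k x))"
        have "y = x"
        proof (rule ccontr)
          assume "y \<noteq> x"
          from cell_separates[OF L this] obtain k where "cell L k y \<noteq> cell L k x" by (auto simp: eventually_sequentially)
          then show False using y by auto
        qed
        then show "y \<in> {x}" by simp
      qed (use x in \<open>auto simp: D_def\<close>)
      moreover have "measure N {x} = 0" using x by (simp add: D_def)
      ultimately have "(\<lambda>k. measure N (?Q k (cell L k x))) \<longlonglongrightarrow> 0" by simp
      from order_tendstoD(2)[OF this \<epsilon>] obtain k where "measure N (?Q k (cell L k x)) < \<epsilon>"
        by (auto simp: eventually_sequentially)
      then have "x \<in> E k" using x by (simp add: EQ)
      then show "x \<in> (\<Union>k. E k)" by blast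
    qed (auto simp: E_def)
    have "measure N (E k) \<le> l * sqrt \<epsilon>" for k
    proof -
      have "measure N (E k) \<le> measure N (\<Union>c\<in>?J k. ?Q k c)"
        by (rule finite_measure_mono) (auto simp: E_def intro!: sets.finite_UN Jf Qm)
      also have "\<dots> \<le> (\<Sum>c\<in>?J k. measure N (?Q k c))"
        by (rule finite_measure_subadditive_finite[OF Jf]) (use Qm in auto)
      \<comment> \<open>For a light cell, one of the two root factors of its mass is bounded by
        \<open>sqrt \<epsilon>\<close>.\<close>
      also have "\<dots> \<le> (\<Sum>c\<in>?J k. sqrt (measure N (?Q k c)) * sqrt \<epsilon>)"
      proof (rule sum_mono)
        fix c assume "c \<in> ?J k"
        then have "sqrt (measure N (?Q k c)) \<le> sqrt \<epsilon>" by simp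
        then have "sqrt (measure N (?Q k c)) * sqrt (measure N (?Q k c)) \<le> sqrt (measure N (?Q k c)) * sqrt \<epsilon>"
          by (rule mult_left_mono) simp
        then show "measure N (?Q k c) \<le> sqrt (measure N (?Q k c)) * sqrt \<epsilon>" by simp
      qed
      also have "\<dots> \<le> (\<Sum>c\<in>?I k. sqrt (measure N (?Q k c)) * sqrt \<epsilon>)"
        by (rule sum_mono2[OF finite_cells[OF L]]) (use \<epsilon> in auto)
      also have "\<dots> \<le> l * sqrt \<epsilon>"
        unfolding sum_distrib_right[symmetric] by (rule mult_right_mono[OF sum_le]) (use \<epsilon> in simp)
      finally show ?thesis .
    qed
    moreover have "(\<lambda>k. measure N (E k)) \<longlonglongrightarrow> measure N (\<Union>k. E k)"
      by (rule finite_Lim_measure_incseq[OF _ inc]) (use Es in auto)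
    ultimately show ?thesis unfolding UE by (intro LIMSEQ_le_const2) auto
  qed
  have "((\<lambda>\<epsilon>. l * sqrt \<epsilon>) \<longlongrightarrow> l * sqrt 0) (at_right 0)" by (intro tendsto_intros)
  moreover have "eventually (\<lambda>\<epsilon>. measure N D \<le> l * sqrt \<epsilon>) (at_right 0)"
    using bound by (intro eventually_at_rightI[of 0 1]) auto
  ultimately have "measure N D \<le> l * sqrt 0" by (rule tendsto_lowerbound) simp
  then have "measure N D = 0" using measure_nonneg[of N D] by simp
  then have "emeasure N (torus L - ?A) = 0" by (simp add: emeasure_eq_measure D_def)
  then show ?thesis by (rule countable_dirac_sumI[OF N A])
qed

end

section \<open>Limits of fluxes\<close>

text \<open>Indicators of closed sets of the embedded torus are limits of continuous functions,
  which gives measurability for a generator; complements use the constant mass and disjoint unions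
  are limits of partial sums.\<close>

lemma kernel_of_measurable_integrals:
  fixes \<kappa> :: "real \<Rightarrow> (real^2) measure"
  assumes L: "L > 0" and fin: "\<And>t. t \<in> {-T<..<T} \<Longrightarrow> finite_borel_measure (torus L) (\<kappa> t)"
    and mass: "\<And>t. t \<in> {-T<..<T} \<Longrightarrow> measure (\<kappa> t) (torus L) = M"
    and meas: "\<And>f :: real^2 \<Rightarrow> real. continuous_on UNIV f \<Longrightarrow> periodic L f \<Longrightarrow>
      (\<lambda>t. \<integral>x. f x \<partial>\<kappa> t) \<in> borel_measurable (restrict_space borel {-T<..<T})"
  shows "kernel L T \<kappa>"
proof -
  let ?R = "restrict_space borel {-T<..<T} :: real measure"
  let ?e = "torus_emb L" and ?r = "torus_inv L"
  have sp: "space ?R = {-T<..<T}" by (simp add: space_restrict_space)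
  have eA: "{x \<in> torus L. ?e x \<in> A} \<in> sets (restrict_space borel (torus L))" if A: "A \<in> sets borel" for A
  proof -
    have "?e -` A \<inter> space borel \<in> sets borel"
      by (rule measurable_sets[OF borel_measurable_continuous_onI[OF continuous_torus_emb] A])
    then have "torus L \<inter> ?e -` A \<in> sets borel" using torus_borel by auto
    moreover have "torus L \<inter> ?e -` A = {x \<in> torus L. ?e x \<in> A}" by auto
    ultimately show ?thesis by (simp add: sets_torus)
  qed
  have eA': "{x \<in> torus L. ?e x \<in> A} \<in> sets (\<kappa> t)" if "A \<in> sets borel" "t \<in> {-T<..<T}" for A t
    using eA[OF that(1)] fin[OF that(2)] by (simp add: finite_borel_measure_def)
  have main: "(\<lambda>t. measure (\<kappa> t) {x \<in> torus L. ?e x \<in> A}) \<in> borel_measurable ?R" if A: "A \<in> sets borel" for A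
  proof -
    have S: "sets (borel :: ((real^2) \<times> (real^2)) measure) = sigma_sets UNIV (Collect closed)"
      by (subst borel_eq_closed) simp
    have A': "A \<in> sigma_sets UNIV (Collect closed)" using A S by simp
    have stab: "Int_stable (Collect closed :: ((real^2) \<times> (real^2)) set set)" by (auto simp: Int_stable_def)
    have GP: "(Collect closed :: ((real^2) \<times> (real^2)) set set) \<subseteq> Pow UNIV" by simp
    show ?thesis
      using stab GP A'
    proof (induction rule: sigma_sets_induct_disjoint)
      case (basic C)
      then have C: "closed C" by simp
      obtain f :: "nat \<Rightarrow> (real^2) \<times> (real^2) \<Rightarrow> real" where f: "(\<forall>n. continuous_on UNIV (f n)) \<and> (\<forall>n x. 0 \<le> f n x \<and> f n x \<le> 1) \<and>
        (\<forall>x. (\<lambda>n. f n x) \<longlonglongrightarrow> indicator C x)"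
        using closed_indicator_limit[OF C] by (rule exE)
      have fc: "continuous_on UNIV (f n)" for n by (rule spec[OF conjunct1[OF f]])
      have f01: "0 \<le> f n x \<and> f n x \<le> 1" for n x by (rule spec[OF spec[OF conjunct1[OF conjunct2[OF f]]]])
      have lim: "(\<lambda>n. f n x) \<longlonglongrightarrow> indicator C x" for x by (rule spec[OF conjunct2[OF conjunct2[OF f]]])
      have fec: "continuous_on UNIV (\<lambda>x. f n (?e x))" for n
        by (rule continuous_on_compose2[OF fc continuous_torus_emb]) simp
      have fep: "periodic L (\<lambda>x. f n (?e x))" for n by (rule periodic_torus_emb[OF L])
      show ?case
      proof (rule borel_measurable_LIMSEQ_real)
        show "(\<lambda>t. \<integral>x. f n (?e x) \<partial>\<kappa> t) \<in> borel_measurable ?R" for n by (rule meas[OF fec fep])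
        fix t assume "t \<in> space ?R"
        then have t: "t \<in> {-T<..<T}" by (simp add: sp)
        interpret finite_measure "\<kappa> t" using fin[OF t] by (simp add: finite_borel_measure_def)
        have "(\<lambda>n. \<integral>x. f n (?e x) \<partial>\<kappa> t) \<longlonglongrightarrow> (\<integral>x. indicator {x \<in> torus L. ?e x \<in> C} x \<partial>\<kappa> t)"
        proof (rule integral_dominated_convergence[where w="\<lambda>_. 1"])
          show "(\<lambda>x. indicator {x \<in> torus L. ?e x \<in> C} x :: real) \<in> borel_measurable (\<kappa> t)"
            by (rule borel_measurable_indicator[OF eA'[OF _ t]]) (use C in simp)
          show "(\<lambda>x. f n (?e x)) \<in> borel_measurable (\<kappa> t)" for n
            by (rule borel_measurable_torus_measure[OF fin[OF t] borel_measurable_continuous_onI[OF fec]])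
          show "AE x in \<kappa> t. (\<lambda>n. f n (?e x)) \<longlonglongrightarrow> indicator {x \<in> torus L. ?e x \<in> C} x"
          proof (rule AE_I2)
            fix x assume "x \<in> space (\<kappa> t)"
            then have "indicator {x \<in> torus L. ?e x \<in> C} x = (indicator C (?e x) :: real)"
              by (simp add: space_torus_measure[OF fin[OF t]] indicator_def)
            then show "(\<lambda>n. f n (?e x)) \<longlonglongrightarrow> indicator {x \<in> torus L. ?e x \<in> C} x" using lim[of "?e x"] by simp
          qed
          show "AE x in \<kappa> t. norm (f n (?e x)) \<le> 1" for n using f01 by (intro AE_I2) simp
        qed simp
        then show "(\<lambda>n. \<integral>x. f n (?e x) \<partial>\<kappa> t) \<longlonglongrightarrow> measure (\<kappa> t) {x \<in> torus L. ?e x \<in> C}"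
          using eA'[OF _ t, of C] C by simp
      qed
    next
      case empty
      then show ?case by simp
    next
      case (compl A)
      have AB: "A \<in> sets borel" using compl.hyps S by simp
      have "(\<lambda>t. M - measure (\<kappa> t) {x \<in> torus L. ?e x \<in> A}) \<in> borel_measurable ?R" using compl.IH by measurable
      then show ?case
      proof (rule measurable_cong[THEN iffD1, rotated])
        fix t assume "t \<in> space ?R"
        then have t: "t \<in> {-T<..<T}" by (simp add: sp)
        interpret finite_measure "\<kappa> t" using fin[OF t] by (simp add: finite_borel_measure_def)
        have "torus L \<in> sets (\<kappa> t)" using fin[OF t] torus_borel by (simp add: finite_borel_measure_def sets_torus)
        then have "measure (\<kappa> t) (torus L - {x \<in> torus L. ?e x \<in> A}) = M - measure (\<kappa> t) {x \<in> torus L. ?e x \<in> A}"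
          using eA'[OF AB t] by (subst finite_measure_Diff) (auto simp: mass[OF t])
        moreover have "torus L - {x \<in> torus L. ?e x \<in> A} = {x \<in> torus L. ?e x \<in> UNIV - A}" by auto
        ultimately show "M - measure (\<kappa> t) {x \<in> torus L. ?e x \<in> A} = measure (\<kappa> t) {x \<in> torus L. ?e x \<in> UNIV - A}" by simp
      qed
    next
      case (union A)
      have AB: "A i \<in> sets borel" for i using union.hyps(2) S by auto
      show ?case
      proof (rule borel_measurable_LIMSEQ_real)
        show "(\<lambda>t. \<Sum>i<n. measure (\<kappa> t) {x \<in> torus L. ?e x \<in> A i}) \<in> borel_measurable ?R" for n
          by (rule borel_measurable_sum) (rule union.IH)
        fix t assume "t \<in> space ?R"
        then have t: "t \<in> {-T<..<T}" by (simp add: sp)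
        interpret finite_measure "\<kappa> t" using fin[OF t] by (simp add: finite_borel_measure_def)
        have "(\<lambda>i. measure (\<kappa> t) {x \<in> torus L. ?e x \<in> A i}) sums measure (\<kappa> t) (\<Union>i. {x \<in> torus L. ?e x \<in> A i})"
        proof (rule finite_measure_UNION)
          show "range (\<lambda>i. {x \<in> torus L. ?e x \<in> A i}) \<subseteq> sets (\<kappa> t)" by (rule image_subsetI) (rule eA'[OF AB t])
          show "disjoint_family (\<lambda>i. {x \<in> torus L. ?e x \<in> A i})"
            using union.hyps(1) unfolding disjoint_family_on_def by blast
        qed
        moreover have "(\<Union>i. {x \<in> torus L. ?e x \<in> A i}) = {x \<in> torus L. ?e x \<in> (\<Union>i. A i)}" by auto
        ultimately show "(\<lambda>n. \<Sum>i<n. measure (\<kappa> t) {x \<in> torus L. ?e x \<in> A i}) \<longlonglongrightarrow> measure (\<kappa> t) {x \<in> torus L. ?e x \<in> (\<Union>i. A i)}"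
          by (simp add: sums_def)
      qed
    qed
  qed
  have "(\<lambda>t. emeasure (\<kappa> t) B) \<in> borel_measurable ?R" if B: "B \<in> sets (restrict_space borel (torus L))" for B
  proof -
    have B': "B \<subseteq> torus L" "B \<in> sets borel" using B by (simp_all add: sets_torus)
    have "?r -` B \<in> sets borel" using measurable_sets[OF torus_inv_measurable B'(2)] by simp
    from main[OF this] have m: "(\<lambda>t. ennreal (measure (\<kappa> t) {x \<in> torus L. ?e x \<in> ?r -` B})) \<in> borel_measurable ?R" by measurable
    have "{x \<in> torus L. ?e x \<in> ?r -` B} = B"
    proof (intro equalityI subsetI)
      fix x assume "x \<in> {x \<in> torus L. ?e x \<in> ?r -` B}"
      then show "x \<in> B" using torus_inv_emb_torus[OF L, of x] by simp
    next
      fix x assume x: "x \<in> B"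
      then have xt: "x \<in> torus L" using B' by blast
      then show "x \<in> {x \<in> torus L. ?e x \<in> ?r -` B}" using torus_inv_emb_torus[OF L xt] x by simp
    qed
    with m have m': "(\<lambda>t. ennreal (measure (\<kappa> t) B)) \<in> borel_measurable ?R" by simp
    show ?thesis
    proof (rule measurable_cong[THEN iffD1, OF _ m'])
      fix t assume "t \<in> space ?R"
      then have t: "t \<in> {-T<..<T}" by (simp add: sp)
      interpret finite_measure "\<kappa> t" using fin[OF t] by (simp add: finite_borel_measure_def)
      show "ennreal (measure (\<kappa> t) B) = emeasure (\<kappa> t) B" by (simp add: emeasure_eq_measure)
    qed
  qed
  then show ?thesis using fin by (simp add: kernel_def)
qed

section \<open>Test functions and their derivatives\<close>

context
  fixes L T :: real and \<psi> :: "(real^2) \<times> real \<Rightarrow> real"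
  assumes \<psi>: "test_function L T \<psi>"
begin

lemma test_function_has_derivative: "(\<psi> has_derivative frechet_derivative \<psi> (at p)) (at p)"
proof -
  have "C_times (Suc 0) \<psi>" using \<psi> unfolding test_function_def smooth_def by blast
  then show ?thesis by (rule C_times_SucD(1))
qed

lemma test_function_derivative_continuous:
  assumes "b \<in> Basis" shows "continuous_on UNIV (\<lambda>p. frechet_derivative \<psi> (at p) b)"
proof -
  have "C_times (Suc 0) \<psi>" using \<psi> unfolding test_function_def smooth_def by blast
  from C_times_SucD(2)[OF this assms] show ?thesis by simp
qed

lemma test_function_derivative_periodic: "periodic L (\<lambda>x. frechet_derivative \<psi> (at (x, t)) b)"
  unfolding periodic_def
proof (intro allI)
  fix x :: "real^2" and i
  let ?a = "(L *\<^sub>R axis i 1, 0) :: (real^2) \<times> real"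
  have per: "\<psi> (q + ?a) = \<psi> q" for q
  proof -
    have "periodic L (\<lambda>x. \<psi> (x, snd q))" using \<psi> by (simp add: test_function_def)
    then have "\<psi> (fst q + L *\<^sub>R axis i 1, snd q) = \<psi> (fst q, snd q)" unfolding periodic_def by blast
    moreover have "q + ?a = (fst q + L *\<^sub>R axis i 1, snd q)" by (simp add: prod_eq_iff)
    ultimately show ?thesis by simp
  qed
  have s: "((\<lambda>q. q + ?a) has_derivative (\<lambda>h. h)) (at (x, t))" by (auto intro!: derivative_eq_intros)
  have "((\<lambda>q. \<psi> (q + ?a)) has_derivative (\<lambda>h. frechet_derivative \<psi> (at ((x, t) + ?a)) h)) (at (x, t))"
    by (rule has_derivative_compose[OF s test_function_has_derivative])
  then have "(\<psi> has_derivative frechet_derivative \<psi> (at ((x, t) + ?a))) (at (x, t))" by (simp add: per)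
  from frechet_derivative_at[OF this] have "frechet_derivative \<psi> (at ((x, t) + ?a)) = frechet_derivative \<psi> (at (x, t))" .
  then show "frechet_derivative \<psi> (at (x + L *\<^sub>R axis i 1, t)) b = frechet_derivative \<psi> (at (x, t)) b" by simp
qed

text \<open>The support in time and the periodicity in space reduce the supremum to a compact box,
  where the derivative is continuous.\<close>

lemma test_function_derivative_bounded:
  assumes L: "L > 0" and b: "b \<in> Basis"
  shows "\<exists>C. \<forall>p. \<bar>frechet_derivative \<psi> (at p) b\<bar> \<le> C"
proof -
  obtain s where s: "s < T" "\<forall>x t. s \<le> \<bar>t\<bar> \<longrightarrow> \<psi> (x, t) = 0" using \<psi> unfolding test_function_def by blast
  let ?g = "\<lambda>p. frechet_derivative \<psi> (at p) b"
  have z: "?g p = 0" if p: "s < \<bar>snd p\<bar>" for p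
  proof -
    have "((\<lambda>_. 0) has_derivative (\<lambda>_. 0)) (at p)" by simp
    then have "(\<psi> has_derivative (\<lambda>_. 0)) (at p)"
    proof (rule has_derivative_transform_within_open)
      show "open ((\<lambda>q :: (real^2) \<times> real. \<bar>snd q\<bar>) -` {s<..})"
        by (intro open_vimage continuous_intros)
      show "p \<in> (\<lambda>q. \<bar>snd q\<bar>) -` {s<..}" using p by simp
      show "0 = \<psi> q" if "q \<in> (\<lambda>q. \<bar>snd q\<bar>) -` {s<..}" for q using s(2) that by (cases q) auto
    qed
    from frechet_derivative_at[OF this] show ?thesis by (metis (no_types))
  qed
  let ?K = "cbox (\<chi> i. - L / 2) (\<chi> i. L / 2) \<times> {-s..s} :: ((real^2) \<times> real) set"
  have cp: "compact (?g ` ?K)"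
    by (rule compact_continuous_image[OF continuous_on_subset[OF test_function_derivative_continuous[OF b] subset_UNIV]])
       (intro compact_Times compact_cbox compact_Icc)
  obtain C where C: "\<forall>y\<in>?g ` ?K. norm y \<le> C"
    using compact_imp_bounded[OF cp] unfolding bounded_iff by blast
  have "\<bar>?g p\<bar> \<le> max 0 C" for p
  proof (cases "s < \<bar>snd p\<bar>")
    case True
    then show ?thesis using z by simp
  next
    case False
    obtain x t where p: "p = (x, t)" by (cases p)
    have "wrap L x \<in> cbox (\<chi> i. - L / 2) (\<chi> i. L / 2)" by (rule subsetD[OF torus_subset_cbox wrap_in_torus[OF L]])
    then have "(wrap L x, t) \<in> ?K" using False p by auto
    then have "norm (?g (wrap L x, t)) \<le> C" using C by blast
    moreover have "?g (wrap L x, t) = ?g (x, t)" by (rule periodic_wrap[OF test_function_derivative_periodic])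
    ultimately show ?thesis using p by simp
  qed
  then show ?thesis by blast
qed

text \<open>The horizontal gradient as a vector, so that the flux term of the continuity equation
  becomes an inner product with the velocity, the form tested in
  \<open>bary_density_test\<close>.\<close>

definition hgrad :: "(real^2) \<times> real \<Rightarrow> real^2"
  where "hgrad p = (\<Sum>b\<in>Basis. frechet_derivative \<psi> (at p) (b, 0) *\<^sub>R b)"

lemma horizontal_in_Basis: "b \<in> Basis \<Longrightarrow> (b :: real^2, 0 :: real) \<in> Basis" "(0 :: real^2, 1 :: real) \<in> Basis"
  by (auto simp: Basis_prod_def)

lemma hgrad_inner: "frechet_derivative \<psi> (at p) (w, 0) = hgrad p \<bullet> w"
proof -
  have lin: "linear (frechet_derivative \<psi> (at p))" using test_function_has_derivative by (rule has_derivative_linear)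
  have "(w, 0) = (\<Sum>b\<in>Basis. (w \<bullet> b) *\<^sub>R (b, 0 :: real))"
    by (simp add: prod_eq_iff fst_sum snd_sum euclidean_representation)
  then have "frechet_derivative \<psi> (at p) (w, 0) = (\<Sum>b\<in>Basis. (w \<bullet> b) *\<^sub>R frechet_derivative \<psi> (at p) (b, 0))"
    by (simp only: linear_sum[OF lin] linear_scale[OF lin])
  then show ?thesis
    unfolding hgrad_def inner_sum_left inner_scaleR_left real_scaleR_def
    by (simp only: inner_commute[of w] mult.commute)
qed

lemma hgrad_continuous: "continuous_on UNIV hgrad"
  unfolding hgrad_def by (intro continuous_intros test_function_derivative_continuous horizontal_in_Basis)

lemma hgrad_periodic: "hgrad (wrap L x, t) = hgrad (x, t)"
  unfolding hgrad_def by (simp add: periodic_wrap[OF test_function_derivative_periodic])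

lemma hgrad_bounded: "L > 0 \<Longrightarrow> \<exists>C. \<forall>p. norm (hgrad p) \<le> C"
proof -
  assume L: "L > 0"
  have "\<forall>b\<in>Basis. \<exists>C. \<forall>p. \<bar>frechet_derivative \<psi> (at p) (b :: real^2, 0)\<bar> \<le> C"
    by (intro ballI test_function_derivative_bounded[OF L] horizontal_in_Basis)
  from bchoice[OF this] obtain C where C: "\<forall>b\<in>Basis. \<forall>p. \<bar>frechet_derivative \<psi> (at p) (b :: real^2, 0)\<bar> \<le> C b" by (rule exE)
  have "norm (hgrad p) \<le> (\<Sum>b\<in>Basis. C b)" for p
  proof -
    have "norm (hgrad p) \<le> (\<Sum>b\<in>Basis. norm (frechet_derivative \<psi> (at p) (b :: real^2, 0) *\<^sub>R b))"
      unfolding hgrad_def by (rule norm_sum)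
    also have "\<dots> \<le> (\<Sum>b\<in>Basis. C b)"
    proof (rule sum_mono)
      fix b :: "real^2" assume b: "b \<in> Basis"
      have "\<bar>frechet_derivative \<psi> (at p) (b, 0)\<bar> \<le> C b" by (rule spec[OF bspec[OF C b]])
      then show "norm (frechet_derivative \<psi> (at p) (b, 0) *\<^sub>R b) \<le> C b" using b by simp
    qed
    finally show ?thesis .
  qed
  then show ?thesis by blast
qed

end


section \<open>Compactified velocities and the limit of the fluxes\<close>

lemma measurable_pair_wrap:
  assumes L: "L > 0"
  shows "(\<lambda>p. (wrap L (fst p), snd p)) \<in> measurable (borel :: ((real^2) \<times> real) measure) (restrict_space borel (torus L \<times> UNIV))"
proof (rule measurable_restrict_space2)
  show "(\<lambda>p. (wrap L (fst p), snd p)) \<in> space borel \<rightarrow> torus L \<times> UNIV" using wrap_in_torus[OF L] by auto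
  show "(\<lambda>p. (wrap L (fst p), snd p)) \<in> measurable (borel :: ((real^2) \<times> real) measure) borel"
    unfolding borel_prod[symmetric]
    by (intro measurable_Pair measurable_compose[OF measurable_fst measurable_wrap_borel] measurable_snd)
qed

lemma slab_mass:
  assumes \<mu>: "finite_borel_measure (cylinder L T) \<mu>" and dis: "disintegration L T \<mu> \<kappa>" and T: "T > 0"
    and mass: "\<And>t. t \<in> {-T<..<T} \<Longrightarrow> measure (\<kappa> t) (torus L) = M"
  shows "measure \<mu> (space \<mu>) = 2 * T * M"
proof -
  have "measure \<mu> (space \<mu>) = (\<integral>p. 1 \<partial>\<mu>)" by simp
  also have "\<dots> = (LINT t:{-T<..<T}|lborel. (\<integral>x. 1 \<partial>\<kappa> t))"
    by (rule disintegration_integral(2)[OF \<mu> dis, of "\<lambda>_. 1" 1]) auto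
  also have "\<dots> = (LINT t:{-T<..<T}|lborel. M)"
  proof (rule set_lebesgue_integral_cong)
    show "\<forall>t. t \<in> {-T<..<T} \<longrightarrow> (\<integral>x. 1 \<partial>\<kappa> t) = M"
    proof (intro allI impI)
      fix t assume t: "t \<in> {-T<..<T}"
      show "(\<integral>x. 1 \<partial>\<kappa> t) = M"
        using mass[OF t] space_torus_measure[OF kernel_finite[OF disintegration_kernel[OF dis] t]] by simp
    qed
  qed simp
  also have "\<dots> = 2 * T * M" using T by (simp add: set_lebesgue_integral_def)
  finally show ?thesis .
qed

text \<open>In the coordinates \<open>(u, q) = (v, 1) / (1 + \<bar>v\<bar>\<^sup>2)\<close> the velocities lie on a compact sphere and,
  after weighting \<open>\<mu>\<close> by \<open>1 + \<bar>v\<bar>\<^sup>2\<close>, mass, flux and kinetic energy become the integrals of the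
  continuous functions \<open>q\<close>, \<open>u\<close> and \<open>1 - q\<close>. Hence no tightness in \<open>v\<close> is needed and only the
  energy carried by \<open>q = 0\<close>, i.e. by infinite velocities, can be lost in the limit.\<close>

definition compactify :: "(real^2) \<times> real \<Rightarrow> real^2 \<Rightarrow> ((real^2) \<times> real) \<times> ((real^2) \<times> real)"
  where "compactify p v = (p, ((1 / (1 + (norm v)\<^sup>2)) *\<^sub>R v, 1 / (1 + (norm v)\<^sup>2)))"

text \<open>The equation describes the sphere with centre (0, 1/2) and radius 1/2, onto which
  velocity space is mapped by inverse stereographic projection; its point (0, 0) is infinite
  velocity. Position and time range over the closed box because weak limits may reach its
  boundary.\<close>

definition velocity_sphere :: "real \<Rightarrow> real \<Rightarrow> (((real^2) \<times> real) \<times> ((real^2) \<times> real)) set"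
  where "velocity_sphere L T = ((cbox (\<chi> i. - L / 2) (\<chi> i. L / 2) \<times> {-T..T}) \<times> (cball 0 1 \<times> {0..1})) \<inter>
    {z. (norm (fst (snd z)))\<^sup>2 + (snd (snd z))\<^sup>2 = snd (snd z)}"

lemma compact_velocity_sphere: "compact (velocity_sphere L T)"
  unfolding velocity_sphere_def
  by (intro compact_Int_closed compact_Times compact_cbox compact_Icc compact_cball closed_Collect_eq continuous_intros)

lemma one_plus_square_pos: "0 < 1 + (norm v)\<^sup>2"
  by (rule add_pos_nonneg) auto

lemma compactify_in_velocity_sphere:
  assumes p: "p \<in> cylinder L T" shows "compactify p v \<in> velocity_sphere L T"
proof -
  define N where "N = norm v"
  have N0: "0 \<le> N" and N1: "0 < 1 + N\<^sup>2" using one_plus_square_pos[of v] by (simp_all add: N_def)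
  have "2 * N \<le> 1 + N\<^sup>2" using zero_le_power2[of "N - 1"] by (simp add: power2_eq_square algebra_simps)
  then have "N \<le> 1 + N\<^sup>2" using N0 by linarith
  then have "N / (1 + N\<^sup>2) \<le> 1" using N1 by (simp add: divide_le_eq)
  then have 1: "norm ((1 / (1 + N\<^sup>2)) *\<^sub>R v) \<le> 1" using N1 by (simp add: N_def)
  have 2: "0 \<le> 1 / (1 + N\<^sup>2)" "1 / (1 + N\<^sup>2) \<le> 1" using N1 by (simp_all add: divide_le_eq)
  have "(norm ((1 / (1 + N\<^sup>2)) *\<^sub>R v))\<^sup>2 + (1 / (1 + N\<^sup>2))\<^sup>2 = (N\<^sup>2 + 1) / (1 + N\<^sup>2)\<^sup>2"
    using N1 by (simp add: N_def[symmetric] power_divide add_divide_distrib)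
  also have "\<dots> = 1 / (1 + N\<^sup>2)" using N1 by (simp add: power2_eq_square add.commute)
  finally have 3: "(norm ((1 / (1 + N\<^sup>2)) *\<^sub>R v))\<^sup>2 + (1 / (1 + N\<^sup>2))\<^sup>2 = 1 / (1 + N\<^sup>2)" .
  have "fst p \<in> cbox (\<chi> i. - L / 2) (\<chi> i. L / 2)" "snd p \<in> {-T..T}"
    using p subsetD[OF torus_subset_cbox, of "fst p" L] by (auto simp: cylinder_def)
  then show ?thesis using 1 2 3 by (cases p) (simp add: velocity_sphere_def compactify_def N_def)
qed

lemma compactify_measurable:
  assumes "v \<in> borel_measurable \<mu>" "(\<lambda>p. p) \<in> measurable \<mu> borel"
  shows "(\<lambda>p. compactify p (v p)) \<in> measurable \<mu> borel"
proof -
  have "continuous_on UNIV (\<lambda>z :: ((real^2) \<times> real) \<times> (real^2). compactify (fst z) (snd z))"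
    unfolding compactify_def
    by (intro continuous_intros) (metis one_plus_square_pos less_irrefl)+
  then have c: "(\<lambda>z. compactify (fst z) (snd z)) \<in> borel_measurable borel" by (rule borel_measurable_continuous_onI)
  have "(\<lambda>p. (p, v p)) \<in> measurable \<mu> (borel \<Otimes>\<^sub>M borel)" by (intro measurable_Pair assms)
  then have "(\<lambda>p. (p, v p)) \<in> measurable \<mu> borel" by (simp only: borel_prod)
  from measurable_compose[OF this c] show ?thesis by simp
qed

text \<open>The weighted images \<open>\<theta> n\<close> live on one compact set and have bounded
  mass, so a subsequence converges weakly to some \<open>N\<close>. The part with
  \<open>q > 0\<close> yields particles with velocity \<open>u / q\<close>; the continuity equation
  survives because its integrand is continuous in the compact coordinates.\<close>

theorem flux_limit:
  fixes \<mu> :: "nat \<Rightarrow> ((real^2) \<times> real) measure" and m :: "nat \<Rightarrow> ((real^2) \<times> real) set \<Rightarrow> real^2"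
    and \<kappa> :: "nat \<Rightarrow> real \<Rightarrow> (real^2) measure" and \<kappa>' :: "real \<Rightarrow> (real^2) measure"
  assumes L: "L > 0" and T: "T > 0"
    and \<mu>: "\<And>n. finite_borel_measure (cylinder L T) (\<mu> n)"
    and \<kappa>: "\<And>n. weakly_continuous_rep L T (\<mu> n) (\<kappa> n)"
    and m: "\<And>n. vector_measure (cylinder L T) (m n)" "\<And>n. vector_abs_cont (m n) (\<mu> n)"
      "\<And>n. continuity_equation L T (\<mu> n) (m n)"
    and b: "0 \<le> b" "(\<lambda>n. \<integral>\<^sup>+p. ennreal ((norm (vector_RN_deriv (\<mu> n) (m n) p))\<^sup>2) \<partial>\<mu> n) \<longlonglongrightarrow> ennreal b"
    and bB: "\<And>n. (\<integral>\<^sup>+p. ennreal ((norm (vector_RN_deriv (\<mu> n) (m n) p))\<^sup>2) \<partial>\<mu> n) \<le> ennreal B"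
    and mass: "\<And>n t. t \<in> {-T..T} \<Longrightarrow> measure (\<kappa> n t) (torus L) = M"
    and \<kappa>': "\<And>t. t \<in> {-T..T} \<Longrightarrow> finite_borel_measure (torus L) (\<kappa>' t)"
    and cont: "\<And>f :: real^2 \<Rightarrow> real. continuous_on UNIV f \<Longrightarrow> periodic L f \<Longrightarrow> continuous_on {-T..T} (\<lambda>t. \<integral>x. f x \<partial>\<kappa>' t)"
    and conv: "\<And>(f :: real^2 \<Rightarrow> real) t. continuous_on UNIV f \<Longrightarrow> periodic L f \<Longrightarrow> t \<in> {-T..T} \<Longrightarrow>
      (\<lambda>n. \<integral>x. f x \<partial>\<kappa> n t) \<longlonglongrightarrow> (\<integral>x. f x \<partial>\<kappa>' t)"
  shows "\<exists>\<mu>' m'. finite_borel_measure (cylinder L T) \<mu>' \<and> weakly_continuous_rep L T \<mu>' \<kappa>' \<and>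
    vector_measure (cylinder L T) m' \<and> vector_abs_cont m' \<mu>' \<and> continuity_equation L T \<mu>' m' \<and>
    (\<integral>\<^sup>+p. ennreal ((norm (vector_RN_deriv \<mu>' m' p))\<^sup>2) \<partial>\<mu>') \<le> ennreal b"
proof -
  have fin: "finite_measure (\<mu> n)" for n using \<mu> by (simp add: finite_borel_measure_def)
  have J: "t \<in> {-T..T}" if "t \<in> {-T<..<T}" for t using that by auto
  have mass': "measure (\<kappa>' t) (torus L) = M" if t: "t \<in> {-T..T}" for t
  proof -
    have per: "periodic L (\<lambda>_ :: real^2. 1 :: real)" by (simp add: periodic_def)
    have "(\<lambda>n. \<integral>x. (1::real) \<partial>\<kappa> n t) \<longlonglongrightarrow> (\<integral>x. 1 \<partial>\<kappa>' t)" by (rule conv[OF _ per t]) simp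
    then have "(\<lambda>n :: nat. M) \<longlonglongrightarrow> measure (\<kappa>' t) (torus L)"
      using mass[OF t] by (simp add: space_torus_measure[OF weakly_continuous_repD(2)[OF \<kappa> t]] space_torus_measure[OF \<kappa>'[OF t]])
    then show ?thesis by (simp add: LIMSEQ_const_iff)
  qed
  have ker: "kernel L T \<kappa>'"
  proof (rule kernel_of_measurable_integrals[OF L \<kappa>'[OF J] mass'[OF J]])
    fix f :: "real^2 \<Rightarrow> real" assume f: "continuous_on UNIV f" "periodic L f"
    show "(\<lambda>t. \<integral>x. f x \<partial>\<kappa>' t) \<in> borel_measurable (restrict_space borel {-T<..<T})"
      by (rule borel_measurable_continuous_on_restrict[OF continuous_on_subset[OF cont[OF f]]]) auto
  qed
  have "emeasure (\<kappa>' t) (torus L) \<le> ennreal M" if t: "t \<in> {-T<..<T}" for t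
  proof -
    interpret finite_measure "\<kappa>' t" using \<kappa>'[OF J[OF t]] by (simp add: finite_borel_measure_def)
    show ?thesis by (simp add: emeasure_eq_measure mass'[OF J[OF t]])
  qed
  \<comment> \<open>The limit measure is built from the limit slices. That the limit
    \<open>N\<close> of positions and velocities projects to it is shown separately.\<close>
  then obtain \<mu>' where \<mu>': "finite_borel_measure (cylinder L T) \<mu>'" and dis: "disintegration L T \<mu>' \<kappa>'"
    using kernel_measure_exists[OF ker, of "ennreal M"] by auto
  have wc: "weakly_continuous_rep L T \<mu>' \<kappa>'"
    unfolding weakly_continuous_rep_def using dis \<kappa>' cont by blast
  define v where "v n = vector_RN_deriv (\<mu> n) (m n)" for n
  have vi: "integrable (\<mu> n) (v n)" for n unfolding v_def by (rule vector_RN_deriv(1)[OF \<mu> m(1,2)])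
  have vm: "v n \<in> borel_measurable (\<mu> n)" for n using vi by auto
  have idm: "(\<lambda>p. p) \<in> measurable (\<mu> n) borel" for n by (rule borel_measurable_cylinder_measure[OF \<mu>]) simp
  have v2: "integrable (\<mu> n) (\<lambda>p. (norm (v n p))\<^sup>2)" for n
    by (rule integrable_square_imp_integrable(1)[OF fin vm]) (use bB[of n] in \<open>auto simp: v_def intro: le_less_trans\<close>)
  have nnv: "(\<integral>\<^sup>+p. ennreal ((norm (v n p))\<^sup>2) \<partial>\<mu> n) = ennreal (\<integral>p. (norm (v n p))\<^sup>2 \<partial>\<mu> n)" for n
    by (rule nn_integral_eq_integral[OF v2]) simp
  have v2b: "(\<lambda>n. \<integral>p. (norm (v n p))\<^sup>2 \<partial>\<mu> n) \<longlonglongrightarrow> b"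
    using b nnv by (subst tendsto_ennreal_iff[symmetric]) (simp_all add: v_def[symmetric])
  have vB: "(\<integral>p. (norm (v n p))\<^sup>2 \<partial>\<mu> n) \<le> max 0 B" for n
  proof -
    have "ennreal (\<integral>p. (norm (v n p))\<^sup>2 \<partial>\<mu> n) \<le> ennreal B"
      using bB[of n] nnv[of n] by (simp add: v_def)
    also have "\<dots> \<le> ennreal (max 0 B)" by (rule ennreal_leI) simp
    finally show ?thesis by (rule ennreal_le_iff[THEN iffD1, rotated]) simp
  qed
  define w where "w n p = 1 + (norm (v n p))\<^sup>2" for n p
  have wpos: "0 < w n p" for n p unfolding w_def by (rule one_plus_square_pos)
  have wm: "w n \<in> borel_measurable (\<mu> n)" for n unfolding w_def using vm[of n] by measurable
  have wi: "integrable (\<mu> n) (w n)" for n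
    unfolding w_def using v2[of n] finite_measure.integrable_const[OF fin[of n]] by (intro Bochner_Integration.integrable_add) auto
  \<comment> \<open>The weight \<open>w\<close> cancels the denominators of
    \<open>compactify\<close>, so that mass, flux and energy appear as integrals of
    \<open>q\<close>, \<open>u\<close> and \<open>1 - q\<close>.\<close>
  define D where "D n = density (\<mu> n) (\<lambda>p. ennreal (w n p))" for n
  have Dm: "(\<lambda>p. compactify p (v n p)) \<in> measurable (D n) borel" for n
    unfolding D_def using compactify_measurable[OF vm idm] by simp
  define \<theta> where "\<theta> n = distr (D n) borel (\<lambda>p. compactify p (v n p))" for n
  have \<theta>int: "(\<integral>z. \<Psi> z \<partial>\<theta> n) = (\<integral>p. w n p * \<Psi> (compactify p (v n p)) \<partial>\<mu> n)"
    if "\<Psi> \<in> borel_measurable borel" for \<Psi> :: "_ \<Rightarrow> real" and n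
  proof -
    have "(\<integral>z. \<Psi> z \<partial>\<theta> n) = (\<integral>p. \<Psi> (compactify p (v n p)) \<partial>D n)"
      unfolding \<theta>_def by (rule integral_distr[OF Dm that])
    also have "\<dots> = (\<integral>p. w n p *\<^sub>R \<Psi> (compactify p (v n p)) \<partial>\<mu> n)"
      unfolding D_def
      by (rule integral_density[OF measurable_compose[OF compactify_measurable[OF vm idm] that] wm])
         (use wpos less_imp_le in blast)
    finally show ?thesis by simp
  qed
  have finD: "finite_measure (D n)" for n
  proof (rule finite_measureI)
    have "emeasure (D n) (space (D n)) = (\<integral>\<^sup>+p. ennreal (w n p) \<partial>\<mu> n)"
      unfolding D_def space_density
      by (subst emeasure_density[OF _ sets.top]) (use wm[of n] in \<open>auto intro!: nn_integral_cong\<close>)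
    also have "\<dots> = ennreal (\<integral>p. w n p \<partial>\<mu> n)"
      by (rule nn_integral_eq_integral[OF wi]) (use wpos less_imp_le in blast)
    finally show "emeasure (D n) (space (D n)) \<noteq> \<infinity>" by simp
  qed
  have ex: "\<exists>r N. strict_mono (r :: nat \<Rightarrow> nat) \<and> sets N = sets borel \<and> finite_measure N \<and>
    (AE z in N. z \<in> velocity_sphere L T) \<and>
    (\<forall>f :: _ \<Rightarrow> real. continuous_on UNIV f \<longrightarrow> (\<lambda>n. \<integral>x. f x \<partial>\<theta> (r n)) \<longlonglongrightarrow> (\<integral>x. f x \<partial>N))"
  proof (rule weakly_convergent_subsequence[OF _ _ _ compact_velocity_sphere])
    show "sets (\<theta> n) = sets borel" for n by (simp add: \<theta>_def)
    show "finite_measure (\<theta> n)" for n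
      unfolding \<theta>_def by (rule finite_measure.finite_measure_distr[OF finD Dm])
    show "AE z in \<theta> n. z \<in> velocity_sphere L T" for n
    proof -
      have "AE p in D n. compactify p (v n p) \<in> velocity_sphere L T"
        by (rule AE_I2) (simp add: D_def space_cylinder_measure[OF \<mu>] compactify_in_velocity_sphere)
      then show ?thesis
        unfolding \<theta>_def using compact_imp_closed[OF compact_velocity_sphere]
        by (subst AE_distr_iff[OF Dm]) auto
    qed
    \<comment> \<open>The weight \<open>1 + \<bar>v\<bar>^2\<close> integrates to the mass of the
      cylinder plus the kinetic energy, both uniformly bounded.\<close>
    show "measure (\<theta> n) UNIV \<le> 2 * T * M + max 0 B" for n
    proof -
      have "measure (\<theta> n) UNIV = (\<integral>z. 1 \<partial>\<theta> n)" by (simp add: \<theta>_def)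
      also have "\<dots> = (\<integral>p. w n p * 1 \<partial>\<mu> n)" by (rule \<theta>int) simp
      also have "\<dots> = measure (\<mu> n) (space (\<mu> n)) + (\<integral>p. (norm (v n p))\<^sup>2 \<partial>\<mu> n)"
        unfolding w_def mult_1_right
        by (subst Bochner_Integration.integral_add[OF finite_measure.integrable_const[OF fin[of n]] v2[of n]]) simp
      also have "measure (\<mu> n) (space (\<mu> n)) = 2 * T * M"
        by (rule slab_mass[OF \<mu> weakly_continuous_repD(1)[OF \<kappa>] T mass[OF J]])
      finally show ?thesis using vB[of n] by simp
    qed
  qed
  then obtain r N where r: "strict_mono (r :: nat \<Rightarrow> nat)" and N: "sets N = sets borel" "finite_measure N"
    and sph: "AE z in N. z \<in> velocity_sphere L T"
    and lim: "\<And>f :: ((real^2) \<times> real) \<times> ((real^2) \<times> real) \<Rightarrow> real. continuous_on UNIV f \<Longrightarrow> (\<lambda>n. \<integral>x. f x \<partial>\<theta> (r n)) \<longlonglongrightarrow> (\<integral>x. f x \<partial>N)"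
    by blast
  interpret N: finite_measure N by fact
  have spN: "space N = UNIV" using sets_eq_imp_space_eq[OF N(1)] by simp
  have mN: "f \<in> borel_measurable N" if "f \<in> borel_measurable borel" for f :: "_ \<Rightarrow> 'z::topological_space"
    using that measurable_cong_sets[OF N(1) refl] by blast
  let ?q = "\<lambda>z :: ((real^2) \<times> real) \<times> ((real^2) \<times> real). snd (snd z)"
  let ?u = "\<lambda>z :: ((real^2) \<times> real) \<times> ((real^2) \<times> real). fst (snd z)"
  have qm: "?q \<in> borel_measurable N" and um: "?u \<in> borel_measurable N" and fstm: "fst \<in> measurable N borel"
    by (intro mN borel_measurable_continuous_onI continuous_intros)+
  have q01: "AE z in N. 0 \<le> ?q z \<and> ?q z \<le> 1 \<and> norm (?u z) \<le> 1 \<and> (norm (?u z))\<^sup>2 + (?q z)\<^sup>2 = ?q z"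
    using sph by eventually_elim (auto simp: velocity_sphere_def)
  \<comment> \<open>Weighting by \<open>q\<close> undoes the weight \<open>w\<close> and deletes the
    particles of infinite velocity.\<close>
  define \<gamma> where "\<gamma> = density N (\<lambda>z. ennreal (?q z))"
  have s\<gamma>: "sets \<gamma> = sets N" "space \<gamma> = UNIV" by (simp_all add: \<gamma>_def spN)
  have m\<gamma>: "f \<in> measurable \<gamma> K \<longleftrightarrow> f \<in> measurable N K" for f :: "_ \<Rightarrow> 'z" and K
    by (simp only: measurable_cong_sets[OF s\<gamma>(1) refl])
  have finG: "finite_measure \<gamma>"
  proof (rule finite_measureI)
    have "emeasure \<gamma> (space \<gamma>) = (\<integral>\<^sup>+z. ennreal (?q z) \<partial>N)"
      unfolding \<gamma>_def space_density
      by (subst emeasure_density[OF _ sets.top]) (use qm in \<open>auto intro!: nn_integral_cong\<close>)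
    also have "\<dots> \<le> (\<integral>\<^sup>+z. 1 \<partial>N)"
      by (rule nn_integral_mono_AE) (use q01 in \<open>auto elim!: eventually_mono\<close>)
    also have "\<dots> < \<infinity>" by (simp add: N.emeasure_eq_measure)
    finally show "emeasure \<gamma> (space \<gamma>) \<noteq> \<infinity>" by simp
  qed
  have \<gamma>int: "(\<integral>z. f z \<partial>\<gamma>) = (\<integral>z. ?q z * f z \<partial>N)" if "f \<in> borel_measurable N" for f :: "_ \<Rightarrow> real"
    unfolding \<gamma>_def
    by (subst integral_density[OF that qm]) (use q01 in \<open>auto elim!: eventually_mono\<close>)
  \<comment> \<open>Limit positions may lie on the missing faces of the square and are moved back
    into the domain.\<close>
  define \<pi>0 where "\<pi>0 z = (wrap L (fst (fst z)), snd (fst z))" for z :: "((real^2) \<times> real) \<times> ((real^2) \<times> real)"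
  have \<pi>0m: "\<pi>0 \<in> measurable \<gamma> (restrict_space borel (torus L \<times> UNIV))"
    unfolding m\<gamma> \<pi>0_def by (rule measurable_compose[OF fstm measurable_pair_wrap[OF L]])
  have id0: "(\<lambda>p. p) \<in> measurable \<mu>' (restrict_space borel (torus L \<times> UNIV))"
    by (rule measurable_restrict_space2)
       (auto intro!: borel_measurable_cylinder_measure[OF \<mu>'] simp: space_cylinder_measure[OF \<mu>'] cylinder_def)
  \<comment> \<open>For a periodic test function both sides are the limit of its integrals over
    \<open>\<mu> (r n)\<close>: once through the weak limit \<open>N\<close>, once slice by slice
    with dominated convergence in time.\<close>
  have proj: "distr \<gamma> (restrict_space borel (torus L \<times> UNIV)) \<pi>0 = distr \<mu>' (restrict_space borel (torus L \<times> UNIV)) (\<lambda>p. p)"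
  proof (rule torus_prod_measure_eqI[OF L])
    show "finite_measure (distr \<gamma> (restrict_space borel (torus L \<times> UNIV)) \<pi>0)"
      by (rule finite_measure.finite_measure_distr[OF finG \<pi>0m])
    show "finite_measure (distr \<mu>' (restrict_space borel (torus L \<times> UNIV)) (\<lambda>p. p))"
      by (rule finite_measure.finite_measure_distr[OF _ id0]) (use \<mu>' in \<open>simp add: finite_borel_measure_def\<close>)
    fix f :: "(real^2) \<times> real \<Rightarrow> real" assume f: "continuous_on UNIV f" "\<And>t. periodic L (\<lambda>x. f (x, t))" "bounded (range f)"
    obtain C where C: "\<And>p. \<bar>f p\<bar> \<le> C" using f(3) unfolding bounded_iff by auto
    have fm: "f \<in> borel_measurable borel" by (rule borel_measurable_continuous_onI[OF f(1)])
    have fx: "continuous_on UNIV (\<lambda>x. f (x, t))" for t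
      by (rule continuous_on_compose2[OF f(1)]) (auto intro!: continuous_intros)
    have f\<pi>: "f (\<pi>0 z) = f (fst z)" for z
      using periodic_wrap[OF f(2)[of "snd (fst z)"], of "fst (fst z)"] by (simp add: \<pi>0_def)
    have c: "continuous_on UNIV (\<lambda>z :: ((real^2) \<times> real) \<times> ((real^2) \<times> real). ?q z * f (fst z))"
      by (intro continuous_intros continuous_on_compose2[OF f(1)]) auto
    have "(\<lambda>n. \<integral>p. f p \<partial>\<mu> (r n)) \<longlonglongrightarrow> (\<integral>z. ?q z * f (fst z) \<partial>N)"
    proof -
      have "(\<integral>z. ?q z * f (fst z) \<partial>\<theta> n) = (\<integral>p. f p \<partial>\<mu> n)" for n
      proof -
        have "w n p * (?q (compactify p (v n p)) * f (fst (compactify p (v n p)))) = f p" for p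
          using wpos[of n p] by (simp add: compactify_def w_def)
        then show ?thesis by (subst \<theta>int[OF borel_measurable_continuous_onI[OF c]]) simp
      qed
      then show ?thesis using lim[OF c] by simp
    qed
    moreover have "(\<lambda>n. \<integral>p. f p \<partial>\<mu> (r n)) \<longlonglongrightarrow> (\<integral>p. f p \<partial>\<mu>')"
    proof -
      have e: "(\<integral>p. f p \<partial>\<mu> n) = (LINT t:{-T<..<T}|lborel. (\<integral>x. f (x, t) \<partial>\<kappa> n t))" for n
        by (rule disintegration_integral(2)[OF \<mu> weakly_continuous_repD(1)[OF \<kappa>] fm C])
      have e': "(\<integral>p. f p \<partial>\<mu>') = (LINT t:{-T<..<T}|lborel. (\<integral>x. f (x, t) \<partial>\<kappa>' t))"
        by (rule disintegration_integral(2)[OF \<mu>' dis fm C])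
      have "(\<lambda>n. \<integral>p. f p \<partial>\<mu> n) \<longlonglongrightarrow> (\<integral>p. f p \<partial>\<mu>')"
        unfolding e e' set_lebesgue_integral_def
      proof (rule integral_dominated_convergence[where w="\<lambda>t. indicator {-T<..<T} t *\<^sub>R (C * M)"])
        show "integrable lborel (\<lambda>t. indicator {-T<..<T} t *\<^sub>R (C * M))"
          by (intro integrable_scaleR_left integrable_real_indicator) (use T in auto)
        show "(\<lambda>t. indicator {-T<..<T} t *\<^sub>R (\<integral>x. f (x, t) \<partial>\<kappa>' t)) \<in> borel_measurable lborel"
          using disintegration_integral(1)[OF \<mu>' dis fm C] by (auto simp: set_integrable_def)
        show "(\<lambda>t. indicator {-T<..<T} t *\<^sub>R (\<integral>x. f (x, t) \<partial>\<kappa> n t)) \<in> borel_measurable lborel" for n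
          using disintegration_integral(1)[OF \<mu> weakly_continuous_repD(1)[OF \<kappa>] fm C, of n] by (auto simp: set_integrable_def)
        show "AE t in lborel. (\<lambda>n. indicator {-T<..<T} t *\<^sub>R (\<integral>x. f (x, t) \<partial>\<kappa> n t)) \<longlonglongrightarrow> indicator {-T<..<T} t *\<^sub>R (\<integral>x. f (x, t) \<partial>\<kappa>' t)"
        proof (rule AE_I2)
          fix t
          show "(\<lambda>n. indicator {-T<..<T} t *\<^sub>R (\<integral>x. f (x, t) \<partial>\<kappa> n t)) \<longlonglongrightarrow> indicator {-T<..<T} t *\<^sub>R (\<integral>x. f (x, t) \<partial>\<kappa>' t)"
            using conv[OF fx f(2), of t t] by (cases "t \<in> {-T<..<T}") (auto intro!: tendsto_intros)
        qed
        show "AE t in lborel. norm (indicator {-T<..<T} t *\<^sub>R (\<integral>x. f (x, t) \<partial>\<kappa> n t)) \<le> indicator {-T<..<T} t *\<^sub>R (C * M)" for n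
        proof (rule AE_I2)
          fix t
          show "norm (indicator {-T<..<T} t *\<^sub>R (\<integral>x. f (x, t) \<partial>\<kappa> n t)) \<le> indicator {-T<..<T} t *\<^sub>R (C * M)"
          proof (cases "t \<in> {-T<..<T}")
            case True
            have z: "continuous_on UNIV (\<lambda>_ :: real^2. 0 :: real)" "periodic L (\<lambda>_ :: real^2. 0 :: real)"
              by (simp_all add: periodic_def)
            have "\<bar>(\<integral>x. f (x, t) \<partial>\<kappa> n t) - (\<integral>x. 0 \<partial>\<kappa> n t)\<bar> \<le> C * measure (\<kappa> n t) (torus L)"
              by (rule torus_integral_diff_le[OF L weakly_continuous_repD(2)[OF \<kappa> J[OF True]] fx f(2) z]) (simp add: C)
            then show ?thesis using True mass[OF J[OF True], of n] by simp
          qed simp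
        qed
      qed
      then show ?thesis by (rule LIMSEQ_subseq_LIMSEQ[OF _ r, unfolded o_def])
    qed
    ultimately have eq: "(\<integral>z. ?q z * f (fst z) \<partial>N) = (\<integral>p. f p \<partial>\<mu>')" by (rule LIMSEQ_unique)
    have frm: "f \<in> borel_measurable (restrict_space borel (torus L \<times> UNIV))" by (rule measurable_restrict_space1[OF fm])
    have "(\<integral>p. f p \<partial>distr \<gamma> (restrict_space borel (torus L \<times> UNIV)) \<pi>0) = (\<integral>z. f (fst z) \<partial>\<gamma>)"
      unfolding integral_distr[OF \<pi>0m frm] f\<pi> ..
    also have "\<dots> = (\<integral>p. f p \<partial>\<mu>')"
      unfolding \<gamma>int[OF measurable_compose[OF fstm fm]] by (rule eq)
    also have "\<dots> = (\<integral>p. f p \<partial>distr \<mu>' (restrict_space borel (torus L \<times> UNIV)) (\<lambda>p. p))"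
      by (rule integral_distr[OF id0 frm, symmetric])
    finally show "(\<integral>p. f p \<partial>distr \<gamma> (restrict_space borel (torus L \<times> UNIV)) \<pi>0) = (\<integral>p. f p \<partial>distr \<mu>' (restrict_space borel (torus L \<times> UNIV)) (\<lambda>p. p))" .
  qed simp_all
  have torU: "torus L \<times> (UNIV :: real set) \<in> sets borel"
    unfolding borel_prod[symmetric] using torus_borel by (intro pair_measureI) auto
  have em: "emeasure \<gamma> (\<pi>0 -` A) = emeasure \<mu>' (A \<inter> cylinder L T)" if A: "A \<in> sets borel" "A \<subseteq> torus L \<times> UNIV" for A
  proof -
    have A': "A \<in> sets (restrict_space borel (torus L \<times> UNIV))" using A torU by (simp add: sets_restrict_space_iff)
    have "emeasure \<gamma> (\<pi>0 -` A) = emeasure (distr \<gamma> (restrict_space borel (torus L \<times> UNIV)) \<pi>0) A"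
      by (simp add: emeasure_distr[OF \<pi>0m A'] s\<gamma>)
    also have "\<dots> = emeasure \<mu>' (A \<inter> cylinder L T)"
      unfolding proj by (simp add: emeasure_distr[OF id0 A'] space_cylinder_measure[OF \<mu>'] vimage_def)
    finally show ?thesis .
  qed
  have cylc: "cylinder L T \<subseteq> torus L \<times> UNIV" by (auto simp: cylinder_def)
  \<comment> \<open>The end times carry no mass, since the projected measure is concentrated on the
    open cylinder.\<close>
  have aeJ: "AE z in \<gamma>. \<pi>0 z \<in> cylinder L T"
  proof (rule AE_I[of _ _ "\<pi>0 -` (torus L \<times> UNIV - cylinder L T)"])
    show "{z \<in> space \<gamma>. \<pi>0 z \<notin> cylinder L T} \<subseteq> \<pi>0 -` (torus L \<times> UNIV - cylinder L T)"
      using wrap_in_torus[OF L] by (auto simp: \<pi>0_def)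
    show "emeasure \<gamma> (\<pi>0 -` (torus L \<times> UNIV - cylinder L T)) = 0"
    proof (subst em)
      show "torus L \<times> UNIV - cylinder L T \<in> sets borel" using torU cylinder_borel by auto
      have "(torus L \<times> UNIV - cylinder L T) \<inter> cylinder L T = {}" by auto
      then show "emeasure \<mu>' ((torus L \<times> UNIV - cylinder L T) \<inter> cylinder L T) = 0" by simp
    qed auto
    have "\<pi>0 -` (torus L \<times> UNIV - cylinder L T) \<inter> space \<gamma> \<in> sets \<gamma>"
      by (rule measurable_sets[OF \<pi>0m]) (use torU cylinder_borel in \<open>auto simp: sets_restrict_space_iff\<close>)
    then show "\<pi>0 -` (torus L \<times> UNIV - cylinder L T) \<in> sets \<gamma>" by (simp add: s\<gamma>)
  qed
  \<comment> \<open>The origin is an arbitrary value on a null set, chosen so that \<pi> maps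
    everywhere into the cylinder.\<close>
  define \<pi> where "\<pi> z = (if \<pi>0 z \<in> cylinder L T then \<pi>0 z else (0, 0))" for z
  have zero: "(0, 0) \<in> cylinder L T" using L T by (simp add: cylinder_def torus_def)
  have \<pi>m: "\<pi> \<in> measurable \<gamma> (restrict_space borel (cylinder L T))"
  proof (rule measurable_restrict_space2)
    show "\<pi> \<in> space \<gamma> \<rightarrow> cylinder L T" using zero by (simp add: \<pi>_def)
    have "\<pi>0 \<in> measurable \<gamma> borel"
      using \<pi>0m by (rule measurable_restrict_space2_iff[THEN iffD1, THEN conjunct1])
    then show "\<pi> \<in> measurable \<gamma> borel"
      unfolding \<pi>_def using cylinder_borel[of L T] by measurable
  qed
  have \<pi>ae: "AE z in \<gamma>. \<pi> z = \<pi>0 z" using aeJ by eventually_elim (simp add: \<pi>_def)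
  have d\<mu>: "distr \<gamma> (restrict_space borel (cylinder L T)) \<pi> = \<mu>'"
  proof (rule measure_eqI)
    show "sets (distr \<gamma> (restrict_space borel (cylinder L T)) \<pi>) = sets \<mu>'" using \<mu>' by (simp add: finite_borel_measure_def)
    fix A assume "A \<in> sets (distr \<gamma> (restrict_space borel (cylinder L T)) \<pi>)"
    then have A': "A \<in> sets (restrict_space borel (cylinder L T))" by simp
    then have A: "A \<in> sets borel" "A \<subseteq> cylinder L T" by (simp_all add: sets_cylinder)
    have A0: "A \<in> sets (restrict_space borel (torus L \<times> UNIV))" using A cylc torU by (auto simp: sets_restrict_space_iff)
    have "emeasure (distr \<gamma> (restrict_space borel (cylinder L T)) \<pi>) A = emeasure \<gamma> (\<pi> -` A \<inter> space \<gamma>)"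
      by (rule emeasure_distr[OF \<pi>m A'])
    also have "\<dots> = emeasure \<gamma> (\<pi>0 -` A \<inter> space \<gamma>)"
      by (rule emeasure_eq_AE) (use \<pi>ae measurable_sets[OF \<pi>m A'] measurable_sets[OF \<pi>0m A0] in \<open>auto elim!: eventually_mono\<close>)
    also have "\<dots> = emeasure \<mu>' A" using em[OF A(1)] A(2) cylc by (simp add: s\<gamma> Int_absorb2)
    finally show "emeasure (distr \<gamma> (restrict_space borel (cylinder L T)) \<pi>) A = emeasure \<mu>' A" .
  qed
  define V where "V z = (1 / ?q z) *\<^sub>R ?u z" for z
  have Vm: "V \<in> borel_measurable \<gamma>"
    unfolding m\<gamma> V_def using qm um by measurable
  have V2: "(\<integral>\<^sup>+z. ennreal ((norm (V z))\<^sup>2) \<partial>\<gamma>) \<le> ennreal b"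
  proof -
    have c: "continuous_on UNIV (\<lambda>z :: ((real^2) \<times> real) \<times> ((real^2) \<times> real). 1 - ?q z)" by (intro continuous_intros)
    have "(\<integral>z. 1 - ?q z \<partial>\<theta> n) = (\<integral>p. (norm (v n p))\<^sup>2 \<partial>\<mu> n)" for n
    proof -
      have "w n p * (1 - ?q (compactify p (v n p))) = (norm (v n p))\<^sup>2" for p
        using wpos[of n p] by (simp add: compactify_def w_def right_diff_distrib)
      then show ?thesis by (subst \<theta>int[OF borel_measurable_continuous_onI[OF c]]) simp
    qed
    then have l: "(\<integral>z. 1 - ?q z \<partial>N) = b"
      using LIMSEQ_unique[OF lim[OF c] ] LIMSEQ_subseq_LIMSEQ[OF v2b r] by (simp add: o_def)
    have qi: "integrable N (\<lambda>z. 1 - ?q z)"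
    proof (rule N.integrable_const_bound[of _ 1])
      show "AE z in N. norm (1 - ?q z) \<le> 1" using q01 by eventually_elim auto
      show "(\<lambda>z. 1 - ?q z) \<in> borel_measurable N" using qm by measurable
    qed
    have "(\<integral>\<^sup>+z. ennreal ((norm (V z))\<^sup>2) \<partial>\<gamma>) = (\<integral>\<^sup>+z. ennreal (?q z) * ennreal ((norm (V z))\<^sup>2) \<partial>N)"
      unfolding \<gamma>_def
    proof (rule nn_integral_density)
      show "(\<lambda>z. ennreal ((norm (V z))\<^sup>2)) \<in> borel_measurable N" using Vm unfolding m\<gamma> by measurable
    qed (use qm in measurable)
    \<comment> \<open>For \<open>q > 0\<close> the equation of the sphere gives equality. At
      \<open>q = 0\<close> the left side is 0 and the right side 1; this is the only place where
      energy is lost.\<close>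
    also have "\<dots> \<le> (\<integral>\<^sup>+z. ennreal (1 - ?q z) \<partial>N)"
    proof (rule nn_integral_mono_AE)
      show "AE z in N. ennreal (?q z) * ennreal ((norm (V z))\<^sup>2) \<le> ennreal (1 - ?q z)"
        using q01
      proof eventually_elim
        case (elim z)
        show ?case
        proof (cases "?q z = 0")
          case False
          then have q: "?q z > 0" using elim by simp
          have "?q z * (norm (V z))\<^sup>2 = (norm (?u z))\<^sup>2 / ?q z"
            using q by (simp add: V_def power_divide power2_eq_square)
          also have "(norm (?u z))\<^sup>2 = ?q z * (1 - ?q z)" using elim by (simp add: power2_eq_square algebra_simps)
          finally have "?q z * (norm (V z))\<^sup>2 = 1 - ?q z" using q by simp
          then show ?thesis using elim by (simp flip: ennreal_mult)
        qed simp
      qed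
    qed
    also have "\<dots> = ennreal (\<integral>z. 1 - ?q z \<partial>N)"
      by (rule nn_integral_eq_integral[OF qi]) (use q01 in \<open>auto elim!: eventually_mono\<close>)
    finally show ?thesis by (simp add: l)
  qed
  then have V2': "(\<integral>\<^sup>+z. ennreal ((norm (V z))\<^sup>2) \<partial>\<gamma>) < \<infinity>" by (rule le_less_trans) simp
  note bary = finG \<pi>m Vm V2'
  define m' where "m' = bary_flux \<gamma> \<pi> V"
  have b\<mu>: "bary_measure \<gamma> \<pi> (cylinder L T) = \<mu>'" using bary_measure_def[OF bary] d\<mu> by simp
  have ce: "continuity_equation L T \<mu>' m'"
    unfolding continuity_equation_def
  proof (intro allI impI)
    fix \<psi> assume \<psi>: "test_function L T \<psi>"
    let ?d = "\<lambda>p. frechet_derivative \<psi> (at p) (0, 1)"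
    have dc: "continuous_on UNIV ?d" by (rule test_function_derivative_continuous[OF \<psi> horizontal_in_Basis(2)[OF \<psi>]])
    have dm: "?d \<in> borel_measurable borel" by (rule borel_measurable_continuous_onI[OF dc])
    obtain C1 where C1: "\<forall>p. \<bar>?d p\<bar> \<le> C1" using test_function_derivative_bounded[OF \<psi> L horizontal_in_Basis(2)[OF \<psi>]] by (rule exE)
    obtain C2 where C2: "\<forall>p. norm (hgrad \<psi> p) \<le> C2" using hgrad_bounded[OF \<psi> L] by (rule exE)
    have gc: "continuous_on UNIV (hgrad \<psi>)" by (rule hgrad_continuous[OF \<psi>])
    have gm: "hgrad \<psi> \<in> borel_measurable borel" by (rule borel_measurable_continuous_onI[OF gc])
    have dw: "?d (wrap L x, t) = ?d (x, t)" for x t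
      by (rule periodic_wrap[OF test_function_derivative_periodic[OF \<psi>]])
    have gm': "hgrad \<psi> \<in> borel_measurable (bary_measure \<gamma> \<pi> (cylinder L T))"
      unfolding b\<mu> by (rule borel_measurable_cylinder_measure[OF \<mu>' gm])
    have e2: "(\<integral>p. hgrad \<psi> p \<bullet> vector_RN_deriv \<mu>' m' p \<partial>\<mu>') = (\<integral>z. hgrad \<psi> (\<pi> z) \<bullet> V z \<partial>\<gamma>)"
      using bary_density_test(1)[OF bary gm' spec[OF C2]] unfolding b\<mu> m'_def .
    have "(\<integral>z. hgrad \<psi> (\<pi> z) \<bullet> V z \<partial>\<gamma>) = (\<integral>z. hgrad \<psi> (fst z) \<bullet> V z \<partial>\<gamma>)"
    proof (rule integral_cong_AE)
      show "(\<lambda>z. hgrad \<psi> (\<pi> z) \<bullet> V z) \<in> borel_measurable \<gamma>"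
        using measurable_compose[OF \<pi>m measurable_restrict_space1[OF gm]] Vm by measurable
      show "(\<lambda>z. hgrad \<psi> (fst z) \<bullet> V z) \<in> borel_measurable \<gamma>"
        using measurable_compose[OF fstm gm] Vm unfolding m\<gamma> by measurable
      show "AE z in \<gamma>. hgrad \<psi> (\<pi> z) \<bullet> V z = hgrad \<psi> (fst z) \<bullet> V z"
        using \<pi>ae by eventually_elim (simp add: \<pi>0_def hgrad_periodic[OF \<psi>])
    qed
    also have "\<dots> = (\<integral>z. ?q z * (hgrad \<psi> (fst z) \<bullet> V z) \<partial>N)"
      by (rule \<gamma>int) (use measurable_compose[OF fstm gm] Vm[unfolded m\<gamma>] in measurable)
    \<comment> \<open>Where \<open>q = 0\<close>, the equation of the sphere forces
      \<open>u = 0\<close>, so \<open>q * V = u\<close> holds there as well: infinite velocities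
      carry no flux.\<close>
    also have "\<dots> = (\<integral>z. hgrad \<psi> (fst z) \<bullet> ?u z \<partial>N)"
    proof (rule integral_cong_AE)
      show "(\<lambda>z. ?q z * (hgrad \<psi> (fst z) \<bullet> V z)) \<in> borel_measurable N"
        using measurable_compose[OF fstm gm] Vm[unfolded m\<gamma>] qm by measurable
      show "(\<lambda>z. hgrad \<psi> (fst z) \<bullet> ?u z) \<in> borel_measurable N"
        using measurable_compose[OF fstm gm] um by measurable
      show "AE z in N. ?q z * (hgrad \<psi> (fst z) \<bullet> V z) = hgrad \<psi> (fst z) \<bullet> ?u z"
        using q01
      proof eventually_elim
        case (elim z)
        then show ?case by (cases "?q z = 0") (auto simp: V_def)
      qed
    qed
    finally have e2': "(\<integral>z. hgrad \<psi> (\<pi> z) \<bullet> V z \<partial>\<gamma>) = (\<integral>z. hgrad \<psi> (fst z) \<bullet> ?u z \<partial>N)" .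
    have "(\<integral>p. ?d p \<partial>\<mu>') = (\<integral>z. ?d (\<pi> z) \<partial>\<gamma>)"
      using integral_distr[OF \<pi>m measurable_restrict_space1[OF dm]] by (simp add: d\<mu>)
    also have "\<dots> = (\<integral>z. ?d (fst z) \<partial>\<gamma>)"
    proof (rule integral_cong_AE)
      show "(\<lambda>z. ?d (\<pi> z)) \<in> borel_measurable \<gamma>"
        by (rule measurable_compose[OF \<pi>m measurable_restrict_space1[OF dm]])
      show "(\<lambda>z. ?d (fst z)) \<in> borel_measurable \<gamma>"
        unfolding m\<gamma> by (rule measurable_compose[OF fstm dm])
      show "AE z in \<gamma>. ?d (\<pi> z) = ?d (fst z)"
        using \<pi>ae by eventually_elim (simp add: \<pi>0_def dw)
    qed
    also have "\<dots> = (\<integral>z. ?q z * ?d (fst z) \<partial>N)"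
      by (rule \<gamma>int[OF measurable_compose[OF fstm dm]])
    finally have e1: "(\<integral>p. ?d p \<partial>\<mu>') = (\<integral>z. ?q z * ?d (fst z) \<partial>N)" .
    \<comment> \<open>The integrand of the continuity equation in compact coordinates. It is
      continuous also at infinite velocity and integrates to 0 against every
      \<open>\<theta> n\<close>.\<close>
    let ?\<Psi> = "\<lambda>z :: ((real^2) \<times> real) \<times> ((real^2) \<times> real). ?q z * ?d (fst z) + hgrad \<psi> (fst z) \<bullet> ?u z"
    have \<Psi>c: "continuous_on UNIV ?\<Psi>"
      by (intro continuous_intros continuous_on_compose2[OF dc] continuous_on_compose2[OF gc]) auto
    have "(\<integral>z. ?\<Psi> z \<partial>\<theta> n) = 0" for n
    proof -
      have "w n p * ?\<Psi> (compactify p (v n p)) = ?d p + hgrad \<psi> p \<bullet> v n p" for p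
      proof -
        have "w n p * ?q (compactify p (v n p)) = 1" "w n p *\<^sub>R ?u (compactify p (v n p)) = v n p"
          "fst (compactify p (v n p)) = p"
          using wpos[of n p] by (simp_all add: compactify_def w_def)
        moreover have "w n p * ?\<Psi> (compactify p (v n p)) = (w n p * ?q (compactify p (v n p))) * ?d (fst (compactify p (v n p))) +
            hgrad \<psi> (fst (compactify p (v n p))) \<bullet> (w n p *\<^sub>R ?u (compactify p (v n p)))"
          by (simp add: algebra_simps)
        ultimately show ?thesis by simp
      qed
      then have "(\<integral>z. ?\<Psi> z \<partial>\<theta> n) = (\<integral>p. ?d p + hgrad \<psi> p \<bullet> v n p \<partial>\<mu> n)"
        by (subst \<theta>int[OF borel_measurable_continuous_onI[OF \<Psi>c]]) simp
      also have "\<dots> = (\<integral>p. ?d p \<partial>\<mu> n) + (\<integral>p. hgrad \<psi> p \<bullet> v n p \<partial>\<mu> n)"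
      proof (rule Bochner_Integration.integral_add)
        show "integrable (\<mu> n) ?d"
          by (rule finite_measure.integrable_const_bound[OF fin, of _ C1])
             (use C1 in \<open>auto intro!: borel_measurable_cylinder_measure[OF \<mu> dm]\<close>)
        show "integrable (\<mu> n) (\<lambda>p. hgrad \<psi> p \<bullet> v n p)"
        proof (rule Bochner_Integration.integrable_bound[of _ "\<lambda>p. C2 * norm (v n p)"])
          show "integrable (\<mu> n) (\<lambda>p. C2 * norm (v n p))" using vi by simp
          show "(\<lambda>p. hgrad \<psi> p \<bullet> v n p) \<in> borel_measurable (\<mu> n)"
            using borel_measurable_cylinder_measure[OF \<mu> gm, of n] vm[of n] by measurable
          show "AE p in \<mu> n. norm (hgrad \<psi> p \<bullet> v n p) \<le> norm (C2 * norm (v n p))"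
          proof (rule AE_I2)
            fix p
            have "\<bar>hgrad \<psi> p \<bullet> v n p\<bar> \<le> norm (hgrad \<psi> p) * norm (v n p)" by (rule Cauchy_Schwarz_ineq2)
            also have "\<dots> \<le> C2 * norm (v n p)" by (rule mult_right_mono[OF spec[OF C2]]) simp
            finally show "norm (hgrad \<psi> p \<bullet> v n p) \<le> norm (C2 * norm (v n p))" by simp
          qed
        qed
      qed
      also have "\<dots> = 0"
      proof -
        have "(\<integral>p. ?d p \<partial>\<mu> n) + (\<integral>p. frechet_derivative \<psi> (at p) (v n p, 0) \<partial>\<mu> n) = 0"
          using m(3)[of n] \<psi> unfolding continuity_equation_def v_def by blast
        then show ?thesis unfolding hgrad_inner[OF \<psi>] .
      qed
      finally show ?thesis .
    qed
    then have "(\<integral>z. ?\<Psi> z \<partial>N) = 0" using lim[OF \<Psi>c] by (simp add: LIMSEQ_const_iff)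
    moreover have "(\<integral>z. ?\<Psi> z \<partial>N) = (\<integral>z. ?q z * ?d (fst z) \<partial>N) + (\<integral>z. hgrad \<psi> (fst z) \<bullet> ?u z \<partial>N)"
    proof (rule Bochner_Integration.integral_add)
      show "integrable N (\<lambda>z. ?q z * ?d (fst z))"
      proof (rule N.integrable_const_bound[of _ "1 * C1"])
        show "AE z in N. norm (?q z * ?d (fst z)) \<le> 1 * C1"
          using q01
        proof eventually_elim
          case (elim z)
          then have "\<bar>?q z\<bar> * \<bar>?d (fst z)\<bar> \<le> 1 * C1" by (intro mult_mono' spec[OF C1]) auto
          then show ?case by (simp add: abs_mult)
        qed
        show "(\<lambda>z. ?q z * ?d (fst z)) \<in> borel_measurable N"
          using measurable_compose[OF fstm dm] qm by measurable
      qed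
      show "integrable N (\<lambda>z. hgrad \<psi> (fst z) \<bullet> ?u z)"
      proof (rule N.integrable_const_bound[of _ "C2 * 1"])
        show "AE z in N. norm (hgrad \<psi> (fst z) \<bullet> ?u z) \<le> C2 * 1"
          using q01
        proof eventually_elim
          case (elim z)
          have "\<bar>hgrad \<psi> (fst z) \<bullet> ?u z\<bar> \<le> norm (hgrad \<psi> (fst z)) * norm (?u z)" by (rule Cauchy_Schwarz_ineq2)
          also have "\<dots> \<le> C2 * 1" by (rule mult_mono'[OF spec[OF C2]]) (use elim in auto)
          finally show ?case by simp
        qed
        show "(\<lambda>z. hgrad \<psi> (fst z) \<bullet> ?u z) \<in> borel_measurable N"
          using measurable_compose[OF fstm gm] um by measurable
      qed
    qed
    ultimately show "(\<integral>p. ?d p \<partial>\<mu>') + (\<integral>p. frechet_derivative \<psi> (at p) (vector_RN_deriv \<mu>' m' p, 0) \<partial>\<mu>') = 0"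
      using e1 e2 e2' by (simp add: hgrad_inner[OF \<psi>])
  qed
  have "(\<integral>\<^sup>+p. ennreal ((norm (vector_RN_deriv \<mu>' m' p))\<^sup>2) \<partial>\<mu>') \<le> ennreal b"
    using nn_integral_bary_density_le[OF bary] V2 unfolding b\<mu> m'_def by (rule order_trans)
  moreover have "vector_measure (cylinder L T) m'" unfolding m'_def by (rule vector_measure_bary_flux[OF bary])
  moreover have "vector_abs_cont m' \<mu>'" using vector_abs_cont_bary_flux[OF bary] unfolding b\<mu> m'_def .
  ultimately show ?thesis using \<mu>' wc ce by blast
qed

section \<open>Branching transport of finite energy\<close>

definition base_corner :: "real \<Rightarrow> real^2"
  where "base_corner L = (\<chi> i. - L / 2)"

text \<open>The lower left corner of the dyadic square of level \<open>n\<close> that contains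
  \<open>x\<close>.\<close>

definition corner :: "real \<Rightarrow> nat \<Rightarrow> real^2 \<Rightarrow> real^2"
  where "corner L n x = (\<chi> i. - L / 2 + L * (of_int \<lfloor>2 ^ n * (x $ i / L + 1 / 2)\<rfloor> / 2 ^ n))"

definition incr :: "real \<Rightarrow> nat \<Rightarrow> real^2 \<Rightarrow> real^2"
  where "incr L n x = corner L (Suc n) x - corner L n x"

lemma torus_unit:
  assumes "L > 0" "x \<in> torus L"
  shows "0 \<le> x $ i / L + 1 / 2" "x $ i / L + 1 / 2 < 1"
proof -
  have "- L / 2 \<le> x $ i" "x $ i < L / 2" using assms(2) by (simp_all add: torus_def)
  then have "- (1 / 2) \<le> x $ i / L" "x $ i / L < 1 / 2" using assms(1) by (simp_all add: field_simps)
  then show "0 \<le> x $ i / L + 1 / 2" "x $ i / L + 1 / 2 < 1" by linarith+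
qed

lemma corner_0:
  assumes "L > 0" "x \<in> torus L" shows "corner L 0 x = base_corner L"
proof -
  have "\<lfloor>x $ i / L + 1 / 2\<rfloor> = 0" for i
    using torus_unit[OF assms, of i] unfolding floor_eq_iff of_int_0 by linarith
  then show ?thesis by (simp add: corner_def base_corner_def vec_eq_iff)
qed

lemma floor_dyadic_refine:
  fixes z :: real assumes "n \<le> k"
  shows "\<lfloor>(2::real) ^ n * (of_int \<lfloor>2 ^ k * z\<rfloor> / 2 ^ k)\<rfloor> = \<lfloor>2 ^ n * z\<rfloor>"
proof -
  define d where "d = k - n"
  have k: "(2::real) ^ k = 2 ^ n * 2 ^ d" using assms by (simp add: d_def flip: power_add)
  have e: "real_of_int (2 ^ d) = 2 ^ d" by simp
  have "(2::real) ^ n * (of_int \<lfloor>2 ^ k * z\<rfloor> / 2 ^ k) = of_int \<lfloor>2 ^ k * z\<rfloor> / real_of_int (2 ^ d)"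
    unfolding e by (simp add: k)
  then have "\<lfloor>(2::real) ^ n * (of_int \<lfloor>2 ^ k * z\<rfloor> / 2 ^ k)\<rfloor> = \<lfloor>2 ^ k * z\<rfloor> div 2 ^ d"
    by (simp only: floor_divide_of_int_eq)
  also have "\<dots> = \<lfloor>2 ^ k * z / real_of_int (2 ^ d)\<rfloor>"
    by (rule floor_divide_real_eq_div[symmetric]) simp
  also have "2 ^ k * z / real_of_int (2 ^ d) = 2 ^ n * z" unfolding e by (simp add: k)
  finally show ?thesis .
qed

lemma corner_corner: "L > 0 \<Longrightarrow> n \<le> k \<Longrightarrow> corner L n (corner L k x) = corner L n x"
proof -
  assume L: "L > 0" and nk: "n \<le> k"
  have "(corner L k x) $ i / L + 1 / 2 = of_int \<lfloor>2 ^ k * (x $ i / L + 1 / 2)\<rfloor> / 2 ^ k" for i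
  proof -
    have "(- L / 2 + L * a) / L + 1 / 2 = a" for a using L by (simp add: field_simps)
    then show ?thesis by (simp only: corner_def vec_lambda_beta)
  qed
  then show ?thesis by (simp only: corner_def[of L n] floor_dyadic_refine[OF nk])
qed

text \<open>Rounding at level \<open>k\<close> keeps the first \<open>k\<close> binary digits. Hence
  all points of one dyadic square share their early increments, which is what makes particles travel
  together.\<close>

lemma incr_corner: "L > 0 \<Longrightarrow> n < k \<Longrightarrow> incr L n (corner L k x) = incr L n x"
  by (simp add: incr_def corner_corner)

text \<open>Doubling before taking the floor changes twice the floor by 0 or 1; this bit is the next
  binary digit, worth \<open>L / 2 ^ Suc n\<close>.\<close>

lemma incr_bounds:
  assumes L: "L > 0"
  shows "0 \<le> incr L n x $ i" "incr L n x $ i \<le> L / 2 ^ Suc n"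
proof -
  define w where "w = 2 ^ n * (x $ i / L + 1 / 2)"
  have w2: "2 ^ Suc n * (x $ i / L + 1 / 2) = 2 * w" by (simp add: w_def)
  have e: "incr L n x $ i = L * (real_of_int (\<lfloor>2 * w\<rfloor> - 2 * \<lfloor>w\<rfloor>) / 2 ^ Suc n)"
  proof -
    have "incr L n x $ i = L * (of_int \<lfloor>2 * w\<rfloor> / 2 ^ Suc n) - L * (of_int \<lfloor>w\<rfloor> / 2 ^ n)"
      by (simp only: incr_def corner_def vector_minus_component vec_lambda_beta w2) (simp add: w_def)
    moreover have "L * (a / 2 ^ Suc n) - L * (b / 2 ^ n) = L * ((a - 2 * b) / 2 ^ Suc n)" for a b :: real
      by (simp add: field_simps)
    ultimately show ?thesis by (simp only: of_int_diff of_int_mult of_int_numeral)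
  qed
  have "2 * \<lfloor>w\<rfloor> \<le> \<lfloor>2 * w\<rfloor>" "\<lfloor>2 * w\<rfloor> \<le> 2 * \<lfloor>w\<rfloor> + 1" by linarith+
  then have b: "0 \<le> real_of_int (\<lfloor>2 * w\<rfloor> - 2 * \<lfloor>w\<rfloor>)" "real_of_int (\<lfloor>2 * w\<rfloor> - 2 * \<lfloor>w\<rfloor>) \<le> 1" by linarith+
  show "0 \<le> incr L n x $ i" unfolding e using L b(1) by (intro mult_nonneg_nonneg divide_nonneg_nonneg) auto
  have "L * (real_of_int (\<lfloor>2 * w\<rfloor> - 2 * \<lfloor>w\<rfloor>) / 2 ^ Suc n) \<le> L * (1 / 2 ^ Suc n)"
    by (intro mult_left_mono divide_right_mono b) (use L in auto)
  then show "incr L n x $ i \<le> L / 2 ^ Suc n" unfolding e by simp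
qed

lemma norm_incr_le:
  assumes L: "L > 0" shows "norm (incr L n x) \<le> L * (1 / 2) ^ n"
proof -
  have "norm (incr L n x) \<le> (\<Sum>i\<in>UNIV. \<bar>incr L n x $ i\<bar>)" by (rule norm_le_l1_cart)
  also have "\<dots> \<le> (\<Sum>i\<in>(UNIV :: 2 set). L / 2 ^ Suc n)"
    using incr_bounds[OF L, of n x] by (intro sum_mono) (simp only: abs_of_nonneg)
  also have "\<dots> = L * (1 / 2) ^ n" by (simp add: power_divide)
  finally show ?thesis .
qed

lemma incr_sums:
  assumes L: "L > 0" and x: "x \<in> torus L"
  shows "(\<lambda>n. incr L n x) sums (x - base_corner L)"
proof -
  have ps: "(\<Sum>n<N. incr L n x) = corner L N x - base_corner L" for N
    by (induction N) (simp_all add: incr_def corner_0[OF L x])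
  have "(\<lambda>N. corner L N x) \<longlonglongrightarrow> x"
  proof (rule vec_tendstoI)
    fix i
    have "(\<lambda>N. - L / 2 + L * (of_int \<lfloor>2 ^ N * (x $ i / L + 1 / 2)\<rfloor> / 2 ^ N)) \<longlonglongrightarrow> - L / 2 + L * (x $ i / L + 1 / 2)"
      by (intro tendsto_intros tendsto_dyadic_floor)
    moreover have "- L / 2 + L * (x $ i / L + 1 / 2) = x $ i" using L by (simp add: field_simps)
    ultimately show "(\<lambda>N. corner L N x $ i) \<longlonglongrightarrow> x $ i" by (simp add: corner_def)
  qed
  then show ?thesis unfolding sums_def ps by (intro tendsto_diff tendsto_const)
qed

lemma finite_corners:
  assumes L: "L > 0"
  shows "finite (corner L N ` torus L)" "card (corner L N ` torus L) \<le> 4 ^ N"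
proof -
  let ?S = "{0..<2 ^ N} \<times> {0..<2 ^ N} :: (int \<times> int) set"
  let ?h = "\<lambda>p. (\<chi> i. - L / 2 + L * (of_int (if i = 1 then fst p else snd p) / 2 ^ N)) :: real^2"
  have sub: "corner L N ` torus L \<subseteq> ?h ` ?S"
  proof
    fix c assume "c \<in> corner L N ` torus L"
    then obtain x where x: "x \<in> torus L" "c = corner L N x" by auto
    define a where "a i = \<lfloor>2 ^ N * (x $ i / L + 1 / 2)\<rfloor>" for i
    have a: "a i \<in> {0..<2 ^ N}" for i
    proof -
      note u = torus_unit[OF L x(1), of i]
      have "0 \<le> 2 ^ N * (x $ i / L + 1 / 2)" using u(1) by simp
      moreover have "2 ^ N * (x $ i / L + 1 / 2) < 2 ^ N * 1" using u(2) by (intro mult_strict_left_mono) auto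
      ultimately show ?thesis by (simp add: a_def floor_less_iff)
    qed
    have "c = ?h (a 1, a 2)"
      unfolding x(2) corner_def by (simp add: vec_eq_iff forall_2 a_def)
    moreover have "(a 1, a 2) \<in> ?S" using a by simp
    ultimately show "c \<in> ?h ` ?S" by (rule image_eqI)
  qed
  have fS: "finite ?S" by simp
  show "finite (corner L N ` torus L)" by (rule finite_subset[OF sub finite_imageI[OF fS]])
  have "card (corner L N ` torus L) \<le> card (?h ` ?S)" by (rule card_mono[OF finite_imageI[OF fS] sub])
  also have "\<dots> \<le> card ?S" by (rule card_image_le[OF fS])
  also have "\<dots> = 4 ^ N" by (simp add: nat_power_eq flip: power_mult_distrib)
  finally show "card (corner L N ` torus L) \<le> 4 ^ N" .
qed

text \<open>The ratio 1/3 lies between 1/4 and 1/2: the lengths \<open>\<tau>\<^sub>n\<close> of the time intervals make both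
  \<open>\<Sum> 2\<^sup>n \<tau>\<^sub>n\<close> (perimeter) and \<open>\<Sum> 4\<^sup>-\<^sup>n / \<tau>\<^sub>n\<close> (kinetic energy) converge.\<close>

definition branch_time :: "real \<Rightarrow> nat \<Rightarrow> real"
  where "branch_time T n = T * (1 - (1 / 3) ^ n)"

definition branch_len :: "real \<Rightarrow> nat \<Rightarrow> real"
  where "branch_len T n = T * (2 / 3) * (1 / 3) ^ n"

definition ramp :: "real \<Rightarrow> nat \<Rightarrow> real \<Rightarrow> real"
  where "ramp T n t = max 0 (min 1 ((t - branch_time T n) / branch_len T n))"

definition rate :: "real \<Rightarrow> nat \<Rightarrow> real \<Rightarrow> real"
  where "rate T n t = (if branch_time T n < t \<and> t < branch_time T (Suc n) then 1 / branch_len T n else 0)"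

definition branch :: "real \<Rightarrow> real \<Rightarrow> real^2 \<Rightarrow> real \<Rightarrow> real^2"
  where "branch L T y t = (\<Sum>n. ramp T n t *\<^sub>R incr L n y)"

definition branch_vel :: "real \<Rightarrow> real \<Rightarrow> real^2 \<Rightarrow> real \<Rightarrow> real^2"
  where "branch_vel L T y t = (\<Sum>n. rate T n t *\<^sub>R incr L n y)"

text \<open>The pair \<open>\<omega>\<close> holds the start in its first and the end in its second
  component. As \<open>branch\<close> vanishes at nonpositive times, only one of the two branches is
  active on each side of 0, and the first is run backwards.\<close>

definition bpath :: "real \<Rightarrow> real \<Rightarrow> (real^2) \<times> (real^2) \<Rightarrow> real \<Rightarrow> real^2"
  where "bpath L T \<omega> t = base_corner L + branch L T (snd \<omega>) t + branch L T (fst \<omega>) (- t)"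

definition bpath_vel :: "real \<Rightarrow> real \<Rightarrow> (real^2) \<times> (real^2) \<Rightarrow> real \<Rightarrow> real^2"
  where "bpath_vel L T \<omega> t = branch_vel L T (snd \<omega>) t - branch_vel L T (fst \<omega>) (- t)"

section \<open>Paths that correct one binary digit at a time\<close>

context
  fixes L T :: real
  assumes L: "L > 0" and T: "T > 0"
begin

lemma branch_len_pos: "0 < branch_len T n"
  using T by (simp add: branch_len_def)

lemma branch_time_Suc: "branch_time T (Suc n) = branch_time T n + branch_len T n"
  by (simp add: branch_time_def branch_len_def field_simps)

lemma branch_time_0: "branch_time T 0 = 0"
  by (simp add: branch_time_def)

lemma branch_time_mono: "m \<le> n \<Longrightarrow> branch_time T m \<le> branch_time T n"
  using T by (simp add: branch_time_def power_decreasing)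

lemma branch_time_nonneg: "0 \<le> branch_time T n"
  using branch_time_mono[of 0 n] by (simp add: branch_time_0)

lemma branch_time_less: "branch_time T n < T"
  using T by (simp add: branch_time_def right_diff_distrib)

lemma branch_time_tendsto: "branch_time T \<longlonglongrightarrow> T"
proof -
  have "(\<lambda>n. T * (1 - (1 / 3) ^ n)) \<longlonglongrightarrow> T * (1 - 0)"
    by (intro tendsto_intros LIMSEQ_realpow_zero) auto
  then show ?thesis by (simp add: branch_time_def[abs_def])
qed

lemma less_branch_time: "t < T \<Longrightarrow> \<exists>N. t < branch_time T N"
  using order_tendstoD(1)[OF branch_time_tendsto] by (auto simp: eventually_sequentially)

lemma branch_level:
  assumes "0 \<le> t" "t < T"
  obtains n where "branch_time T n \<le> t" "t < branch_time T (Suc n)"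
proof -
  define N where "N = (LEAST n. t < branch_time T n)"
  have N: "t < branch_time T N" unfolding N_def by (rule LeastI_ex[OF less_branch_time[OF assms(2)]])
  have "N \<noteq> 0" using N assms(1) by (auto simp: branch_time_0 intro: ccontr)
  then obtain n where n: "N = Suc n" using not0_implies_Suc by blast
  have "\<not> t < branch_time T n" using not_less_Least[of n "\<lambda>n. t < branch_time T n"] n by (simp add: N_def)
  then show thesis using that[of n] N n by simp
qed

lemma ramp_bounds: "0 \<le> ramp T n t" "ramp T n t \<le> 1"
  by (simp_all add: ramp_def)

lemma ramp_early: "t \<le> branch_time T n \<Longrightarrow> ramp T n t = 0"
proof -
  assume "t \<le> branch_time T n"
  then have "(t - branch_time T n) / branch_len T n \<le> 0" using branch_len_pos[of n] by (simp add: divide_le_0_iff)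
  then show ?thesis by (simp add: ramp_def)
qed

lemma ramp_late: "branch_time T (Suc n) \<le> t \<Longrightarrow> ramp T n t = 1"
proof -
  assume "branch_time T (Suc n) \<le> t"
  then have "1 \<le> (t - branch_time T n) / branch_len T n" using branch_len_pos[of n] by (simp add: branch_time_Suc)
  then show ?thesis by (simp add: ramp_def)
qed

lemma continuous_ramp: "continuous_on S (ramp T n)"
  unfolding ramp_def using branch_len_pos[of n] by (intro continuous_intros) auto

lemma ramp_deriv:
  assumes "t \<noteq> branch_time T n" "t \<noteq> branch_time T (Suc n)"
  shows "(ramp T n has_real_derivative rate T n t) (at t)"
proof -
  consider "t < branch_time T n" | "branch_time T n < t" "t < branch_time T (Suc n)" | "branch_time T (Suc n) < t"
    using assms by linarith
  then show ?thesis
  proof cases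
    case 1
    have d: "((\<lambda>_. 0) has_real_derivative rate T n t) (at t)" using 1 by (simp add: rate_def)
    show ?thesis
      by (rule has_field_derivative_transform_within_open[OF d, of "{..<branch_time T n}"]) (use 1 ramp_early in auto)
  next
    case 2
    have d: "((\<lambda>t. (t - branch_time T n) / branch_len T n) has_real_derivative rate T n t) (at t)"
      using 2 branch_len_pos[of n] by (auto intro!: derivative_eq_intros simp: rate_def)
    have e: "(s - branch_time T n) / branch_len T n = ramp T n s" if "s \<in> {branch_time T n<..<branch_time T (Suc n)}" for s
    proof -
      have "0 \<le> (s - branch_time T n) / branch_len T n" "(s - branch_time T n) / branch_len T n \<le> 1"
        using that branch_len_pos[of n] by (simp_all add: branch_time_Suc)
      then show ?thesis by (simp add: ramp_def)
    qed
    show ?thesis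
      by (rule has_field_derivative_transform_within_open[OF d open_greaterThanLessThan _ e]) (use 2 in auto)
  next
    case 3
    have "branch_time T n < t" using 3 branch_len_pos[of n] by (simp add: branch_time_Suc)
    then have d: "((\<lambda>_. 1) has_real_derivative rate T n t) (at t)" using 3 by (simp add: rate_def)
    show ?thesis
      by (rule has_field_derivative_transform_within_open[OF d, of "{branch_time T (Suc n)<..}"]) (use 3 ramp_late in auto)
  qed
qed

lemma summable_L: "summable (\<lambda>n. L * (1 / 2) ^ n)"
  by (intro summable_mult summable_geometric) auto

lemma norm_ramp_incr: "norm (ramp T n t *\<^sub>R incr L n y) \<le> L * (1 / 2) ^ n"
  using ramp_bounds[of n t] norm_incr_le[OF L, of n y] mult_mono[of "ramp T n t" 1 "norm (incr L n y)" "L * (1 / 2) ^ n"]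
  by simp

lemma summable_branch: "summable (\<lambda>n. ramp T n t *\<^sub>R incr L n y)"
  by (rule summable_comparison_test'[OF summable_L norm_ramp_incr])

text \<open>The increments decay geometrically, so the series converges uniformly. This includes
  time \<open>T\<close>, where infinitely many digits accumulate.\<close>

lemma branch_continuous: "continuous_on UNIV (branch L T y)"
proof -
  have "uniform_limit UNIV (\<lambda>N t. \<Sum>n<N. ramp T n t *\<^sub>R incr L n y) (\<lambda>t. \<Sum>n. ramp T n t *\<^sub>R incr L n y) sequentially"
    by (rule Weierstrass_m_test[OF norm_ramp_incr summable_L])
  then have "uniform_limit UNIV (\<lambda>N t. \<Sum>n<N. ramp T n t *\<^sub>R incr L n y) (branch L T y) sequentially"
    unfolding branch_def .
  then show ?thesis
    by (rule uniform_limit_theorem[rotated]) (auto intro!: always_eventually continuous_intros continuous_ramp)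
qed

lemma branch_nonpos: "t \<le> 0 \<Longrightarrow> branch L T y t = 0"
proof -
  assume t: "t \<le> 0"
  have "ramp T n t = 0" for n using ramp_early[of t n] branch_time_nonneg[of n] t by linarith
  then show ?thesis by (simp add: branch_def)
qed

text \<open>All increments are nonnegative and all ramps lie between 0 and 1, so each coordinate
  stays between the base corner and the target. The paths therefore never cross the seam of the
  torus.\<close>

lemma branch_bounds:
  assumes y: "y \<in> torus L"
  shows "0 \<le> branch L T y t $ i" "branch L T y t $ i \<le> y $ i + L / 2"
proof -
  have s: "(\<lambda>n. (ramp T n t *\<^sub>R incr L n y) $ i) sums (branch L T y t $ i)"
    unfolding branch_def by (rule bounded_linear.sums[OF bounded_linear_vec_nth summable_sums[OF summable_branch]])
  have s': "(\<lambda>n. incr L n y $ i) sums ((y - base_corner L) $ i)"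
    by (rule bounded_linear.sums[OF bounded_linear_vec_nth incr_sums[OF L y]])
  note ib = incr_bounds(1)[OF L, of _ y i]
  show "0 \<le> branch L T y t $ i"
  proof (rule sums_le[OF _ sums_zero s])
    show "0 \<le> (ramp T n t *\<^sub>R incr L n y) $ i" for n using ramp_bounds(1)[of n t] ib[of n] by simp
  qed
  have "branch L T y t $ i \<le> (y - base_corner L) $ i"
  proof (rule sums_le[OF _ s s'])
    show "(ramp T n t *\<^sub>R incr L n y) $ i \<le> incr L n y $ i" for n
      using mult_right_mono[OF ramp_bounds(2)[of n t] ib[of n]] by simp
  qed
  then show "branch L T y t $ i \<le> y $ i + L / 2" by (simp add: base_corner_def)
qed

lemma branch_end: "y \<in> torus L \<Longrightarrow> branch L T y T = y - base_corner L"
proof -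
  assume y: "y \<in> torus L"
  have "ramp T n T = 1" for n by (rule ramp_late[OF less_imp_le[OF branch_time_less]])
  then show ?thesis using incr_sums[OF L y] by (simp add: branch_def sums_iff)
qed

lemma branch_finite_sum:
  assumes "t \<le> branch_time T N"
  shows "branch L T y t = (\<Sum>n<N. ramp T n t *\<^sub>R incr L n y)"
  unfolding branch_def
proof (rule suminf_finite)
  fix n assume "n \<notin> {..<N}"
  then have "t \<le> branch_time T n" using assms branch_time_mono[of N n] by simp
  then show "ramp T n t *\<^sub>R incr L n y = 0" by (simp add: ramp_early)
qed simp

text \<open>Up to that time only increments below level \<open>N\<close> have started, and these
  depend on \<open>y\<close> only through its corner.\<close>

lemma branch_corner: "t \<le> branch_time T N \<Longrightarrow> branch L T (corner L N y) t = branch L T y t"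
  unfolding branch_finite_sum by (rule sum.cong) (simp_all add: incr_corner[OF L])

lemma rate_early: "t \<le> branch_time T n \<Longrightarrow> rate T n t = 0"
  by (simp add: rate_def)

lemma branch_vel_finite_sum:
  assumes "t \<le> branch_time T N"
  shows "branch_vel L T y t = (\<Sum>n<N. rate T n t *\<^sub>R incr L n y)"
  unfolding branch_vel_def
proof (rule suminf_finite)
  fix n assume "n \<notin> {..<N}"
  then have "t \<le> branch_time T n" using assms branch_time_mono[of N n] by simp
  then show "rate T n t *\<^sub>R incr L n y = 0" by (simp add: rate_early)
qed simp

text \<open>The time intervals of the levels are disjoint, so at most one digit moves at any
  time.\<close>

lemma branch_vel_cases:
  "branch_vel L T y t = 0 \<or> (\<exists>n. branch_time T n < t \<and> t < branch_time T (Suc n) \<and>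
    branch_vel L T y t = (1 / branch_len T n) *\<^sub>R incr L n y)"
proof (cases "\<exists>n. branch_time T n < t \<and> t < branch_time T (Suc n)")
  case True
  then obtain n where n: "branch_time T n < t" "t < branch_time T (Suc n)" by blast
  have z: "rate T k t = 0" if "k \<noteq> n" for k
  proof (cases "k < n")
    case True
    then have "branch_time T (Suc k) \<le> t" using branch_time_mono[of "Suc k" n] n by simp
    then show ?thesis by (simp add: rate_def)
  next
    case False
    then have "t < branch_time T k" using branch_time_mono[of "Suc n" k] n that by simp
    then show ?thesis by (simp add: rate_def)
  qed
  have "branch_vel L T y t = (\<Sum>k\<in>{n}. rate T k t *\<^sub>R incr L k y)"
    unfolding branch_vel_def by (rule suminf_finite) (use z in auto)
  then show ?thesis using n by (auto simp: rate_def)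
next
  case False
  then have "rate T k t = 0" for k by (auto simp: rate_def)
  then show ?thesis by (simp add: branch_vel_def)
qed

lemma branch_vel_nonpos: "t \<le> 0 \<Longrightarrow> branch_vel L T y t = 0"
  using branch_vel_finite_sum[of t 0 y] by (simp add: branch_time_0)

lemma branch_has_derivative:
  assumes t: "t < branch_time T N" and ne: "\<And>n. n \<le> N \<Longrightarrow> t \<noteq> branch_time T n"
  shows "(branch L T y has_vector_derivative branch_vel L T y t) (at t)"
proof -
  have "((\<lambda>t. \<Sum>n<N. ramp T n t *\<^sub>R incr L n y) has_vector_derivative (\<Sum>n<N. rate T n t *\<^sub>R incr L n y)) (at t)"
  proof (rule has_vector_derivative_sum)
    fix n assume "n \<in> {..<N}"
    then have "(ramp T n has_real_derivative rate T n t) (at t)" using ne[of n] ne[of "Suc n"] by (intro ramp_deriv) auto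
    then show "((\<lambda>t. ramp T n t *\<^sub>R incr L n y) has_vector_derivative rate T n t *\<^sub>R incr L n y) (at t)"
      by (auto intro!: derivative_eq_intros simp: has_real_derivative_iff_has_vector_derivative[symmetric])
  qed
  then have d: "((\<lambda>t. \<Sum>n<N. ramp T n t *\<^sub>R incr L n y) has_vector_derivative branch_vel L T y t) (at t)"
    using branch_vel_finite_sum[of t N y] t by simp
  have e: "(\<Sum>n<N. ramp T n s *\<^sub>R incr L n y) = branch L T y s" if "s \<in> {..<branch_time T N}" for s
    using branch_finite_sum[of s N y] that by simp
  show ?thesis
    by (rule has_vector_derivative_transform_within_open[OF d open_lessThan _ e]) (use t in auto)
qed

lemma bpath_continuous: "continuous_on UNIV (bpath L T \<omega>)"
  unfolding bpath_def
  by (intro continuous_intros continuous_on_compose2[OF branch_continuous]) auto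

lemma bpath_in_torus:
  assumes "\<omega> \<in> torus L \<times> torus L" shows "bpath L T \<omega> t \<in> torus L"
proof -
  have x: "fst \<omega> \<in> torus L" and y: "snd \<omega> \<in> torus L" using assms by auto
  have "- L / 2 \<le> bpath L T \<omega> t $ i \<and> bpath L T \<omega> t $ i < L / 2" for i
  proof (cases "0 \<le> t")
    case True
    then have "bpath L T \<omega> t $ i = - L / 2 + branch L T (snd \<omega>) t $ i"
      by (simp add: bpath_def branch_nonpos base_corner_def)
    moreover have "snd \<omega> $ i < L / 2" using y by (simp add: torus_def)
    ultimately show ?thesis using branch_bounds[OF y, of t i] by linarith
  next
    case False
    then have "bpath L T \<omega> t $ i = - L / 2 + branch L T (fst \<omega>) (- t) $ i"
      by (simp add: bpath_def branch_nonpos base_corner_def)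
    moreover have "fst \<omega> $ i < L / 2" using x by (simp add: torus_def)
    ultimately show ?thesis using branch_bounds[OF x, of "- t" i] by linarith
  qed
  then show ?thesis by (simp add: torus_def)
qed

lemma bpath_ends:
  assumes "\<omega> \<in> torus L \<times> torus L" shows "bpath L T \<omega> T = snd \<omega>" "bpath L T \<omega> (- T) = fst \<omega>"
  using assms T by (auto simp: bpath_def branch_nonpos branch_end)

text \<open>On each side of 0 the position depends on only one of the two end points, and on that
  one only through its corner of level \<open>N\<close>; this gives \<open>4 ^ N\<close> positions
  instead of the square of that number.\<close>

lemma bpath_finite_values:
  assumes t: "\<bar>t\<bar> \<le> branch_time T N"
  obtains F where "finite F" "F \<subseteq> torus L" "card F \<le> 4 ^ N" "\<And>\<omega>. \<omega> \<in> torus L \<times> torus L \<Longrightarrow> bpath L T \<omega> t \<in> F"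
proof -
  let ?C = "corner L N ` torus L"
  define g where "g c = base_corner L + branch L T c \<bar>t\<bar>" for c
  have e: "\<exists>y\<in>torus L. bpath L T \<omega> t = g (corner L N y)" if "\<omega> \<in> torus L \<times> torus L" for \<omega>
  proof (cases "0 \<le> t")
    case True
    then show ?thesis using that t
      by (intro bexI[of _ "snd \<omega>"]) (auto simp: bpath_def g_def branch_nonpos branch_corner)
  next
    case False
    then show ?thesis using that t
      by (intro bexI[of _ "fst \<omega>"]) (auto simp: bpath_def g_def branch_nonpos branch_corner)
  qed
  show thesis
  proof (rule that[of "g ` ?C \<inter> torus L"])
    show "finite (g ` ?C \<inter> torus L)" using finite_corners(1)[OF L] by simp
    have "card (g ` ?C \<inter> torus L) \<le> card (g ` ?C)"
      by (rule card_mono) (use finite_corners(1)[OF L] in auto)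
    also have "\<dots> \<le> card ?C" by (rule card_image_le[OF finite_corners(1)[OF L]])
    also have "\<dots> \<le> 4 ^ N" by (rule finite_corners(2)[OF L])
    finally show "card (g ` ?C \<inter> torus L) \<le> 4 ^ N" .
    show "bpath L T \<omega> t \<in> g ` ?C \<inter> torus L" if "\<omega> \<in> torus L \<times> torus L" for \<omega>
      using e[OF that] bpath_in_torus[OF that] by auto
  qed auto
qed

lemma bpath_has_derivative:
  assumes t: "\<bar>t\<bar> < branch_time T N" and ne: "\<And>n. n \<le> N \<Longrightarrow> \<bar>t\<bar> \<noteq> branch_time T n"
  shows "(bpath L T \<omega> has_vector_derivative bpath_vel L T \<omega> t) (at t)"
proof -
  have 1: "(branch L T (snd \<omega>) has_vector_derivative branch_vel L T (snd \<omega>) t) (at t)"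
  proof (rule branch_has_derivative)
    show "t < branch_time T N" using t by simp
    show "t \<noteq> branch_time T n" if "n \<le> N" for n
      using ne[OF that] branch_time_nonneg[of n] by auto
  qed
  have "(branch L T (fst \<omega>) has_vector_derivative branch_vel L T (fst \<omega>) (- t)) (at (- t))"
  proof (rule branch_has_derivative)
    show "- t < branch_time T N" using t by simp
    show "- t \<noteq> branch_time T n" if "n \<le> N" for n
      using ne[OF that] branch_time_nonneg[of n] by auto
  qed
  then have "((branch L T (fst \<omega>) \<circ> uminus) has_vector_derivative (- 1) *\<^sub>R branch_vel L T (fst \<omega>) (- t)) (at t)"
    by (intro vector_diff_chain_at) (auto intro!: derivative_eq_intros)
  then have 2: "((\<lambda>t. branch L T (fst \<omega>) (- t)) has_vector_derivative - branch_vel L T (fst \<omega>) (- t)) (at t)"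
    by (simp add: o_def)
  have "((\<lambda>t. base_corner L + branch L T (snd \<omega>) t + branch L T (fst \<omega>) (- t)) has_vector_derivative
      0 + branch_vel L T (snd \<omega>) t + - branch_vel L T (fst \<omega>) (- t)) (at t)"
    by (intro has_vector_derivative_add has_vector_derivative_const 1 2)
  then show ?thesis by (simp add: bpath_def[abs_def] bpath_vel_def)
qed

text \<open>The times at which digit \<open>n\<close> is moving, on both sides of 0; the union of
  these sets is the open time interval.\<close>

definition level_set :: "nat \<Rightarrow> real set"
  where "level_set n = {branch_time T n..branch_time T (Suc n)} \<union> {- branch_time T (Suc n)..- branch_time T n}"

lemma level_set_measure: "emeasure lborel (level_set n) \<le> ennreal (2 * branch_len T n)"
proof -
  have "emeasure lborel (level_set n) \<le> emeasure lborel {branch_time T n..branch_time T (Suc n)} + emeasure lborel {- branch_time T (Suc n)..- branch_time T n}"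
    unfolding level_set_def by (rule emeasure_subadditive) auto
  also have "\<dots> = ennreal (branch_len T n) + ennreal (branch_len T n)"
    using branch_len_pos[of n] by (simp add: branch_time_Suc)
  also have "\<dots> = ennreal (2 * branch_len T n)" using branch_len_pos[of n] by (simp flip: ennreal_plus)
  finally show ?thesis .
qed

lemma level_integral_finite:
  assumes c: "\<And>n. 0 \<le> c n" and s: "summable (\<lambda>n. c n * branch_len T n)"
  shows "(\<integral>\<^sup>+t. (\<Sum>n. ennreal (c n) * indicator (level_set n) t) \<partial>lborel) < \<infinity>"
proof -
  have ls: "level_set n \<in> sets lborel" for n by (simp add: level_set_def)
  have "(\<integral>\<^sup>+t. (\<Sum>n. ennreal (c n) * indicator (level_set n) t) \<partial>lborel) = (\<Sum>n. \<integral>\<^sup>+t. ennreal (c n) * indicator (level_set n) t \<partial>lborel)"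
    by (rule nn_integral_suminf) (use ls in auto)
  also have "\<dots> = (\<Sum>n. ennreal (c n) * emeasure lborel (level_set n))"
    using ls by (simp add: nn_integral_cmult_indicator)
  also have "\<dots> \<le> (\<Sum>n. ennreal (2 * (c n * branch_len T n)))"
  proof (rule suminf_le)
    show "ennreal (c n) * emeasure lborel (level_set n) \<le> ennreal (2 * (c n * branch_len T n))" for n
    proof -
      have "ennreal (c n) * emeasure lborel (level_set n) \<le> ennreal (c n) * ennreal (2 * branch_len T n)"
        by (rule mult_left_mono[OF level_set_measure]) simp
      also have "\<dots> = ennreal (2 * (c n * branch_len T n))"
        using c[of n] branch_len_pos[of n] by (simp add: ennreal_mult[symmetric] mult.left_commute)
      finally show ?thesis .
    qed
  qed auto
  also have "\<dots> = ennreal (\<Sum>n. 2 * (c n * branch_len T n))"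
  proof (rule suminf_ennreal2)
    show "0 \<le> 2 * (c n * branch_len T n)" for n using c[of n] branch_len_pos[of n] by simp
    show "summable (\<lambda>n. 2 * (c n * branch_len T n))" by (rule summable_mult[OF s])
  qed
  finally show ?thesis by (rule le_less_trans) simp
qed

lemma bpath_vel_square_le:
  "ennreal ((norm (bpath_vel L T \<omega> t))\<^sup>2) \<le> (\<Sum>n. ennreal ((L * (1 / 2) ^ n / branch_len T n)\<^sup>2) * indicator (level_set n) t)"
proof -
  have b: "ennreal ((norm (branch_vel L T y s))\<^sup>2) \<le> (\<Sum>n. ennreal ((L * (1 / 2) ^ n / branch_len T n)\<^sup>2) * indicator (level_set n) t)"
    if s: "s = t \<or> s = - t" for y s
    using branch_vel_cases[of y s]
  proof
    assume "\<exists>n. branch_time T n < s \<and> s < branch_time T (Suc n) \<and> branch_vel L T y s = (1 / branch_len T n) *\<^sub>R incr L n y"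
    then obtain n where n: "branch_time T n < s" "s < branch_time T (Suc n)"
      "branch_vel L T y s = (1 / branch_len T n) *\<^sub>R incr L n y" by blast
    have tl: "t \<in> level_set n" using n s by (auto simp: level_set_def)
    have "norm (branch_vel L T y s) \<le> L * (1 / 2) ^ n / branch_len T n"
      using norm_incr_le[OF L, of n y] branch_len_pos[of n] by (simp add: n(3) divide_right_mono)
    then have "(norm (branch_vel L T y s))\<^sup>2 \<le> (L * (1 / 2) ^ n / branch_len T n)\<^sup>2" by (rule power_mono) simp
    then have "ennreal ((norm (branch_vel L T y s))\<^sup>2) \<le> ennreal ((L * (1 / 2) ^ n / branch_len T n)\<^sup>2) * indicator (level_set n) t"
      using tl by (simp add: ennreal_leI)
    also have "\<dots> \<le> (\<Sum>k. ennreal ((L * (1 / 2) ^ k / branch_len T k)\<^sup>2) * indicator (level_set k) t)"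
      using sum_le_suminf[of "\<lambda>k. ennreal ((L * (1 / 2) ^ k / branch_len T k)\<^sup>2) * indicator (level_set k) t" "{n}"]
      by (simp only: sum.insert[OF finite.emptyI] sum.empty empty_iff not_False_eq_True add_0_right finite.intros summableI zero_le simp_thms)
    finally show ?thesis .
  qed simp
  show ?thesis
  proof (cases "0 \<le> t")
    case True
    then have "bpath_vel L T \<omega> t = branch_vel L T (snd \<omega>) t" by (simp add: bpath_vel_def branch_vel_nonpos)
    then show ?thesis using b[of t "snd \<omega>"] by simp
  next
    case False
    then have "norm (bpath_vel L T \<omega> t) = norm (branch_vel L T (fst \<omega>) (- t))" by (simp add: bpath_vel_def branch_vel_nonpos)
    then show ?thesis using b[of "- t" "fst \<omega>"] by simp
  qed
qed

text \<open>Level \<open>n\<close> contributes a constant times \<open>4^-n / 3^-n\<close>; the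
  ratio 3/4 is below 1 because the time steps shrink more slowly than the squared distances.\<close>

lemma summable_kinetic: "summable (\<lambda>n. (L * (1 / 2) ^ n / branch_len T n)\<^sup>2 * branch_len T n)"
proof -
  have "(L * (1 / 2) ^ n / branch_len T n)\<^sup>2 * branch_len T n = (3 * L\<^sup>2 / (2 * T)) * (3 / 4) ^ n" for n
  proof -
    have "(L * (1 / 2) ^ n / branch_len T n)\<^sup>2 * branch_len T n = L\<^sup>2 * ((1 / 2) ^ n)\<^sup>2 / branch_len T n"
      using branch_len_pos[of n] by (simp add: power2_eq_square)
    also have "((1 / 2 :: real) ^ n)\<^sup>2 = (1 / 4) ^ n" by (simp add: power2_eq_square flip: power_mult_distrib)
    also have "L\<^sup>2 * (1 / 4) ^ n / branch_len T n = (3 * L\<^sup>2 / (2 * T)) * ((1 / 4) ^ n / (1 / 3) ^ n)"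
      using T by (simp add: branch_len_def)
    also have "(1 / 4 :: real) ^ n / (1 / 3) ^ n = (3 / 4) ^ n" by (simp flip: power_divide)
    finally show ?thesis .
  qed
  then show ?thesis by (simp add: summable_mult summable_geometric)
qed

text \<open>The factor \<open>2 ^ Suc n * sqrt M\<close> bounds the perimeter of mass
  \<open>M\<close> spread over \<open>4 ^ Suc n\<close> points. Together with time steps of order
  \<open>3^-n\<close> it leaves the ratio 2/3.\<close>

lemma summable_perimeter: "0 \<le> M \<Longrightarrow> summable (\<lambda>n. (2 ^ Suc n * sqrt M) * branch_len T n)"
proof -
  have "(2 ^ Suc n * sqrt M) * branch_len T n = (4 / 3 * sqrt M * T) * (2 / 3) ^ n" for n
  proof -
    have "(2 ^ Suc n * sqrt M) * branch_len T n = (4 / 3 * sqrt M * T) * (2 ^ n * (1 / 3) ^ n)"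
      by (simp add: branch_len_def)
    also have "(2::real) ^ n * (1 / 3) ^ n = (2 / 3) ^ n" by (simp flip: power_mult_distrib)
    finally show ?thesis .
  qed
  then have "(\<lambda>n. (2 ^ Suc n * sqrt M) * branch_len T n) = (\<lambda>n. (4 / 3 * sqrt M * T) * (2 / 3) ^ n)" by (rule ext)
  then show ?thesis by (simp only:) (intro summable_mult summable_geometric, simp)
qed

end

text \<open>Cauchy-Schwarz over the finitely many atoms.\<close>

lemma finite_support_atom_sum_le:
  assumes \<nu>: "finite_borel_measure (torus L) \<nu>" and F: "finite F" "F \<subseteq> torus L" and null: "emeasure \<nu> (torus L - F) = 0"
  shows "atom_sum L \<nu> \<le> ennreal (sqrt (real (card F)) * sqrt (measure \<nu> (torus L)))"
proof (rule atom_sum_le[OF \<nu>])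
  interpret finite_measure \<nu> using \<nu> by (simp add: finite_borel_measure_def)
  have sing: "{x} \<in> sets \<nu>" if "x \<in> torus L" for x using singleton_torus[OF that] \<nu> by (simp add: finite_borel_measure_def)
  have tL: "torus L \<in> sets \<nu>" using \<nu> torus_borel by (simp add: finite_borel_measure_def sets_torus)
  have Fs: "F \<in> sets \<nu>"
    by (rule sets.countable[OF _ countable_finite[OF F(1)]]) (use sing F(2) in auto)
  fix G assume G: "finite G" "G \<subseteq> torus L"
  have z: "measure \<nu> {x} = 0" if "x \<in> G - F" for x
  proof -
    have "emeasure \<nu> {x} \<le> emeasure \<nu> (torus L - F)" using that G(2) tL Fs by (intro emeasure_mono) auto
    then show ?thesis using null by (simp add: measure_def)
  qed
  have "(\<Sum>x\<in>G. sqrt (measure \<nu> {x})) = (\<Sum>x\<in>G \<inter> F. sqrt (measure \<nu> {x}))"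
    by (rule sum.mono_neutral_right) (use G z in auto)
  also have "\<dots> \<le> (\<Sum>x\<in>F. sqrt (measure \<nu> {x}))"
    by (rule sum_mono2[OF F(1)]) auto
  also have "\<dots> = (\<Sum>x\<in>F. \<bar>1\<bar> * \<bar>sqrt (measure \<nu> {x})\<bar>)" by simp
  also have "\<dots> \<le> L2_set (\<lambda>_. 1) F * L2_set (\<lambda>x. sqrt (measure \<nu> {x})) F" by (rule L2_set_mult_ineq)
  also have "\<dots> = sqrt (real (card F)) * sqrt (\<Sum>x\<in>F. measure \<nu> {x})" by (simp add: L2_set_def)
  also have "\<dots> \<le> sqrt (real (card F)) * sqrt (measure \<nu> (torus L))"
  proof (intro mult_left_mono real_sqrt_le_mono)
    have "(\<Sum>x\<in>F. measure \<nu> {x}) = measure \<nu> F"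
      by (rule finite_measure_eq_sum_singleton[symmetric]) (use F sing in auto)
    also have "\<dots> \<le> measure \<nu> (torus L)" by (rule finite_measure_mono[OF F(2) tL])
    finally show "(\<Sum>x\<in>F. measure \<nu> {x}) \<le> measure \<nu> (torus L)" .
  qed simp
  finally have "ennreal (\<Sum>x\<in>G. sqrt (measure \<nu> {x})) \<le> ennreal (sqrt (real (card F)) * sqrt (measure \<nu> (torus L)))"
    by (rule ennreal_leI)
  then show "(\<Sum>x\<in>G. ennreal (sqrt (measure \<nu> {x}))) \<le> ennreal (sqrt (real (card F)) * sqrt (measure \<nu> (torus L)))"
    by (simp add: sum_ennreal)
qed

lemma borel_measurable_corner[measurable]: "corner L n \<in> borel_measurable borel"
  unfolding corner_def by measurable

lemma borel_measurable_incr[measurable]: "incr L n \<in> borel_measurable borel"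
  unfolding incr_def by measurable

lemma borel_measurable_ramp[measurable]: "ramp T n \<in> borel_measurable borel"
  unfolding ramp_def by measurable

lemma borel_measurable_rate[measurable]: "rate T n \<in> borel_measurable borel"
  unfolding rate_def by measurable

lemma borel_measurable_bpath:
  assumes [measurable]: "w \<in> measurable M (borel \<Otimes>\<^sub>M borel)" "s \<in> borel_measurable M"
  shows "(\<lambda>z. bpath L T (w z) (s z)) \<in> borel_measurable M"
  unfolding bpath_def branch_def by measurable

lemma borel_measurable_bpath_vel:
  assumes [measurable]: "w \<in> measurable M (borel \<Otimes>\<^sub>M borel)" "s \<in> borel_measurable M"
  shows "(\<lambda>z. bpath_vel L T (w z) (s z)) \<in> borel_measurable M"
  unfolding bpath_vel_def branch_vel_def by measurable

lemma coupling_exists: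
  assumes \<nu>: "finite_borel_measure S \<nu>\<^sub>m" "finite_borel_measure S' \<nu>\<^sub>p"
    and eq: "measure \<nu>\<^sub>m (space \<nu>\<^sub>m) = measure \<nu>\<^sub>p (space \<nu>\<^sub>p)"
  obtains P where "finite_measure P" "sets P = sets (restrict_space borel S \<Otimes>\<^sub>M restrict_space borel S')"
    "distr P (restrict_space borel S) fst = \<nu>\<^sub>m" "distr P (restrict_space borel S') snd = \<nu>\<^sub>p"
proof -
  interpret m: finite_measure \<nu>\<^sub>m using \<nu> by (simp add: finite_borel_measure_def)
  interpret p: finite_measure \<nu>\<^sub>p using \<nu> by (simp add: finite_borel_measure_def)
  have s: "sets \<nu>\<^sub>m = sets (restrict_space borel S)" "sets \<nu>\<^sub>p = sets (restrict_space borel S')"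
    using \<nu> by (simp_all add: finite_borel_measure_def)
  define M where "M = measure \<nu>\<^sub>m (space \<nu>\<^sub>m)"
  have M: "emeasure \<nu>\<^sub>m (space \<nu>\<^sub>m) = ennreal M" "emeasure \<nu>\<^sub>p (space \<nu>\<^sub>p) = ennreal M" "0 \<le> M"
    using eq by (simp_all add: M_def m.emeasure_eq_measure p.emeasure_eq_measure)
  \<comment> \<open>for \<open>M = 0\<close> the density is \<open>1 / 0 = 0\<close>\<close>
  define P where "P = density (\<nu>\<^sub>m \<Otimes>\<^sub>M \<nu>\<^sub>p) (\<lambda>_. ennreal (1 / M))"
  have sP: "sets P = sets (\<nu>\<^sub>m \<Otimes>\<^sub>M \<nu>\<^sub>p)" by (simp add: P_def)
  have spP: "space P = space \<nu>\<^sub>m \<times> space \<nu>\<^sub>p" by (simp add: P_def space_pair_measure)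
  have emP: "emeasure P (A \<times> B) = ennreal (1 / M) * (emeasure \<nu>\<^sub>m A * emeasure \<nu>\<^sub>p B)"
    if "A \<in> sets \<nu>\<^sub>m" "B \<in> sets \<nu>\<^sub>p" for A B
    using that by (simp add: P_def emeasure_density nn_integral_cmult p.emeasure_pair_measure_Times)
  have scale: "ennreal (1 / M) * (ennreal a * ennreal M) = ennreal a" if "0 \<le> a" "a \<le> M" for a
    using that by (cases "M = 0") (simp_all add: ennreal_mult[symmetric])
  have "finite_measure P"
  proof (rule finite_measureI)
    show "emeasure P (space P) \<noteq> \<infinity>" unfolding spP using emP[OF sets.top sets.top] M
      by (simp add: ennreal_mult_eq_top_iff)
  qed
  moreover have "distr P (restrict_space borel S) fst = \<nu>\<^sub>m"
  proof (rule measure_eqI)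
    have fm: "fst \<in> measurable P (restrict_space borel S)"
      unfolding measurable_cong_sets[OF sP s(1)[symmetric]] by (rule measurable_fst)
    fix A assume "A \<in> sets (distr P (restrict_space borel S) fst)"
    then have A: "A \<in> sets (restrict_space borel S)" "A \<in> sets \<nu>\<^sub>m" by (simp_all add: s)
    have "fst -` A \<inter> space P = A \<times> space \<nu>\<^sub>p" using sets.sets_into_space[OF A(2)] by (auto simp: spP)
    then have "emeasure (distr P (restrict_space borel S) fst) A = emeasure P (A \<times> space \<nu>\<^sub>p)"
      using emeasure_distr[OF fm A(1)] by simp
    also have "\<dots> = ennreal (1 / M) * (ennreal (measure \<nu>\<^sub>m A) * ennreal M)"
      using emP[OF A(2) sets.top] M by (simp add: m.emeasure_eq_measure)
    also have "\<dots> = emeasure \<nu>\<^sub>m A"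
      using scale[of "measure \<nu>\<^sub>m A"] m.bounded_measure[of A] by (simp add: m.emeasure_eq_measure M_def)
    finally show "emeasure (distr P (restrict_space borel S) fst) A = emeasure \<nu>\<^sub>m A" .
  qed (simp add: s)
  moreover have "distr P (restrict_space borel S') snd = \<nu>\<^sub>p"
  proof (rule measure_eqI)
    have fm: "snd \<in> measurable P (restrict_space borel S')"
      unfolding measurable_cong_sets[OF sP s(2)[symmetric]] by (rule measurable_snd)
    fix A assume "A \<in> sets (distr P (restrict_space borel S') snd)"
    then have A: "A \<in> sets (restrict_space borel S')" "A \<in> sets \<nu>\<^sub>p" by (simp_all add: s)
    have "snd -` A \<inter> space P = space \<nu>\<^sub>m \<times> A" using sets.sets_into_space[OF A(2)] by (auto simp: spP)
    then have "emeasure (distr P (restrict_space borel S') snd) A = emeasure P (space \<nu>\<^sub>m \<times> A)"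
      using emeasure_distr[OF fm A(1)] by simp
    also have "\<dots> = ennreal (1 / M) * (ennreal (measure \<nu>\<^sub>p A) * ennreal M)"
      using emP[OF sets.top A(2)] M by (simp add: p.emeasure_eq_measure mult.commute)
    also have "\<dots> = emeasure \<nu>\<^sub>p A"
      using scale[of "measure \<nu>\<^sub>p A"] p.bounded_measure[of A] by (simp add: p.emeasure_eq_measure M_def eq)
    finally show "emeasure (distr P (restrict_space borel S') snd) A = emeasure \<nu>\<^sub>p A" .
  qed (simp add: s)
  moreover have "sets P = sets (restrict_space borel S \<Otimes>\<^sub>M restrict_space borel S')"
    unfolding sP by (rule sets_pair_measure_cong[OF s])
  ultimately show thesis using that[of P] by blast
qed

lemma test_function_derivative_vanishes:
  assumes \<psi>: "\<And>x t. s \<le> \<bar>t\<bar> \<Longrightarrow> \<psi> (x, t) = (0 :: real)" and p: "s < \<bar>snd p\<bar>"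
  shows "frechet_derivative \<psi> (at (p :: (real^2) \<times> real)) = (\<lambda>_. 0)"
proof -
  have op: "open {p :: (real^2) \<times> real. s < \<bar>snd p\<bar>}"
    by (intro open_Collect_less continuous_intros)
  have "((\<lambda>_. 0) has_derivative (\<lambda>_. 0)) (at p)" by simp
  then have "(\<psi> has_derivative (\<lambda>_. 0)) (at p)"
  proof (rule has_derivative_transform_within_open[OF _ op])
    fix q :: "(real^2) \<times> real" assume "q \<in> {p. s < \<bar>snd p\<bar>}"
    then show "0 = \<psi> q" using \<psi>[of "snd q" "fst q"] by simp
  qed (use p in simp)
  then show ?thesis by (rule frechet_derivative_at[symmetric])
qed

text \<open>The integrand is the derivative of \<open>\<psi>\<close> along the path in space and
  time, and \<open>\<psi>\<close> vanishes near both end times.\<close>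

lemma test_function_along_bpath:
  fixes \<psi> :: "(real^2) \<times> real \<Rightarrow> real"
  assumes L: "L > 0" and T: "T > 0" and \<psi>: "test_function L T \<psi>"
    and \<omega>: "\<omega> \<in> torus L \<times> torus L"
  shows "((\<lambda>t. frechet_derivative \<psi> (at (bpath L T \<omega> t, t)) (bpath_vel L T \<omega> t, 1)) has_integral 0) {-T..T}"
proof -
  obtain s where s: "s < T" "\<forall>x t. s \<le> \<bar>t\<bar> \<longrightarrow> \<psi> (x, t) = 0"
    using \<psi> unfolding test_function_def by blast
  have s0: "\<psi> (x, t) = 0" if "s \<le> \<bar>t\<bar>" for x t using s(2) that by blast
  \<comment> \<open>The kinks of the path accumulate at the end times. Beyond level \<open>N\<close>
    the test function is 0, so only the finitely many kinks in \<open>S\<close> have to be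
    exempted.\<close>
  obtain N where N: "s < branch_time T N" using less_branch_time[OF L T s(1)] by blast
  define S where "S = (\<lambda>n. branch_time T n) ` {..N} \<union> (\<lambda>n. - branch_time T n) ` {..N}"
  have fS: "finite S" by (simp add: S_def)
  let ?g = "\<lambda>t. \<psi> (bpath L T \<omega> t, t)"
  have \<psi>c: "continuous_on UNIV \<psi>"
    using test_function_has_derivative[OF \<psi>] by (intro has_derivative_continuous_on) (rule has_derivative_at_withinI)
  have "((\<lambda>t. frechet_derivative \<psi> (at (bpath L T \<omega> t, t)) (bpath_vel L T \<omega> t, 1)) has_integral (?g T - ?g (- T))) {-T..T}"
  proof (rule fundamental_theorem_of_calculus_interior_strong[OF fS])
    show "continuous_on {-T..T} ?g"
      by (intro continuous_on_compose2[OF \<psi>c] continuous_intros continuous_on_subset[OF bpath_continuous[OF L T]]) auto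
    fix t assume t: "t \<in> {-T<..<T} - S"
    have ne: "\<bar>t\<bar> \<noteq> branch_time T n" if "n \<le> N" for n
    proof
      assume "\<bar>t\<bar> = branch_time T n"
      then have "t = branch_time T n \<or> t = - branch_time T n" by linarith
      then show False using t that by (auto simp: S_def)
    qed
    show "(?g has_vector_derivative frechet_derivative \<psi> (at (bpath L T \<omega> t, t)) (bpath_vel L T \<omega> t, 1)) (at t)"
    proof (cases "\<bar>t\<bar> < branch_time T N")
      case True
      have d1: "(bpath L T \<omega> has_vector_derivative bpath_vel L T \<omega> t) (at t)" by (rule bpath_has_derivative[OF L T True ne])
      have d2: "((\<lambda>t. (bpath L T \<omega> t, t)) has_vector_derivative (bpath_vel L T \<omega> t, 1)) (at t)"
        by (rule has_vector_derivative_Pair[OF d1 has_vector_derivative_id])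
      have "((\<psi> \<circ> (\<lambda>t. (bpath L T \<omega> t, t))) has_derivative
          (frechet_derivative \<psi> (at (bpath L T \<omega> t, t)) \<circ> (\<lambda>h. h *\<^sub>R (bpath_vel L T \<omega> t, 1)))) (at t)"
        by (rule diff_chain_at[OF d2[unfolded has_vector_derivative_def] test_function_has_derivative[OF \<psi>]])
      moreover have "frechet_derivative \<psi> (at (bpath L T \<omega> t, t)) (h *\<^sub>R w) = h *\<^sub>R frechet_derivative \<psi> (at (bpath L T \<omega> t, t)) w" for h w
        by (rule linear_scale[OF has_derivative_linear[OF test_function_has_derivative[OF \<psi>]]])
      ultimately show ?thesis by (simp only: has_vector_derivative_def o_def)
    next
      case False
      then have st: "s < \<bar>t\<bar>" using N by linarith
      have op: "open {t. s < \<bar>t :: real\<bar>}" by (intro open_Collect_less continuous_intros)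
      have "((\<lambda>_. 0 :: real) has_vector_derivative 0) (at t)" by simp
      then have "(?g has_vector_derivative 0) (at t)"
        by (rule has_vector_derivative_transform_within_open[OF _ op]) (use st s0 in auto)
      moreover have "frechet_derivative \<psi> (at (bpath L T \<omega> t, t)) = (\<lambda>_. 0)"
        by (rule test_function_derivative_vanishes[of s \<psi>, OF s0]) (use st in simp_all)
      ultimately show ?thesis by simp
    qed
  qed (use T in simp)
  moreover have "?g T = 0" "?g (- T) = 0" using s0 s(1) T by simp_all
  ultimately show ?thesis by simp
qed

section \<open>The transport carried by a coupling\<close>

context
  fixes L T :: real and P :: "((real^2) \<times> (real^2)) measure"
  assumes L: "L > 0" and T: "T > 0" and P: "finite_measure P"
    and sP: "sets P = sets (restrict_space borel (torus L) \<Otimes>\<^sub>M restrict_space borel (torus L))"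
begin

definition branch_slice :: "real \<Rightarrow> (real^2) measure"
  where "branch_slice t = distr P (restrict_space borel (torus L)) (\<lambda>\<omega>. bpath L T \<omega> t)"

lemma space_coupling: "space P = torus L \<times> torus L"
  using sets_eq_imp_space_eq[OF sP] by (simp add: space_pair_measure space_restrict_space)

lemma coupling_id_measurable: "(\<lambda>\<omega>. \<omega>) \<in> measurable P (borel \<Otimes>\<^sub>M borel)"
proof -
  have i: "(\<lambda>x. x) \<in> measurable (restrict_space borel (torus L)) borel"
    by (rule measurable_restrict_space1) simp
  have "fst \<in> measurable P (restrict_space borel (torus L))" "snd \<in> measurable P (restrict_space borel (torus L))"
    unfolding measurable_cong_sets[OF sP refl] by (rule measurable_fst measurable_snd)+
  then have "(\<lambda>\<omega>. fst \<omega>) \<in> borel_measurable P" "(\<lambda>\<omega>. snd \<omega>) \<in> borel_measurable P"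
    by (auto intro: measurable_compose[OF _ i])
  then have "(\<lambda>\<omega>. (fst \<omega>, snd \<omega>)) \<in> measurable P (borel \<Otimes>\<^sub>M borel)" by (rule measurable_Pair)
  then show ?thesis by simp
qed

lemma bpath_measurable: "(\<lambda>\<omega>. bpath L T \<omega> t) \<in> measurable P (restrict_space borel (torus L))"
proof (rule measurable_restrict_space2)
  show "(\<lambda>\<omega>. bpath L T \<omega> t) \<in> space P \<rightarrow> torus L" using bpath_in_torus[OF L T] by (auto simp: space_coupling)
  show "(\<lambda>\<omega>. bpath L T \<omega> t) \<in> borel_measurable P" by (rule borel_measurable_bpath[OF coupling_id_measurable]) simp
qed

lemma finite_branch_slice: "finite_borel_measure (torus L) (branch_slice t)"
  unfolding branch_slice_def by (rule finite_borel_measure_distr[OF P bpath_measurable])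

lemma emeasure_branch_slice:
  "A \<in> sets (restrict_space borel (torus L)) \<Longrightarrow> emeasure (branch_slice t) A = emeasure P {\<omega> \<in> space P. bpath L T \<omega> t \<in> A}"
  unfolding branch_slice_def
  by (subst emeasure_distr[OF bpath_measurable]) (auto intro!: arg_cong[of _ _ "emeasure P"])

lemma branch_slice_mass: "measure (branch_slice t) (torus L) = measure P (space P)"
proof -
  have "{\<omega> \<in> space P. bpath L T \<omega> t \<in> torus L} = space P" using bpath_in_torus[OF L T] by (auto simp: space_coupling)
  then show ?thesis using emeasure_branch_slice[of "torus L" t] torus_borel by (simp add: measure_def sets_torus)
qed

lemma branch_slice_ends:
  "branch_slice T = distr P (restrict_space borel (torus L)) snd"
  "branch_slice (- T) = distr P (restrict_space borel (torus L)) fst"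
  unfolding branch_slice_def using bpath_ends[OF L T] by (intro distr_cong; simp add: space_coupling)+

lemma branch_slice_continuous:
  fixes f :: "real^2 \<Rightarrow> real"
  assumes f: "continuous_on UNIV f" "periodic L f"
  shows "continuous_on S (\<lambda>t. \<integral>x. f x \<partial>branch_slice t)"
proof -
  interpret finite_measure P by (rule P)
  obtain C where C: "\<And>x. \<bar>f x\<bar> \<le> C" using periodic_bounded[OF L f] by blast
  have fm: "f \<in> borel_measurable borel" by (rule borel_measurable_continuous_onI[OF f(1)])
  have m: "(\<lambda>\<omega>. f (bpath L T \<omega> t)) \<in> borel_measurable P" for t
    by (rule measurable_compose[OF bpath_measurable measurable_restrict_space1[OF fm]])
  have e: "(\<integral>x. f x \<partial>branch_slice t) = (\<integral>\<omega>. f (bpath L T \<omega> t) \<partial>P)" for t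
    unfolding branch_slice_def by (rule integral_distr[OF bpath_measurable measurable_restrict_space1[OF fm]])
  show ?thesis unfolding e
  proof (rule continuous_on_sequentiallyI)
    fix u :: "nat \<Rightarrow> real" and a assume u: "u \<longlonglongrightarrow> a"
    show "(\<lambda>n. \<integral>\<omega>. f (bpath L T \<omega> (u n)) \<partial>P) \<longlonglongrightarrow> (\<integral>\<omega>. f (bpath L T \<omega> a) \<partial>P)"
    proof (rule integral_dominated_convergence[where w = "\<lambda>_. C"])
      show "AE \<omega> in P. (\<lambda>n. f (bpath L T \<omega> (u n))) \<longlonglongrightarrow> f (bpath L T \<omega> a)"
      proof (rule AE_I2)
        fix \<omega>
        have "continuous_on UNIV (\<lambda>t. f (bpath L T \<omega> t))"
          by (rule continuous_on_compose2[OF f(1) bpath_continuous[OF L T]]) simp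
        then show "(\<lambda>n. f (bpath L T \<omega> (u n))) \<longlonglongrightarrow> f (bpath L T \<omega> a)"
          by (rule continuous_on_tendsto_compose[OF _ u]) auto
      qed
      show "AE \<omega> in P. norm (f (bpath L T \<omega> (u n))) \<le> C" for n using C by simp
    qed (use m in auto)
  qed
qed

text \<open>At a time of level \<open>n\<close> no digit after number \<open>n\<close> has started
  to move, so the positions are determined by corners of level \<open>Suc n\<close>.\<close>

lemma branch_slice_support:
  assumes t: "t \<in> {-T<..<T}"
  obtains n F where "t \<in> level_set T n" "finite F" "F \<subseteq> torus L" "card F \<le> 4 ^ Suc n"
    "emeasure (branch_slice t) (torus L - F) = 0"
proof -
  obtain n where n: "branch_time T n \<le> \<bar>t\<bar>" "\<bar>t\<bar> < branch_time T (Suc n)"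
  proof (rule branch_level[OF L T])
    show "0 \<le> \<bar>t\<bar>" "\<bar>t\<bar> < T" using t by auto
  qed
  obtain F where F: "finite F" "F \<subseteq> torus L" "card F \<le> 4 ^ Suc n"
    "\<And>\<omega>. \<omega> \<in> torus L \<times> torus L \<Longrightarrow> bpath L T \<omega> t \<in> F"
    using bpath_finite_values[OF L T less_imp_le[OF n(2)]] by blast
  have "F \<in> sets borel" using F(1) by (simp add: finite_imp_closed)
  then have "torus L - F \<in> sets (restrict_space borel (torus L))" using torus_borel by (auto simp: sets_torus)
  moreover have "{\<omega> \<in> space P. bpath L T \<omega> t \<in> torus L - F} = {}" using F(4) by (auto simp: space_coupling)
  ultimately have "emeasure (branch_slice t) (torus L - F) = 0" using emeasure_branch_slice[of "torus L - F" t] by (simp only: emeasure_empty)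
  moreover have "t \<in> level_set T n" using n by (auto simp: level_set_def[OF L T] abs_if split: if_splits)
  ultimately show thesis using that[OF _ F(1-3)] by blast
qed

lemma branch_slice_atomic: "t \<in> {-T<..<T} \<Longrightarrow> countable_dirac_sum L (branch_slice t)"
  by (elim branch_slice_support) (rule countable_dirac_sumI[OF finite_branch_slice countable_finite])

text \<open>The root of the number \<open>4 ^ Suc n\<close> of positions is
  \<open>2 ^ Suc n\<close>, the weight in \<open>summable_perimeter\<close>.\<close>

lemma branch_slice_perimeter:
  "(\<integral>\<^sup>+t\<in>{-T<..<T}. atom_sum L (branch_slice t) \<partial>lborel) < \<infinity>"
proof -
  let ?M = "measure P (space P)"
  let ?c = "\<lambda>n. 2 ^ Suc n * sqrt ?M"
  have "(\<integral>\<^sup>+t\<in>{-T<..<T}. atom_sum L (branch_slice t) \<partial>lborel) \<le> (\<integral>\<^sup>+t. (\<Sum>n. ennreal (?c n) * indicator (level_set T n) t) \<partial>lborel)"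
  proof (rule nn_integral_mono)
    fix t :: real
    show "atom_sum L (branch_slice t) * indicator {-T<..<T} t \<le> (\<Sum>n. ennreal (?c n) * indicator (level_set T n) t)"
    proof (cases "t \<in> {-T<..<T}")
      case True
      obtain n F where n: "t \<in> level_set T n" "finite F" "F \<subseteq> torus L" "card F \<le> 4 ^ Suc n"
        "emeasure (branch_slice t) (torus L - F) = 0" by (rule branch_slice_support[OF True])
      have "real (card F) \<le> real (4 ^ Suc n)" using n(4) by (simp only: of_nat_le_iff)
      also have "\<dots> = (2 ^ Suc n)\<^sup>2" by (simp add: power_mult[symmetric] mult.commute[of _ 2] power_mult)
      finally have "sqrt (real (card F)) \<le> 2 ^ Suc n" by (rule real_le_lsqrt[rotated]) simp
      then have "sqrt (real (card F)) * sqrt ?M \<le> ?c n" by (rule mult_right_mono) simp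
      then have "ennreal (sqrt (real (card F)) * sqrt (measure (branch_slice t) (torus L))) \<le> ennreal (?c n)"
        unfolding branch_slice_mass by (rule ennreal_leI)
      then have "atom_sum L (branch_slice t) * indicator {-T<..<T} t \<le> ennreal (?c n) * indicator (level_set T n) t"
        using order_trans[OF finite_support_atom_sum_le[OF finite_branch_slice n(2,3,5)]] n(1) True by simp
      also have "\<dots> \<le> (\<Sum>n. ennreal (?c n) * indicator (level_set T n) t)"
        using sum_le_suminf[of "\<lambda>n. ennreal (?c n) * indicator (level_set T n) t" "{n}"]
        by (simp only: sum.insert[OF finite.emptyI] sum.empty empty_iff not_False_eq_True add_0_right finite.intros summableI zero_le simp_thms)
      finally show ?thesis .
    qed simp
  qed
  also have "\<dots> < \<infinity>"
    by (rule level_integral_finite[OF L T _ summable_perimeter[OF L T]]) simp_all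
  finally show ?thesis .
qed

text \<open>The particles are the paths under the product of the coupling and time, projected to
  their positions. By Fubini the continuity equation reduces to the statement along single paths.
  Particles that meet with different velocities, as when a branch splits, are averaged, and Jensen's
  inequality keeps the energy finite.\<close>

lemma branch_transport_exists:
  "\<exists>\<mu> m. finite_borel_measure (cylinder L T) \<mu> \<and> weakly_continuous_rep L T \<mu> branch_slice \<and>
    vector_measure (cylinder L T) m \<and> vector_abs_cont m \<mu> \<and> continuity_equation L T \<mu> m \<and>
    (\<integral>\<^sup>+p. ennreal ((norm (vector_RN_deriv \<mu> m p))\<^sup>2) \<partial>\<mu>) < \<infinity>"
proof -
  define I where "I = restrict_space (lborel :: real measure) {-T<..<T}"
  have spI: "space I = {-T<..<T}" by (simp add: I_def space_restrict_space)
  have Ib: "(\<lambda>t. t) \<in> borel_measurable I" unfolding I_def by (rule measurable_restrict_space1) simp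
  interpret P: finite_measure P by (rule P)
  interpret I: finite_measure I
    by (rule finite_measureI) (use T in \<open>simp add: I_def emeasure_restrict_space space_restrict_space\<close>)
  interpret PI: pair_sigma_finite P I ..
  define \<gamma> where "\<gamma> = P \<Otimes>\<^sub>M I"
  define \<pi> where "\<pi> = (\<lambda>z. (bpath L T (fst z) (snd z), snd z :: real))"
  define V where "V = (\<lambda>z :: ((real^2) \<times> (real^2)) \<times> real. bpath_vel L T (fst z) (snd z))"
  have sp\<gamma>: "space \<gamma> = (torus L \<times> torus L) \<times> {-T<..<T}" by (simp add: \<gamma>_def space_pair_measure space_coupling spI)
  have fin: "finite_measure \<gamma>" unfolding \<gamma>_def using I.finite_measure_axioms P by (rule finite_measure_pair_measure)
  have fm: "fst \<in> measurable \<gamma> (borel \<Otimes>\<^sub>M borel)" unfolding \<gamma>_def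
    by (rule measurable_compose[OF measurable_fst coupling_id_measurable])
  have sm: "snd \<in> borel_measurable \<gamma>" unfolding \<gamma>_def
    by (rule measurable_compose[OF measurable_snd Ib])
  have \<pi>m: "\<pi> \<in> measurable \<gamma> (restrict_space borel (cylinder L T))"
  proof (rule measurable_restrict_space2)
    show "\<pi> \<in> space \<gamma> \<rightarrow> cylinder L T" using bpath_in_torus[OF L T] by (auto simp: \<pi>_def sp\<gamma> cylinder_def)
    show "\<pi> \<in> borel_measurable \<gamma>"
      unfolding \<pi>_def by (rule borel_measurable_Pair[OF borel_measurable_bpath[OF fm sm] sm])
  qed
  have Vm: "V \<in> borel_measurable \<gamma>" unfolding V_def by (rule borel_measurable_bpath_vel[OF fm sm])
  let ?c = "\<lambda>n. (L * (1 / 2) ^ n / branch_len T n)\<^sup>2"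
  define g where "g = (\<lambda>t. \<Sum>n. ennreal (?c n) * indicator (level_set T n) t)"
  have ls: "level_set T n \<in> sets borel" for n by (simp add: level_set_def[OF L T])
  have gm: "g \<in> borel_measurable borel" unfolding g_def using ls by measurable
  have gi: "(\<integral>\<^sup>+t. g t \<partial>lborel) < \<infinity>"
    unfolding g_def by (rule level_integral_finite[OF L T _ summable_kinetic[OF L T]]) simp
  have V2: "(\<integral>\<^sup>+z. ennreal ((norm (V z))\<^sup>2) \<partial>\<gamma>) < \<infinity>"
  proof -
    have "(\<integral>\<^sup>+z. ennreal ((norm (V z))\<^sup>2) \<partial>\<gamma>) \<le> (\<integral>\<^sup>+z. g (snd z) \<partial>\<gamma>)"
      by (rule nn_integral_mono) (simp only: V_def g_def bpath_vel_square_le[OF L T])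
    also have "\<dots> = (\<integral>\<^sup>+t. (\<integral>\<^sup>+\<omega>. g t \<partial>P) \<partial>I)"
      using PI.nn_integral_snd[of "\<lambda>z. g (snd z)"] measurable_compose[OF sm gm] by (simp add: \<gamma>_def)
    also have "\<dots> = (\<integral>\<^sup>+t. g t \<partial>I) * emeasure P (space P)"
      by (simp add: nn_integral_multc measurable_compose[OF Ib gm])
    also have "\<dots> < \<infinity>"
    proof -
      have "(\<integral>\<^sup>+t. g t \<partial>I) \<le> (\<integral>\<^sup>+t. g t \<partial>lborel)"
        unfolding I_def by (subst nn_integral_restrict_space) (auto intro!: nn_integral_mono split: split_indicator)
      then have "(\<integral>\<^sup>+t. g t \<partial>I) < \<infinity>" using gi by (rule le_less_trans)
      then show ?thesis using P.emeasure_finite[of "space P"] by (simp add: ennreal_mult_eq_top_iff less_top[symmetric])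
    qed
    finally show ?thesis .
  qed
  note bary = fin \<pi>m Vm V2
  define \<mu> where "\<mu> = bary_measure \<gamma> \<pi> (cylinder L T)"
  define m where "m = bary_flux \<gamma> \<pi> V"
  have d\<mu>: "\<mu> = distr \<gamma> (restrict_space borel (cylinder L T)) \<pi>" unfolding \<mu>_def by (rule bary_measure_def[OF bary])
  have \<mu>: "finite_borel_measure (cylinder L T) \<mu>" unfolding \<mu>_def by (rule finite_borel_bary_measure[OF bary])
  have ker: "kernel L T branch_slice"
  proof (rule kernel_of_measurable_integrals[OF L finite_branch_slice branch_slice_mass])
    fix f :: "real^2 \<Rightarrow> real" assume f: "continuous_on UNIV f" "periodic L f"
    show "(\<lambda>t. \<integral>x. f x \<partial>branch_slice t) \<in> borel_measurable (restrict_space borel {-T<..<T})"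
      by (rule borel_measurable_continuous_on_restrict[OF branch_slice_continuous[OF f]])
  qed
  have dis: "disintegration L T \<mu> branch_slice"
    unfolding disintegration_def
  proof (intro conjI)
    show "\<forall>A\<in>sets \<mu>. emeasure \<mu> A = (\<integral>\<^sup>+t\<in>{-T<..<T}. emeasure (branch_slice t) {x. (x, t) \<in> A} \<partial>lborel)"
    proof
      fix A assume "A \<in> sets \<mu>"
      then have A: "A \<in> sets (restrict_space borel (cylinder L T))" using \<mu> by (simp add: finite_borel_measure_def)
      then have A': "A \<subseteq> cylinder L T" "A \<in> sets borel" by (simp_all add: sets_cylinder)
      have "emeasure \<mu> A = emeasure (P \<Otimes>\<^sub>M I) (\<pi> -` A \<inter> space \<gamma>)"
        unfolding d\<mu> using emeasure_distr[OF \<pi>m A] by (simp add: \<gamma>_def)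
      also have "\<dots> = (\<integral>\<^sup>+t. emeasure P ((\<lambda>\<omega>. (\<omega>, t)) -` (\<pi> -` A \<inter> space \<gamma>)) \<partial>I)"
        by (rule PI.emeasure_pair_measure_alt2) (use measurable_sets[OF \<pi>m A] in \<open>simp add: \<gamma>_def\<close>)
      also have "\<dots> = (\<integral>\<^sup>+t. emeasure (branch_slice t) {x. (x, t) \<in> A} \<partial>I)"
      proof (rule nn_integral_cong)
        fix t assume "t \<in> space I"
        then have t: "t \<in> {-T<..<T}" by (simp add: spI)
        have e: "{x. (x, t) \<in> A} = {x \<in> torus L. (x, t) \<in> A}" using A'(1) by (auto simp: cylinder_def)
        have s: "{x. (x, t) \<in> A} \<in> sets (restrict_space borel (torus L))"
          unfolding e by (rule kernel_section[OF ker A'(2)])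
        show "emeasure P ((\<lambda>\<omega>. (\<omega>, t)) -` (\<pi> -` A \<inter> space \<gamma>)) = emeasure (branch_slice t) {x. (x, t) \<in> A}"
          unfolding emeasure_branch_slice[OF s]
          by (rule arg_cong[of _ _ "emeasure P"]) (use t in \<open>auto simp: \<pi>_def sp\<gamma> space_coupling\<close>)
      qed
      also have "\<dots> = (\<integral>\<^sup>+t\<in>{-T<..<T}. emeasure (branch_slice t) {x. (x, t) \<in> A} \<partial>lborel)"
        unfolding I_def by (rule nn_integral_restrict_space) simp
      finally show "emeasure \<mu> A = (\<integral>\<^sup>+t\<in>{-T<..<T}. emeasure (branch_slice t) {x. (x, t) \<in> A} \<partial>lborel)" .
    qed
  next
    show "\<forall>t\<in>{-T<..<T}. finite_borel_measure (torus L) (branch_slice t)" using finite_branch_slice by simp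
    show "\<forall>B\<in>sets (restrict_space borel (torus L)).
        (\<lambda>t. emeasure (branch_slice t) B) \<in> borel_measurable (restrict_space borel {-T<..<T})"
      using ker unfolding kernel_def by (rule conjunct2)
  qed
  have wc: "weakly_continuous_rep L T \<mu> branch_slice"
    unfolding weakly_continuous_rep_def using dis finite_branch_slice branch_slice_continuous by blast
  have ce: "continuity_equation L T \<mu> m"
    unfolding continuity_equation_def
  proof (intro allI impI)
    fix \<psi> assume \<psi>: "test_function L T \<psi>"
    let ?d = "\<lambda>p. frechet_derivative \<psi> (at p) (0, 1)"
    have dc: "continuous_on UNIV ?d" by (rule test_function_derivative_continuous[OF \<psi> horizontal_in_Basis(2)[OF \<psi>]])
    have dm: "?d \<in> borel_measurable borel" by (rule borel_measurable_continuous_onI[OF dc])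
    obtain C1 where C1: "\<forall>p. \<bar>?d p\<bar> \<le> C1" using test_function_derivative_bounded[OF \<psi> L horizontal_in_Basis(2)[OF \<psi>]] by (rule exE)
    obtain C2 where C2: "\<forall>p. norm (hgrad \<psi> p) \<le> C2" using hgrad_bounded[OF \<psi> L] by (rule exE)
    have gm: "hgrad \<psi> \<in> borel_measurable borel" by (rule borel_measurable_continuous_onI[OF hgrad_continuous[OF \<psi>]])
    have gm': "hgrad \<psi> \<in> borel_measurable (bary_measure \<gamma> \<pi> (cylinder L T))"
      using borel_measurable_cylinder_measure[OF \<mu> gm] unfolding \<mu>_def .
    have e2: "(\<integral>p. hgrad \<psi> p \<bullet> vector_RN_deriv \<mu> m p \<partial>\<mu>) = (\<integral>z. hgrad \<psi> (\<pi> z) \<bullet> V z \<partial>\<gamma>)"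
      using bary_density_test(1)[OF bary gm' spec[OF C2]] unfolding \<mu>_def m_def .
    have e1: "(\<integral>p. ?d p \<partial>\<mu>) = (\<integral>z. ?d (\<pi> z) \<partial>\<gamma>)"
      unfolding d\<mu> by (rule integral_distr[OF \<pi>m measurable_restrict_space1[OF dm]])
    let ?\<Phi> = "\<lambda>z. ?d (\<pi> z) + hgrad \<psi> (\<pi> z) \<bullet> V z"
    have i1: "integrable \<gamma> (\<lambda>z. ?d (\<pi> z))"
    proof (rule finite_measure.integrable_const_bound[OF fin])
      show "AE z in \<gamma>. norm (?d (\<pi> z)) \<le> C1" unfolding real_norm_def by (rule AE_I2, rule spec[OF C1])
      show "(\<lambda>z. ?d (\<pi> z)) \<in> borel_measurable \<gamma>" by (rule measurable_compose[OF \<pi>m measurable_restrict_space1[OF dm]])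
    qed
    have i2: "integrable \<gamma> (\<lambda>z. hgrad \<psi> (\<pi> z) \<bullet> V z)" by (rule bary_density_test(3)[OF bary gm' spec[OF C2]])
    have "integrable (P \<Otimes>\<^sub>M I) ?\<Phi>" using Bochner_Integration.integrable_add[OF i1 i2] by (simp add: \<gamma>_def)
    then have "(\<integral>z. ?\<Phi> z \<partial>\<gamma>) = (\<integral>\<omega>. (\<integral>t. ?\<Phi> (\<omega>, t) \<partial>I) \<partial>P)" unfolding \<gamma>_def by (rule PI.integral_fst'[symmetric])
    also have "\<dots> = (\<integral>\<omega>. 0 \<partial>P)"
    proof (rule Bochner_Integration.integral_cong[OF refl])
      fix \<omega> assume "\<omega> \<in> space P"
      then have \<omega>: "\<omega> \<in> torus L \<times> torus L" by (simp add: space_coupling)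
      show "(\<integral>t. ?\<Phi> (\<omega>, t) \<partial>I) = 0"
      \<comment> \<open>If the inner integral does not exist, it is 0 by convention; the identity
        thus holds for every path, without an exceptional null set.\<close>
      proof (cases "integrable I (\<lambda>t. ?\<Phi> (\<omega>, t))")
        case True
        have \<Phi>: "?\<Phi> (\<omega>, t) = frechet_derivative \<psi> (at (bpath L T \<omega> t, t)) (bpath_vel L T \<omega> t, 1)" for t
        proof -
          let ?D = "frechet_derivative \<psi> (at (bpath L T \<omega> t, t))"
          have "?D ((0, 1) + (bpath_vel L T \<omega> t, 0)) = ?D (0, 1) + ?D (bpath_vel L T \<omega> t, 0)"
            by (rule linear_add[OF has_derivative_linear[OF test_function_has_derivative[OF \<psi>]]])
          then show ?thesis by (simp add: \<pi>_def V_def hgrad_inner[OF \<psi>, symmetric])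
        qed
        have si: "set_integrable lborel {-T<..<T} (\<lambda>t. ?\<Phi> (\<omega>, t))"
          using True unfolding I_def set_integrable_def by (subst (asm) integrable_restrict_space) simp_all
        have "(\<integral>t. ?\<Phi> (\<omega>, t) \<partial>I) = (LINT t:{-T<..<T}|lborel. ?\<Phi> (\<omega>, t))"
          unfolding I_def set_lebesgue_integral_def by (rule integral_restrict_space) simp
        also have "\<dots> = integral {-T<..<T} (\<lambda>t. ?\<Phi> (\<omega>, t))" by (rule set_borel_integral_eq_integral(2)[OF si])
        also have "\<dots> = integral {-T..T} (\<lambda>t. ?\<Phi> (\<omega>, t))" by (rule integral_open_interval_real[symmetric])
        also have "\<dots> = 0" unfolding \<Phi> by (rule integral_unique[OF test_function_along_bpath[OF L T \<psi> \<omega>]])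
        finally show ?thesis .
      qed (rule not_integrable_integral_eq)
    qed
    finally have "(\<integral>z. ?\<Phi> z \<partial>\<gamma>) = 0" by simp
    then have "(\<integral>z. ?d (\<pi> z) \<partial>\<gamma>) + (\<integral>z. hgrad \<psi> (\<pi> z) \<bullet> V z \<partial>\<gamma>) = 0"
      using Bochner_Integration.integral_add[OF i1 i2] by simp
    then show "(\<integral>p. ?d p \<partial>\<mu>) + (\<integral>p. frechet_derivative \<psi> (at p) (vector_RN_deriv \<mu> m p, 0) \<partial>\<mu>) = 0"
      by (simp only: e1 e2 hgrad_inner[OF \<psi>])
  qed
  have "(\<integral>\<^sup>+p. ennreal ((norm (vector_RN_deriv \<mu> m p))\<^sup>2) \<partial>\<mu>) < \<infinity>"
    using nn_integral_bary_density_le[OF bary] V2 unfolding \<mu>_def m_def by (rule le_less_trans)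
  moreover have "vector_measure (cylinder L T) m" unfolding m_def by (rule vector_measure_bary_flux[OF bary])
  moreover have "vector_abs_cont m \<mu>" unfolding m_def \<mu>_def by (rule vector_abs_cont_bary_flux[OF bary])
  ultimately show ?thesis using \<mu> wc ce by blast
qed

end

text \<open>By uniqueness the chosen slices in the energy may be exchanged for any weakly continuous
  representative at hand.\<close>

lemma energy_atom_sum:
  assumes "L > 0" "T > 0" "finite_borel_measure (cylinder L T) \<mu>" "weakly_continuous_rep L T \<mu> \<kappa>"
  shows "energy L T \<mu> m = ennreal (K_star / L\<^sup>2) * (\<integral>\<^sup>+t\<in>{-T<..<T}. atom_sum L (\<kappa> t) \<partial>lborel)
    + ennreal (1 / L\<^sup>2) * (\<integral>\<^sup>+p. ennreal ((norm (vector_RN_deriv \<mu> m p))\<^sup>2) \<partial>\<mu>)"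
proof -
  have "(\<integral>\<^sup>+t\<in>{-T<..<T}. atom_sum L (slice L T \<mu> t) \<partial>lborel) = (\<integral>\<^sup>+t\<in>{-T<..<T}. atom_sum L (\<kappa> t) \<partial>lborel)"
  proof (rule nn_integral_cong)
    fix t :: real
    show "atom_sum L (slice L T \<mu> t) * indicator {-T<..<T} t = atom_sum L (\<kappa> t) * indicator {-T<..<T} t"
      using slice_eq[OF assms, of t] by (cases "t \<in> {-T<..<T}") simp_all
  qed
  then show ?thesis by (simp only: energy_def atom_sum_def)
qed

lemma competitorI:
  assumes L: "L > 0" "T > 0" and \<mu>: "finite_borel_measure (cylinder L T) \<mu>" and \<kappa>: "weakly_continuous_rep L T \<mu> \<kappa>"
    and m: "vector_measure (cylinder L T) m" "vector_abs_cont m \<mu>" "continuity_equation L T \<mu> m"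
    and at: "AE t in lborel. t \<in> {-T<..<T} \<longrightarrow> countable_dirac_sum L (\<kappa> t)"
    and ends: "\<kappa> (- T) = \<nu>\<^sub>m" "\<kappa> T = \<nu>\<^sub>p"
  shows "\<mu> \<in> competitors L T \<nu>\<^sub>m \<nu>\<^sub>p" "min_energy L T \<mu> \<le> energy L T \<mu> m"
proof -
  note sl = slice_eq[OF L \<mu> \<kappa>]
  have "AE t in lborel. t \<in> {-T<..<T} \<longrightarrow> countable_dirac_sum L (slice L T \<mu> t)"
    using at by eventually_elim (simp add: sl)
  then have "(\<mu>, m) \<in> admissible L T"
    using \<mu> m weakly_continuous_repD(1)[OF \<kappa>] unfolding admissible_def by blast
  moreover have "has_traces L T \<mu> \<nu>\<^sub>m \<nu>\<^sub>p"
    using \<kappa> ends sl[of "- T"] sl[of T] L(2) unfolding has_traces_def by auto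
  ultimately show "\<mu> \<in> competitors L T \<nu>\<^sub>m \<nu>\<^sub>p" by (auto simp: competitors_def admissible_star_def)
  show "min_energy L T \<mu> \<le> energy L T \<mu> m"
    unfolding min_energy_def using m by (intro INF_lower) simp
qed

theorem finite_energy_competitor:
  assumes L: "L > 0" and T: "T > 0" and \<nu>: "finite_borel_measure (torus L) \<nu>\<^sub>m" "finite_borel_measure (torus L) \<nu>\<^sub>p"
    and mass: "emeasure \<nu>\<^sub>p (torus L) = emeasure \<nu>\<^sub>m (torus L)"
  obtains \<mu> where "\<mu> \<in> competitors L T \<nu>\<^sub>m \<nu>\<^sub>p" "min_energy L T \<mu> < \<infinity>"
proof -
  have "measure \<nu>\<^sub>m (space \<nu>\<^sub>m) = measure \<nu>\<^sub>p (space \<nu>\<^sub>p)"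
    using mass by (simp add: space_torus_measure[OF \<nu>(1)] space_torus_measure[OF \<nu>(2)] measure_def)
  then obtain P where P: "finite_measure P" "sets P = sets (restrict_space borel (torus L) \<Otimes>\<^sub>M restrict_space borel (torus L))"
    and ends: "distr P (restrict_space borel (torus L)) fst = \<nu>\<^sub>m" "distr P (restrict_space borel (torus L)) snd = \<nu>\<^sub>p"
    by (rule coupling_exists[OF \<nu>])
  note LTP = L T P
  let ?\<kappa> = "branch_slice L T P"
  obtain \<mu> m where \<mu>: "finite_borel_measure (cylinder L T) \<mu>" and wc: "weakly_continuous_rep L T \<mu> ?\<kappa>"
    and m: "vector_measure (cylinder L T) m" "vector_abs_cont m \<mu>" "continuity_equation L T \<mu> m"
    and E: "(\<integral>\<^sup>+p. ennreal ((norm (vector_RN_deriv \<mu> m p))\<^sup>2) \<partial>\<mu>) < \<infinity>"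
    using branch_transport_exists[OF LTP] by (elim exE conjE)
  have at: "AE t in lborel. t \<in> {-T<..<T} \<longrightarrow> countable_dirac_sum L (?\<kappa> t)"
    using branch_slice_atomic[OF LTP] by (intro AE_I2) simp
  have e: "?\<kappa> (- T) = \<nu>\<^sub>m" "?\<kappa> T = \<nu>\<^sub>p" using branch_slice_ends[OF LTP] ends by simp_all
  note c = competitorI[OF L T \<mu> wc m at e]
  have "energy L T \<mu> m < \<infinity>"
    unfolding energy_atom_sum[OF L T \<mu> wc] using branch_slice_perimeter[OF LTP] E
    by (simp add: ennreal_add_less_top ennreal_mult_less_top)
  then show thesis using that[OF c(1)] c(2) by (blast intro: le_less_trans)
qed

section \<open>The direct method\<close>

text \<open>The partial derivatives are continuous and again periodic, hence bounded. This supplies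
  the Lipschitz constant for \<open>slice_equicontinuous\<close>.\<close>

lemma periodic_gradient_bound:
  fixes f :: "real^2 \<Rightarrow> real"
  assumes L: "L > 0" and f: "C_times 1 f" "periodic L f"
  obtains C where "0 \<le> C" "\<And>x w. \<bar>frechet_derivative f (at x) w\<bar> \<le> C * norm w"
proof -
  have diff: "f differentiable at x" for x using f(1) by simp
  have d: "(f has_derivative frechet_derivative f (at x)) (at x)" for x
    using diff[of x] by (simp only: frechet_derivative_works)
  have per: "periodic L (\<lambda>x. frechet_derivative f (at x) b)" for b
    unfolding periodic_def
  proof (intro allI)
    fix x :: "real^2" and i :: 2
    let ?v = "L *\<^sub>R axis i (1 :: real)"
    have "((\<lambda>y. y + ?v) has_derivative (\<lambda>h. h)) (at x)" by (auto intro!: derivative_eq_intros)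
    from has_derivative_compose[OF this d] have "((\<lambda>y. f (y + ?v)) has_derivative frechet_derivative f (at (x + ?v))) (at x)" .
    moreover have "(\<lambda>y. f (y + ?v)) = f" using f(2) by (simp add: periodic_def)
    ultimately have "(f has_derivative frechet_derivative f (at (x + ?v))) (at x)" by (simp only:)
    then show "frechet_derivative f (at (x + ?v)) b = frechet_derivative f (at x) b"
      by (rule fun_cong[OF frechet_derivative_at])
  qed
  have "\<exists>C. \<forall>x. \<bar>frechet_derivative f (at x) b\<bar> \<le> C" if "b \<in> Basis" for b
  proof -
    have "continuous_on UNIV (\<lambda>x. frechet_derivative f (at x) b)" using f(1) that by simp
    then obtain C where "\<And>x. \<bar>frechet_derivative f (at x) b\<bar> \<le> C" using periodic_bounded[OF L _ per] by blast
    then show ?thesis by blast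
  qed
  then have "\<forall>b\<in>Basis. \<exists>C. \<forall>x. \<bar>frechet_derivative f (at x) b\<bar> \<le> C" by (rule ballI)
  then obtain C where C: "\<forall>b\<in>Basis. \<forall>x. \<bar>frechet_derivative f (at x) b\<bar> \<le> C b" by (rule bchoice[THEN exE])
  have Cb: "\<bar>frechet_derivative f (at x) b\<bar> \<le> C b" if "b \<in> Basis" for b x
    by (rule spec[OF bspec[OF C that]])
  show thesis
  proof (rule that[of "\<Sum>b\<in>Basis. C b"])
    show "0 \<le> (\<Sum>b\<in>Basis. C b)" by (rule sum_nonneg) (rule order_trans[OF abs_ge_zero Cb[where x = 0]])
    fix x w :: "real^2"
    let ?D = "frechet_derivative f (at x)"
    have lin: "linear ?D" by (rule has_derivative_linear[OF d])
    have "?D w = ?D (\<Sum>b\<in>Basis. (w \<bullet> b) *\<^sub>R b)" by (simp only: euclidean_representation)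
    also have "\<dots> = (\<Sum>b\<in>Basis. (w \<bullet> b) * ?D b)" by (simp add: linear_sum[OF lin] linear_scale[OF lin])
    finally have "\<bar>?D w\<bar> \<le> (\<Sum>b\<in>Basis. \<bar>(w \<bullet> b) * ?D b\<bar>)" by (simp only: sum_abs)
    also have "\<dots> \<le> (\<Sum>b\<in>Basis. norm w * C b)"
      unfolding abs_mult by (intro sum_mono mult_mono Basis_le_norm Cb) auto
    finally show "\<bar>?D w\<bar> \<le> (\<Sum>b\<in>Basis. C b) * norm w" by (simp only: sum_distrib_left mult.commute[of "sum C Basis"])
  qed
qed

text \<open>Provides the measurable integrand for Fatou's lemma, in place of the sum over all points
  of the torus.\<close>

lemma cell_sum_measurable:
  assumes \<kappa>: "kernel L T \<kappa>"
  shows "(\<lambda>t. (SUP k. cell_sum L k (\<kappa> t)) * indicator {-T<..<T} t) \<in> borel_measurable lborel"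
proof -
  have "(\<lambda>t. emeasure (\<kappa> t) {x \<in> torus L. cell L k x = c}) \<in> borel_measurable (restrict_space borel {-T<..<T})" for k c
    using \<kappa> cell_measurable[of L k c] unfolding kernel_def by blast
  note [measurable] = this
  have "(\<lambda>t. SUP k. cell_sum L k (\<kappa> t)) \<in> borel_measurable (restrict_space borel {-T<..<T})"
    unfolding cell_sum_def measure_def by measurable
  then show ?thesis by (subst (asm) borel_measurable_restrict_space_iff_ennreal) simp_all
qed

text \<open>Fatou's lemma is applied to the suprema of cell sums, which equal the atom sums for
  almost every time. The integrated liminf is finite, so for almost every time the liminf is finite,
  and there the limit slice is atomic.\<close>

lemma perimeter_lower_semicontinuous:
  assumes L: "L > 0" and ker: "\<And>n. kernel L T (\<kappa> n)"
    and at: "\<And>n. AE t in lborel. t \<in> {-T<..<T} \<longrightarrow> countable_dirac_sum L (\<kappa> n t)"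
    and \<kappa>': "\<And>t. t \<in> {-T<..<T} \<Longrightarrow> finite_borel_measure (torus L) (\<kappa>' t)"
    and conv: "\<And>(f :: real^2 \<Rightarrow> real) t. continuous_on UNIV f \<Longrightarrow> periodic L f \<Longrightarrow> t \<in> {-T<..<T} \<Longrightarrow>
      (\<lambda>n. \<integral>x. f x \<partial>\<kappa> n t) \<longlonglongrightarrow> (\<integral>x. f x \<partial>\<kappa>' t)"
    and \<alpha>: "(\<lambda>n. \<integral>\<^sup>+t\<in>{-T<..<T}. atom_sum L (\<kappa> n t) \<partial>lborel) \<longlonglongrightarrow> ennreal \<alpha>"
  shows "(\<integral>\<^sup>+t\<in>{-T<..<T}. atom_sum L (\<kappa>' t) \<partial>lborel) \<le> ennreal \<alpha>"
    and "AE t in lborel. t \<in> {-T<..<T} \<longrightarrow> countable_dirac_sum L (\<kappa>' t)"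
proof -
  let ?I = "{-T<..<T}"
  define f where "f n t = (SUP k. cell_sum L k (\<kappa> n t)) * indicator ?I t" for n t
  have fm: "f n \<in> borel_measurable lborel" for n
    using cell_sum_measurable[OF ker] unfolding f_def[abs_def] .
  \<comment> \<open>The exceptional null sets of the countably many measures are united into
    one.\<close>
  have all: "AE t in lborel. \<forall>n. t \<in> ?I \<longrightarrow> countable_dirac_sum L (\<kappa> n t)"
    unfolding AE_all_countable using at by (rule allI)
  have feq: "f n t = atom_sum L (\<kappa> n t) * indicator ?I t"
    if "\<forall>n. t \<in> ?I \<longrightarrow> countable_dirac_sum L (\<kappa> n t)" for n t
  proof (cases "t \<in> ?I")
    case True
    then have "countable_dirac_sum L (\<kappa> n t)" using that by blast
    then show ?thesis using atom_sum_eq_SUP_cell_sum[OF L kernel_finite[OF ker True]] by (simp only: f_def)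
  qed (simp add: f_def)
  have "(\<integral>\<^sup>+t. f n t \<partial>lborel) = (\<integral>\<^sup>+t\<in>?I. atom_sum L (\<kappa> n t) \<partial>lborel)" for n
    by (rule nn_integral_cong_AE[OF eventually_mono[OF all feq]])
  then have "liminf (\<lambda>n. \<integral>\<^sup>+t. f n t \<partial>lborel) = ennreal \<alpha>"
    using lim_imp_Liminf[OF _ \<alpha>] by simp
  then have fatou: "(\<integral>\<^sup>+t. liminf (\<lambda>n. f n t) \<partial>lborel) \<le> ennreal \<alpha>"
    using nn_integral_liminf[of f lborel, OF fm] by simp
  have lim: "atom_sum L (\<kappa>' t) \<le> liminf (\<lambda>n. f n t)"
    "liminf (\<lambda>n. f n t) \<noteq> \<infinity> \<Longrightarrow> countable_dirac_sum L (\<kappa>' t)"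
    if a: "\<forall>n. t \<in> ?I \<longrightarrow> countable_dirac_sum L (\<kappa> n t)" and t: "t \<in> ?I" for t
  proof -
    have d: "countable_dirac_sum L (\<kappa> n t)" for n using a t by blast
    have e: "liminf (\<lambda>n. f n t) = liminf (\<lambda>n. atom_sum L (\<kappa> n t))" using feq[OF a] t by simp
    note P = L kernel_finite[OF ker t] d \<kappa>'[OF t] conv[OF _ _ t]
    show "atom_sum L (\<kappa>' t) \<le> liminf (\<lambda>n. f n t)" unfolding e by (rule atom_sum_lower_semicontinuous[OF P])
    show "countable_dirac_sum L (\<kappa>' t)" if "liminf (\<lambda>n. f n t) \<noteq> \<infinity>"
      by (rule limit_atomic[OF P]) (use that in \<open>simp_all add: e less_top\<close>)
  qed
  have "(\<integral>\<^sup>+t\<in>?I. atom_sum L (\<kappa>' t) \<partial>lborel) \<le> (\<integral>\<^sup>+t. liminf (\<lambda>n. f n t) \<partial>lborel)"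
  proof (rule nn_integral_mono_AE)
    show "AE t in lborel. atom_sum L (\<kappa>' t) * indicator ?I t \<le> liminf (\<lambda>n. f n t)"
      using all
    proof eventually_elim
      case (elim t)
      then show ?case using lim(1)[OF elim] by (cases "t \<in> ?I") simp_all
    qed
  qed
  then show "(\<integral>\<^sup>+t\<in>?I. atom_sum L (\<kappa>' t) \<partial>lborel) \<le> ennreal \<alpha>" using fatou by (rule order_trans)
  have "AE t in lborel. liminf (\<lambda>n. f n t) \<noteq> \<infinity>"
  proof (rule nn_integral_PInf_AE)
    show "(\<lambda>t. liminf (\<lambda>n. f n t)) \<in> borel_measurable lborel" using fm by measurable
    show "(\<integral>\<^sup>+t. liminf (\<lambda>n. f n t) \<partial>lborel) \<noteq> \<infinity>" using fatou by (auto simp: top_unique)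
  qed
  then show "AE t in lborel. t \<in> ?I \<longrightarrow> countable_dirac_sum L (\<kappa>' t)"
    using all by eventually_elim (use lim(2) in blast)
qed

lemma K_star_pos: "0 < K_star"
  by (simp add: K_star_def)

theorem proposition5p5:
  fixes L T :: real and \<nu>\<^sub>m \<nu>\<^sub>p :: "(real^2) measure"
  assumes "0 < L" and "0 < T"
    and "finite_borel_measure (torus L) \<nu>\<^sub>m"
    and "finite_borel_measure (torus L) \<nu>\<^sub>p"
    and "emeasure \<nu>\<^sub>p (torus L) = emeasure \<nu>\<^sub>m (torus L)"
  shows "(INF \<mu>\<in>competitors L T \<nu>\<^sub>m \<nu>\<^sub>p. min_energy L T \<mu>) < \<infinity> \<and>
    (\<exists>\<mu>\<^sub>0\<in>competitors L T \<nu>\<^sub>m \<nu>\<^sub>p.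
       min_energy L T \<mu>\<^sub>0 = (INF \<mu>\<in>competitors L T \<nu>\<^sub>m \<nu>\<^sub>p. min_energy L T \<mu>))"
proof -
  note L = assms(1) and T = assms(2) and \<nu> = assms(3,4)
  let ?X = "competitors L T \<nu>\<^sub>m \<nu>\<^sub>p"
  define E where "E = (INF \<mu>\<in>?X. min_energy L T \<mu>)"
  have Ef: "E < \<infinity>"
  proof -
    obtain \<mu> where "\<mu> \<in> ?X" "min_energy L T \<mu> < \<infinity>" by (rule finite_energy_competitor[OF assms])
    then show ?thesis unfolding E_def by (blast intro: le_less_trans INF_lower)
  qed
  then obtain e where e: "E = ennreal e" "0 \<le> e" by (cases E) auto
  \<comment> \<open>Measure and flux are minimised jointly: \<open>min_energy\<close> is an infimum
    over fluxes, so only a nearly optimal flux is available for each measure.\<close>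
  define J where "J n p \<longleftrightarrow> fst p \<in> ?X \<and> vector_measure (cylinder L T) (snd p) \<and> vector_abs_cont (snd p) (fst p) \<and>
    continuity_equation L T (fst p) (snd p) \<and> energy L T (fst p) (snd p) < ennreal (e + 1 / real (Suc n))" for n p
  have "\<exists>p. J n p" for n
  proof -
    have "E < ennreal (e + 1 / real (Suc n))" unfolding e(1) using e(2) by (intro ennreal_lessI) (simp_all add: add_nonneg_pos)
    then obtain \<mu> where \<mu>: "\<mu> \<in> ?X" "min_energy L T \<mu> < ennreal (e + 1 / real (Suc n))"
      unfolding E_def by (auto simp: INF_less_iff)
    then obtain m where "vector_measure (cylinder L T) m" "vector_abs_cont m \<mu>" "continuity_equation L T \<mu> m"
      "energy L T \<mu> m < ennreal (e + 1 / real (Suc n))"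
      unfolding min_energy_def by (auto simp: INF_less_iff)
    then have "J n (\<mu>, m)" using \<mu>(1) by (simp add: J_def)
    then show ?thesis by blast
  qed
  then have "\<exists>p. \<forall>n. J n (p n)" by (intro choice allI)
  then obtain p where p: "J n (p n)" for n by blast
  define \<mu> where "\<mu> n = fst (p n)" for n
  define m where "m n = snd (p n)" for n
  define \<kappa> where "\<kappa> n = slice L T (\<mu> n)" for n
  have X: "\<mu> n \<in> ?X" and vm: "vector_measure (cylinder L T) (m n)" and ac: "vector_abs_cont (m n) (\<mu> n)"
    and ce: "continuity_equation L T (\<mu> n) (m n)" and en: "energy L T (\<mu> n) (m n) < ennreal (e + 1 / real (Suc n))" for n
    using p[of n] by (simp_all add: J_def \<mu>_def m_def)
  have \<mu>: "finite_borel_measure (cylinder L T) (\<mu> n)"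
    and at: "AE t in lborel. t \<in> {-T<..<T} \<longrightarrow> countable_dirac_sum L (\<kappa> n t)" for n
    using X[of n] by (auto simp: competitors_def admissible_star_def admissible_def \<kappa>_def)
  have tr: "has_traces L T (\<mu> n) \<nu>\<^sub>m \<nu>\<^sub>p" for n using X[of n] by (simp add: competitors_def)
  have wc: "weakly_continuous_rep L T (\<mu> n) (\<kappa> n)" for n
    using tr[of n] weakly_continuous_rep_slice unfolding has_traces_def \<kappa>_def by blast
  have ends: "\<kappa> n (- T) = \<nu>\<^sub>m" "\<kappa> n T = \<nu>\<^sub>p" for n
    using tr[of n] by (simp_all add: has_traces_def \<kappa>_def)
  have ker: "kernel L T (\<kappa> n)" for n by (rule disintegration_kernel[OF weakly_continuous_repD(1)[OF wc]])
  have J: "t \<in> {-T..T}" if "t \<in> {-T<..<T}" for t using that by simp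
  define A where "A n = (\<integral>\<^sup>+t\<in>{-T<..<T}. atom_sum L (\<kappa> n t) \<partial>lborel)" for n
  define B where "B n = (\<integral>\<^sup>+p. ennreal ((norm (vector_RN_deriv (\<mu> n) (m n) p))\<^sup>2) \<partial>\<mu> n)" for n
  define a where "a = K_star / L\<^sup>2"
  define c where "c = 1 / L\<^sup>2"
  have ac0: "0 < a" "0 < c" using L K_star_pos by (simp_all add: a_def c_def)
  have eAB: "energy L T (\<mu> n) (m n) = ennreal a * A n + ennreal c * B n" for n
    unfolding energy_atom_sum[OF L T \<mu> wc] A_def B_def a_def c_def ..
  have fin: "A n < \<infinity>" "B n < \<infinity>" for n
  proof -
    have "ennreal a * A n + ennreal c * B n < \<infinity>" using en[of n] unfolding eAB by (rule less_trans) simp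
    then show "A n < \<infinity>" "B n < \<infinity>" using ac0 by (auto simp: ennreal_add_less_top ennreal_mult_less_top)
  qed
  define A' where "A' n = enn2real (A n)" for n
  define B' where "B' n = enn2real (B n)" for n
  have A': "A n = ennreal (A' n)" "0 \<le> A' n" and B': "B n = ennreal (B' n)" "0 \<le> B' n" for n
    using fin[of n] by (simp_all add: A'_def B'_def)
  have enr: "a * A' n + c * B' n \<le> e + 1 / real (Suc n)" for n
  proof -
    have "energy L T (\<mu> n) (m n) = ennreal (a * A' n + c * B' n)"
      unfolding eAB A'(1) B'(1) using ac0 A'(2) B'(2) by (simp add: ennreal_mult ennreal_plus)
    then have "ennreal (a * A' n + c * B' n) \<le> ennreal (e + 1 / real (Suc n))" using en[of n] by simp
    then show ?thesis using e(2) by (subst (asm) ennreal_le_iff) auto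
  qed
  define A0 where "A0 = (e + 1) / a"
  define B0 where "B0 = (e + 1) / c"
  have AB0: "A' n \<le> A0" "B' n \<le> B0" for n
  proof -
    have "1 / real (Suc n) \<le> 1" by simp
    then have "a * A' n + c * B' n \<le> e + 1" using enr[of n] by linarith
    moreover have "0 \<le> a * A' n" "0 \<le> c * B' n" using ac0 A'(2)[of n] B'(2)[of n] by simp_all
    ultimately have "a * A' n \<le> e + 1" "c * B' n \<le> e + 1" by linarith+
    then show "A' n \<le> A0" "B' n \<le> B0" using ac0 by (simp_all add: A0_def B0_def pos_le_divide_eq mult.commute)
  qed
  have B0: "0 \<le> B0" using AB0(2)[of 0] B'(2)[of 0] by linarith
  have BB0: "(\<integral>\<^sup>+p. ennreal ((norm (vector_RN_deriv (\<mu> n) (m n) p))\<^sup>2) \<partial>\<mu> n) \<le> ennreal B0" for n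
    using AB0(2)[of n] B'(1)[of n] by (simp add: B_def ennreal_leI)
  note hyps = L T \<mu> wc vm ac ce B0 BB0
  define M where "M = measure \<nu>\<^sub>m (torus L)"
  have mass: "measure (\<kappa> n t) (torus L) = M" if "t \<in> {-T..T}" for n t
    using mass_const[OF hyps that] by (simp add: ends M_def)
  have M0: "0 \<le> M" by (simp add: M_def)
  \<comment> \<open>Perimeter and kinetic energy are made to converge separately, because each is
    compared with its own limit later.\<close>
  obtain \<alpha> \<beta> r1 where r1: "strict_mono (r1 :: nat \<Rightarrow> nat)" "(\<lambda>n. A' (r1 n)) \<longlonglongrightarrow> \<alpha>" "(\<lambda>n. B' (r1 n)) \<longlonglongrightarrow> \<beta>" "0 \<le> \<beta>"
  proof -
    have "compact ({0..A0} \<times> {0..B0})" by (intro compact_Times compact_Icc)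
    then have sc: "seq_compact ({0..A0} \<times> {0..B0})" by (simp only: compact_eq_seq_compact_metric)
    have "\<forall>n. (A' n, B' n) \<in> {0..A0} \<times> {0..B0}" using A'(2) B'(2) AB0 by simp
    then obtain l r where l: "l \<in> {0..A0} \<times> {0..B0}" "strict_mono (r :: nat \<Rightarrow> nat)"
      "((\<lambda>n. (A' n, B' n)) \<circ> r) \<longlonglongrightarrow> l" by (rule seq_compactE[OF sc])
    have "(\<lambda>n. fst (((\<lambda>n. (A' n, B' n)) \<circ> r) n)) \<longlonglongrightarrow> fst l" "(\<lambda>n. snd (((\<lambda>n. (A' n, B' n)) \<circ> r) n)) \<longlonglongrightarrow> snd l"
      by (rule tendsto_fst[OF l(3)], rule tendsto_snd[OF l(3)])
    then show thesis using that[of r "fst l" "snd l"] l(1,2) by auto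
  qed
  have equi: "\<exists>d>0. \<forall>n. \<forall>s\<in>{-T..T}. \<forall>t\<in>{-T..T}. \<bar>t - s\<bar> < d \<longrightarrow>
      \<bar>(\<integral>x. f x \<partial>\<kappa> (r1 n) t) - (\<integral>x. f x \<partial>\<kappa> (r1 n) s)\<bar> \<le> \<epsilon>"
    if f: "\<And>k. C_times k f" "periodic L f" and \<epsilon>: "\<epsilon> > 0" for f :: "real^2 \<Rightarrow> real" and \<epsilon>
  proof -
    obtain C where C: "0 \<le> C" "\<And>x w. \<bar>frechet_derivative f (at x) w\<bar> \<le> C * norm w"
      using periodic_gradient_bound[OF L f] by blast
    \<comment> \<open>First \<open>l\<close> makes the energy term at most half of \<epsilon>, then
      \<open>d\<close> does the same with the mass term divided by \<open>l\<close>. The summands 1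
      keep the denominators positive.\<close>
    define l where "l = \<epsilon> / (2 * (C * B0 + 1))"
    define d where "d = \<epsilon> * l / (2 * (C * M + 1))"
    have pos: "0 < C * B0 + 1" "0 < C * M + 1" using C(1) B0 M0 by (simp_all add: add_nonneg_pos)
    have l: "l > 0" and d: "d > 0" using \<epsilon> pos by (simp_all add: l_def d_def)
    have half: "q \<noteq> 0 \<Longrightarrow> q * (y / (2 * q)) = y / 2" for q y :: real by simp
    have l1: "C * B0 * l \<le> \<epsilon> / 2"
    proof -
      have "C * B0 * l \<le> (C * B0 + 1) * l" using l by simp
      also have "\<dots> = \<epsilon> / 2" using half[OF less_imp_neq[OF pos(1), symmetric], of \<epsilon>] by (simp only: l_def)
      finally show ?thesis .
    qed
    have d1: "C * M * d / l \<le> \<epsilon> / 2"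
    proof -
      have "C * M * d / l \<le> (C * M + 1) * d / l" using l d by (simp add: divide_right_mono)
      also have "\<dots> = \<epsilon> / 2" using l unfolding d_def half[OF less_imp_neq[OF pos(2), symmetric]] by simp
      finally show ?thesis .
    qed
    have step: "\<bar>(\<integral>x. f x \<partial>\<kappa> n t) - (\<integral>x. f x \<partial>\<kappa> n s)\<bar> \<le> \<epsilon>"
      if st: "- T \<le> s" "s \<le> t" "t \<le> T" "t - s < d" for n s t
    proof -
      have "\<bar>(\<integral>x. f x \<partial>\<kappa> n t) - (\<integral>x. f x \<partial>\<kappa> n s)\<bar> \<le> C * (l * B0 + measure (\<kappa> n (- T)) (torus L) * (t - s) / l)"
        by (rule slice_equicontinuous[OF hyps f C st(1-3) l])
      also have "\<dots> = C * B0 * l + C * M * (t - s) / l" by (simp add: ends M_def algebra_simps)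
      also have "C * M * (t - s) / l \<le> C * M * d / l"
        using C(1) M0 st(4) l by (intro divide_right_mono mult_left_mono mult_nonneg_nonneg) auto
      finally show ?thesis using l1 d1 by linarith
    qed
    show ?thesis
    proof (intro exI[of _ d] conjI d allI ballI impI)
      fix n s t assume *: "s \<in> {-T..T}" "t \<in> {-T..T}" "\<bar>t - s\<bar> < d"
      show "\<bar>(\<integral>x. f x \<partial>\<kappa> (r1 n) t) - (\<integral>x. f x \<partial>\<kappa> (r1 n) s)\<bar> \<le> \<epsilon>"
        using step[of s t "r1 n"] step[of t s "r1 n"] * by (cases "s \<le> t") (auto simp: abs_minus_commute)
    qed
  qed
  have "\<exists>r2 \<kappa>'. strict_mono (r2 :: nat \<Rightarrow> nat) \<and> (\<forall>t\<in>{-T..T}. finite_borel_measure (torus L) (\<kappa>' t)) \<and>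
    (\<forall>f :: real^2 \<Rightarrow> real. continuous_on UNIV f \<longrightarrow> periodic L f \<longrightarrow>
      continuous_on {-T..T} (\<lambda>t. \<integral>x. f x \<partial>\<kappa>' t) \<and>
      (\<forall>t\<in>{-T..T}. (\<lambda>n. \<integral>x. f x \<partial>\<kappa> (r1 (r2 n)) t) \<longlonglongrightarrow> (\<integral>x. f x \<partial>\<kappa>' t)))"
    by (rule slices_convergent_subsequence[OF L T weakly_continuous_repD(2)[OF wc] mass equi])
  then obtain r2 \<kappa>' where r2: "strict_mono (r2 :: nat \<Rightarrow> nat)"
    and \<kappa>': "\<forall>t\<in>{-T..T}. finite_borel_measure (torus L) (\<kappa>' t)"
    and lim: "\<forall>f :: real^2 \<Rightarrow> real. continuous_on UNIV f \<longrightarrow> periodic L f \<longrightarrow>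
      continuous_on {-T..T} (\<lambda>t. \<integral>x. f x \<partial>\<kappa>' t) \<and>
      (\<forall>t\<in>{-T..T}. (\<lambda>n. \<integral>x. f x \<partial>\<kappa> (r1 (r2 n)) t) \<longlonglongrightarrow> (\<integral>x. f x \<partial>\<kappa>' t))"
    by (elim exE conjE)
  define r where "r n = r1 (r2 n)" for n
  have lA: "(\<lambda>n. A' (r n)) \<longlonglongrightarrow> \<alpha>" and lB: "(\<lambda>n. B' (r n)) \<longlonglongrightarrow> \<beta>" and rr: "strict_mono r"
    using LIMSEQ_subseq_LIMSEQ[OF r1(2) r2] LIMSEQ_subseq_LIMSEQ[OF r1(3) r2] strict_mono_o[OF r1(1) r2]
    by (simp_all add: r_def[abs_def] o_def)
  have \<kappa>'f: "finite_borel_measure (torus L) (\<kappa>' t)" if "t \<in> {-T..T}" for t using \<kappa>' that by blast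
  have cont: "continuous_on {-T..T} (\<lambda>t. \<integral>x. f x \<partial>\<kappa>' t)" if "continuous_on UNIV f" "periodic L f" for f :: "real^2 \<Rightarrow> real"
    using lim that by blast
  have conv: "(\<lambda>n. \<integral>x. f x \<partial>\<kappa> (r n) t) \<longlonglongrightarrow> (\<integral>x. f x \<partial>\<kappa>' t)"
    if "continuous_on UNIV f" "periodic L f" "t \<in> {-T..T}" for f :: "real^2 \<Rightarrow> real" and t
    unfolding r_def using lim that by blast
  \<comment> \<open>At the two end times the slices are the prescribed traces for every member of
    the sequence, so their weak limits are these traces.\<close>
  have ends': "\<kappa>' (- T) = \<nu>\<^sub>m" "\<kappa>' T = \<nu>\<^sub>p"
  proof -
    have T': "- T \<in> {-T..T}" "T \<in> {-T..T}" using T by auto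
    show "\<kappa>' (- T) = \<nu>\<^sub>m"
      by (rule torus_measure_eqI[OF L \<kappa>'f[OF T'(1)] \<nu>(1)])
         (rule LIMSEQ_unique[OF conv[OF _ _ T'(1), unfolded ends] tendsto_const])
    show "\<kappa>' T = \<nu>\<^sub>p"
      by (rule torus_measure_eqI[OF L \<kappa>'f[OF T'(2)] \<nu>(2)])
         (rule LIMSEQ_unique[OF conv[OF _ _ T'(2), unfolded ends] tendsto_const])
  qed
  have "B (r n) = ennreal (B' (r n))" "A (r n) = ennreal (A' (r n))" for n by (rule B'(1), rule A'(1))
  then have lA': "(\<lambda>n. A (r n)) \<longlonglongrightarrow> ennreal \<alpha>" and lB': "(\<lambda>n. B (r n)) \<longlonglongrightarrow> ennreal \<beta>"
    using tendsto_ennrealI[OF lA] tendsto_ennrealI[OF lB] by simp_all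
  have "\<exists>\<mu>' m'. finite_borel_measure (cylinder L T) \<mu>' \<and> weakly_continuous_rep L T \<mu>' \<kappa>' \<and>
    vector_measure (cylinder L T) m' \<and> vector_abs_cont m' \<mu>' \<and> continuity_equation L T \<mu>' m' \<and>
    (\<integral>\<^sup>+p. ennreal ((norm (vector_RN_deriv \<mu>' m' p))\<^sup>2) \<partial>\<mu>') \<le> ennreal \<beta>"
    by (rule flux_limit[OF L T \<mu> wc vm ac ce r1(4) lB'[unfolded B_def] BB0 mass \<kappa>'f cont conv])
  then obtain \<mu>' m' where \<mu>': "finite_borel_measure (cylinder L T) \<mu>'" "weakly_continuous_rep L T \<mu>' \<kappa>'"
    and m': "vector_measure (cylinder L T) m'" "vector_abs_cont m' \<mu>'" "continuity_equation L T \<mu>' m'"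
    and b: "(\<integral>\<^sup>+p. ennreal ((norm (vector_RN_deriv \<mu>' m' p))\<^sup>2) \<partial>\<mu>') \<le> ennreal \<beta>"
    by (elim exE conjE)
  note per = perimeter_lower_semicontinuous[OF L ker at \<kappa>'f[OF J] conv[OF _ _ J] lA'[unfolded A_def]]
  note comp = competitorI[OF L T \<mu>' m' per(2) ends']
  \<comment> \<open>The weighted sum is at most \<open>e + 1 / real (Suc (r n))\<close> along the
    sequence. Since each part of the limit energy is bounded by its own limit \<alpha> or \<beta>,
    the limit pair has energy at most the infimum.\<close>
  have "a * \<alpha> + c * \<beta> \<le> e + 0"
  proof (rule tendsto_le[OF sequentially_bot])
    have "(\<lambda>n. 1 / real (Suc n)) \<longlonglongrightarrow> 0" using LIMSEQ_inverse_real_of_nat by (simp add: inverse_eq_divide)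
    from LIMSEQ_subseq_LIMSEQ[OF this rr] have "(\<lambda>n. 1 / real (Suc (r n))) \<longlonglongrightarrow> 0" by (simp add: o_def)
    then show "(\<lambda>n. e + 1 / real (Suc (r n))) \<longlonglongrightarrow> e + 0" by (intro tendsto_add tendsto_const)
    show "(\<lambda>n. a * A' (r n) + c * B' (r n)) \<longlonglongrightarrow> a * \<alpha> + c * \<beta>" by (intro tendsto_intros lA lB)
    show "\<forall>\<^sub>F n in sequentially. a * A' (r n) + c * B' (r n) \<le> e + 1 / real (Suc (r n))" using enr by simp
  qed
  moreover have "0 \<le> \<alpha>" by (rule LIMSEQ_le_const[OF lA]) (use A'(2) in blast)
  ultimately have "ennreal a * ennreal \<alpha> + ennreal c * ennreal \<beta> \<le> E"
    unfolding e(1) using ac0 r1(4) by (simp add: ennreal_mult[symmetric] ennreal_plus[symmetric] ennreal_leI del: ennreal_plus)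
  moreover have "energy L T \<mu>' m' \<le> ennreal a * ennreal \<alpha> + ennreal c * ennreal \<beta>"
    unfolding energy_atom_sum[OF L T \<mu>'] a_def[symmetric] c_def[symmetric]
    by (intro add_mono mult_left_mono per(1) b) auto
  ultimately have "min_energy L T \<mu>' \<le> E" using comp(2) by (blast intro: order_trans)
  moreover have "E \<le> min_energy L T \<mu>'" unfolding E_def by (rule INF_lower[OF comp(1)])
  ultimately have "min_energy L T \<mu>' = E" by (rule antisym)
  then show ?thesis using Ef comp(1) unfolding E_def by blast
qed

end
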